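(* Let $N\ge 4$, let $\Omega\subset\mathbb R^N$ be a bounded smooth domain with $0\in\partial\Omega$, let $0<s<2$, and let $2^*(s)-1<p<\frac{N+2}{N-2}$. Then the problem $$\Delta u-\frac{u^{2^*(s)-1}}{|x|^s}+u^p+u^{\frac{N+2}{N-2}}=0\ \text{ in }\Omega,\qquad u>0\ \text{ in }\Omega,\qquad u=0\ \text{ on }\partial\Omega$$ has a solution $u\in H^1_0(\Omega)$.
   Context: $2^*(s)=\frac{2(N-s)}{N-2}$. *)

theory Defs
  imports "HOL-Analysis.Analysis"
begin

fun pd :: "'n list \<Rightarrow> (real^'n \<Rightarrow> real) \<Rightarrow> real^'n \<Rightarrow> real" where
  "pd [] f = f"
| "pd (i # is) f = (\<lambda>x. deriv (\<lambda>t. pd is f (x + t *\<^sub>R axis i 1)) 0)"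

definition smooth_on :: "(real^'n) set \<Rightarrow> (real^'n \<Rightarrow> real) \<Rightarrow> bool" where
  "smooth_on S f \<longleftrightarrow>
     (\<forall>is. continuous_on S (pd is f) \<and>
        (\<forall>i. \<forall>x\<in>S. (\<lambda>t. pd is f (x + t *\<^sub>R axis i 1)) differentiable (at 0)))"

definition grad :: "(real^'n \<Rightarrow> real) \<Rightarrow> real^'n \<Rightarrow> real^'n" where
  "grad f x = (\<chi> i. pd [i] f x)"

definition smooth_bounded_domain :: "(real^'n) set \<Rightarrow> bool" where
  "smooth_bounded_domain \<Omega> \<longleftrightarrow> open \<Omega> \<and> connected \<Omega> \<and> \<Omega> \<noteq> {} \<and> bounded \<Omega> \<and>
     (\<forall>p\<in>frontier \<Omega>. \<exists>r>0. \<exists>\<rho>. smooth_on (ball p r) \<rho> \<and>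
         (\<forall>x\<in>ball p r. grad \<rho> x \<noteq> 0) \<and>
         \<Omega> \<inter> ball p r = {x \<in> ball p r. \<rho> x < 0})"

definition test_fun :: "(real^'n) set \<Rightarrow> (real^'n \<Rightarrow> real) \<Rightarrow> bool" where
  "test_fun \<Omega> \<phi> \<longleftrightarrow> smooth_on UNIV \<phi> \<and>
     compact (closure {x. \<phi> x \<noteq> 0}) \<and> closure {x. \<phi> x \<noteq> 0} \<subseteq> \<Omega>"

definition H10 :: "(real^'n) set \<Rightarrow> (real^'n \<Rightarrow> real) \<Rightarrow> (real^'n \<Rightarrow> real^'n) \<Rightarrow> bool" where
  "H10 \<Omega> u g \<longleftrightarrow>
     set_borel_measurable lborel \<Omega> u \<and> set_borel_measurable lborel \<Omega> g \<and>
     set_integrable lborel \<Omega> (\<lambda>x. (u x)\<^sup>2) \<and>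
     set_integrable lborel \<Omega> (\<lambda>x. (norm (g x))\<^sup>2) \<and>
     (\<exists>\<phi>. (\<forall>k. test_fun \<Omega> (\<phi> k)) \<and>
        (\<lambda>k. LINT x:\<Omega>|lborel. (\<phi> k x - u x)\<^sup>2) \<longlonglongrightarrow> 0 \<and>
        (\<lambda>k. LINT x:\<Omega>|lborel. (norm (grad (\<phi> k) x - g x))\<^sup>2) \<longlonglongrightarrow> 0)"

definition crit_hs :: "real \<Rightarrow> real \<Rightarrow> real" where
  "crit_hs N s = 2 * (N - s) / (N - 2)"

definition weak_solution ::
  "(real^'n) set \<Rightarrow> real \<Rightarrow> real \<Rightarrow> (real^'n \<Rightarrow> real) \<Rightarrow> bool" where
  "weak_solution \<Omega> s p u \<longleftrightarrow>
     (let N = real CARD('n);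
          f = (\<lambda>x. u x powr p + u x powr ((N + 2) / (N - 2))
                    - u x powr (crit_hs N s - 1) / norm x powr s)
      in \<exists>g. H10 \<Omega> u g \<and>
         (AE x in lborel. x \<in> \<Omega> \<longrightarrow> u x > 0) \<and>
         (\<forall>\<phi>. test_fun \<Omega> \<phi> \<longrightarrow>
            set_integrable lborel \<Omega> (\<lambda>x. f x * \<phi> x) \<and>
            (LINT x:\<Omega>|lborel. g x \<bullet> grad \<phi> x) = (LINT x:\<Omega>|lborel. f x * \<phi> x)))"

end

theory Submission
 imports Defs "HOL-Library.Diagonal_Subsequence"
begin

text \<open>Let $r=2N/(N-2)$ and $q=2^*(s)$. The Nehari manifold of the energy is minimized: since
  $2<q<p+1<r$, each ray meets it at most once. A minimizing sequence converges once the infimum lies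
  below $(1/2-1/r)S^{r/(r-2)}$, $S$ being the Sobolev constant. Bubbles of width $\varepsilon$ around an interior point show
  this: the term $u^{p+1}$ gains order $\varepsilon^\kappa$ with $\kappa=N-(N-2)(p+1)/2$, the singular term costs only order $\varepsilon^s$, and
  $\kappa<s<2$. Extremals of the Sobolev inequality are used only through existence and an integral decay bound.\<close>

text \<open>The integral of the t-th power of a bubble of width eps scales like eps^(N-(N-2)t/2).
  This exponent is s at t = q and kappa at t = p+1, so kappa < s is the hypothesis p+1 > q.
  Truncating the bubble costs eps^(2 alpha) for any alpha with 2 alpha < N-2, by the decay bound; N
  >= 4 leaves room for s < 2 alpha < 2, so this cost is dominated as well. The singular term enters
  the energy with a positive sign. Hence no Hardy-Sobolev inequality is invoked: finiteness of the
  weighted integral is built into the function space, and pointwise bounds on the weight are used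
  only on compact subsets of the domain, which avoid 0. Compactness fails at the critical exponent
  in two places: the part of a minimizing sequence lost in the limit must be excluded by its energy,
  and for the extremals dilations and translations must be normalized first. Positivity is shown
  without regularity theory: a gradient bound for a regularized log u, compared across translations,
  prevents u from vanishing on a part of positive measure of a small ball without vanishing on the
  whole ball.\<close>

lemmas L1_integrable_bound = Bochner_Integration.integrable_bound
lemmas L1_integrable_add = Bochner_Integration.integrable_add
lemmas L1_integrable_diff = Bochner_Integration.integrable_diff
lemmas L1_integral_add = Bochner_Integration.integral_add
lemmas L1_integral_diff = Bochner_Integration.integral_diff
lemmas L1_integral_nonneg = Bochner_Integration.integral_nonneg
lemmas L1_integral_cong = Bochner_Integration.integral_cong

abbreviation (input) "bmeas \<equiv> borel_measurable"

abbreviation (input) nnint (binder "NN" 10) where "nnint f \<equiv> nn_integral lborel f"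

abbreviation (input) tends_seq ("_ ~~> _" [60, 60] 60) where "X ~~> L \<equiv> X \<longlonglongrightarrow> L"

abbreviation (input) scale_ascii (infixr "*R" 75) where "a *R x \<equiv> a *\<^sub>R x"

section \<open>Functions with continuous partial derivatives\<close>

text \<open>C^1 functions with the gradient as explicit data. Derivatives are taken at 0 along
  coordinate lines, exactly as in \<open>pd\<close>, so that \<open>grad f = f'\<close> follows
  without Frechet derivatives.\<close>

definition has_grad :: "(real^'n => real) => (real^'n => real^'n) => bool" where
 "has_grad f f' \<longleftrightarrow> continuous_on UNIV f & continuous_on UNIV f' &
  (\<forall>i x. ((%t. f (x + t *R axis i 1)) has_real_derivative f' x $ i) (at 0))"

lemma has_gradD:
 assumes "has_grad f f'"
 shows "continuous_on UNIV f" "continuous_on UNIV f'"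
  "((%t. f (x + t *R axis i 1)) has_real_derivative f' x $ i) (at 0)"
 using assms unfolding has_grad_def by auto

lemma has_grad_at:
 assumes "has_grad f f'"
 shows "((%t. f (x + t *R axis i 1)) has_real_derivative f' (x + a *R axis i 1) $ i) (at a)"
proof -
 have "((%t. f ((x + a *R axis i 1) + t *R axis i 1)) has_real_derivative f' (x + a *R axis i 1) $ i) (at 0)"
  using has_gradD(3)[OF assms] .
 also have "(%t. f ((x + a *R axis i 1) + t *R axis i 1)) = (%t. f (x + (t + a) *R axis i 1))"
  by (auto simp: algebra_simps)
 finally show ?thesis using DERIV_shift[of "%t. f (x + t *R axis i 1)" _ 0 a] by simp
qed

lemma has_grad_eq: "has_grad f f' ==> grad f = f'"
 by (auto simp: grad_def fun_eq_iff vec_eq_iff intro!: DERIV_imp_deriv dest: has_gradD(3))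

lemma has_grad_const [simp, intro]: "has_grad (%x. c) (%x. 0)"
 by (auto simp: has_grad_def)

lemma has_grad_add [intro]:
 "has_grad f f' ==> has_grad g g' ==> has_grad (%x. f x + g x) (%x. f' x + g' x)"
 by (auto simp: has_grad_def intro!: continuous_intros derivative_eq_intros)

lemma has_grad_mult:
 assumes "has_grad f f'" "has_grad g g'"
 shows "has_grad (%x. f x * g x) (%x. f x *R g' x + g x *R f' x)"
proof -
 have "((%t. f (x + t *R axis i 1) * g (x + t *R axis i 1)) has_real_derivative
   (f x *R g' x + g x *R f' x) $ i) (at 0)" for i x
  using DERIV_mult[OF has_gradD(3)[OF assms(1), of x i] has_gradD(3)[OF assms(2), of x i]]
  by (simp add: algebra_simps)
 then show ?thesis
  using assms by (auto simp: has_grad_def intro!: continuous_intros)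
qed

lemma has_grad_scale: "has_grad f f' ==> has_grad (%x. c * f x) (%x. c *R f' x)"
 using has_grad_mult[OF has_grad_const, of f f' c] by simp

lemma has_grad_compose:
 assumes f: "has_grad f f'"
  and F: "!!x. (F has_real_derivative F' (f x)) (at (f x))"
  and c: "continuous_on (range f) F'"
 shows "has_grad (%x. F (f x)) (%x. F' (f x) *R f' x)"
proof -
 have "((%t. F (f (x + t *R axis i 1))) has_real_derivative (F' (f x) *R f' x) $ i) (at 0)" for i x
 proof -
  have "(F has_real_derivative F' (f x)) (at (f (x + 0 *R axis i 1)))" using F by simp
  from DERIV_chain2[OF this has_gradD(3)[OF f, of x i]] show ?thesis by simp
 qed
 moreover have "continuous_on (range f) F"
  by (rule DERIV_continuous_on[where D=F']) (use F in \<open>force intro: has_field_derivative_at_within\<close>)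
 then have "continuous_on UNIV (%x. F (f x))"
  by (rule continuous_on_compose2[OF _ has_gradD(1)[OF f]]) simp
 moreover have "continuous_on UNIV (%x. F' (f x))"
  by (rule continuous_on_compose2[OF c has_gradD(1)[OF f]]) simp
 ultimately show ?thesis using f by (auto simp: has_grad_def intro!: continuous_intros)
qed

lemma has_grad_affine:
 assumes f: "has_grad f f'"
 shows "has_grad (%x. f (c *R x + y)) (%x. c *R f' (c *R x + y))"
proof -
 have "((%t. f (c *R (x + t *R axis i 1) + y)) has_real_derivative (c *R f' (c *R x + y)) $ i) (at 0)" for i x
 proof -
  have *: "((%t. f ((c *R x + y) + t *R axis i 1)) has_real_derivative f' (c *R x + y) $ i) (at (c * 0))"
   using has_gradD(3)[OF f] by simp
  have "((%t::real. c * t) has_real_derivative c) (at 0)"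
   by (auto intro!: derivative_eq_intros)
  from DERIV_chain2[OF * this] show ?thesis by (simp add: algebra_simps)
 qed
 moreover have "continuous_on UNIV (%x. f (c *R x + y))" "continuous_on UNIV (%x. f' (c *R x + y))"
  by (rule continuous_on_compose2[OF has_gradD(1)[OF f]] continuous_on_compose2[OF has_gradD(2)[OF f]],
    intro continuous_intros, simp)+
 ultimately show ?thesis by (auto simp: has_grad_def intro!: continuous_intros)
qed

section \<open>Smooth functions\<close>

text \<open>A coinduction principle: membership in any class of continuous functions that is stable
  under partial derivatives suffices. It replaces an induction over index lists for each concrete
  function.\<close>

lemma smooth_classI:
 assumes "f : C" "!!f. f : C ==> continuous_on UNIV f"
  and d: "!!f i. f : C ==> \<exists>f'\<in>C. \<forall>x. ((%t. f (x + t *R axis i 1)) has_real_derivative f' x) (at 0)"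
 shows "smooth_on UNIV f"
proof -
 have "pd is f : C" for "is"
 proof (induction "is")
  case (Cons i "is")
  obtain f' where f': "f' : C" "\<forall>x. ((%t. pd is f (x + t *R axis i 1)) has_real_derivative f' x) (at 0)"
   using d[OF Cons] by blast
  have "pd (i # is) f = f'" using f'(2) by (auto simp: fun_eq_iff intro!: DERIV_imp_deriv)
  then show ?case using f' by simp
 qed (use assms in simp)
 then show ?thesis unfolding smooth_on_def
  using assms(2) d by (metis real_differentiable_def)
qed

lemma smooth_onD:
 assumes "smooth_on UNIV f"
 shows "continuous_on UNIV (pd is f)"
  "((%t. pd is f (x + t *R axis i 1)) has_real_derivative pd (i # is) f x) (at 0)"
 using assms unfolding smooth_on_def by (auto simp: DERIV_deriv_iff_real_differentiable)

lemma smooth_pd: assumes "smooth_on UNIV f" shows "smooth_on UNIV (pd is f)"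
proof (rule smooth_classI[of _ "range (%is. pd is f)"])
 fix h i assume "h : range (%is. pd is f)"
 then obtain "is" where h: "h = pd is f" by auto
 show "\<exists>f'\<in>range (%is. pd is f). \<forall>x. ((%t. h (x + t *R axis i 1)) has_real_derivative f' x) (at 0)"
  unfolding h using smooth_onD(2)[OF assms, of "is" _ i] by blast
qed (use smooth_onD(1)[OF assms] in auto)

lemma smooth_has_grad: assumes "smooth_on UNIV f" shows "has_grad f (grad f)"
proof -
 have "continuous_on UNIV (grad f)"
  unfolding grad_def by (intro continuous_on_vec_lambda smooth_onD(1)[OF assms])
 then show ?thesis unfolding has_grad_def
  using smooth_onD(1)[OF assms, of "[]"] smooth_onD(2)[OF assms, of "[]"] by (simp add: grad_def)
qed

text \<open>One-variable smoothness in the same coinductive style: a family stable under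
  differentiation on \<open>I\<close>, without names for higher derivatives.\<close>

definition real_smooth :: "real set => (real => real) => bool" where
 "real_smooth I F \<longleftrightarrow> (\<exists>C. F : C & (\<forall>f\<in>C. \<exists>f'\<in>C. \<forall>x\<in>I. (f has_real_derivative f' x) (at x)))"

lemma real_smooth_deriv:
 assumes "real_smooth I F"
 obtains F' where "real_smooth I F'" "!!x. x : I ==> (F has_real_derivative F' x) (at x)"
 using assms unfolding real_smooth_def by metis

text \<open>The product and chain rules lead out of the products alone and out of the compositions
  alone, but not out of this joint closure; thus \<open>smooth_classI\<close> applies to it.\<close>

inductive_set smcl :: "(real^'n => real) set" where
 base: "smooth_on UNIV f ==> f : smcl"
| add: "f : smcl ==> g : smcl ==> (%x. f x + g x) : smcl"
| mult: "f : smcl ==> g : smcl ==> (%x. f x * g x) : smcl"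
| comp: "real_smooth I F ==> f : smcl ==> range f <= I ==> (%x. F (f x)) : smcl"

lemma smcl_props:
 assumes "f : smcl"
 shows "continuous_on UNIV f & (\<forall>i. \<exists>f'\<in>smcl. \<forall>x. ((%t. f (x + t *R axis i 1)) has_real_derivative f' x) (at 0))"
 using assms
proof induction
 case (base f)
 have "pd [i] f : smcl" for i using smooth_pd[OF base, of "[i]"] by (rule smcl.base)
 moreover have "((%t. f (x + t *R axis i 1)) has_real_derivative pd [i] f x) (at 0)" for i x
  using smooth_onD(2)[OF base, of "[]" x i] by simp
 ultimately show ?case using smooth_onD(1)[OF base, of "[]"] by (metis pd.simps(1))
next
 case (add f g)
 show ?case
 proof (intro conjI allI)
  show "continuous_on UNIV (%x. f x + g x)" using add by (auto intro!: continuous_intros)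
  fix i
  obtain f' g' where fg: "f' : smcl" "g' : smcl" "!!x. ((%t. f (x + t *R axis i 1)) has_real_derivative f' x) (at 0)"
   "!!x. ((%t. g (x + t *R axis i 1)) has_real_derivative g' x) (at 0)" using add by meson
  show "\<exists>h\<in>smcl. \<forall>x. ((%t. f (x + t *R axis i 1) + g (x + t *R axis i 1)) has_real_derivative h x) (at 0)"
   using DERIV_add[OF fg(3,4)] by (intro bexI[of _ "%x. f' x + g' x"] smcl.add fg) auto
 qed
next
 case (mult f g)
 show ?case
 proof (intro conjI allI)
  show "continuous_on UNIV (%x. f x * g x)" using mult by (auto intro!: continuous_intros)
  fix i
  obtain f' g' where fg: "f' : smcl" "g' : smcl" "!!x. ((%t. f (x + t *R axis i 1)) has_real_derivative f' x) (at 0)"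
   "!!x. ((%t. g (x + t *R axis i 1)) has_real_derivative g' x) (at 0)" using mult by meson
  show "\<exists>h\<in>smcl. \<forall>x. ((%t. f (x + t *R axis i 1) * g (x + t *R axis i 1)) has_real_derivative h x) (at 0)"
   using DERIV_mult[OF fg(3,4)] mult
   by (intro bexI[of _ "%x. f' x * g x + g' x * f x"] smcl.add smcl.mult fg) auto
 qed
next
 case (comp I F f)
 obtain F' where F': "real_smooth I F'" "!!x. x : I ==> (F has_real_derivative F' x) (at x)"
  using real_smooth_deriv[OF comp(1)] by metis
 show ?case
 proof (intro conjI allI)
  have "continuous_on I F"
   by (rule DERIV_continuous_on[where D=F']) (use F'(2) in \<open>blast intro: has_field_derivative_at_within\<close>)
  then show "continuous_on UNIV (%x. F (f x))"
   by (rule continuous_on_compose2[OF _ conjunct1[OF comp.IH]]) (use comp in blast)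
  fix i
  obtain f' where f': "f' : smcl" "!!x. ((%t. f (x + t *R axis i 1)) has_real_derivative f' x) (at 0)"
   using comp.IH by metis
  have "((%t. F (f (x + t *R axis i 1))) has_real_derivative F' (f x) * f' x) (at 0)" for x
  proof (rule DERIV_chain2[OF _ f'(2)])
   show "(F has_real_derivative F' (f x)) (at (f (x + 0 *R axis i 1)))"
    using comp(3) F'(2)[of "f x"] by auto
  qed
  then show "\<exists>h\<in>smcl. \<forall>x. ((%t. F (f (x + t *R axis i 1))) has_real_derivative h x) (at 0)"
   by (intro bexI[of _ "%x. F' (f x) * f' x"] smcl.mult smcl.comp[OF F'(1) comp(2,3)] f'(1)) blast
 qed
qed

lemma smcl_smooth: "f : smcl ==> smooth_on UNIV f"
 by (rule smooth_classI[of f smcl]) (simp_all add: smcl_props)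

lemma smooth_add: "smooth_on UNIV f ==> smooth_on UNIV g ==> smooth_on UNIV (%x. f x + g x)"
 by (rule smcl_smooth[OF smcl.add[OF smcl.base smcl.base]])

lemma smooth_mult: "smooth_on UNIV f ==> smooth_on UNIV g ==> smooth_on UNIV (%x. f x * g x)"
 by (rule smcl_smooth[OF smcl.mult[OF smcl.base smcl.base]])

lemma smooth_compose: "real_smooth I F ==> smooth_on UNIV f ==> range f <= I ==> smooth_on UNIV (%x. F (f x))"
 by (rule smcl_smooth[OF smcl.comp[OF _ smcl.base]])

lemma smooth_const: "smooth_on UNIV (%x. c)"
 by (rule smooth_classI[of _ "range (%c x. c)"]) (auto intro!: exI[of _ 0])

lemma smooth_diff: "smooth_on UNIV f ==> smooth_on UNIV g ==> smooth_on UNIV (%x. f x - g x)"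
 using smooth_add[of f "%x. -1 * g x"] smooth_mult[OF smooth_const[of "-1"], of g] by simp

lemma smooth_coord: "smooth_on UNIV (%x. x $ i)"
proof (rule smooth_classI[of _ "insert (%x. x $ i) (range (%c x. c))"])
 fix f :: "real^'a => real" and j
 assume f: "f : insert (%x. x $ i) (range (%c x. c))"
 show "\<exists>f'\<in>insert (%x. x $ i) (range (%c x. c)). \<forall>x. ((%t. f (x + t *R axis j 1)) has_real_derivative f' x) (at 0)"
 proof (cases "f = (%x. x $ i)")
  case True
  then show ?thesis
   by (intro bexI[of _ "%x. axis j 1 $ i"]) (auto intro!: derivative_eq_intros)
 next
  case False
  then show ?thesis using f by (intro bexI[of _ "%x. 0"]) auto
 qed
qed (auto intro!: continuous_intros)

lemma smooth_sum: "finite A ==> (!!a. a : A ==> smooth_on UNIV (f a)) ==> smooth_on UNIV (%x. \<Sum>a\<in>A. f a x)"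
 by (induction A rule: finite_induct) (auto intro: smooth_const smooth_add)

lemma smooth_norm2: "smooth_on UNIV (%x. (norm (x - x0))^2)"
proof -
 have "(%x. (norm (x - x0))^2) = (%x. \<Sum>i\<in>UNIV. (x $ i - x0 $ i) * (x $ i - x0 $ i))"
  by (auto simp: power2_norm_eq_inner inner_vec_def)
 then show ?thesis
  by (auto intro!: smooth_sum smooth_mult smooth_diff smooth_const smooth_coord)
qed

lemma smooth_affine:
 assumes "smooth_on UNIV f"
 shows "smooth_on UNIV (%x. f (c *R x + y))"
\<comment> \<open>The factor k collects the powers of c that repeated differentiation
  produces.\<close>
proof (rule smooth_classI[of _ "{%x. k * h (c *R x + y) | k h. smooth_on UNIV h}"])
 show "(%x. f (c *R x + y)) : {%x. k * h (c *R x + y) | k h. smooth_on UNIV h}"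
  using assms by (auto intro!: exI[of _ 1] exI[of _ f])
next
 fix f assume "f : {%x. k * h (c *R x + y) | k h. smooth_on UNIV h}"
 then obtain k h where f: "f = (%x. k * h (c *R x + y))" and h: "smooth_on UNIV h" by auto
 note g = has_grad_scale[OF has_grad_affine[OF smooth_has_grad[OF h]], of k c y]
 show "continuous_on UNIV f" using has_gradD(1)[OF g] f by simp
 fix i
 have "((%t. f (x + t *R axis i 1)) has_real_derivative (k * c) * pd [i] h (c *R x + y)) (at 0)" for x
  using has_gradD(3)[OF g, of x i] f by (simp add: grad_def)
 then show "\<exists>f'\<in>{%x. k * h (c *R x + y) | k h. smooth_on UNIV h}.
   \<forall>x. ((%t. f (x + t *R axis i 1)) has_real_derivative f' x) (at 0)"
  by (intro bexI[of _ "%x. (k * c) * pd [i] h (c *R x + y)"])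
   (use smooth_pd[OF h] in blast)+
qed

section \<open>Powers, the function exp(-1/t), and smooth cut-offs\<close>

lemma real_smooth_powr: "real_smooth {0<..} (%t. t powr b)"
 unfolding real_smooth_def
proof (intro exI[of _ "{%t. c * t powr b | c b. True}"] conjI ballI)
 show "(%t. t powr b) : {%t. c * t powr b | c b. True}"
  by (rule CollectI, rule exI[of _ 1], rule exI[of _ b]) simp
 fix f :: "real => real" assume "f : {%t. c * t powr b | c b. True}"
 then obtain c b where "f = (%t. c * t powr b)" by auto
 then show "\<exists>f'\<in>{%t. c * t powr b | c b. True}. \<forall>x\<in>{0<..}. (f has_real_derivative f' x) (at x)"
  by (intro bexI[of _ "%t. (c * b) * t powr (b - 1)"]) (auto intro!: derivative_eq_intros)
qed

lemma smooth_powr: "smooth_on UNIV f ==> (!!x. f x > 0) ==> smooth_on UNIV (%x. f x powr b)"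
 using smooth_compose[OF real_smooth_powr] by force

lemma real_smooth_exp_inv: "real_smooth UNIV (%t. if t > 0 then exp (- 1 / t) else 0)"
 unfolding real_smooth_def
proof (intro exI[of _ "{%t. if t > 0 then poly P (1 / t) * exp (- 1 / t) else 0 | P. True}"] conjI ballI)
 let ?F = "%P t::real. if t > 0 then poly P (1 / t) * exp (- 1 / t) else 0"
 show "(%t. if t > 0 then exp (- 1 / t) else 0) : {?F P | P. True}"
  by (auto intro!: exI[of _ "1"])
 have lim: "(?F P \<longlongrightarrow> 0) (at 0)" for P
 proof -
  have "((\<lambda>x. poly P x * exp (- x)) \<longlongrightarrow> 0) at_top"
  proof -
   have "((\<lambda>x. \<Sum>i\<le>degree P. coeff P i * (x ^ i / exp x)) \<longlongrightarrow> (\<Sum>i\<le>degree P. coeff P i * 0)) at_top"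
    by (intro tendsto_intros tendsto_power_div_exp_0)
   then show ?thesis by (simp add: poly_altdef sum_distrib_right exp_minus divide_inverse mult.assoc)
  qed
  moreover have "filterlim (%t::real. 1 / t) at_top (at_right 0)"
   using filterlim_inverse_at_top_right by (simp add: inverse_eq_divide)
  ultimately have "((%t. poly P (1 / t) * exp (- (1 / t))) \<longlongrightarrow> 0) (at_right 0)"
   by (rule filterlim_compose)
  then have "(?F P \<longlongrightarrow> 0) (at_right 0)"
   by (rule Lim_transform_eventually) (auto simp: eventually_at_right_less eventually_at_right_field intro!: exI[of _ 1])
  moreover have "(?F P \<longlongrightarrow> 0) (at_left 0)"
   by (rule Lim_transform_eventually[OF tendsto_const]) (auto simp: eventually_at_left_field intro!: exI[of _ "-1"])
  ultimately show ?thesis using filterlim_split_at by blast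
 qed
 fix f assume "f : {?F P | P. True}"
 then obtain P where f: "f = ?F P" by auto
 \<comment> \<open>With y = 1/t, the derivative of P(y) exp(-y) in t is y^2 (P - P')(y)
   exp(-y).\<close>
 define Q where "Q = [:0, 0, 1:] * (P - pderiv P)"
 have "(f has_real_derivative ?F Q x) (at x)" for x
 proof -
  consider "x > 0" | "x < 0" | "x = 0" by linarith
  then show ?thesis
  proof cases
   case 1
   have "((%t. poly P (1 / t) * exp (- 1 / t)) has_real_derivative ?F Q x) (at x)"
    using 1 by (auto intro!: derivative_eq_intros poly_DERIV DERIV_chain2[of "poly P"] simp: Q_def field_simps power2_eq_square)
   then show ?thesis using 1 f
    by (subst DERIV_cong_ev[OF refl _ refl, where g="%t. poly P (1 / t) * exp (- 1 / t)"])
     (auto simp: eventually_nhds intro!: exI[of _ "{0<..}"])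
  next
   case 2
   have "((%t. 0) has_real_derivative ?F Q x) (at x)" using 2 by simp
   then show ?thesis using 2 f
    by (subst DERIV_cong_ev[OF refl _ refl, where g="%t. 0"])
     (auto simp: eventually_nhds intro!: exI[of _ "{..<0}"])
  next
   case 3
   \<comment> \<open>At 0 the difference quotient belongs to the same class, with y P(y) in place of
     P(y), so it tends to 0.\<close>
   have "(%h. (f (0 + h) - f 0) / h) \<midarrow>0\<rightarrow> 0"
    by (rule Lim_transform_eventually[OF lim[of "[:0,1:] * P"]])
     (auto simp: f eventually_at_filter)
   then show ?thesis using 3 by (simp add: DERIV_def)
  qed
 qed
 then show "\<exists>f'\<in>{?F P | P. True}. \<forall>x\<in>UNIV. (f has_real_derivative f' x) (at x)"
  by (intro bexI[of _ "?F Q"]) auto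
qed

lemma smooth_cutoff:
 fixes x0 :: "real^'n"
 assumes "0 < a" "a < b"
 obtains et where "smooth_on UNIV et" "!!x. 0 <= et x" "!!x. et x <= 1"
  "!!x. norm (x - x0) <= a ==> et x = 1" "!!x. norm (x - x0) >= b ==> et x = 0"
proof -
 define F where "F = (%t::real. if t > 0 then exp (- 1 / t) else 0)"
 \<comment> \<open>This denominator is positive everywhere: since a < b, at least one of the two
   arguments of \<open>F\<close> is positive.\<close>
 define d where "d = (%x::real^'n. F (b^2 - (norm (x - x0))^2) + F ((norm (x - x0))^2 - a^2))"
 define et where "et = (%x. F (b^2 - (norm (x - x0))^2) * d x powr (-1))"
 have F: "F t >= 0" "t > 0 ==> F t > 0" "t <= 0 ==> F t = 0" for t by (auto simp: F_def)
 have ab: "a^2 < b^2" using assms by (simp add: power_strict_mono)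
 have d: "d x > 0" for x
 proof (cases "(norm (x - x0))^2 < b^2")
  case True then show ?thesis unfolding d_def by (intro add_pos_nonneg F) auto
 next
  case False then show ?thesis unfolding d_def using ab by (intro add_nonneg_pos F) auto
 qed
 have sF: "smooth_on UNIV (%x. F (f x))" if "smooth_on UNIV f" for f :: "real^'n => real"
  using smooth_compose[OF real_smooth_exp_inv that] by (simp add: F_def)
 have "smooth_on UNIV et"
  unfolding et_def using d
  by (intro smooth_mult smooth_powr) (auto simp: d_def intro!: smooth_add sF smooth_diff smooth_const smooth_norm2)
 moreover have "et x = F (b^2 - (norm (x - x0))^2) / d x" for x
  using d[of x] by (simp add: et_def powr_minus_divide)
 then have "0 <= et x" "et x <= 1" "norm (x - x0) <= a ==> et x = 1" "norm (x - x0) >= b ==> et x = 0" for x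
  using d[of x] F(1) F(3)[of "(norm (x - x0))^2 - a^2"] F(3)[of "b^2 - (norm (x - x0))^2"] assms
  by (auto simp: d_def power_mono divide_le_eq)
 ultimately show ?thesis using that by blast
qed

section \<open>Test functions\<close>

lemma test_funI:
 assumes "smooth_on UNIV ph" "compact K" "K <= Om" "!!x. x \<notin> K ==> ph x = 0"
 shows "test_fun Om ph"
proof -
 have "closure {x. ph x ~= 0} <= K" using assms by (intro closure_minimal) (auto simp: compact_imp_closed)
 moreover have "compact (closure {x. ph x ~= 0})"
  using compact_Int_closed[OF assms(2) closed_closure] calculation by (metis inf.absorb_iff2)
 ultimately show ?thesis using assms unfolding test_fun_def by auto
qed

lemma test_fun_obtain:
 assumes "test_fun Om ph"
 obtains K where "compact K" "K <= Om" "!!x. x \<notin> K ==> ph x = 0" "!!x. x \<notin> K ==> grad ph x = 0"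
proof -
 let ?K = "closure {x. ph x ~= 0}"
 have c: "compact ?K" "?K <= Om" using assms by (auto simp: test_fun_def)
 have 0: "ph x = 0" if "x \<notin> ?K" for x using that closure_subset[of "{x. ph x ~= 0}"] by blast
 have 1: "grad ph x = 0" if "x \<notin> ?K" for x
 proof -
  have "open (- ?K)" "x : - ?K" using that by (auto simp: open_Compl)
  then obtain e where e: "e > 0" "ball x e <= - ?K" by (rule openE)
  have "deriv (%t. ph (x + t *R axis i 1)) 0 = 0" for i
  proof (rule DERIV_imp_deriv)
   show "((%t. ph (x + t *R axis i 1)) has_real_derivative 0) (at 0)"
   proof (subst DERIV_cong_ev[OF refl _ refl, where g="%t. 0"])
    have "ph (x + t *R axis i 1) = 0" if "t : ball 0 e" for t
     using that e by (intro 0) (auto simp: subset_eq dist_norm)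
    then show "\<forall>\<^sub>F t in nhds 0. ph (x + t *R axis i 1) = 0"
     unfolding eventually_nhds using e(1) by (intro exI[of _ "ball 0 e"]) auto
   qed simp
  qed
  then show ?thesis by (simp add: grad_def vec_eq_iff)
 qed
 show thesis by (rule that[OF c]) (fact 0, fact 1)
qed

lemma test_fun_smooth: "test_fun Om ph ==> smooth_on UNIV ph" by (simp add: test_fun_def)

lemma test_fun_grad: "test_fun Om ph ==> has_grad ph (grad ph)"
 by (intro smooth_has_grad test_fun_smooth)

lemma test_fun_mono: "test_fun Om ph ==> Om <= Om' ==> test_fun Om' ph"
 by (auto simp: test_fun_def)

lemma test_fun_zero: "test_fun Om (%x. 0)"
 by (rule test_funI[of _ "{}"]) (auto intro: smooth_const)

lemma test_fun_add: 
 assumes "test_fun Om ph" "test_fun Om psi" shows "test_fun Om (%x. ph x + psi x)"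
proof -
 obtain K L where "compact K" "K <= Om" "!!x. x \<notin> K ==> ph x = 0" "compact L" "L <= Om" "!!x. x \<notin> L ==> psi x = 0"
  using assms test_fun_obtain by metis
 then show ?thesis using assms
  by (intro test_funI[of _ "K \<union> L"]) (auto intro: smooth_add test_fun_smooth)
qed

lemma test_fun_mult:
 assumes "test_fun Om ph" "smooth_on UNIV w" shows "test_fun Om (%x. w x * ph x)"
proof -
 obtain K where "compact K" "K <= Om" "!!x. x \<notin> K ==> ph x = 0"
  using assms test_fun_obtain by metis
 then show ?thesis using assms
  by (intro test_funI[of _ "K"]) (auto intro: smooth_mult test_fun_smooth)
qed

lemma test_fun_scale: "test_fun Om ph ==> test_fun Om (%x. c * ph x)"
 using test_fun_mult[OF _ smooth_const] .

lemma grad_add: "smooth_on UNIV f ==> smooth_on UNIV g ==> grad (%x. f x + g x) = (%x. grad f x + grad g x)"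
 by (intro has_grad_eq has_grad_add smooth_has_grad)

lemma grad_scale: "smooth_on UNIV f ==> grad (%x. c * f x) = (%x. c *R grad f x)"
 by (intro has_grad_eq has_grad_scale smooth_has_grad)

lemma grad_mult: "smooth_on UNIV f ==> smooth_on UNIV g ==>
  grad (%x. f x * g x) = (%x. f x *R grad g x + g x *R grad f x)"
 by (intro has_grad_eq has_grad_mult smooth_has_grad)

lemma grad_affine: "smooth_on UNIV f ==> grad (%x. f (c *R x + y)) = (%x. c *R grad f (c *R x + y))"
 by (intro has_grad_eq has_grad_affine smooth_has_grad)

section \<open>Convergence of integrals\<close>

lemma powr_add_le:
 fixes a b r :: real assumes "a >= 0" "b >= 0" "r >= 0"
 shows "(a + b) powr r <= 2 powr r * (a powr r + b powr r)"
proof -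
 have "(a + b) powr r <= (2 * max a b) powr r" using assms by (intro powr_mono2) auto
 also have "... = 2 powr r * max a b powr r" using assms by (simp add: powr_mult)
 also have "max a b powr r <= a powr r + b powr r" by (auto simp: max_def)
 finally show ?thesis by simp
qed

lemma abs_powr_add_le:
 fixes a b r :: real assumes "r >= 0"
 shows "abs (a + b) powr r <= 2 powr r * (abs a powr r + abs b powr r)"
 using powr_mono2[OF assms, of "abs (a + b)" "abs a + abs b"] powr_add_le[of "abs a" "abs b" r] assms
 by (simp add: abs_triangle_ineq)

lemma integrable_powr_add:
 fixes u v :: "'a => real"
 assumes [measurable]: "u : bmeas M" "v : bmeas M"
  and "integrable M (%x. abs (u x) powr r)" "integrable M (%x. abs (v x) powr r)" "r >= 0"
 shows "integrable M (%x. abs (u x + v x) powr r)"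
proof (rule L1_integrable_bound)
 show "integrable M (%x. 2 powr r * (abs (u x) powr r + abs (v x) powr r))" using assms by simp
 show "AE x in M. norm (abs (u x + v x) powr r) <= norm (2 powr r * (abs (u x) powr r + abs (v x) powr r))"
  using abs_powr_add_le[OF assms(5)] by (simp add: abs_of_nonneg)
qed simp

lemma integrable_powr_diff:
 fixes u v :: "'a => real"
 assumes "u : bmeas M" "v : bmeas M"
  and "integrable M (%x. abs (u x) powr r)" "integrable M (%x. abs (v x) powr r)" "r >= 0"
 shows "integrable M (%x. abs (u x - v x) powr r)"
 using integrable_powr_add[of u M "%x. - v x" r] assms by simp

lemma fatou_tendsto:
 fixes f :: "nat => 'a => real"
 assumes i: "!!n. integrable M (f n)" and nn: "!!n x. f n x >= 0" and [measurable]: "g : bmeas M"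
  and ae: "AE x in M. (%n. f n x) ~~> g x" and L: "(%n. \<integral>x. f n x \<partial>M) ~~> L"
 shows "integrable M g" "(\<integral>x. g x \<partial>M) <= L"
proof -
 have [measurable]: "f n : bmeas M" for n using i by auto
 have L0: "L >= 0" using L nn by (intro LIMSEQ_le_const[OF L]) (auto intro!: integral_nonneg_AE)
 have g0: "AE x in M. 0 <= g x"
  using ae by eventually_elim (auto intro!: LIMSEQ_le_const nn)
 have "(\<integral>\<^sup>+x. ennreal (g x) \<partial>M) = (\<integral>\<^sup>+x. liminf (%n. ennreal (f n x)) \<partial>M)"
  using ae by (intro nn_integral_cong_AE) (auto elim!: eventually_mono intro!: lim_imp_Liminf[symmetric] tendsto_ennrealI)
 also have "... <= liminf (%n. \<integral>\<^sup>+x. ennreal (f n x) \<partial>M)"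
  by (intro nn_integral_liminf) measurable
 also have "(%n. \<integral>\<^sup>+x. ennreal (f n x) \<partial>M) = (%n. ennreal (\<integral>x. f n x \<partial>M))"
  using i nn by (intro ext nn_integral_eq_integral) auto
 also have "liminf ... = ennreal L"
  by (intro lim_imp_Liminf tendsto_ennrealI L) simp
 finally have le: "(\<integral>\<^sup>+x. ennreal (g x) \<partial>M) <= ennreal L" .
 then show gi: "integrable M g"
  using g0 by (intro integrableI_nonneg) (auto simp: top_unique less_top[symmetric] intro: le_less_trans)
 have "ennreal (\<integral>x. g x \<partial>M) <= ennreal L"
  using le nn_integral_eq_integral[OF gi g0] by simp
 then show "(\<integral>x. g x \<partial>M) <= L" using L0 by simp
qed

text \<open>Bounded integrals converge along a subsequence, and Fatou's lemma is applied
  there.\<close>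

lemma fatou_bound:
 fixes f :: "nat => 'a => real"
 assumes i: "!!n. integrable M (f n)" and nn: "!!n x. f n x >= 0" and m: "g : bmeas M"
  and ae: "AE x in M. (%n. f n x) ~~> g x" and C: "!!n. (\<integral>x. f n x \<partial>M) <= C"
 shows "integrable M g" "(\<integral>x. g x \<partial>M) <= C"
proof -
 have "abs (\<integral>x. f n x \<partial>M) <= C" for n using C[of n] nn by (simp add: integral_nonneg_AE)
 then have "bounded (range (%n. \<integral>x. f n x \<partial>M))" by (auto simp: bounded_iff)
 then obtain L s where s: "strict_mono s" "((%n. \<integral>x. f n x \<partial>M) \<circ> s) ~~> L"
  using bounded_imp_convergent_subsequence by blast
 have ae': "AE x in M. (%n. f (s n) x) ~~> g x"
  using ae by eventually_elim (use LIMSEQ_subseq_LIMSEQ[OF _ s(1)] in \<open>auto simp: o_def\<close>)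
 note F = fatou_tendsto[of M "%n. f (s n)" g L, OF i nn m ae' s(2)[unfolded o_def]]
 show "integrable M g" by (rule F)
 have "L <= C" using C by (intro LIMSEQ_le_const2[OF s(2)]) auto
 then show "(\<integral>x. g x \<partial>M) <= C" using F(2) by simp
qed

text \<open>Subcritical powers lose no mass on sets of finite measure. Where |v| > K one has |v|^t
  <= K^(t-r) |v|^r, which is uniformly small because t < r; below the height K dominated convergence
  applies.\<close>

lemma lower_power_tendsto_zero:
 fixes v :: "nat => 'a => real"
 assumes [measurable]: "!!n. v n : bmeas M" "B : sets M"
  and fin: "emeasure M B < \<infinity>" and i: "!!n. integrable M (%x. abs (v n x) powr r)"
  and C: "!!n. (\<integral>x. abs (v n x) powr r \<partial>M) <= C"
  and ae: "AE x in M. (%n. v n x) ~~> 0" and t: "0 < t" "t < r"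
 shows "!!n. integrable M (%x. indicator B x * abs (v n x) powr t)"
  and "(%n. \<integral>x. indicator B x * abs (v n x) powr t \<partial>M) ~~> 0"
proof -
 have iB: "integrable M (indicator B :: 'a => real)" using fin by simp
 have pw: "abs (v n x) powr t <= min (abs (v n x) powr t) (K powr t) + K powr (t - r) * abs (v n x) powr r" if "K > 0" for K n x
 proof (cases "abs (v n x) <= K")
  case True
  then have "abs (v n x) powr t <= K powr t" using t by (intro powr_mono2) auto
  then show ?thesis by simp
 next
  case False
  then have "abs (v n x) powr t = abs (v n x) powr (t - r) * abs (v n x) powr r" by (simp add: powr_add[symmetric])
  also have "... <= K powr (t - r) * abs (v n x) powr r"
   using False t that by (intro mult_right_mono powr_mono2') auto
  finally show ?thesis by (simp add: add_increasing)
 qed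
 have im: "integrable M (%x. indicator B x * min (abs (v n x) powr t) (K powr t))" for n K
  by (rule L1_integrable_bound[OF integrable_mult_left[OF iB, of "K powr t"]])
   (auto simp: indicator_def)
 show ii: "integrable M (%x. indicator B x * abs (v n x) powr t)" for n
 proof (rule L1_integrable_bound)
  show "integrable M (%x. indicator B x * min (abs (v n x) powr t) (1 powr t) + 1 powr (t - r) * abs (v n x) powr r)"
   using i by (intro L1_integrable_add im) simp
  show "AE x in M. norm (indicator B x * abs (v n x) powr t)
   <= norm (indicator B x * min (abs (v n x) powr t) (1 powr t) + 1 powr (t - r) * abs (v n x) powr r)"
   using pw[of 1 n] by (auto simp: indicator_def)
 qed simp
 have C0: "C >= 0" using C[of 0] by (rule order_trans[rotated]) simp
 show "(%n. \<integral>x. indicator B x * abs (v n x) powr t \<partial>M) ~~> 0"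
 proof (rule LIMSEQ_I)
  fix e :: real assume "e > 0"
  \<comment> \<open>The height at which the part above contributes at most K^(t-r) (C+1) = e/2; the
    exponent t-r is negative.\<close>
  define K where "K = (e / (2 * (C + 1))) powr (1 / (t - r))"
  have K0: "K > 0" using \<open>e > 0\<close> C0 by (auto simp: K_def)
  have Kp: "K powr (t - r) = e / (2 * (C + 1))" using \<open>e > 0\<close> C0 t by (simp add: K_def powr_powr)
  have "(%n. \<integral>x. indicator B x * min (abs (v n x) powr t) (K powr t) \<partial>M) ~~> (\<integral>x. 0 \<partial>M)"
  proof (rule integral_dominated_convergence[where w="%x. K powr t * indicator B x"])
   show "AE x in M. (%n. indicator B x * min (abs (v n x) powr t) (K powr t)) ~~> 0"
    using ae
   proof eventually_elim
    case (elim x)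
    have "(%n. abs (v n x) powr t) ~~> abs 0 powr t"
     using t by (intro tendsto_powr2 tendsto_rabs elim tendsto_const) auto
    then have "(%n. indicator B x * min (abs (v n x) powr t) (K powr t)) ~~> indicator B x * min (abs 0 powr t) (K powr t)"
     by (intro tendsto_mult tendsto_min tendsto_const)
    then show ?case using t by simp
   qed
  qed (use iB in \<open>auto split: split_indicator\<close>)
  then obtain n0 where n0: "!!n. n >= n0 ==> \<bar>\<integral>x. indicator B x * min (\<bar>v n x\<bar> powr t) (K powr t) \<partial>M\<bar> < e / 2"
   using LIMSEQ_D[of _ 0 "e/2"] \<open>e > 0\<close> by fastforce
  have "norm ((\<integral>x. indicator B x * abs (v n x) powr t \<partial>M) - 0) < e" if "n >= n0" for n
  proof -
   have "(\<integral>x. indicator B x * abs (v n x) powr t \<partial>M) <=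
     (\<integral>x. indicator B x * min (abs (v n x) powr t) (K powr t) + K powr (t - r) * abs (v n x) powr r \<partial>M)"
    using i pw[OF K0, of n]
    by (intro integral_mono ii L1_integrable_add im) (auto simp: indicator_def)
   also have "... = (\<integral>x. indicator B x * min (abs (v n x) powr t) (K powr t) \<partial>M) + K powr (t - r) * (\<integral>x. abs (v n x) powr r \<partial>M)"
    using i im by simp
   also have "... < e / 2 + K powr (t - r) * (C + 1)"
    using n0[OF that] C[of n] by (intro add_less_le_mono mult_left_mono) auto
   also have "... = e" using C0 by (simp add: Kp field_simps)
   finally show ?thesis by (simp add: integral_nonneg_AE)
  qed
  then show "\<exists>no. \<forall>n\<ge>no. norm ((\<integral>x. indicator B x * \<bar>v n x\<bar> powr t \<partial>M) - 0) < e" by blast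
 qed
qed

text \<open>Completeness of L^2 for vector-valued functions, stated through nonnegative integrals so
  that only differences of the sequence enter. A rapidly converging subsequence gives the pointwise
  limit, and Fatou's lemma gives convergence of the whole sequence in norm.\<close>

lemma Riesz_Fischer_L2:
 fixes f :: "nat \<Rightarrow> 'a \<Rightarrow> 'b::euclidean_space"
 assumes [measurable]: "\<And>n. f n \<in> borel_measurable M"
  and cau: "\<And>e. e > 0 \<Longrightarrow> \<exists>K. \<forall>m\<ge>K. \<forall>n\<ge>K. (\<integral>\<^sup>+x. ennreal ((norm (f m x - f n x))\<^sup>2) \<partial>M) \<le> ennreal e"
 obtains s g where "strict_mono s" "g \<in> borel_measurable M" "AE x in M. (\<lambda>k. f (s k) x) \<longlonglongrightarrow> g x"
  "\<And>e. e > 0 \<Longrightarrow> \<exists>K. \<forall>n\<ge>K. (\<integral>\<^sup>+x. ennreal ((norm (f n x - g x))\<^sup>2) \<partial>M) \<le> ennreal e"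
proof -
 define P where "P = (\<lambda>k K. \<forall>m\<ge>K. \<forall>n\<ge>K. (\<integral>\<^sup>+x. ennreal ((norm (f m x - f n x))\<^sup>2) \<partial>M) \<le> ennreal ((1/4)^k))"
 have "\<exists>s. strict_mono s \<and> (\<forall>k. P k (s k))"
 proof -
  have ex: "\<exists>K. K > j & P k K" for j k
  proof -
   obtain K where K: "P k K" using cau[of "(1/4)^k"] unfolding P_def by auto
   then show ?thesis by (intro exI[of _ "max K (Suc j)"]) (auto simp: P_def)
  qed
  define s where "s = rec_nat (SOME K. P 0 K) (%k j. SOME K. K > j & P (Suc k) K)"
  have 0: "P 0 (s 0)" unfolding s_def using ex[where j=0 and k=0] by (auto intro: someI)
  have S: "s (Suc k) > s k & P (Suc k) (s (Suc k))" for k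
   using someI_ex[OF ex[of "s k" "Suc k"]] by (simp add: s_def)
  have "P k (s k)" for k using 0 S by (cases k) auto
  moreover have "strict_mono s" using S by (intro strict_monoI_Suc) auto
  ultimately show ?thesis by blast
 qed
 then obtain s where s: "strict_mono s" and P: "!!k. P k (s k)" by blast
 \<comment> \<open>The squares of these increments integrate to at most 4^-k, so that even after
   multiplication by 2^k they form a convergent series.\<close>
 define a where "a = (%k x. norm (f (s (Suc k)) x - f (s k) x))"
 have [measurable]: "a k : bmeas M" for k unfolding a_def by measurable
 have ak: "(\<integral>\<^sup>+x. ennreal ((a k x)^2) \<partial>M) <= ennreal ((1/4)^k)" for k
  using P[of k] strict_mono_leD[OF s, of k "Suc k"] unfolding P_def a_def by auto
 have "(\<integral>\<^sup>+x. (\<Sum>k. ennreal (2^k * (a k x)^2)) \<partial>M) = (\<Sum>k. \<integral>\<^sup>+x. ennreal (2^k * (a k x)^2) \<partial>M)"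
  by (intro nn_integral_suminf) measurable
 also have "... <= (\<Sum>k. ennreal ((1/2)^k))"
 proof (intro suminf_le)
  fix k
  have "(\<integral>\<^sup>+x. ennreal (2^k * (a k x)^2) \<partial>M) = ennreal (2^k) * (\<integral>\<^sup>+x. ennreal ((a k x)^2) \<partial>M)"
   by (subst nn_integral_cmult[symmetric]) (auto simp: ennreal_mult)
  also have "... <= ennreal (2^k) * ennreal ((1/4)^k)" by (intro mult_left_mono ak) auto
  also have "... = ennreal ((1/2)^k)" by (simp add: ennreal_mult[symmetric] power_mult_distrib[symmetric])
  finally show "(\<integral>\<^sup>+x. ennreal (2^k * (a k x)^2) \<partial>M) <= ennreal ((1/2)^k)" .
 qed auto
 also have "... = ennreal (\<Sum>k. (1/2)^k)" by (intro suminf_ennreal2) (auto simp: summable_geometric)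
 finally have "(\<integral>\<^sup>+x. (\<Sum>k. ennreal (2^k * (a k x)^2)) \<partial>M) ~= \<infinity>" by (auto simp: top_unique)
 then have "AE x in M. (\<Sum>k. ennreal (2^k * (a k x)^2)) ~= \<infinity>"
  by (intro nn_integral_noteq_infinite) auto
 then have conv: "AE x in M. convergent (%k. f (s k) x)"
 proof eventually_elim
  case (elim x)
  then have "summable (%k. 2^k * (a k x)^2)"
   by (intro summable_suminf_not_top) auto
  \<comment> \<open>The inequality a <= 2^k a^2 + 2^-k passes from summable weighted squares to
    summable increments.\<close>
  then have "summable (%k. 2^k * (a k x)^2 + (1/2)^k)" by (intro summable_add summable_geometric) auto
  then have "summable (%k. norm (f (s (Suc k)) x - f (s k) x))"
  proof (rule summable_comparison_test'[where N=0])
   fix k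
   have "0 <= (2^k * a k x - 1)^2" by simp
   then have "2 * (2^k * a k x) <= (2^k * a k x)^2 + 1" by (simp add: power2_diff)
   moreover have "0 <= 2^k * a k x" by (simp add: a_def)
   ultimately have "2^k * a k x <= (2^k * a k x)^2 + 1" by linarith
   then have "2^k * a k x <= 2^k * (2^k * (a k x)^2 + (1/2)^k)"
    by (simp add: power2_eq_square algebra_simps power_one_over)
   then have "a k x <= 2^k * (a k x)^2 + (1/2)^k" by simp
   then show "norm (norm (f (s (Suc k)) x - f (s k) x)) <= 2^k * (a k x)^2 + (1/2)^k"
    by (simp add: a_def)
  qed
  then have "summable (%k. f (s (Suc k)) x - f (s k) x)" by (rule summable_norm_cancel)
  then have "convergent (%n. \<Sum>k<n. f (s (Suc k)) x - f (s k) x)" by (simp add: summable_iff_convergent)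
  then have "convergent (%n. f (s n) x - f (s 0) x)" 
   by (subst (asm) sum_lessThan_telescope[of "%k. f (s k) x"])
  from convergent_add[OF this convergent_const[of "f (s 0) x"]] show ?case by simp
 qed
 define g where "g = (\<lambda>x. lim (\<lambda>k. f (s k) x))"
 have [measurable]: "g \<in> borel_measurable M" unfolding g_def by (rule borel_measurable_lim_metric) measurable
 have ae: "AE x in M. (\<lambda>k. f (s k) x) \<longlonglongrightarrow> g x"
  using conv by eventually_elim (simp add: g_def convergent_LIMSEQ_iff)
 have "\<exists>K. \<forall>n\<ge>K. (\<integral>\<^sup>+x. ennreal ((norm (f n x - g x))\<^sup>2) \<partial>M) \<le> ennreal e" if e: "e > 0" for e
 proof -
  obtain K where K: "!!m n. m >= K ==> n >= K ==> (\<integral>\<^sup>+x. ennreal ((norm (f m x - f n x))^2) \<partial>M) <= ennreal e"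
   using cau[OF e] by blast
  have "(\<integral>\<^sup>+x. ennreal ((norm (f n x - g x))^2) \<partial>M) <= ennreal e" if n: "n >= K" for n
  proof -
   have "(\<integral>\<^sup>+x. ennreal ((norm (f n x - g x))^2) \<partial>M) = (\<integral>\<^sup>+x. liminf (%k. ennreal ((norm (f n x - f (s k) x))^2)) \<partial>M)"
    using ae by (intro nn_integral_cong_AE)
     (auto elim!: eventually_mono intro!: lim_imp_Liminf[symmetric] tendsto_ennrealI tendsto_intros)
   also have "... <= liminf (%k. \<integral>\<^sup>+x. ennreal ((norm (f n x - f (s k) x))^2) \<partial>M)"
    by (intro nn_integral_liminf) measurable
   also have "... <= liminf (%k. ennreal e)"
   proof (rule Liminf_mono)
    show "\<forall>\<^sub>F k in sequentially. (\<integral>\<^sup>+x. ennreal ((norm (f n x - f (s k) x))^2) \<partial>M) <= ennreal e"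
     using eventually_ge_at_top[of K] by eventually_elim (use K n seq_suble[OF s] order_trans in blast)
   qed
   finally show ?thesis by (simp add: Liminf_const)
  qed
  then show ?thesis by blast
 qed
 from that[OF s _ ae this] show thesis by simp
qed

section \<open>The Brezis--Lieb lemma\<close>

text \<open>By homogeneity only the ratio b/a matters. If |b| <= d|a| with d small, continuity of
  the power at 1 makes the defect at most e|a|^r; otherwise |a| <= |b|/d, and every term is a
  multiple of |b|^r.\<close>

lemma Brezis_Lieb_pointwise:
 fixes r e :: real assumes "r > 0" "e > 0"
 obtains K where "K >= 0" "!!a b. \<bar>\<bar>a + b\<bar> powr r - \<bar>a\<bar> powr r - \<bar>b\<bar> powr r\<bar> <= e * \<bar>a\<bar> powr r + K * \<bar>b\<bar> powr r"
proof -
 have lims: "((%d. (1 + d) powr r - 1 + d powr r) \<longlongrightarrow> (1 + 0) powr r - 1 + 0 powr r) (at_right (0::real))"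
      "((%d. 1 - (1 - d) powr r + d powr r) \<longlongrightarrow> 1 - (1 - 0) powr r + 0 powr r) (at_right (0::real))"
 proof -
  have "((%d::real. d powr r) \<longlongrightarrow> 0 powr r) (at_right 0)"
   using assms by (intro tendsto_powr2 tendsto_ident_at tendsto_const) (auto simp: eventually_at_right_field intro: exI[of _ 1])
  moreover have "((%d::real. (1 + d) powr r) \<longlongrightarrow> (1 + 0) powr r) (at_right 0)"
   "((%d::real. (1 - d) powr r) \<longlongrightarrow> (1 - 0) powr r) (at_right 0)"
   by (intro tendsto_powr tendsto_intros; simp)+
  ultimately show "((%d. (1 + d) powr r - 1 + d powr r) \<longlongrightarrow> (1 + 0) powr r - 1 + 0 powr r) (at_right (0::real))"
      "((%d. 1 - (1 - d) powr r + d powr r) \<longlongrightarrow> 1 - (1 - 0) powr r + 0 powr r) (at_right (0::real))"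
   by (intro tendsto_add tendsto_diff tendsto_const; simp)+
 qed
 have "\<forall>\<^sub>F d in at_right (0::real). (1 + d) powr r - 1 + d powr r < e" "\<forall>\<^sub>F d in at_right (0::real). 1 - (1 - d) powr r + d powr r < e"
   "\<forall>\<^sub>F d in at_right (0::real). d > 0 & d < 1"
  using order_tendstoD(2)[OF lims(1), of e] order_tendstoD(2)[OF lims(2), of e] assms
  by (auto simp: eventually_at_right_field intro: exI[of _ 1])
 then have "\<forall>\<^sub>F d in at_right (0::real). (1 + d) powr r - 1 + d powr r < e & 1 - (1 - d) powr r + d powr r < e & d > 0 & d < 1"
  by eventually_elim auto
 then obtain d where d: "0 < d" "d < 1" "(1 + d) powr r - 1 + d powr r < e" "1 - (1 - d) powr r + d powr r < e"
  using eventually_happens[of _ "at_right (0::real)"] by force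
 define K where "K = (1 / d + 1) powr r + (1 / d) powr r + 1"
 have "\<bar>\<bar>a + b\<bar> powr r - \<bar>a\<bar> powr r - \<bar>b\<bar> powr r\<bar> <= e * \<bar>a\<bar> powr r + K * \<bar>b\<bar> powr r" for a b :: real
 proof (cases "abs b <= d * abs a")
  case True
  have b: "abs b powr r <= d powr r * abs a powr r"
   using powr_mono2[of r "abs b" "d * abs a"] True d assms by (simp add: powr_mult)
  have "abs (a + b) <= (1 + d) * abs a" using True by (simp add: algebra_simps)
  then have u: "abs (a + b) powr r <= (1 + d) powr r * abs a powr r"
   using powr_mono2[of r "abs (a + b)" "(1 + d) * abs a"] d assms by (simp add: powr_mult)
  have "(1 - d) * abs a <= abs (a + b)" using True by (simp add: algebra_simps)
  then have l: "(1 - d) powr r * abs a powr r <= abs (a + b) powr r"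
   using powr_mono2[of r "(1 - d) * abs a" "abs (a + b)"] d assms by (simp add: powr_mult)
  have "\<bar>\<bar>a + b\<bar> powr r - \<bar>a\<bar> powr r - \<bar>b\<bar> powr r\<bar> <= e * \<bar>a\<bar> powr r"
  proof -
   have gen: "abs (X - Y - Z) <= E" if "X <= p" "q <= X" "Z <= z" "0 <= Z" "p - Y + z <= E" "Y - q + z <= E" for X Y Z p q z E :: real
    using that by linarith
   show ?thesis
    by (rule gen[OF u l b]) (use mult_right_mono[OF less_imp_le[OF d(3)], of "abs a powr r"]
      mult_right_mono[OF less_imp_le[OF d(4)], of "abs a powr r"] in \<open>simp_all add: algebra_simps\<close>)
  qed
  moreover have "K * abs b powr r >= 0" by (simp add: K_def)
  ultimately show ?thesis by linarith
 next
  case False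
  then have a: "abs a <= 1 / d * abs b" using d by (simp add: field_simps)
  have 1: "abs a powr r <= (1 / d) powr r * abs b powr r"
   using powr_mono2[of r "abs a" "1 / d * abs b"] a d assms by (simp add: powr_mult[symmetric])
  have "abs (a + b) <= (1 / d + 1) * abs b" using a by (simp add: algebra_simps)
  then have 2: "abs (a + b) powr r <= (1 / d + 1) powr r * abs b powr r"
   using powr_mono2[of r "abs (a + b)" "(1 / d + 1) * abs b"] d assms by (simp add: powr_mult[symmetric])
  have gen: "abs (X - Y - Z) <= p + q + Z" if "0 <= X" "0 <= Y" "0 <= Z" "X <= p" "Y <= q" for X Y Z p q :: real
   using that by linarith
  have "\<bar>\<bar>a + b\<bar> powr r - \<bar>a\<bar> powr r - \<bar>b\<bar> powr r\<bar> <= K * \<bar>b\<bar> powr r"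
   using gen[OF _ _ _ 2 1, of "abs b powr r"] by (simp add: K_def distrib_right)
  then show ?thesis using assms by (simp add: add_increasing)
 qed
 moreover have "K >= 0" by (simp add: K_def)
 ultimately show thesis using that by blast
qed

text \<open>Splits the r-th power integral exactly into the part of the limit and the part that
  escapes. It is what makes the energy additive along sequences that converge only almost
  everywhere.\<close>

lemma Brezis_Lieb:
 fixes f :: "nat => 'a => real"
 assumes r: "r > 0" and [measurable]: "!!n. f n : bmeas M" "g : bmeas M"
  and i: "!!n. integrable M (%x. abs (f n x) powr r)" and C: "!!n. (\<integral>x. abs (f n x) powr r \<partial>M) <= C"
  and ae: "AE x in M. (%n. f n x) ~~> g x"
 shows "integrable M (%x. abs (g x) powr r)" "!!n. integrable M (%x. abs (f n x - g x) powr r)"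
  "(%n. (\<integral>x. abs (f n x) powr r \<partial>M) - (\<integral>x. abs (f n x - g x) powr r \<partial>M)) ~~> (\<integral>x. abs (g x) powr r \<partial>M)"
proof -
 show gi: "integrable M (%x. abs (g x) powr r)"
 proof (rule fatou_bound(1)[OF i _ _ _ C])
  show "AE x in M. (%n. abs (f n x) powr r) ~~> abs (g x) powr r"
   using ae by eventually_elim (use r in \<open>auto intro!: tendsto_powr2 tendsto_rabs\<close>)
 qed auto
 have "(\<integral>x. abs (g x) powr r \<partial>M) <= C"
 proof (rule fatou_bound(2)[OF i _ _ _ C])
  show "AE x in M. (%n. abs (f n x) powr r) ~~> abs (g x) powr r"
   using ae by eventually_elim (use r in \<open>auto intro!: tendsto_powr2 tendsto_rabs\<close>)
 qed auto
 note gC = this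
 show di: "integrable M (%x. abs (f n x - g x) powr r)" for n
  using r by (intro integrable_powr_diff i gi) auto
 define B where "B = 2 powr r * (C + C)"
 have dB: "(\<integral>x. abs (f n x - g x) powr r \<partial>M) <= B" for n
 proof -
  have "(\<integral>x. abs (f n x - g x) powr r \<partial>M) <= (\<integral>x. 2 powr r * (abs (f n x) powr r + abs (g x) powr r) \<partial>M)"
   using i gi di abs_powr_add_le[of r "f n _" "- g _"] r by (intro integral_mono) auto
  also have "... = 2 powr r * ((\<integral>x. abs (f n x) powr r \<partial>M) + (\<integral>x. abs (g x) powr r \<partial>M))" using i gi by simp
  also have "... <= B" unfolding B_def using C[of n] gC by (intro mult_left_mono add_mono) auto
  finally show ?thesis .
 qed
 have B0: "B >= 0" using dB[of 0] by (rule order_trans[rotated]) simp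
 define D where "D = (%n x. abs (f n x) powr r - abs (f n x - g x) powr r - abs (g x) powr r)"
 have Di: "integrable M (D n)" for n unfolding D_def using i gi di by auto
 have "(%n. \<integral>x. D n x \<partial>M) ~~> 0"
 proof (rule LIMSEQ_I)
  fix e :: real assume "e > 0"
  define e' where "e' = e / (2 * (B + 1))"
  have e': "e' > 0" using \<open>e > 0\<close> B0 by (simp add: e'_def)
  obtain K where K: "K >= 0" "!!a b. \<bar>\<bar>a + b\<bar> powr r - \<bar>a\<bar> powr r - \<bar>b\<bar> powr r\<bar> <= e' * \<bar>a\<bar> powr r + K * \<bar>b\<bar> powr r"
   using Brezis_Lieb_pointwise[OF r e'] by metis
  \<comment> \<open>Subtracting the small multiple of |f n - g|^r leaves a quantity dominated by
    K|g|^r, so dominated convergence applies to \<open>W\<close>; the subtracted part has integral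
    of order e.\<close>
  define W where "W = (%n x. max 0 (abs (D n x) - e' * abs (f n x - g x) powr r))"
  have [measurable]: "D n : bmeas M" "W n : bmeas M" for n unfolding D_def W_def by measurable
  have Wb: "W n x <= K * abs (g x) powr r" for n x
   using K(2)[of "f n x - g x" "g x"] K(1) by (simp add: W_def D_def)
  have W0: "W n x >= 0" for n x by (simp add: W_def)
  have "(%n. \<integral>x. W n x \<partial>M) ~~> (\<integral>x. 0 \<partial>M)"
  proof (rule integral_dominated_convergence[where w="%x. K * abs (g x) powr r"])
   show "AE x in M. (%n. W n x) ~~> 0"
    using ae
   proof eventually_elim
    case (elim x)
    have "(%n. abs (f n x - g x) powr r) ~~> abs (g x - g x) powr r"
     using r by (intro tendsto_powr2 tendsto_intros elim) auto
    moreover have "(%n. abs (f n x) powr r) ~~> abs (g x) powr r"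
     using r by (intro tendsto_powr2 tendsto_intros elim) auto
    ultimately have "(%n. W n x) ~~> max 0 (\<bar>\<bar>g x\<bar> powr r - \<bar>g x - g x\<bar> powr r - \<bar>g x\<bar> powr r\<bar> - e' * \<bar>g x - g x\<bar> powr r)"
     unfolding W_def D_def by (intro tendsto_max tendsto_diff tendsto_rabs tendsto_mult tendsto_const)
    then show ?case by simp
   qed
  qed (use gi Wb W0 in auto)
  then obtain n0 where n0: "!!n. n >= n0 ==> abs (\<integral>x. W n x \<partial>M) < e / 2"
   using LIMSEQ_D[of _ 0 "e/2"] \<open>e > 0\<close> by fastforce
  have Wi: "integrable M (W n)" for n
   by (rule L1_integrable_bound[of M "%x. K * abs (g x) powr r"]) (use gi Wb W0 K(1) in auto)
  have "norm ((\<integral>x. D n x \<partial>M) - 0) < e" if "n >= n0" for n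
  proof -
   have "abs (\<integral>x. D n x \<partial>M) <= (\<integral>x. abs (D n x) \<partial>M)" by (rule integral_abs_bound)
   also have "... <= (\<integral>x. W n x + e' * abs (f n x - g x) powr r \<partial>M)"
    using Di Wi di by (intro integral_mono) (auto simp: W_def)
   also have "... = (\<integral>x. W n x \<partial>M) + e' * (\<integral>x. abs (f n x - g x) powr r \<partial>M)" using Wi di by simp
   also have "... < e / 2 + e' * (B + 1)"
    using n0[OF that] dB[of n] e' by (intro add_less_le_mono mult_left_mono) auto
   also have "\<dots> = e" using B0 by (simp add: e'_def field_simps)
   finally show ?thesis by simp
  qed
  then show "\<exists>no. \<forall>n\<ge>no. norm ((\<integral>x. D n x \<partial>M) - 0) < e" by blast
 qed
 then have "(%n. ((\<integral>x. abs (f n x) powr r \<partial>M) - (\<integral>x. abs (f n x - g x) powr r \<partial>M) - (\<integral>x. abs (g x) powr r \<partial>M)) + (\<integral>x. abs (g x) powr r \<partial>M)) ~~> 0 + (\<integral>x. abs (g x) powr r \<partial>M)"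
  unfolding D_def using i di gi by (intro tendsto_add) auto
 then show "(%n. (\<integral>x. abs (f n x) powr r \<partial>M) - (\<integral>x. abs (f n x - g x) powr r \<partial>M)) ~~> (\<integral>x. abs (g x) powr r \<partial>M)"
  by simp
qed

section \<open>Differentiation of power integrals\<close>

lemma DERIV_abs_powr:
 fixes t r :: real assumes "r > 1"
 shows "((%t. abs t powr r) has_real_derivative r * (sgn t * abs t powr (r - 1))) (at t)"
proof -
 consider "t > 0" | "t < 0" | "t = 0" by linarith
 then show ?thesis
 proof cases
  case 1
  have "((%t. t powr r) has_real_derivative r * (sgn t * abs t powr (r - 1))) (at t)"
   using 1 by (auto intro!: derivative_eq_intros)
  then show ?thesis using 1
   by (subst DERIV_cong_ev[OF refl _ refl, where g="%t. t powr r"])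
    (auto simp: eventually_nhds intro!: exI[of _ "{0<..}"])
 next
  case 2
  have "((%t. (- t) powr r) has_real_derivative r * (sgn t * abs t powr (r - 1))) (at t)"
   using 2 by (auto intro!: derivative_eq_intros)
  then show ?thesis using 2
   by (subst DERIV_cong_ev[OF refl _ refl, where g="%t. (- t) powr r"])
    (auto simp: eventually_nhds intro!: exI[of _ "{..<0}"])
 next
  case 3
  have "((%h::real. sgn h * abs h powr (r - 1)) \<longlongrightarrow> 0) (at 0)"
  proof (rule tendsto_rabs_zero_cancel, rule Lim_transform_eventually)
   have "((%h::real. abs h powr (r - 1)) \<longlongrightarrow> abs 0 powr (r - 1)) (at 0)"
    using assms by (intro tendsto_powr2 tendsto_intros) auto
   then show "((%h::real. abs h powr (r - 1)) \<longlongrightarrow> 0) (at 0)" using assms by simp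
   show "\<forall>\<^sub>F h in at 0. \<bar>h\<bar> powr (r - 1) = \<bar>sgn h * \<bar>h\<bar> powr (r - 1)\<bar>"
    by (auto simp: eventually_at_filter abs_mult sgn_if)
  qed
  then have "(%h. (abs (0 + h) powr r - abs 0 powr r) / h) \<midarrow>0\<rightarrow> (0::real)"
  proof (rule Lim_transform_eventually)
   have "sgn h * abs h powr (r - 1) = (abs (0 + h) powr r - abs 0 powr r) / h" if "h ~= 0" for h :: real
    using that assms by (auto simp: powr_diff sgn_if)
   then show "\<forall>\<^sub>F h in at 0. sgn h * abs h powr (r - 1) = (abs (0 + h) powr r - abs 0 powr r) / h"
    by (auto simp: eventually_at_filter)
  qed
  then show ?thesis using 3 assms by (simp add: DERIV_def)
 qed
qed

text \<open>The integrable majorant for the difference quotients of the next lemma. The mean value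
  inequality is applied in h on [-1,1], where |a + hb| <= |a| + |b| absorbs |a + zb|^(r-1) |b| into
  (|a| + |b|)^r.\<close>

lemma abs_powr_diff_le:
 fixes a b r h :: real assumes "r > 1" "abs h <= 1"
 shows "\<bar>\<bar>a + h * b\<bar> powr r - \<bar>a\<bar> powr r\<bar> <= \<bar>h\<bar> * (r * (2 powr r * (\<bar>a\<bar> powr r + \<bar>b\<bar> powr r)))"
proof -
 have "norm (abs (a + h * b) powr r - abs (a + 0 * b) powr r) <= (r * (abs a + abs b) powr r) * norm (h - 0)"
 proof (rule field_differentiable_bound[of "{-1..1}"])
  fix z :: real assume z: "z : {-1..1}"
  show "((%z. abs (a + z * b) powr r) has_field_derivative r * (sgn (a + z * b) * abs (a + z * b) powr (r - 1)) * b) (at z within {-1..1})"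
   by (rule has_field_derivative_at_within, rule DERIV_chain2[OF DERIV_abs_powr[OF assms(1)]])
    (auto intro!: derivative_eq_intros)
  have "abs (a + z * b) <= abs a + abs b"
  proof -
   have "abs z * abs b <= 1 * abs b" using z by (intro mult_right_mono) auto
   then show ?thesis using abs_triangle_ineq[of a "z * b"] by (simp add: abs_mult)
  qed
  then have "abs (a + z * b) powr (r - 1) * abs b <= (abs a + abs b) powr (r - 1) * (abs a + abs b)"
   using assms by (intro mult_mono powr_mono2) auto
  also have "... = (abs a + abs b) powr r"
   using powr_mult_base[of "abs a + abs b" "r - 1"] by (simp add: mult.commute)
  finally have *: "abs (a + z * b) powr (r - 1) * abs b <= (abs a + abs b) powr r" .
  have "norm (r * (sgn (a + z * b) * abs (a + z * b) powr (r - 1)) * b) <= r * (abs (a + z * b) powr (r - 1) * abs b)"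
   using assms by (auto simp: abs_mult sgn_if)
  also have "... <= r * (abs a + abs b) powr r" using * assms by simp
  finally show "norm (r * (sgn (a + z * b) * abs (a + z * b) powr (r - 1)) * b) <= r * (abs a + abs b) powr r" .
 qed (use assms in auto)
 also have "... <= (r * (2 powr r * (abs a powr r + abs b powr r))) * norm (h - 0)"
  using assms powr_add_le[of "abs a" "abs b" r] by (intro mult_right_mono mult_left_mono) auto
 finally show ?thesis by (simp add: mult.commute)
qed

lemma DERIV_powr_integral:
 fixes u v :: "'a => real"
 assumes r: "r > 1" and [measurable]: "u : bmeas M" "v : bmeas M"
  and i: "integrable M (%x. abs (u x) powr r)" "integrable M (%x. abs (v x) powr r)"
 shows "integrable M (%x. sgn (u x) * abs (u x) powr (r - 1) * v x)"
  "((%e. \<integral>x. abs (u x + e * v x) powr r \<partial>M) has_real_derivative r * (\<integral>x. sgn (u x) * abs (u x) powr (r - 1) * v x \<partial>M)) (at 0)"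
proof -
 define w where "w = (%x. r * (2 powr r * (abs (u x) powr r + abs (v x) powr r)))"
 have wi: "integrable M w" unfolding w_def using i by simp
 have w0: "w x >= 0" for x using r by (simp add: w_def)
 let ?D = "%x. r * (sgn (u x) * abs (u x) powr (r - 1) * v x)"
 have d: "((%e. abs (u x + e * v x) powr r) has_real_derivative ?D x) (at 0)" for x
 proof -
  have *: "((%t. abs t powr r) has_real_derivative r * (sgn (u x) * abs (u x) powr (r - 1))) (at (u x + 0 * v x))"
   using DERIV_abs_powr[OF r, of "u x"] by simp
  have "((%e. u x + e * v x) has_real_derivative v x) (at 0)" by (auto intro!: derivative_eq_intros)
  from DERIV_chain2[OF * this] show ?thesis by (simp add: algebra_simps)
 qed
 have vi: "integrable M (%x. abs (e * v x) powr r)" for e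
  using integrable_mult_right[OF i(2), of "abs e powr r"] by (simp add: abs_mult powr_mult)
 have fi: "integrable M (%x. abs (u x + e * v x) powr r)" for e
  using r by (intro integrable_powr_add i vi) auto
 have bd: "\<bar>(\<bar>u x + h * v x\<bar> powr r - \<bar>u x\<bar> powr r) / h\<bar> <= w x" if "h ~= 0" "abs h <= 1" for h x
  using abs_powr_diff_le[OF r that(2), of "u x" "v x"] that by (simp add: w_def abs_divide divide_le_eq mult.commute)
 have lim: "(%h. (abs (u x + h * v x) powr r - abs (u x) powr r) / h) \<midarrow>0\<rightarrow> ?D x" for x
  using d[of x] by (simp add: DERIV_def)
 \<comment> \<open>The derivative inherits the majorant as a limit of difference quotients; this
   already proves that it is integrable.\<close>
 have db: "abs (?D x) <= w x" for x
 proof (rule tendsto_upperbound[OF tendsto_rabs[OF lim]])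
  show "\<forall>\<^sub>F h in at 0. \<bar>(\<bar>u x + h * v x\<bar> powr r - \<bar>u x\<bar> powr r) / h\<bar> <= w x"
   unfolding eventually_at using bd by (intro exI[of _ 1]) (auto simp: dist_real_def)
 qed simp
 have Di: "integrable M ?D"
  by (rule L1_integrable_bound[OF wi]) (use db w0 in auto)
 then show Di': "integrable M (%x. sgn (u x) * abs (u x) powr (r - 1) * v x)"
  using integrable_mult_right[OF Di, of "1/r"] r by simp
 have "(%h. ((\<integral>x. abs (u x + h * v x) powr r \<partial>M) - (\<integral>x. abs (u x) powr r \<partial>M)) / h) \<midarrow>0\<rightarrow> (\<integral>x. ?D x \<partial>M)"
  unfolding tendsto_at_iff_sequentially
 proof (intro allI impI)
  fix X :: "nat => real" assume X: "\<forall>i. X i : UNIV - {0}" "X ~~> 0"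
  obtain n0 where n0: "!!n. n >= n0 ==> abs (X n) <= 1"
   using LIMSEQ_D[OF X(2), of 1] by fastforce
  define Y where "Y = (%n. X (n + n0))"
  have Y: "Y n ~= 0" "abs (Y n) <= 1" for n using X n0 by (auto simp: Y_def)
  have Y0: "Y ~~> 0" unfolding Y_def using X(2) by (rule LIMSEQ_ignore_initial_segment)
  have "(%n. \<integral>x. (abs (u x + Y n * v x) powr r - abs (u x) powr r) / Y n \<partial>M) ~~> (\<integral>x. ?D x \<partial>M)"
  proof (rule integral_dominated_convergence[where w=w])
   show "AE x in M. (%n. (abs (u x + Y n * v x) powr r - abs (u x) powr r) / Y n) ~~> ?D x"
    using lim Y Y0 unfolding tendsto_at_iff_sequentially by (auto simp: o_def)
   show "AE x in M. norm ((abs (u x + Y n * v x) powr r - abs (u x) powr r) / Y n) <= w x" for n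
    using bd[OF Y] by simp
  qed (use wi in auto)
  also have "(%n. \<integral>x. (abs (u x + Y n * v x) powr r - abs (u x) powr r) / Y n \<partial>M) =
    (%n. ((\<integral>x. abs (u x + X (n + n0) * v x) powr r \<partial>M) - (\<integral>x. abs (u x) powr r \<partial>M)) / X (n + n0))"
   using fi i by (simp add: Y_def)
  finally show "((%h. ((\<integral>x. abs (u x + h * v x) powr r \<partial>M) - (\<integral>x. abs (u x) powr r \<partial>M)) / h) \<circ> X) ~~> (\<integral>x. ?D x \<partial>M)"
   unfolding o_def by (rule LIMSEQ_offset)
 qed
 then show "((%e. \<integral>x. abs (u x + e * v x) powr r \<partial>M) has_real_derivative r * (\<integral>x. sgn (u x) * abs (u x) powr (r - 1) * v x \<partial>M)) (at 0)"
  by (simp add: DERIV_def)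
qed

section \<open>Integration of compactly supported functions\<close>

lemma integrable_compact_support:
 fixes f :: "'a::euclidean_space => 'b::{banach, second_countable_topology}"
 assumes "continuous_on UNIV f" "compact K" "!!x. x \<notin> K ==> f x = 0"
 shows "integrable lborel f"
proof -
 have "integrable lborel (%x. indicat_real K x *R f x)"
  using assms by (intro borel_integrable_compact) (auto intro: continuous_on_subset)
 also have "(%x. indicat_real K x *R f x) = f" using assms(3) by (auto simp: indicator_def fun_eq_iff)
 finally show ?thesis .
qed

lemma bounded_compact_support:
 fixes f :: "'a::euclidean_space => 'b::real_normed_vector"
 assumes "continuous_on UNIV f" "compact K" "!!x. x \<notin> K ==> f x = 0"
 obtains B where "B > 0" "!!x. norm (f x) <= B"
proof -
 have "compact (f ` K)" using assms by (intro compact_continuous_image) (auto intro: continuous_on_subset)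
 then obtain B where B: "!!x. x : K ==> norm (f x) <= B" "B > 0"
  using bounded_pos[of "f ` K"] compact_imp_bounded by blast
 have "norm (f x) <= B" for x using B assms(3)[of x] by (cases "x : K") auto
 then show thesis using that B by blast
qed

lemma cont_borel: "continuous_on UNIV f ==> f : bmeas borel"
 by (rule borel_measurable_continuous_onI)

lemma nn_integral_affine:
 fixes f :: "real^'n => ennreal"
 assumes [measurable]: "f : bmeas borel" and c: "c ~= 0"
 shows "(NN x. f x) = ennreal (abs c^CARD('n)) * (NN x. f (c *R x + t))"
proof -
 have "(NN x. f x) = (\<integral>\<^sup>+x. f x \<partial>(density (distr lborel borel (%x. t + c *R x)) (%_. abs c^DIM(real^'n))))"
  using lborel_affine[OF c, of t] by simp
 also have "... = ennreal (abs c^CARD('n)) * (NN x. f (t + c *R x))"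
  by (simp add: nn_integral_density nn_integral_distr nn_integral_cmult)
 finally show ?thesis by (simp add: add.commute)
qed

lemma nn_integral_translate:
 fixes f :: "real^'n => ennreal"
 assumes "f : bmeas borel"
 shows "(NN x. f (x + t)) = (NN x. f x)"
 using nn_integral_affine[OF assms, of 1 t] by simp

lemma integral_affine:
 fixes f :: "real^'n => real"
 assumes [measurable]: "f : bmeas borel" and c: "c ~= 0"
 shows "integrable lborel (%x. f (c *R x + t)) \<longleftrightarrow> integrable lborel f"
  "(LBINT x. f (c *R x + t)) = (LBINT x. f x) / abs c^CARD('n)"
proof -
 have m: "(%x. t + c *R x) : measurable lborel (borel :: (real^'n) measure)" by simp
 have L: "(lborel :: (real^'n) measure) = density (distr lborel borel (%x. t + c *R x)) (%_. abs c^DIM(real^'n))"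
  using lborel_affine[OF c, of t] by simp
 have "integrable lborel f \<longleftrightarrow> integrable (density (distr lborel borel (%x. t + c *R x)) (%_. abs c^DIM(real^'n))) f"
  using L by simp
 also have "... \<longleftrightarrow> integrable lborel (%x. abs c^CARD('n) * f (t + c *R x))"
  by (subst integrable_density) (auto simp: integrable_distr_eq)
 also have "... \<longleftrightarrow> integrable lborel (%x. f (c *R x + t))"
  using c by (simp add: integrable_mult_right_iff add.commute)
 finally show "integrable lborel (%x. f (c *R x + t)) \<longleftrightarrow> integrable lborel f" by simp
 have "(LBINT x. f x) = (\<integral>x. f x \<partial>(density (distr lborel borel (%x. t + c *R x)) (%_. abs c^DIM(real^'n))))"
  using L by simp
 also have "... = (LBINT x. abs c^CARD('n) * f (t + c *R x))"
  by (subst integral_density) (auto simp: integral_distr)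
 also have "... = abs c^CARD('n) * (LBINT x. f (c *R x + t))" by (simp add: add.commute)
 finally show "(LBINT x. f (c *R x + t)) = (LBINT x. f x) / abs c^CARD('n)"
  using c by simp
qed

text \<open>Difference quotients have integral zero by translation invariance, and dominated
  convergence passes this to the derivative.\<close>

lemma integral_partial_zero:
 fixes f :: "real^'n => real"
 assumes g: "has_grad f f'" and K: "compact K" and z: "!!x. x \<notin> K ==> f x = 0" "!!x. x \<notin> K ==> f' x = 0"
 shows "integrable lborel (%x. f' x $ i)" "(LBINT x. f' x $ i) = 0"
proof -
 let ?e = "axis i 1 :: real^'n"
 note cf = has_gradD(1)[OF g] and cf' = has_gradD(2)[OF g]
 show "integrable lborel (%x. f' x $ i)"
  using z by (intro integrable_compact_support[OF _ K] continuous_intros cf') auto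
 have fi: "integrable lborel f" by (rule integrable_compact_support[OF cf K z(1)])
 have [measurable]: "f : bmeas borel" "f' : bmeas borel" by (intro cont_borel cf cf')+
 have [measurable]: "(%x. f' x $ i) : bmeas borel" by (intro cont_borel continuous_intros cf')
 obtain B where B: "B > 0" "!!x. norm (f' x) <= B" using bounded_compact_support[OF cf' K z(2)] by metis
 \<comment> \<open>All points from which a step of length at most 1 in direction i can reach K; it
   supports every difference quotient at once.\<close>
 define K' where "K' = (%(x, t). x - t *R ?e) ` (K \<times> {0..1::real})"
 have cK': "compact K'" unfolding K'_def case_prod_beta
  by (intro compact_continuous_image compact_Times K continuous_intros) auto
 have [measurable]: "K' : sets borel" using cK' by (simp add: borel_compact)
 have bd: "abs ((f (x + t *R ?e) - f x) / t) <= B * indicator K' x" if t: "0 < t" "t <= 1" for x t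
 proof (cases "x : K'")
  case True
  have "norm (f (x + t *R ?e) - f (x + 0 *R ?e)) <= B * norm (t - 0)"
  proof (rule field_differentiable_bound[of UNIV])
   fix z show "((%t. f (x + t *R ?e)) has_field_derivative f' (x + z *R ?e) $ i) (at z within UNIV)"
    using has_grad_at[OF g] by simp
   show "norm (f' (x + z *R ?e) $ i) <= B"
    using component_le_norm_cart[of "f' (x + z *R ?e)" i] B(2)[of "x + z *R ?e"] by simp
  qed auto
  then show ?thesis using True t by (simp add: abs_divide divide_le_eq)
 next
  case False
  have "x + t *R ?e \<notin> K"
  proof
   assume "x + t *R ?e : K"
   then have "x : K'" unfolding K'_def using t by (intro image_eqI[of _ _ "(x + t *R ?e, t)"]) auto
   with False show False by simp
  qed
  moreover have "x \<notin> K"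
  proof
   assume "x : K"
   then have "x : K'" unfolding K'_def by (intro image_eqI[of _ _ "(x, 0)"]) auto
   with False show False by simp
  qed
  ultimately show ?thesis using False z by simp
 qed
 let ?t = "%n::nat. inverse (real (Suc n))"
 have t: "0 < ?t n" "?t n <= 1" for n by (auto simp: inverse_le_1_iff)
 have "(%n. LBINT x. (f (x + ?t n *R ?e) - f x) / ?t n) ~~> (LBINT x. f' x $ i)"
 proof (rule integral_dominated_convergence[where w="%x. B * indicator K' x"])
  show "integrable lborel (%x. B * indicat_real K' x)"
   using cK' by (intro integrable_mult_right integrable_real_indicator) (use emeasure_compact_finite[OF cK'] in simp_all)
  show "AE x in lborel. norm ((f (x + ?t n *R ?e) - f x) / ?t n) <= B * indicator K' x" for n
   using bd[OF t] by simp
  show "AE x in lborel. (%n. (f (x + ?t n *R ?e) - f x) / ?t n) ~~> f' x $ i"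
  proof (rule AE_I2)
   fix x
   have "(%h. (f (x + (0 + h) *R ?e) - f (x + 0 *R ?e)) / h) \<midarrow>0\<rightarrow> f' x $ i"
    using has_gradD(3)[OF g, of x i] by (simp add: DERIV_def)
   moreover have "?t ~~> 0" by (rule LIMSEQ_inverse_real_of_nat)
   ultimately show "(%n. (f (x + ?t n *R ?e) - f x) / ?t n) ~~> f' x $ i"
    unfolding tendsto_at_iff_sequentially using t by (auto simp: o_def less_imp_neq[symmetric])
  qed
 qed simp_all
 moreover have "(LBINT x. (f (x + ?t n *R ?e) - f x) / ?t n) = 0" for n
 proof -
  have i: "integrable lborel (%x. f (x + ?t n *R ?e))"
   using integral_affine(1)[of f 1 "?t n *R ?e"] fi by simp
  have e: "(LBINT x. f (x + ?t n *R ?e)) = (LBINT x. f x)"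
   using integral_affine(2)[of f 1 "?t n *R ?e"] by simp
  have "(LBINT x. (f (x + ?t n *R ?e) - f x) / ?t n) = ((LBINT x. f (x + ?t n *R ?e)) - (LBINT x. f x)) / ?t n"
   using i fi by (subst integral_divide_zero, subst L1_integral_diff) auto
  then show ?thesis using e by simp
 qed
 ultimately show "(LBINT x. f' x $ i) = 0"
  using LIMSEQ_unique[OF _ tendsto_const[of 0]] by simp
qed

section \<open>Square-integrable vector fields\<close>

lemma L2_inner:
 fixes f g :: "'a => 'b::euclidean_space"
 assumes [measurable]: "f : bmeas M" "g : bmeas M"
  and i: "integrable M (%x. (norm (f x))^2)" "integrable M (%x. (norm (g x))^2)"
 shows "integrable M (%x. f x \<bullet> g x)" "integrable M (%x. (norm (f x + g x))^2)" "integrable M (%x. (norm (f x - g x))^2)"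
  "abs (\<integral>x. f x \<bullet> g x \<partial>M) <= sqrt (\<integral>x. (norm (f x))^2 \<partial>M) * sqrt (\<integral>x. (norm (g x))^2 \<partial>M)"
proof -
 have in2: "abs (a \<bullet> b) <= (norm a)^2 + (norm b)^2" for a b :: 'b
 proof -
  have "abs (a \<bullet> b) <= norm a * norm b" by (rule Cauchy_Schwarz_ineq2)
  also have "... <= (norm a)^2 + (norm b)^2"
   using sum_squares_bound[of "norm a" "norm b"] mult_nonneg_nonneg[OF norm_ge_zero norm_ge_zero, of a b] by linarith
  finally show ?thesis .
 qed
 show fg: "integrable M (%x. f x \<bullet> g x)"
  by (rule L1_integrable_bound[OF L1_integrable_add[OF i]])
   (use in2 in auto)
 have e: "(norm (a + b))^2 = (norm a)^2 + 2 * (a \<bullet> b) + (norm b)^2" "(norm (a - b))^2 = (norm a)^2 - 2 * (a \<bullet> b) + (norm b)^2" for a b :: 'b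
  by (simp_all add: power2_norm_eq_inner inner_simps inner_commute)
 show "integrable M (%x. (norm (f x + g x))^2)" "integrable M (%x. (norm (f x - g x))^2)"
  unfolding e using i fg by auto
 define A B C where "A = (\<integral>x. (norm (f x))^2 \<partial>M)" and "B = (\<integral>x. (norm (g x))^2 \<partial>M)" and "C = (\<integral>x. f x \<bullet> g x \<partial>M)"
 have nn: "A >= 0" "B >= 0" by (auto simp: A_def B_def)
 have q: "A + 2 * t * C + t^2 * B >= 0" for t
 proof -
  have "0 <= (\<integral>x. (norm (f x + t *R g x))^2 \<partial>M)" by simp
  also have "(%x. (norm (f x + t *R g x))^2) = (%x. (norm (f x))^2 + 2 * t * (f x \<bullet> g x) + t^2 * (norm (g x))^2)"
   by (simp add: e power_mult_distrib mult.assoc)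
  also have "integral\<^sup>L M ... = A + 2 * t * C + t^2 * B"
   using i fg by (simp add: A_def B_def C_def)
  finally show ?thesis .
 qed
 have "C^2 <= A * B"
 proof (cases "B = 0")
  case True
  have "C = 0"
  proof (rule ccontr)
   assume "C ~= 0"
   then show False using q[of "- (A + 1) / (2 * C)"] True by (simp add: field_simps)
  qed
  then show ?thesis using nn by simp
 next
  case False
  \<comment> \<open>The nonnegative quadratic in t is evaluated at its minimum t = -C/B.\<close>
  then have "0 <= B * (A + 2 * (- C / B) * C + (- C / B)^2 * B)" by (intro mult_nonneg_nonneg nn(2) q)
  also have "... = A * B - C^2" using False by (simp add: field_simps power2_eq_square)
  finally show ?thesis by simp
 qed
 then show "abs (\<integral>x. f x \<bullet> g x \<partial>M) <= sqrt (\<integral>x. (norm (f x))^2 \<partial>M) * sqrt (\<integral>x. (norm (g x))^2 \<partial>M)"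
  using real_le_rsqrt[of "abs C" "A * B"] by (simp add: A_def B_def C_def real_sqrt_mult)
qed

lemma L2_triangle:
 fixes f g :: "'a => 'b::euclidean_space"
 assumes "f : bmeas M" "g : bmeas M"
  and i: "integrable M (%x. (norm (f x))^2)" "integrable M (%x. (norm (g x))^2)"
 shows "(\<integral>x. (norm (f x + g x))^2 \<partial>M) <= 2 * (\<integral>x. (norm (f x))^2 \<partial>M) + 2 * (\<integral>x. (norm (g x))^2 \<partial>M)"
proof -
 have "(norm (a + b))^2 <= 2 * (norm a)^2 + 2 * (norm b)^2" for a b :: 'b
 proof -
  have "(norm (a + b))^2 <= (norm a + norm b)^2" by (intro power_mono norm_triangle_ineq) auto
  also have "... <= 2 * (norm a)^2 + 2 * (norm b)^2"
   using sum_squares_bound[of "norm a" "norm b"] by (simp add: power2_sum)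
  finally show ?thesis .
 qed
 then have "(\<integral>x. (norm (f x + g x))^2 \<partial>M) <= (\<integral>x. 2 * (norm (f x))^2 + 2 * (norm (g x))^2 \<partial>M)"
  using i L2_inner(2)[OF assms] by (intro integral_mono) auto
 then show ?thesis using i by simp
qed

section \<open>Hardy's inequality\<close>

lemma has_grad_norm2: "has_grad (%x::real^'n. (norm x)^2) (%x. 2 *R x)"
proof -
 have "((%t. (norm (x + t *R axis i 1))^2) has_real_derivative (2 *R x) $ i) (at 0)" for x :: "real^'n" and i
 proof -
  have "(%t. (norm (x + t *R axis i 1))^2) = (%t. (norm x)^2 + 2 * t * (x $ i) + t^2)"
   unfolding power2_norm_eq_inner
   by (simp add: inner_simps inner_axis inner_axis' inner_axis_axis fun_eq_iff power2_eq_square inner_real_def algebra_simps)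
  then show ?thesis by (auto intro!: derivative_eq_intros)
 qed
 then show ?thesis by (auto simp: has_grad_def intro!: continuous_intros)
qed

lemma has_grad_coord: "has_grad (%x::real^'n. x $ i) (%x. axis i 1)"
 using smooth_has_grad[OF smooth_coord] 
 by (auto simp: has_grad_def axis_def intro!: continuous_intros derivative_eq_intros)

text \<open>Hardy's inequality with the weight |x|^-2 smoothed to 1/(1+|x|^2). It plays two roles:
  on bounded sets it acts as a Poincare inequality, and on the whole space it controls u grad w for
  weights w whose gradient decays like 1/|x|.\<close>

theorem Hardy_test:
 fixes ph :: "real^'n => real"
 assumes N: "CARD('n) >= 3" and t: "test_fun UNIV ph"
 shows "integrable lborel (%x. (ph x)^2 / (1 + (norm x)^2))"
  "(LBINT x. (ph x)^2 / (1 + (norm x)^2)) <= 4 / (real CARD('n) - 2)^2 * (LBINT x. (norm (grad ph x))^2)"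
proof -
 obtain K where K: "compact K" "!!x. x \<notin> K ==> ph x = 0" "!!x. x \<notin> K ==> grad ph x = 0"
  using test_fun_obtain[OF t] by metis
 note g = test_fun_grad[OF t]
 note cph = has_gradD(1)[OF g] and cg = has_gradD(2)[OF g]
 define rh where "rh = (%x::real^'n. inverse (1 + (norm x)^2))"
 have p: "1 + (norm x)^2 > 0" for x :: "real^'n" by (simp add: add_pos_nonneg)
 have pn: "1 + (norm x)^2 ~= 0" for x :: "real^'n" using p[of x] by simp
 have crh: "continuous_on UNIV rh" unfolding rh_def by (intro continuous_intros) (simp add: pn)
 have grh: "has_grad rh (%x. (- ((rh x)^2)) *R (2 *R x))"
 proof -
  have g1: "has_grad (\<lambda>x::real^'n. 1 + (norm x)\<^sup>2) (\<lambda>x. 0 + 2 *\<^sub>R x)"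
   by (intro has_grad_add has_grad_const has_grad_norm2)
  have "has_grad (\<lambda>x::real^'n. inverse (1 + (norm x)\<^sup>2)) (\<lambda>x. (\<lambda>t. - ((inverse t)\<^sup>2)) (1 + (norm x)\<^sup>2) *\<^sub>R (0 + 2 *\<^sub>R x))"
  proof (rule has_grad_compose[OF g1])
   show "(inverse has_real_derivative - (inverse (1 + (norm x)\<^sup>2))\<^sup>2) (at (1 + (norm x)\<^sup>2))" for x :: "real^'n"
    using DERIV_inverse[of "1 + (norm x)\<^sup>2"] p[of x] by (simp add: numeral_2_eq_2)
   show "continuous_on (range (%x::real^'n. 1 + (norm x)^2)) (%t. - (inverse t)\<^sup>2)"
    by (intro continuous_intros) (auto simp: pn)
  qed
  then show ?thesis by (simp add: rh_def)
 qed
 let ?N = "real CARD('n)"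
 \<comment> \<open>The components of the vector field ph^2 x/(1+|x|^2), whose divergence has
   integral zero.\<close>
 define F where "F = (%i x. (ph x * ph x) * (x $ i * rh x))"
 define F' where "F' = (%i x. (ph x * ph x) *R (x $ i *R ((- ((rh x)^2)) *R (2 *R x)) + rh x *R axis i 1) +
   (x $ i * rh x) *R (ph x *R grad ph x + ph x *R grad ph x))"
 have gF: "has_grad (F i) (F' i)" for i unfolding F_def F'_def
  by (intro has_grad_mult g grh has_grad_coord)
 have F0: "x \<notin> K ==> F i x = 0" "x \<notin> K ==> F' i x = 0" for x i using K by (auto simp: F_def F'_def)
 have int0: "integrable lborel (%x. F' i x $ i)" "(LBINT x. F' i x $ i) = 0" for i
  using integral_partial_zero[OF gF K(1) F0] by auto
 have sumF: "(\<Sum>i\<in>UNIV. F' i x $ i) = (ph x)^2 * (?N * rh x - 2 * (norm x)^2 * (rh x)^2) + 2 * ph x * rh x * (grad ph x \<bullet> x)" for x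
 proof -
  have "F' i x $ i = (ph x)^2 * rh x - 2 * (ph x)^2 * (rh x)^2 * (x $ i * x $ i) + 2 * ph x * rh x * (grad ph x $ i * x $ i)" for i
   by (simp add: F'_def axis_def power2_eq_square algebra_simps)
  then have "(\<Sum>i\<in>UNIV. F' i x $ i) = ?N * ((ph x)^2 * rh x) - 2 * (ph x)^2 * (rh x)^2 * (x \<bullet> x) + 2 * ph x * rh x * (grad ph x \<bullet> x)"
   by (simp add: sum.distrib sum_subtractf sum_distrib_left[symmetric] inner_vec_def)
  then show ?thesis by (simp add: power2_norm_eq_inner algebra_simps)
 qed
 have "(LBINT x. (\<Sum>i\<in>UNIV. F' i x $ i)) = 0" using int0 by (simp add: Bochner_Integration.integral_sum)
 then have I0: "(LBINT x. (ph x)^2 * (?N * rh x - 2 * (norm x)^2 * (rh x)^2) + 2 * ph x * rh x * (grad ph x \<bullet> x)) = 0"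
  by (simp add: sumF)
 have gi: "integrable lborel (%x. (norm (grad ph x))^2)"
  using K by (intro integrable_compact_support[OF _ K(1)] continuous_intros cg) auto
 have hi: "integrable lborel (%x. (ph x)^2 * rh x)"
  using K by (intro integrable_compact_support[OF _ K(1)] continuous_intros cph crh) auto
 have Ii: "integrable lborel (%x. (ph x)^2 * (?N * rh x - 2 * (norm x)^2 * (rh x)^2) + 2 * ph x * rh x * (grad ph x \<bullet> x))"
  using int0(1) by (subst sumF[symmetric]) auto
 have k: "?N - 2 > 0" using N by simp
 \<comment> \<open>Since |x|^2 rh <= 1, the divergence of x rh is at least (N-2) rh. The mixed term
   is split by Young's inequality with weights (N-2)/2 and 2/(N-2); it absorbs half of the main
   term, and the quotient of the weights is the constant 4/(N-2)^2.\<close>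
 have pw: "(?N - 2) / 2 * ((ph x)^2 * rh x) - 2 / (?N - 2) * (norm (grad ph x))^2
  <= (ph x)^2 * (?N * rh x - 2 * (norm x)^2 * (rh x)^2) + 2 * ph x * rh x * (grad ph x \<bullet> x)" for x
 proof -
  have rh0: "rh x > 0" using p[of x] by (simp add: rh_def)
  have r1: "(norm x)^2 * rh x <= 1" using p[of x] by (simp add: rh_def divide_simps)
  then have r2: "(norm x)^2 * (rh x)^2 <= rh x"
   using mult_right_mono[OF r1, of "rh x"] rh0 by (simp add: power2_eq_square mult.assoc)
  define a b where "a = abs (ph x) * norm x * rh x" and "b = norm (grad ph x)"
  have "abs (2 * ph x * rh x * (grad ph x \<bullet> x)) = 2 * abs (ph x) * rh x * abs (grad ph x \<bullet> x)"
   using rh0 by (simp add: abs_mult)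
  also have "... <= 2 * abs (ph x) * rh x * (norm (grad ph x) * norm x)"
   using rh0 by (intro mult_left_mono Cauchy_Schwarz_ineq2) auto
  also have "... = 2 * a * b" by (simp add: a_def b_def)
  also have "... <= (?N - 2) / 2 * a^2 + 2 / (?N - 2) * b^2"
  proof -
   have "0 <= ((?N - 2) / 2 * a - b)^2 * (2 / (?N - 2))" using k by (intro mult_nonneg_nonneg) auto
   also have "... = (?N - 2) / 2 * a^2 + 2 / (?N - 2) * b^2 - 2 * a * b"
    using k by (simp add: power2_diff field_simps power2_eq_square)
   finally show ?thesis by simp
  qed
  finally have 1: "- (2 * ph x * rh x * (grad ph x \<bullet> x)) <= (?N - 2) / 2 * a^2 + 2 / (?N - 2) * b^2" by linarith
  have "a^2 = (ph x)^2 * ((norm x)^2 * (rh x)^2)" by (simp add: a_def power_mult_distrib)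
  also have "... <= (ph x)^2 * rh x" using r2 by (intro mult_left_mono) auto
  finally have 2: "(?N - 2) / 2 * a^2 <= (?N - 2) / 2 * ((ph x)^2 * rh x)" using k by (intro mult_left_mono) auto
  have "(ph x)^2 * ((?N - 2) * rh x) <= (ph x)^2 * (?N * rh x - 2 * (norm x)^2 * (rh x)^2)"
   using r2 by (intro mult_left_mono) (auto simp: algebra_simps)
  then have 3: "(?N - 2) * ((ph x)^2 * rh x) <= (ph x)^2 * (?N * rh x - 2 * (norm x)^2 * (rh x)^2)"
   by (simp add: algebra_simps)
  have "(?N - 2) / 2 * ((ph x)^2 * rh x) + (?N - 2) / 2 * ((ph x)^2 * rh x) = (?N - 2) * ((ph x)^2 * rh x)" by simp
  with 1 2 3 show ?thesis unfolding b_def by linarith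
 qed
 have "(LBINT x. (?N - 2) / 2 * ((ph x)^2 * rh x) - 2 / (?N - 2) * (norm (grad ph x))^2) <= 0"
  using integral_mono[OF _ Ii pw] I0 hi gi by simp
 then have le: "(?N - 2) / 2 * (LBINT x. (ph x)^2 * rh x) <= 2 / (?N - 2) * (LBINT x. (norm (grad ph x))^2)"
  using hi gi by simp
 have *: "(LBINT x. (ph x)^2 * rh x) <= 4 / (?N - 2)^2 * (LBINT x. (norm (grad ph x))^2)"
 proof -
  have "A <= 4 / k^2 * B" if "k > 0" "k / 2 * A <= 2 / k * B" for A B k :: real
   using mult_left_mono[OF that(2), of "2 / k"] that(1) by (simp add: power2_eq_square)
  from this[OF k] show ?thesis using le by blast
 qed
 have e: "(%x. (ph x)^2 / (1 + (norm x)^2)) = (%x. (ph x)^2 * rh x)" by (simp add: rh_def divide_inverse)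
 show "integrable lborel (%x. (ph x)^2 / (1 + (norm x)^2))"
  "(LBINT x. (ph x)^2 / (1 + (norm x)^2)) <= 4 / (?N - 2)^2 * (LBINT x. (norm (grad ph x))^2)"
  unfolding e using hi * by auto
qed

section \<open>Translation estimates\<close>

lemma square_integral_le:
 fixes h :: "'a::euclidean_space => real"
 assumes c: "continuous_on UNIV h" and Q: "compact Q"
 shows "ennreal ((LBINT t. indicator Q t * h t)^2) <= ennreal (measure lborel Q) * (NN t. indicator Q t * ennreal ((h t)^2))"
proof -
 have [measurable]: "h : bmeas borel" by (rule cont_borel[OF c])
 have [measurable]: "Q : sets borel" using Q by (simp add: borel_compact)
 have fin: "emeasure lborel Q < \<infinity>" by (rule emeasure_compact_finite[OF Q])
 have e1: "(%t. (norm (indicator Q t * h t))^2) = (%t. indicat_real Q t *R (h t)^2)"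
  by (auto simp: indicator_def fun_eq_iff)
 have i1: "integrable lborel (%t. (norm (indicator Q t * h t))^2)"
  unfolding e1 by (intro borel_integrable_compact continuous_intros continuous_on_subset[OF c] Q) auto
 have e2: "(%t. (norm (indicat_real Q t))^2) = indicat_real Q" by (auto simp: indicator_def fun_eq_iff)
 have i2: "integrable lborel (%t. (norm (indicat_real Q t))^2)"
  unfolding e2 using fin by (intro integrable_real_indicator) simp_all
 have e3: "(%t. (indicator Q t * h t) \<bullet> indicat_real Q t) = (%t. indicator Q t * h t)"
  by (auto simp: indicator_def fun_eq_iff)
 have "abs (LBINT t. (indicator Q t * h t) \<bullet> indicat_real Q t) <=
   sqrt (LBINT t. (norm (indicator Q t * h t))^2) * sqrt (LBINT t. (norm (indicat_real Q t))^2)"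
  by (rule L2_inner(4)[OF _ _ i1 i2]) measurable
 then have "abs (LBINT t. indicator Q t * h t) <= sqrt ((LBINT t. (norm (indicator Q t * h t))^2) * measure lborel Q)"
  unfolding e3 e2 by (simp add: real_sqrt_mult)
 then have "(LBINT t. indicator Q t * h t)^2 <= (LBINT t. (norm (indicator Q t * h t))^2) * measure lborel Q"
  by (metis real_sqrt_abs real_sqrt_le_iff)
 then have "ennreal ((LBINT t. indicator Q t * h t)^2) <= ennreal (measure lborel Q * (LBINT t. (norm (indicator Q t * h t))^2))"
  by (intro ennreal_leI) (simp add: mult.commute)
 also have "... = ennreal (measure lborel Q) * (NN t. ennreal ((norm (indicator Q t * h t))^2))"
  by (subst nn_integral_eq_integral[OF i1]) (auto simp: ennreal_mult'' integral_nonneg_AE)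
 also have "(NN t. ennreal ((norm (indicator Q t * h t))^2)) = (NN t. indicator Q t * ennreal ((h t)^2))"
  by (intro nn_integral_cong) (auto simp: indicator_def)
 finally show ?thesis .
qed

text \<open>The increment is the integral of the derivative along the segment, and Cauchy-Schwarz
  bounds its square. As the segment stays in B, the indicator of B may be inserted; after Fubini,
  translation invariance removes the dependence on tau.\<close>

lemma translation_estimate:
 fixes v :: "real^'n => real"
 assumes g: "has_grad v v'" and [measurable]: "A : sets borel" "B : sets borel"
  and AB: "!!x tau. x : A ==> 0 <= tau ==> tau <= 1 ==> x + (tau * t) *R axis i 1 : B"
 shows "(NN x. indicator A x * ennreal ((v (x + t *R axis i 1) - v x)^2))
  <= ennreal (t^2) * (NN x. indicator B x * ennreal ((v' x $ i)^2))"
proof -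
 let ?e = "axis i 1 :: real^'n"
 note cv = has_gradD(1)[OF g] and cv' = has_gradD(2)[OF g]
 have [measurable]: "v : bmeas borel" "v' : bmeas borel" by (intro cont_borel cv cv')+
 have [measurable]: "(%x. v' x $ i) : bmeas borel" by (intro cont_borel continuous_intros cv')
 have pw: "ennreal ((v (x + t *R ?e) - v x)^2) <= ennreal (t^2) * (NN tau. indicator {0..1} tau * ennreal ((v' (x + (tau * t) *R ?e) $ i)^2))" for x
 proof -
  define h where "h = (%tau. t * v' (x + (tau * t) *R ?e) $ i)"
  have ch: "continuous_on UNIV h" unfolding h_def
   by (intro continuous_intros continuous_on_compose2[OF cv']) auto
  have "(LBINT tau. indicator {0..1} tau *R h tau) = v (x + (1 * t) *R ?e) - v (x + (0 * t) *R ?e)"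
  proof (rule integral_FTC_atLeastAtMost)
   fix tau :: real
   have "((%tau. v (x + (tau * t) *R ?e)) has_real_derivative v' (x + (tau * t) *R ?e) $ i * t) (at tau)"
    by (rule DERIV_chain2[OF has_grad_at[OF g]]) (auto intro!: derivative_eq_intros)
   then show "((%tau. v (x + (tau * t) *R ?e)) has_vector_derivative h tau) (at tau within {0..1})"
    unfolding h_def by (simp add: has_real_derivative_iff_has_vector_derivative mult.commute has_vector_derivative_at_within)
  qed (auto intro: continuous_on_subset[OF ch])
  then have "v (x + t *R ?e) - v x = (LBINT tau. indicator {0..1} tau * h tau)" by simp
  then have "ennreal ((v (x + t *R ?e) - v x)^2) <= (NN tau. indicator {0..1} tau * ennreal ((h tau)^2))"
   using square_integral_le[OF ch, of "{0..1}"] by simp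
  also have "... = (NN tau. ennreal (t^2) * (indicator {0..1} tau * ennreal ((v' (x + (tau * t) *R ?e) $ i)^2)))"
   by (intro nn_integral_cong) (auto simp: h_def power_mult_distrib ennreal_mult indicator_def)
  also have "... = ennreal (t^2) * (NN tau. indicator {0..1} tau * ennreal ((v' (x + (tau * t) *R ?e) $ i)^2))"
   by (rule nn_integral_cmult) measurable
  finally show ?thesis .
 qed
 let ?W = "%x. indicator B x * ennreal ((v' x $ i)^2)"
 have "(NN x. indicator A x * ennreal ((v (x + t *R ?e) - v x)^2)) <=
  (NN x. ennreal (t^2) * (NN tau. indicator {0..1} tau * ?W (x + (tau * t) *R ?e)))"
 proof (intro nn_integral_mono)
  fix x
  show "indicator A x * ennreal ((v (x + t *R ?e) - v x)^2) <= ennreal (t^2) * (NN tau. indicator {0..1} tau * ?W (x + (tau * t) *R ?e))"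
  proof (cases "x : A")
   case True
   have "(NN tau. indicator {0..1} tau * ennreal ((v' (x + (tau * t) *R ?e) $ i)^2)) = (NN tau. indicator {0..1} tau * ?W (x + (tau * t) *R ?e))"
    using AB[OF True] by (intro nn_integral_cong) (auto simp: indicator_def)
   then show ?thesis using pw[of x] True by simp
  qed simp
 qed
 also have "... = ennreal (t^2) * (NN x. NN tau. indicator {0..1} tau * ?W (x + (tau * t) *R ?e))"
  by (rule nn_integral_cmult) measurable
 also have "(NN x. NN tau. indicator {0..1} tau * ?W (x + (tau * t) *R ?e)) =
   (NN tau. NN x. indicator {0..1} tau * ?W (x + (tau * t) *R ?e))"
  by (rule lborel_pair.Fubini'[symmetric]) measurable
 also have "... = (NN tau. indicator {0..1::real} tau * (NN x. ?W x))"
 proof (intro nn_integral_cong)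
  fix tau :: real
  have "(NN x. indicator {0..1} tau * ?W (x + (tau * t) *R ?e)) = indicator {0..1} tau * (NN x. ?W (x + (tau * t) *R ?e))"
   by (rule nn_integral_cmult) measurable
  also have "(NN x. ?W (x + (tau * t) *R ?e)) = (NN x. ?W x)"
   by (rule nn_integral_translate) measurable
  finally show "(NN x. indicator {0..1} tau * ?W (x + (tau * t) *R ?e)) = indicator {0..1} tau * (NN x. ?W x)" .
 qed
 also have "... = (NN x. ?W x)" by (simp add: nn_integral_multc)
 finally show ?thesis .
qed

section \<open>The Gagliardo--Nirenberg--Sobolev inequality\<close>

text \<open>The m-th root extended by the value \<open>top\<close> at \<open>top\<close>, since a
  line integral may be infinite before the total integral is known to be finite.\<close>

definition eroot :: "nat => ennreal => ennreal" where
 "eroot m x = (if x = top then top else ennreal (root m (enn2real x)))"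

lemma eroot_ennreal [simp]: "a >= 0 ==> eroot m (ennreal a) = ennreal (root m a)"
 by (simp add: eroot_def)

lemma eroot_mono: assumes "m > 0" "x <= y" shows "eroot m x <= eroot m y"
proof (cases "y = top")
 case False
 then have "x < top" "y < top" using assms(2) by (auto simp: less_top top_unique)
 then show ?thesis using assms by (auto simp: eroot_def intro!: ennreal_leI enn2real_mono)
qed (simp add: eroot_def)

lemma eroot_measurable [measurable]: "eroot m : bmeas borel"
proof -
 have "(%x. root m x) : bmeas borel" by (intro borel_measurable_continuous_onI continuous_intros)
 then show ?thesis unfolding eroot_def by measurable
qed

lemma prod_root_le_mean:
 fixes a :: "'i => real"
 assumes B: "finite B" "card B = m" "m > 0" and a: "!!b. b : B ==> a b >= 0"
 shows "(\<Prod>b\<in>B. root m (a b)) <= (\<Sum>b\<in>B. a b) / real m"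
proof (cases "\<exists>b\<in>B. a b = 0")
 case True
 then have "(\<Prod>b\<in>B. root m (a b)) = 0" using B by (auto simp: prod_zero_iff)
 then show ?thesis using a by (simp add: sum_nonneg)
next
 case False
 then have pos: "b : B ==> a b > 0" for b using a[of b] by force
 have ne: "B ~= {}" using B by auto
 have "(\<Prod>b\<in>B. root m (a b)) = (\<Prod>b\<in>B. exp ((1 / real m) *R ln (a b)))"
 proof (intro prod.cong refl)
  fix b assume b: "b : B"
  have "root m (a b) = a b powr (1 / real m)" using pos[OF b] B by (simp add: root_powr_inverse)
  also have "... = exp ((1 / real m) * ln (a b))" using pos[OF b] by (simp add: powr_def)
  finally show "root m (a b) = exp ((1 / real m) *R ln (a b))" by simp
 qed
 also have "... = exp (\<Sum>b\<in>B. (1 / real m) *R ln (a b))" using B by (simp add: exp_sum)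
 also have "... <= (\<Sum>b\<in>B. (1 / real m) * exp (ln (a b)))"
  using B by (intro convex_on_sum[OF B(1) ne exp_convex]) auto
 also have "... = (\<Sum>b\<in>B. a b) / real m"
  using pos by (simp add: sum_divide_distrib)
 finally show ?thesis .
qed

lemma prod_ennreal_top:
 fixes f :: "'i => ennreal"
 assumes "finite B" "b : B" "f b = top" "!!b. b : B ==> f b ~= 0"
 shows "(\<Prod>b\<in>B. f b) = top"
proof -
 have "(\<Prod>b\<in>B. f b) = f b * (\<Prod>b\<in>B - {b}. f b)" using assms by (simp add: prod.remove)
 moreover have "(\<Prod>b\<in>B - {b}. f b) ~= 0" using assms by (simp add: prod_zero_iff)
 ultimately show ?thesis using assms by (simp add: ennreal_top_mult)
qed

text \<open>Hoelder's inequality for m factors with all exponents m. If every integral is positive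
  and finite, normalizing the factors reduces it to the arithmetic-geometric mean inequality. A zero
  integral and an infinite one are separated beforehand, because their product would be 0 times
  infinity.\<close>

lemma nn_integral_Holder_root:
 fixes h :: "'i => 'a => ennreal"
 assumes B: "finite B" "card B = m" "m > 0" and [measurable]: "!!b. b : B ==> h b : bmeas M"
 shows "(\<integral>\<^sup>+x. (\<Prod>b\<in>B. eroot m (h b x)) \<partial>M) <= (\<Prod>b\<in>B. eroot m (\<integral>\<^sup>+x. h b x \<partial>M))"
proof -
 define c where "c = (%b. \<integral>\<^sup>+x. h b x \<partial>M)"
 have e0: "eroot m x = 0 \<longleftrightarrow> x = 0" for x
 proof (cases x)
  case (real a) then show ?thesis using B by (simp add: ennreal_eq_0_iff)
 qed (simp add: eroot_def)
 consider (zero) b where "b : B" "c b = 0" | (top) b where "b : B" "c b = top" "!!b. b : B ==> c b ~= 0"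
  | (fin) "!!b. b : B ==> c b ~= 0 & c b ~= top" by blast
 then show ?thesis
 proof cases
  case zero
  then have "AE x in M. h b x = 0" unfolding c_def by (subst (asm) nn_integral_0_iff_AE) auto
  then have "AE x in M. (\<Prod>b\<in>B. eroot m (h b x)) = 0"
   by eventually_elim (use zero B e0 in \<open>auto simp: prod_zero_iff\<close>)
  then have "(\<integral>\<^sup>+x. (\<Prod>b\<in>B. eroot m (h b x)) \<partial>M) = 0" using B by (subst nn_integral_0_iff_AE) auto
  then show ?thesis by simp
 next
  case top
  have "(\<Prod>b\<in>B. eroot m (c b)) = top"
   using top B e0 by (intro prod_ennreal_top[of B b]) (auto simp: eroot_def)
  then show ?thesis by (simp add: c_def)
 next
  case fin
  define k where "k = (%b. enn2real (c b))"
  have k: "c b = ennreal (k b)" "k b > 0" if "b : B" for b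
   using fin[OF that] by (auto simp: k_def less_top enn2real_positive_iff zero_less_iff_neq_zero)
  have "AE x in M. \<forall>b\<in>B. h b x ~= top"
   using B fin by (subst AE_finite_all) (auto simp: c_def intro!: nn_integral_noteq_infinite[unfolded infinity_ennreal_def])
  then have "AE x in M. (\<Prod>b\<in>B. eroot m (h b x)) <= (\<Prod>b\<in>B. eroot m (c b)) * (\<Sum>b\<in>B. ennreal (1 / (real m * k b)) * h b x)"
  proof eventually_elim
   case (elim x)
   define y where "y = (%b. enn2real (h b x))"
   have y: "h b x = ennreal (y b)" "y b >= 0" if "b : B" for b
    using elim that by (auto simp: y_def less_top)
   have "(\<Prod>b\<in>B. eroot m (h b x)) = (\<Prod>b\<in>B. ennreal (root m (k b)) * ennreal (root m (y b / k b)))"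
   proof (intro prod.cong refl)
    fix b assume b: "b : B"
    have "root m (y b) = root m (k b) * root m (y b / k b)"
     using k(2)[OF b] by (simp add: real_root_mult[symmetric])
    then show "eroot m (h b x) = ennreal (root m (k b)) * ennreal (root m (y b / k b))"
     using y[OF b] k(2)[OF b] by (simp add: ennreal_mult'' real_root_ge_zero)
   qed
   also have "... = (\<Prod>b\<in>B. eroot m (c b)) * ennreal (\<Prod>b\<in>B. root m (y b / k b))"
    using k y by (simp add: prod.distrib prod_ennreal less_imp_le real_root_ge_zero)
   also have "... <= (\<Prod>b\<in>B. eroot m (c b)) * ennreal ((\<Sum>b\<in>B. y b / k b) / real m)"
    using k y B by (intro mult_left_mono ennreal_leI prod_root_le_mean) (auto simp: less_imp_le)
   also have "ennreal ((\<Sum>b\<in>B. y b / k b) / real m) = (\<Sum>b\<in>B. ennreal (1 / (real m * k b)) * h b x)"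
   proof -
    have "(\<Sum>b\<in>B. ennreal (1 / (real m * k b)) * h b x) = (\<Sum>b\<in>B. ennreal (y b / k b / real m))"
     using y k by (intro sum.cong refl) (auto simp: ennreal_mult''[symmetric] less_imp_le field_simps)
    also have "... = ennreal (\<Sum>b\<in>B. y b / k b / real m)"
     using y k by (intro sum_ennreal) (auto simp: less_imp_le)
    finally show ?thesis by (simp add: sum_divide_distrib)
   qed
   finally show ?case .
  qed
  then have "(\<integral>\<^sup>+x. (\<Prod>b\<in>B. eroot m (h b x)) \<partial>M) <= (\<integral>\<^sup>+x. (\<Prod>b\<in>B. eroot m (c b)) * (\<Sum>b\<in>B. ennreal (1 / (real m * k b)) * h b x) \<partial>M)"
   by (rule nn_integral_mono_AE)
  also have "... = (\<Prod>b\<in>B. eroot m (c b)) * (\<integral>\<^sup>+x. (\<Sum>b\<in>B. ennreal (1 / (real m * k b)) * h b x) \<partial>M)"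
   by (rule nn_integral_cmult) measurable
  also have "(\<integral>\<^sup>+x. (\<Sum>b\<in>B. ennreal (1 / (real m * k b)) * h b x) \<partial>M) = (\<Sum>b\<in>B. ennreal (1 / (real m * k b)) * c b)"
   unfolding c_def by (subst nn_integral_sum) (auto intro!: sum.cong nn_integral_cmult)
  also have "... = (\<Sum>b\<in>B. ennreal (1 / real m))"
  proof (intro sum.cong refl)
   fix b assume "b : B"
   note k = k[OF this]
   show "ennreal (1 / (real m * k b)) * c b = ennreal (1 / real m)"
    using k by (simp add: ennreal_mult''[symmetric] less_imp_le)
  qed
  also have "... = 1" using B by (simp add: ennreal_of_nat_eq_real_of_nat ennreal_mult''[symmetric])
  finally show ?thesis by (simp add: c_def)
 qed
qed

section \<open>Iterated integration over coordinate lines\<close>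

definition upd :: "real^'n => 'n => real => real^'n" where
 "upd x b t = (\<chi> i. if i = b then t else x $ i)"

lemma upd_eq_axis: "upd x b t = x + (t - x $ b) *R axis b 1"
 by (auto simp: upd_def vec_eq_iff axis_def)

lemma upd_measurable [measurable]:
 "(%p. upd (fst p) b (snd p)) : borel_measurable (borel \<Otimes>\<^sub>M borel)"
proof -
 have "continuous_on UNIV (%p::(real^'a) \<times> real. upd (fst p) b (snd p))"
  unfolding upd_eq_axis by (intro continuous_intros)
 then show ?thesis using borel_measurable_continuous_onI by (simp add: borel_prod)
qed

lemma upd_measurable2 [measurable (raw)]:
 assumes "f : bmeas M" "g : bmeas M"
 shows "(%x. upd (f x) b (g x)) : bmeas M"
 using measurable_compose[OF measurable_Pair[OF assms] upd_measurable, of b] by simp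

text \<open>Integration in direction b kept as a function on the full space, constant in the
  coordinate b. This avoids spaces of lower dimension when coordinates are integrated out one by
  one.\<close>

definition slice :: "'n => (real^'n => ennreal) => real^'n => ennreal" where
 "slice b G = (%x. NN t. G (upd x b t))"

lemma slice_measurable [measurable (raw)]:
 assumes [measurable]: "G : bmeas borel"
 shows "slice b G : bmeas borel"
 unfolding slice_def by measurable

lemma slice_upd [simp]: "slice b G (upd x b t) = slice b G x"
 by (auto simp: slice_def upd_def if_distrib cong: if_cong)

lemma slice_commute:
 assumes [measurable]: "G : bmeas borel" and ab: "a ~= b"
 shows "slice a (slice b G) = slice b (slice a G)"
proof
 fix x
 have u: "upd (upd x a s) b t = upd (upd x b t) a s" for s t using ab by (auto simp: upd_def vec_eq_iff)
 have "slice a (slice b G) x = (NN s. NN t. G (upd (upd x b t) a s))"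
  by (simp add: slice_def u)
 also have "... = (NN t. NN s. G (upd (upd x b t) a s))"
  by (rule lborel_pair.Fubini'[symmetric]) measurable
 finally show "slice a (slice b G) x = slice b (slice a G) x" by (simp add: slice_def)
qed

fun slices :: "'n list => (real^'n => ennreal) => real^'n => ennreal" where
 "slices [] G = G" | "slices (b # bs) G = slice b (slices bs G)"

lemma slices_measurable [measurable (raw)]:
 "G : bmeas borel ==> slices bs G : bmeas borel"
 by (induction bs) (auto intro: slice_measurable)

lemma slices_PiM:
 assumes [measurable]: "G : bmeas borel" and "distinct bs"
 shows "slices bs G x = (\<integral>\<^sup>+z. G (\<chi> i. if i : set bs then z i else x $ i) \<partial>(Pi\<^sub>M (set bs) (%_. lborel)))"
 using assms(2)
proof (induction bs arbitrary: x)
 interpret product_sigma_finite "%_. lborel :: real measure" ..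
 {
  case Nil
  show ?case by (simp add: nn_integral_empty del: nn_integral_const)
 next
  case (Cons b bs)
  have m: "(%z. \<chi> i. if i : insert b (set bs) then z i else x $ i) : borel_measurable (Pi\<^sub>M (insert b (set bs)) (%_. lborel))"
  proof (subst borel_measurable_euclidean_space, intro ballI)
   fix c :: "real^'a" assume "c : Basis"
   then obtain i where c: "c = axis i 1" by (auto simp: Basis_vec_def)
   show "(%z. (\<chi> i. if i : insert b (set bs) then z i else x $ i) \<bullet> c) : borel_measurable (Pi\<^sub>M (insert b (set bs)) (%_. lborel))"
    unfolding c by (cases "i : insert b (set bs)") (simp_all add: inner_axis)
  qed
  have "slices (b # bs) G x = (NN t. slices bs G (upd x b t))" by (simp add: slice_def)
  also have "... = (NN t. \<integral>\<^sup>+z. G (\<chi> i. if i : set bs then z i else upd x b t $ i) \<partial>(Pi\<^sub>M (set bs) (%_. lborel)))"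
   using Cons by simp
  also have "... = (NN t. \<integral>\<^sup>+z. G (\<chi> i. if i : set (b # bs) then (z(b := t)) i else x $ i) \<partial>(Pi\<^sub>M (set bs) (%_. lborel)))"
  proof (intro nn_integral_cong arg_cong[where f=G])
   fix t z
   show "(\<chi> i. if i : set bs then z i else upd x b t $ i) = (\<chi> i. if i : set (b # bs) then (z(b := t)) i else x $ i)"
    using Cons.prems by (auto simp: vec_eq_iff upd_def)
  qed
  also have "... = (\<integral>\<^sup>+z. G (\<chi> i. if i : set (b # bs) then z i else x $ i) \<partial>(Pi\<^sub>M (insert b (set bs)) (%_. lborel)))"
  proof (rule product_nn_integral_insert_rev[symmetric])
   show "(%z. G (\<chi> i. if i : set (b # bs) then z i else x $ i)) : borel_measurable (Pi\<^sub>M (insert b (set bs)) (%_. lborel))"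
    using measurable_compose[OF m, of G borel] by simp
  qed (use Cons.prems in auto)
  finally show ?case by simp
 }
qed

text \<open>Lebesgue measure on vectors as the image of a finite product measure, checked on boxes;
  through it iterated slices become the full integral.\<close>

lemma lborel_cart: "(lborel :: (real^'n) measure) = distr (Pi\<^sub>M UNIV (%_. lborel)) borel (%z. \<chi> i. z i)"
proof (rule lborel_eqI)
 interpret product_sigma_finite "%_. lborel :: real measure" ..
 have m[measurable]: "(%z. \<chi> i. z i) : measurable (Pi\<^sub>M (UNIV::'n set) (%_. lborel)) (borel :: (real^'n) measure)"
 proof (subst borel_measurable_euclidean_space, intro ballI)
  fix c :: "real^'n" assume "c : Basis"
  then obtain i where c: "c = axis i 1" by (auto simp: Basis_vec_def)
  show "(%z. (\<chi> i. z i) \<bullet> c) : borel_measurable (Pi\<^sub>M (UNIV::'n set) (%_. lborel))"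
   unfolding c by (simp add: inner_axis)
 qed
 fix l u :: "real^'n" assume lu: "!!b. b : Basis ==> l \<bullet> b <= u \<bullet> b"
 have lu': "l $ i <= u $ i" for i using lu[of "axis i 1"] by (simp add: axis_in_Basis_iff inner_axis)
 have "emeasure (distr (Pi\<^sub>M UNIV (%_. lborel)) borel (%z. \<chi> i. z i)) (box l u) =
   emeasure (Pi\<^sub>M UNIV (%_. lborel)) (Pi\<^sub>E UNIV (%i. {l $ i<..<u $ i}))"
  by (subst emeasure_distr) (auto simp: space_PiM box_def PiE_UNIV_domain Basis_vec_def inner_axis intro!: arg_cong2[where f=emeasure])
 also have "... = (\<Prod>i\<in>UNIV. emeasure lborel {l $ i<..<u $ i})" by (rule emeasure_PiM) auto
 also have "... = (\<Prod>i\<in>UNIV. ennreal (u $ i - l $ i))" using lu' by simp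
 also have "... = ennreal (\<Prod>i\<in>UNIV. u $ i - l $ i)" using lu' by (intro prod_ennreal) auto
 also have "(\<Prod>i\<in>UNIV. u $ i - l $ i) = prod ((\<bullet>) (u - l)) Basis"
 proof -
  have "prod ((\<bullet>) (u - l)) Basis = prod ((\<bullet>) (u - l)) ((%i. axis i 1) ` UNIV)"
   by (intro prod.cong) (auto simp: Basis_vec_def)
  also have "... = (\<Prod>i\<in>UNIV. (u - l) \<bullet> axis i 1)"
   by (subst prod.reindex) (auto simp: inj_on_def axis_eq_axis)
  finally show ?thesis by (simp add: inner_axis inner_diff_left)
 qed
 finally show "emeasure (distr (Pi\<^sub>M UNIV (%_. lborel)) borel (%z. \<chi> i. z i)) (box l u) = ennreal (prod ((\<bullet>) (u - l)) Basis)" .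
qed simp

lemma slices_lborel:
 assumes [measurable]: "G : bmeas borel" and "distinct bs" "set bs = UNIV"
 shows "slices bs G x = (NN y. G y)"
proof -
 have m[measurable]: "(%z. \<chi> i. z i) : measurable (Pi\<^sub>M (UNIV::'a set) (%_. lborel)) (borel :: (real^'a) measure)"
 proof (subst borel_measurable_euclidean_space, intro ballI)
  fix c :: "real^'a" assume "c : Basis"
  then obtain i where c: "c = axis i 1" by (auto simp: Basis_vec_def)
  show "(%z. (\<chi> i. z i) \<bullet> c) : borel_measurable (Pi\<^sub>M (UNIV::'a set) (%_. lborel))"
   unfolding c by (simp add: inner_axis)
 qed
 have "(NN y. G y) = (\<integral>\<^sup>+y. G y \<partial>(distr (Pi\<^sub>M UNIV (%_. lborel)) borel (%z. \<chi> i. z i)))"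
  by (simp flip: lborel_cart)
 also have "... = (\<integral>\<^sup>+z. G (\<chi> i. z i) \<partial>(Pi\<^sub>M UNIV (%_. lborel)))" by (rule nn_integral_distr) measurable
 finally show ?thesis using slices_PiM[OF assms(1,2), of x] assms(3) by simp
qed

text \<open>Integrating out one coordinate after the other: the factor belonging to that coordinate
  does not depend on it, and Hoelder's inequality applies to the remaining ones.\<close>
lemma slices_Loomis_Whitney:
 fixes F :: "real^'n => ennreal" and V :: "'n => real^'n => ennreal"
 assumes N: "CARD('n) >= 2" and [measurable]: "F : bmeas borel" "!!b. V b : bmeas borel"
  and F: "!!x. F x <= (\<Prod>b\<in>UNIV. eroot (CARD('n) - 1) (slice b (V b) x))" and "distinct bs"
 shows "slices bs F x <= (\<Prod>b\<in>UNIV. eroot (CARD('n) - 1) (slices (if b : set bs then bs else b # bs) (V b) x))"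
 using \<open>distinct bs\<close>
proof (induction bs arbitrary: x)
 case Nil
 then show ?case using F by simp
next
 case (Cons j bs)
 define m where "m = CARD('n) - 1"
 have m: "m > 0" using N by (simp add: m_def)
 define H where "H = (%b. slices (if b : set bs then bs else b # bs) (V b))"
 have [measurable]: "H b : bmeas borel" for b unfolding H_def by (rule slices_measurable) measurable
 have Hj: "H j (upd x j t) = H j x" for t using Cons.prems by (simp add: H_def)
 have "slices (j # bs) F x = (NN t. slices bs F (upd x j t))" by (simp add: slice_def)
 also have "... <= (NN t. (\<Prod>b\<in>UNIV. eroot m (H b (upd x j t))))"
  using Cons by (intro nn_integral_mono) (auto simp: H_def m_def)
 also have "... = (NN t. eroot m (H j x) * (\<Prod>b\<in>UNIV - {j}. eroot m (H b (upd x j t))))"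
  by (subst prod.remove[of UNIV j]) (auto simp: Hj)
 also have "... = eroot m (H j x) * (NN t. (\<Prod>b\<in>UNIV - {j}. eroot m (H b (upd x j t))))"
  by (rule nn_integral_cmult) measurable
 also have "... <= eroot m (H j x) * (\<Prod>b\<in>UNIV - {j}. eroot m (NN t. H b (upd x j t)))"
  using m by (intro mult_left_mono nn_integral_Holder_root) (auto simp: m_def)
 also have "... = eroot m (slices (j # bs) (V j) x) * (\<Prod>b\<in>UNIV - {j}. eroot m (slices (if b : set (j # bs) then j # bs else b # j # bs) (V b) x))"
 proof (intro arg_cong2[where f="(*)"] prod.cong refl arg_cong[where f="eroot m"])
  show "H j x = slices (j # bs) (V j) x" using Cons.prems by (simp add: H_def)
  fix b assume b: "b : UNIV - {j}"
  have "(NN t. H b (upd x j t)) = slice j (H b) x" by (simp add: slice_def)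
  also have "... = slices (if b : set (j # bs) then j # bs else b # j # bs) (V b) x"
  proof (cases "b : set bs")
   case False
   have "slice j (slice b (slices bs (V b))) = slice b (slice j (slices bs (V b)))"
    using b by (intro slice_commute slices_measurable) auto
   then show ?thesis using b False by (simp add: H_def)
  qed (simp add: H_def)
  finally show "(NN t. H b (upd x j t)) = slices (if b : set (j # bs) then j # bs else b # j # bs) (V b) x" .
 qed
 also have "... = (\<Prod>b\<in>UNIV. eroot m (slices (if b : set (j # bs) then j # bs else b # j # bs) (V b) x))"
  by (subst prod.remove[of UNIV j]) auto
 finally show ?case by (simp add: m_def)
qed

text \<open>The fundamental theorem of calculus along the line in direction i, starting at a point
  below both the support and x, where f vanishes.\<close>

lemma abs_le_slice:
 fixes f :: "real^'n => real"
 assumes g: "has_grad f f'" and K: "compact K" and z: "!!x. x \<notin> K ==> f x = 0"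
 shows "ennreal (abs (f x)) <= slice i (%x. ennreal (abs (f' x $ i))) x"
proof -
 obtain M where M: "!!y. y : K ==> norm y <= M" "M > 0" using compact_imp_bounded[OF K] bounded_pos by blast
 define L where "L = max (M + 1) (abs (x $ i) + 1)"
 have "upd x i (- L) \<notin> K"
 proof
  assume "upd x i (- L) : K"
  then have "abs (upd x i (- L) $ i) <= M" using M(1) component_le_norm_cart order_trans by blast
  then show False using M(2) by (auto simp: upd_def L_def)
 qed
 then have f0: "f (upd x i (- L)) = 0" by (rule z)
 have Lx: "- L <= x $ i" by (auto simp: L_def)
 have cu: "continuous_on UNIV (%t. f' (upd x i t) $ i)"
  unfolding upd_eq_axis by (intro continuous_intros continuous_on_compose2[OF has_gradD(2)[OF g]]) auto
 have "(LBINT t. indicator {- L..x $ i} t *R (f' (upd x i t) $ i)) = f (upd x i (x $ i)) - f (upd x i (- L))"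
 proof (rule integral_FTC_atLeastAtMost[OF Lx])
  fix t
  have "((%t. f ((x - (x $ i) *R axis i 1) + t *R axis i 1)) has_real_derivative f' ((x - (x $ i) *R axis i 1) + t *R axis i 1) $ i) (at t)"
   by (rule has_grad_at[OF g])
  moreover have "(x - (x $ i) *R axis i 1) + t *R axis i 1 = upd x i t" for t
   by (simp add: upd_eq_axis algebra_simps)
  ultimately show "((%t. f (upd x i t)) has_vector_derivative f' (upd x i t) $ i) (at t within {- L..x $ i})"
   by (simp add: has_real_derivative_iff_has_vector_derivative has_vector_derivative_at_within)
 qed (rule continuous_on_subset[OF cu], simp)
 then have e: "f x = (LBINT t. indicator {- L..x $ i} t *R (f' (upd x i t) $ i))"
  using f0 by (simp add: upd_eq_axis)
 have "integrable lborel (%t. indicator {- L..x $ i} t *R (f' (upd x i t) $ i))"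
  by (intro borel_integrable_compact continuous_on_subset[OF cu]) auto
 from integral_norm_bound_ennreal[OF this] have "ennreal (abs (f x)) <= (NN t. ennreal (norm (indicator {- L..x $ i} t *R (f' (upd x i t) $ i))))"
  using e by simp
 also have "... <= (NN t. ennreal (abs (f' (upd x i t) $ i)))"
  by (intro nn_integral_mono) (auto simp: indicator_def)
 finally show ?thesis by (simp add: slice_def)
qed

lemma prod_mono_ennreal:
 fixes f g :: "'i => ennreal"
 shows "(!!b. b : B ==> f b <= g b) ==> prod f B <= prod g B"
 by (induction B rule: infinite_finite_induct) (auto intro!: mult_mono)

text \<open>The Gagliardo-Nirenberg argument: |f| is bounded by each of its N line integrals, so
  |f|^(N/(N-1)), written as a product of N roots of order N-1, is at most the product of the roots
  of these line integrals.\<close>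

lemma Sobolev_W11:
 fixes f :: "real^'n => real"
 assumes N: "CARD('n) >= 2" and g: "has_grad f f'" and K: "compact K"
  and z: "!!x. x \<notin> K ==> f x = 0" "!!x. x \<notin> K ==> f' x = 0"
 shows "(LBINT x. abs (f x) powr (real CARD('n) / (real CARD('n) - 1)))
  <= (LBINT x. norm (f' x)) powr (real CARD('n) / (real CARD('n) - 1))"
proof -
 define m where "m = CARD('n) - 1"
 have m: "m > 0" "real m = real CARD('n) - 1" using N by (auto simp: m_def)
 let ?k = "real CARD('n) / (real CARD('n) - 1)"
 have k0: "?k > 0" using N by simp
 note cf = has_gradD(1)[OF g] and cf' = has_gradD(2)[OF g]
 have [measurable]: "f : bmeas borel" "!!b. (%x. f' x $ b) : bmeas borel"
  by (intro cont_borel continuous_intros cf cf')+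
 have rp: "(root m a) ^ CARD('n) = a powr ?k" if "a >= 0" for a
 proof (cases "a = 0")
  case False
  then have "root m a = a powr (1 / real m)" using that m by (simp add: root_powr_inverse)
  then have "(root m a) ^ CARD('n) = (a powr (1 / real m)) powr real CARD('n)" using False that by (simp add: powr_realpow)
  then show ?thesis using m by (simp add: powr_powr)
 qed (use m k0 in simp)
 define F where "F = (%x. \<Prod>b\<in>(UNIV::'n set). eroot m (ennreal (abs (f x))))"
 have Fe: "F x = ennreal (abs (f x) powr ?k)" for x
  using m by (simp add: F_def ennreal_power real_root_ge_zero rp)
 define V where "V = (%b x. ennreal (abs (f' x $ b)))"
 have [measurable]: "F : bmeas borel" "V b : bmeas borel" for b unfolding F_def V_def by measurable
 obtain bs where bs: "set bs = (UNIV::'n set)" "distinct bs" using finite_distinct_list[of "UNIV::'n set"] by auto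
 have le: "F x <= (\<Prod>b\<in>UNIV. eroot (CARD('n) - 1) (slice b (V b) x))" for x
  unfolding F_def V_def m_def[symmetric]
  by (intro prod_mono_ennreal eroot_mono m(1) abs_le_slice[OF g K z(1)])
 have ni: "integrable lborel (%x. norm (f' x))"
  using z by (intro integrable_compact_support[OF _ K] continuous_intros cf') auto
 define I where "I = (LBINT x. norm (f' x))"
 have I0: "I >= 0" by (simp add: I_def)
 have "(NN x. F x) = slices bs F 0" using bs by (intro slices_lborel[symmetric]) auto
 also have "... <= (\<Prod>b\<in>UNIV. eroot m (slices (if b : set bs then bs else b # bs) (V b) 0))"
  unfolding m_def using le by (intro slices_Loomis_Whitney N bs) auto
 also have "... = (\<Prod>b\<in>UNIV. eroot m (NN x. V b x))"
  using bs by (intro prod.cong) (auto simp: slices_lborel)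
 also have "... <= (\<Prod>b\<in>(UNIV::'n set). eroot m (ennreal I))"
 proof (intro prod_mono_ennreal eroot_mono m(1))
  fix b
  have "(NN x. V b x) <= (NN x. ennreal (norm (f' x)))"
   unfolding V_def using component_le_norm_cart by (intro nn_integral_mono ennreal_leI) auto
  also have "... = ennreal I" unfolding I_def using ni by (intro nn_integral_eq_integral) auto
  finally show "(NN x. V b x) <= ennreal I" .
 qed
 also have "... = ennreal (I powr ?k)" using I0 m by (simp add: ennreal_power real_root_ge_zero rp)
 finally have "(NN x. ennreal (abs (f x) powr ?k)) <= ennreal (I powr ?k)" by (simp add: Fe)
 moreover have "integrable lborel (%x. abs (f x) powr ?k)"
  using z k0 by (intro integrable_compact_support[OF _ K] continuous_on_powr' continuous_intros cf) auto
 ultimately have "ennreal (LBINT x. abs (f x) powr ?k) <= ennreal (I powr ?k)"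
  by (subst nn_integral_eq_integral[symmetric]) auto
 then show ?thesis by (simp add: I_def)
qed

text \<open>The exponent for which the Dirichlet energy and the power integral are preserved by the
  same dilations; the type argument carries N.\<close>

definition crit :: "'n itself => real" where "crit _ = 2 * real CARD('n) / (real CARD('n) - 2)"

lemma crit_gt_2: "CARD('n) >= 3 ==> crit TYPE('n) > 2"
 by (simp add: crit_def field_simps)

lemma test_powr_integrable:
 assumes t: "test_fun UNIV ph" and "r > 0"
 shows "integrable lborel (%x. abs (ph x) powr r)"
proof -
 obtain K where K: "compact K" "!!x. x \<notin> K ==> ph x = 0" using test_fun_obtain[OF t] by metis
 show ?thesis using assms(2) K has_gradD(1)[OF test_fun_grad[OF t]]
  by (intro integrable_compact_support[OF _ K(1)] continuous_on_powr' continuous_intros) auto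
qed

lemma test_grad_integrable:
 assumes t: "test_fun UNIV ph"
 shows "integrable lborel (%x. (norm (grad ph x))^2)"
proof -
 obtain K where K: "compact K" "!!x. x \<notin> K ==> grad ph x = 0" using test_fun_obtain[OF t] by metis
 show ?thesis using K has_gradD(2)[OF test_fun_grad[OF t]]
  by (intro integrable_compact_support[OF _ K(1)] continuous_intros) auto
qed

lemma test_measurable [measurable (raw)]:
 assumes t: "test_fun UNIV ph"
 shows "ph : bmeas borel" "grad ph : bmeas borel"
 using has_gradD[OF test_fun_grad[OF t]] by (auto intro: cont_borel)

theorem Sobolev_test:
 fixes ph :: "real^'n => real"
 assumes N: "CARD('n) >= 3"
 obtains C where "C > 0" "!!ph. test_fun UNIV ph ==>
  (LBINT x. abs (ph x) powr crit TYPE('n)) powr (2 / crit TYPE('n)) <= C * (LBINT x. (norm (grad (ph :: real^'n => real) x))^2)"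
proof -
 let ?N = "real CARD('n)" and ?r = "crit TYPE('n)"
 have N3: "?N >= 3" using N by simp
 \<comment> \<open>The W^{1,1} inequality is applied to |ph|^gm. This exponent satisfies gm N/(N-1)
   = r and 2(gm-1) = r, so that Cauchy-Schwarz on |ph|^(gm-1) |grad ph| returns the same L^r norm as
   on the left.\<close>
 define gm where "gm = 2 * (?N - 1) / (?N - 2)"
 have gen: "a ~= 0 ==> 2 * a / b * (c / a) = 2 * c / b" for a b c :: real by simp
 have gm2: "gm * (?N / (?N - 1)) = ?r" unfolding gm_def crit_def by (rule gen) (use N3 in linarith)
 have gm: "gm > 1" "gm * (?N / (?N - 1)) = ?r" "2 * (gm - 1) = ?r" "1 < ?r"
  using N3 gm2 by (auto simp: gm_def crit_def field_simps)
 have "(LBINT x. abs (ph x) powr ?r) powr (2 / ?r) <= gm^2 * (LBINT x. (norm (grad ph x))^2)"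
  if t: "test_fun UNIV ph" for ph :: "real^'n => real"
 proof -
  obtain K where K: "compact K" "!!x. x \<notin> K ==> ph x = 0" "!!x. x \<notin> K ==> grad ph x = 0" using test_fun_obtain[OF t] by metis
  note g = test_fun_grad[OF t]
  define X Y where "X = (LBINT x. abs (ph x) powr ?r)" and "Y = (LBINT x. (norm (grad ph x))^2)"
  have XY: "X >= 0" "Y >= 0" by (auto simp: X_def Y_def)
  define F' where "F' = (%t::real. gm * (sgn t * abs t powr (gm - 1)))"
  have cF': "continuous_on UNIV F'"
  proof -
   \<comment> \<open>Written with positive parts, both summands are visibly continuous at 0.\<close>
   have "(%t::real. sgn t * abs t powr (gm - 1)) = (%t. max t 0 powr (gm - 1) - max (- t) 0 powr (gm - 1))"
    using gm by (auto simp: fun_eq_iff max_def sgn_if)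
   then have e: "F' = (%t. gm * (max t 0 powr (gm - 1) - max (- t) 0 powr (gm - 1)))" by (simp add: F'_def fun_eq_iff)
   show ?thesis unfolding e using gm(1) by (intro continuous_intros continuous_on_powr') auto
  qed
  have gf: "has_grad (%x. abs (ph x) powr gm) (%x. F' (ph x) *R grad ph x)"
   by (rule has_grad_compose[OF g]) (use DERIV_abs_powr[OF gm(1)] continuous_on_subset[OF cF'] in \<open>auto simp: F'_def\<close>)
  have "(LBINT x. \<bar>\<bar>ph x\<bar> powr gm\<bar> powr (?N / (?N - 1))) <= (LBINT x. norm (F' (ph x) *R grad ph x)) powr (?N / (?N - 1))"
   using N K gm by (intro Sobolev_W11[OF _ gf K(1)]) auto
  also have "(%x. \<bar>\<bar>ph x\<bar> powr gm\<bar> powr (?N / (?N - 1))) = (%x. \<bar>ph x\<bar> powr ?r)"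
   by (simp only: powr_powr gm(2) abs_of_nonneg[OF powr_ge_zero])
  also have "(%x. norm (F' (ph x) *R grad ph x)) = (%x. gm * (abs (ph x) powr (gm - 1) * norm (grad ph x)))"
   using gm by (auto simp: F'_def fun_eq_iff abs_mult sgn_if)
  finally have 1: "X <= (gm * (LBINT x. abs (ph x) powr (gm - 1) * norm (grad ph x))) powr (?N / (?N - 1))"
   by (simp add: X_def)
  have sq: "(norm (abs (ph x) powr (gm - 1)))^2 = abs (ph x) powr ?r" for x
  proof (cases "ph x = 0")
   case False
   have "(norm (abs (ph x) powr (gm - 1)))^2 = abs (ph x) powr (gm - 1) * abs (ph x) powr (gm - 1)" by (simp add: power2_eq_square)
   also have "... = abs (ph x) powr ((gm - 1) + (gm - 1))" by (rule powr_add[symmetric])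
   also have "(gm - 1) + (gm - 1) = ?r" using gm(3) by (simp add: algebra_simps)
   finally show ?thesis .
  qed (use gm in simp)
  have [measurable]: "ph : bmeas borel" "grad ph : bmeas borel" using test_measurable[OF t] .
  have "\<bar>LBINT x. (\<bar>ph x\<bar> powr (gm - 1)) \<bullet> norm (grad ph x)\<bar> <=
   sqrt (LBINT x. (norm (\<bar>ph x\<bar> powr (gm - 1)))^2) * sqrt (LBINT x. (norm (norm (grad ph x)))^2)"
  proof (rule L2_inner(4))
   show "integrable lborel (%x. (norm (abs (ph x) powr (gm - 1)))^2)"
    unfolding sq using test_powr_integrable[OF t, of ?r] gm(4) by simp
   show "integrable lborel (%x. (norm (norm (grad ph x)))^2)" using test_grad_integrable[OF t] by simp
  qed measurable
  then have 2: "(LBINT x. abs (ph x) powr (gm - 1) * norm (grad ph x)) <= sqrt X * sqrt Y"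
   unfolding sq X_def Y_def by simp
  show ?thesis
  proof (cases "X = 0")
   case True then show ?thesis using XY gm by (simp add: X_def Y_def)
  next
   case False
   then have X0: "X > 0" using XY by simp
   have "X <= (gm * (sqrt X * sqrt Y)) powr (?N / (?N - 1))"
    by (rule order_trans[OF 1], rule powr_mono2) (use 2 gm N3 in \<open>auto intro!: mult_nonneg_nonneg integral_nonneg_AE\<close>)
   then have "X powr ((?N - 1) / ?N) <= ((gm * (sqrt X * sqrt Y)) powr (?N / (?N - 1))) powr ((?N - 1) / ?N)"
    using N3 XY by (intro powr_mono2) auto
   also have "... = gm * (sqrt X * sqrt Y)"
    using N3 XY gm by (simp add: powr_powr)
   finally have "X powr ((?N - 1) / ?N) <= gm * (sqrt X * sqrt Y)" .
   then have "(X powr ((?N - 1) / ?N))^2 <= (gm * (sqrt X * sqrt Y))^2" by (intro power_mono) auto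
   also have "... = gm^2 * Y * X" using XY by (simp add: power_mult_distrib)
   also have "(X powr ((?N - 1) / ?N))^2 = X powr (2 / ?r) * X"
   proof -
    have "(X powr ((?N - 1) / ?N))^2 = X powr ((?N - 1) / ?N + (?N - 1) / ?N)" unfolding power2_eq_square by (rule powr_add[symmetric])
    also have "(?N - 1) / ?N + (?N - 1) / ?N = 2 / ?r + 1" using N3 by (simp add: crit_def field_simps)
    finally show ?thesis using X0 by (simp add: powr_add)
   qed
   finally show ?thesis using X0 by (simp add: X_def Y_def)
  qed
 qed
 then show thesis using that[of "gm^2"] gm by simp
qed

section \<open>Compactness\<close>

text \<open>The displacement h is applied one coordinate at a time; each further coordinate doubles
  the constant through (a+b)^2 <= 2a^2 + 2b^2.\<close>

lemma translation_L2:
 fixes v :: "real^'n => real"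
 assumes g: "has_grad v v'" and [measurable]: "A : sets borel" "B : sets borel"
  and AB: "!!x. x : A ==> cball x (norm h) <= B"
 shows "(NN x. indicator A x * ennreal ((v (x + h) - v x)^2))
  <= ennreal (2 ^ CARD('n) * (norm h)^2) * (NN x. indicator B x * ennreal ((norm (v' x))^2))"
proof -
 note cv = has_gradD(1)[OF g] and cv' = has_gradD(2)[OF g]
 have [measurable]: "v : bmeas borel" "!!b. (%x. v' x $ b) : bmeas borel"
  by (intro cont_borel continuous_intros cv cv')+
 define H where "H = (%J. \<Sum>i\<in>J. (h $ i) *R (axis i 1 :: real^'n))"
 have Hc: "H J $ j = (if j : J then h $ j else 0)" for J j
 proof -
  have "H J $ j = (\<Sum>i\<in>J. if i = j then h $ i else 0)" unfolding H_def sum_component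
   by (rule sum.cong) (auto simp: axis_def)
  then show ?thesis by simp
 qed
 have HU: "H UNIV = h" by (simp add: vec_eq_iff Hc)
 have "(NN x. indicator A x * ennreal ((v (x + H J) - v x)^2))
  <= ennreal (2 ^ card J * (norm h)^2) * (NN x. indicator B x * ennreal (\<Sum>i\<in>J. (v' x $ i)^2))" for J
 proof (induction J rule: finite_induct[OF finite])
  case 1
  show ?case by (simp add: H_def)
 next
  case (2 i J)
  have Hi: "H (insert i J) = H J + (h $ i) *R axis i 1" using 2 by (simp add: H_def add.commute)
  define A' where "A' = (%y. y - H J) -` A"
  have [measurable]: "A' : sets borel" unfolding A'_def by (rule measurable_sets_borel[OF _ assms(2)]) simp
  have "(NN x. indicator A x * ennreal ((v (x + H J + (h $ i) *R axis i 1) - v (x + H J))^2)) =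
   (NN x. (%y. indicator A' y * ennreal ((v (y + (h $ i) *R axis i 1) - v y)^2)) (x + H J))"
   by (intro nn_integral_cong) (auto simp: A'_def indicator_def)
  also have "... = (NN y. indicator A' y * ennreal ((v (y + (h $ i) *R axis i 1) - v y)^2))"
   by (rule nn_integral_translate) measurable
  also have "... <= ennreal ((h $ i)^2) * (NN x. indicator B x * ennreal ((v' x $ i)^2))"
  proof (rule translation_estimate[OF g])
   fix y and tau :: real assume y: "y : A'" and tau: "0 <= tau" "tau <= 1"
   \<comment> \<open>Each component of an intermediate displacement is dominated by that of h, so
     the whole path stays within distance |h|.\<close>
   have "norm (H J + (tau * h $ i) *R axis i 1) <= norm h"
   proof (rule norm_le_componentwise_cart)
    fix j
    have "tau * abs (h $ i) <= abs (h $ i)" using tau by (simp add: mult_left_le_one_le)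
    then show "norm ((H J + (tau * h $ i) *R axis i 1) $ j) <= norm (h $ j)"
     using 2 tau by (auto simp: Hc axis_def abs_mult)
   qed
   then have "y + (tau * h $ i) *R axis i 1 : cball (y - H J) (norm h)"
   proof -
    have "(y - H J) - (y + (tau * h $ i) *R axis i 1) = - (H J + (tau * h $ i) *R axis i 1)" by simp
    then have "dist (y - H J) (y + (tau * h $ i) *R axis i 1) = norm (H J + (tau * h $ i) *R axis i 1)"
     unfolding dist_norm by (metis norm_minus_cancel)
    then show ?thesis using \<open>norm (H J + (tau * h $ i) *R axis i 1) <= norm h\<close> by simp
   qed
   then show "y + (tau * h $ i) *R axis i 1 : B" using AB[of "y - H J"] y by (auto simp: A'_def)
  qed auto
  also have "... <= ennreal ((norm h)^2) * (NN x. indicator B x * ennreal ((v' x $ i)^2))"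
   using component_le_norm_cart[of h i] by (intro mult_right_mono ennreal_leI) (auto simp: abs_le_square_iff[symmetric])
  finally have a: "(NN x. indicator A x * ennreal ((v (x + H J + (h $ i) *R axis i 1) - v (x + H J))^2))
    <= ennreal ((norm h)^2) * (NN x. indicator B x * ennreal ((v' x $ i)^2))" .
  have sq: "ennreal ((a - c)^2) <= 2 * ennreal ((a - b)^2) + 2 * ennreal ((b - c)^2)" for a b c :: real
  proof -
   have "(a - c)^2 <= 2 * (a - b)^2 + 2 * (b - c)^2"
    using zero_le_power2[of "(a - b) - (b - c)"] by (simp add: power2_eq_square algebra_simps)
   then have "ennreal ((a - c)^2) <= ennreal (2 * (a - b)^2 + 2 * (b - c)^2)" by (rule ennreal_leI)
   also have "... = 2 * ennreal ((a - b)^2) + 2 * ennreal ((b - c)^2)"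
    by (simp add: ennreal_plus ennreal_mult'' flip: ennreal_numeral)
   finally show ?thesis .
  qed
  have "(NN x. indicator A x * ennreal ((v (x + H (insert i J)) - v x)^2)) <=
   (NN x. 2 * (indicator A x * ennreal ((v (x + H J + (h $ i) *R axis i 1) - v (x + H J))^2)) + 2 * (indicator A x * ennreal ((v (x + H J) - v x)^2)))"
   unfolding Hi using sq by (intro nn_integral_mono) (auto simp: indicator_def add.assoc)
  also have "... = 2 * (NN x. indicator A x * ennreal ((v (x + H J + (h $ i) *R axis i 1) - v (x + H J))^2)) +
    2 * (NN x. indicator A x * ennreal ((v (x + H J) - v x)^2))"
   by (subst nn_integral_add) (auto simp: nn_integral_cmult)
  also have "... <= 2 * (ennreal ((norm h)^2) * (NN x. indicator B x * ennreal ((v' x $ i)^2))) +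
   2 * (ennreal (2 ^ card J * (norm h)^2) * (NN x. indicator B x * ennreal (\<Sum>i\<in>J. (v' x $ i)^2)))"
   using a 2 by (intro add_mono mult_left_mono) auto
  also have "... <= ennreal (2 ^ card (insert i J) * (norm h)^2) * (NN x. indicator B x * ennreal ((v' x $ i)^2)) +
   ennreal (2 ^ card (insert i J) * (norm h)^2) * (NN x. indicator B x * ennreal (\<Sum>i\<in>J. (v' x $ i)^2))"
  proof (intro add_mono)
   have 22: "2 * ennreal a = ennreal (2 * a)" if "a >= 0" for a using that by (simp add: ennreal_mult'' flip: ennreal_numeral)
   have "(1::real) <= 2 ^ card J" by simp
   then have "2 * ennreal ((norm h)^2) <= ennreal (2 ^ card (insert i J) * (norm h)^2)"
    using 2 mult_right_mono[OF \<open>1 <= 2 ^ card J\<close>, of "(norm h)^2"] by (auto simp: 22 intro!: ennreal_leI)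
   then show "2 * (ennreal ((norm h)^2) * (NN x. indicator B x * ennreal ((v' x $ i)^2))) <= ennreal (2 ^ card (insert i J) * (norm h)^2) * (NN x. indicator B x * ennreal ((v' x $ i)^2))"
    unfolding mult.assoc[symmetric] by (rule mult_right_mono) simp
   have "2 * ennreal (2 ^ card J * (norm h)^2) = ennreal (2 ^ card (insert i J) * (norm h)^2)"
    using 2 by (simp add: 22)
   then show "2 * (ennreal (2 ^ card J * (norm h)^2) * (NN x. indicator B x * ennreal (\<Sum>i\<in>J. (v' x $ i)^2))) <= ennreal (2 ^ card (insert i J) * (norm h)^2) * (NN x. indicator B x * ennreal (\<Sum>i\<in>J. (v' x $ i)^2))"
    by (simp add: mult.assoc[symmetric])
  qed
  also have "... = ennreal (2 ^ card (insert i J) * (norm h)^2) * (NN x. indicator B x * ennreal ((v' x $ i)^2) + indicator B x * ennreal (\<Sum>i\<in>J. (v' x $ i)^2))"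
   by (subst nn_integral_add) (auto simp: distrib_left)
  also have "... = ennreal (2 ^ card (insert i J) * (norm h)^2) * (NN x. indicator B x * ennreal (\<Sum>i\<in>insert i J. (v' x $ i)^2))"
   using 2 by (intro arg_cong2[where f="(*)"] nn_integral_cong refl) (auto simp: indicator_def ennreal_plus sum_nonneg)
  finally show ?case .
 qed
 from this[of UNIV] have "(NN x. indicator A x * ennreal ((v (x + h) - v x)^2))
  <= ennreal (2 ^ CARD('n) * (norm h)^2) * (NN x. indicator B x * ennreal (\<Sum>i\<in>UNIV. (v' x $ i)^2))"
  by (simp add: HU)
 also have "(%x. \<Sum>i\<in>UNIV. (v' x $ i)^2) = (%x. (norm (v' x))^2)"
  unfolding power2_norm_eq_inner inner_vec_def by (simp add: power2_eq_square)
 finally show ?thesis .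
qed

lemma diagonal_convergent:
 fixes f :: "nat => nat => real"
 assumes "!!n k. abs (f n k) <= B k"
 obtains s where "strict_mono s" "!!k. convergent (%n. f (s n) k)"
proof -
 interpret subseqs "%k s. convergent (%n. f (s n) k)"
 proof
  fix k and s :: "nat => nat" assume "strict_mono s"
  have "bounded (range (%n. f (s n) k))" using assms by (auto simp: bounded_iff)
  then obtain l r where "strict_mono r" "((%n. f (s n) k) \<circ> r) ~~> l"
   using bounded_imp_convergent_subsequence by blast
  then show "\<exists>r. strict_mono r & convergent (%n. f ((s \<circ> r) n) k)"
   by (auto simp: convergent_def o_def)
 qed
 have "convergent (%n. f (diagseq n) k)" for k
 proof -
  have "convergent (%n. f ((diagseq \<circ> (+) (Suc k)) n) k)"
   by (rule diagseq_holds) (drule (1) convergent_subseq_convergent, simp add: o_def)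
  then have "convergent (%n. f (diagseq (n + Suc k)) k)" by (simp add: o_def add.commute)
  then show ?thesis by (simp only: convergent_ignore_initial_segment[where f="%n. f (diagseq n) k"])
 qed
 then show thesis using that subseq_diagseq by blast
qed

lemma average_square_le:
 fixes h :: "'a::euclidean_space => real"
 assumes c: "continuous_on UNIV h" and Q: "compact Q" and V: "measure lborel Q > 0"
 shows "ennreal (((LBINT t. indicator Q t * h t) / measure lborel Q)^2)
  <= ennreal (1 / measure lborel Q) * (NN t. indicator Q t * ennreal ((h t)^2))"
proof -
 let ?V = "measure lborel Q"
 have "ennreal (((LBINT t. indicator Q t * h t) / ?V)^2) = ennreal (1 / ?V^2) * ennreal ((LBINT t. indicator Q t * h t)^2)"
  by (simp add: ennreal_mult''[symmetric] power_divide)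
 also have "... <= ennreal (1 / ?V^2) * (ennreal ?V * (NN t. indicator Q t * ennreal ((h t)^2)))"
  by (intro mult_left_mono square_integral_le[OF c Q]) simp
 also have "... = (ennreal (1 / ?V^2) * ennreal ?V) * (NN t. indicator Q t * ennreal ((h t)^2))"
  by (simp add: mult.assoc)
 also have "ennreal (1 / ?V^2) * ennreal ?V = ennreal (1 / ?V)"
  using V by (simp add: ennreal_mult''[symmetric] power2_eq_square)
 finally show ?thesis .
qed

text \<open>A finite measure with the same null sets as Lebesgue measure, under which constants can
  serve as majorants on the whole space.\<close>

lemma positive_finite_weight:
 obtains w :: "'a::euclidean_space => real" where "w : bmeas borel" "!!x. 0 < w x" "!!x. w x <= 1"
  "(NN x. ennreal (w x)) < \<infinity>"
proof -
 have "\<exists>h\<in>borel_measurable (lborel :: 'a measure). integral\<^sup>N lborel h ~= \<infinity> & (\<forall>x\<in>space lborel. 0 < h x & h x < \<infinity>)"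
  by (rule sigma_finite_measure.Ex_finite_integrable_function[OF sigma_finite_lborel])
 then obtain h :: "'a => ennreal" where h: "h : bmeas lborel" "integral\<^sup>N lborel h ~= \<infinity>" "!!x. 0 < h x & h x < \<infinity>"
  unfolding space_lborel space_borel by (elim bexE conjE) blast
 define w where "w = (%x. min 1 (enn2real (h x)))"
 have [measurable]: "h : bmeas borel" using h by simp
 have "w : bmeas borel" unfolding w_def by measurable
 moreover have "0 < w x" "w x <= 1" for x using h(3)[of x] by (auto simp: w_def enn2real_positive_iff)
 moreover have "(NN x. ennreal (w x)) <= integral\<^sup>N lborel h"
 proof (intro nn_integral_mono)
  fix x
  have "ennreal (w x) <= ennreal (enn2real (h x))" by (intro ennreal_leI) (simp add: w_def)
  also have "ennreal (enn2real (h x)) = h x" using h(3)[of x] by (intro ennreal_enn2real) simp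
  finally show "ennreal (w x) <= h x" .
 qed
 then have "(NN x. ennreal (w x)) < \<infinity>" using h(2) by (simp add: less_top le_less_trans)
 ultimately show thesis using that by blast
qed

text \<open>A Rellich theorem on the whole space. Averages over small balls are bounded and
  equi-Lipschitz for each fixed radius, so a diagonal subsequence converges pointwise; they are also
  L^2-close to the functions, uniformly in n. Hence the functions are Cauchy in L^2 of a finite
  measure, and a further subsequence converges almost everywhere.\<close>

lemma Rellich_AE:
 fixes ph :: "nat => real^'n => real"
 assumes N: "CARD('n) >= 3" and t: "!!n. test_fun UNIV (ph n)"
  and C: "!!n. (LBINT x. (norm (grad (ph n) x))^2) <= C"
 obtains s u where "strict_mono s" "u : bmeas borel" "AE x in lborel. (%n. ph (s n) x) ~~> u x"
proof -
 let ?r = "crit TYPE('n)"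
 have r2: "?r > 2" by (rule crit_gt_2[OF N])
 have C0: "C >= 0" using C[of 0] by (rule order_trans[rotated]) simp
 have [measurable]: "ph n : bmeas borel" "grad (ph n) : bmeas borel" for n using test_measurable[OF t] .
 have cont: "continuous_on UNIV (ph n)" for n using has_gradD(1)[OF test_fun_grad[OF t]] .
 obtain S where S: "S > 0" "!!psi. test_fun UNIV psi ==>
  (LBINT x. abs (psi x) powr ?r) powr (2 / ?r) <= S * (LBINT x. (norm (grad (psi :: real^'n => real) x))^2)"
  using Sobolev_test[OF N] by metis
 define P where "P = (S * C) powr (?r / 2)"
 have P: "(LBINT x. abs (ph n x) powr ?r) <= P" for n
 proof -
  have "(LBINT x. abs (ph n x) powr ?r) powr (2 / ?r) <= S * C"
   using S(2)[OF t[of n]] mult_left_mono[OF C[of n], of S] S(1) by linarith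
  then have "((LBINT x. abs (ph n x) powr ?r) powr (2 / ?r)) powr (?r / 2) <= P"
   unfolding P_def using r2 by (intro powr_mono2) auto
  then show ?thesis using r2 by (simp add: powr_powr)
 qed
 have P0: "P >= 0" by (simp add: P_def)
 define c where "c = 2 ^ CARD('n) * C"
 have c0: "c >= 0" using C0 by (simp add: c_def)
 have T: "(NN x. ennreal ((ph n (x + h) - ph n x)^2)) <= ennreal (c * (norm h)^2)" for n h
 proof -
  have "(NN x. indicator UNIV x * ennreal ((ph n (x + h) - ph n x)^2)) <=
   ennreal (2 ^ CARD('n) * (norm h)^2) * (NN x. indicator UNIV x * ennreal ((norm (grad (ph n) x))^2))"
   by (rule translation_L2[OF test_fun_grad[OF t]]) auto
  also have "(NN x. indicator UNIV x * ennreal ((norm (grad (ph n) x))^2)) = ennreal (LBINT x. (norm (grad (ph n) x))^2)"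
   using nn_integral_eq_integral[OF test_grad_integrable[OF t]] by simp
  also have "ennreal (2 ^ CARD('n) * (norm h)^2) * ... <= ennreal (2 ^ CARD('n) * (norm h)^2) * ennreal C"
   using C by (intro mult_left_mono ennreal_leI) auto
  also have "... = ennreal (c * (norm h)^2)" using C0 by (simp add: c_def ennreal_mult''[symmetric] mult_ac)
  finally show ?thesis by simp
 qed
 define rh where "rh = (%j::nat. inverse (real (Suc j)))"
 define Q where "Q = (%j. cball (0::real^'n) (rh j))"
 define V where "V = (%j. measure lborel (Q j))"
 have rh: "rh j > 0" for j by (simp add: rh_def)
 have Q: "compact (Q j)" "Q j : sets borel" for j by (auto simp: Q_def)
 have V: "V j > 0" for j
  using content_cball_pos[OF rh, of "0::real^'n" j] by (simp add: V_def Q_def)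
 \<comment> \<open>Three estimates follow: distance to \<open>ph n\<close> in L^2
   (\<open>b1\<close>), a Lipschitz bound (\<open>b2\<close>), both from the translation estimate,
   and a uniform bound (\<open>b3\<close>) from the Sobolev inequality and y^2 <= 1 + |y|^r.\<close>
 define A where "A = (%n j x. (LBINT h. indicator (Q j) h * ph n (x + h)) / V j)"
 have ii: "integrable lborel (%h. indicator (Q j) h * f h)" if "continuous_on UNIV f" for f :: "real^'n => real" and j
  using borel_integrable_compact[OF Q(1), of j f] continuous_on_subset[OF that] by simp
 have ct: "continuous_on UNIV (%h. ph n (x + h))" for n x
  by (rule continuous_on_compose2[OF cont]) (auto intro!: continuous_intros)
 have Am[measurable]: "A n j : bmeas borel" for n j
  unfolding A_def using Q(2)[of j] by measurable
 have indV: "(LBINT h. indicator (Q j) h * a) = V j * a" for j and a :: real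
  by (simp add: V_def Q_def)
 have b1: "(NN x. ennreal ((A n j x - ph n x)^2)) <= ennreal (c * (rh j)^2)" for n j
 proof -
  have [measurable]: "Q j : sets borel" by (rule Q)
  have "(NN x. ennreal ((A n j x - ph n x)^2)) <= (NN x. ennreal (1 / V j) * (NN h. indicator (Q j) h * ennreal ((ph n (x + h) - ph n x)^2)))"
  proof (intro nn_integral_mono)
   fix x
   have cc: "continuous_on UNIV (%h. ph n (x + h) - ph n x)" by (intro continuous_intros ct)
   have "(LBINT h. indicator (Q j) h * (ph n (x + h) - ph n x)) = (LBINT h. indicator (Q j) h * ph n (x + h)) - (LBINT h. indicator (Q j) h * ph n x)"
    unfolding right_diff_distrib by (intro L1_integral_diff ii ct continuous_on_const)
   also have "... = V j * (A n j x - ph n x)" unfolding indV using V[of j] by (simp add: A_def right_diff_distrib)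
   finally have "(LBINT h. indicator (Q j) h * (ph n (x + h) - ph n x)) / V j = A n j x - ph n x" using V[of j] by simp
   then show "ennreal ((A n j x - ph n x)^2) <= ennreal (1 / V j) * (NN h. indicator (Q j) h * ennreal ((ph n (x + h) - ph n x)^2))"
    using average_square_le[OF cc Q(1), of j] V[of j] by (simp add: V_def)
  qed
  also have "... = ennreal (1 / V j) * (NN x. NN h. indicator (Q j) h * ennreal ((ph n (x + h) - ph n x)^2))"
   by (rule nn_integral_cmult) measurable
  also have "(NN x. NN h. indicator (Q j) h * ennreal ((ph n (x + h) - ph n x)^2)) =
   (NN h. NN x. indicator (Q j) h * ennreal ((ph n (x + h) - ph n x)^2))"
   by (rule lborel_pair.Fubini'[symmetric]) measurable
  also have "... <= (NN h. ennreal (c * (rh j)^2) * indicator (Q j) h)"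
  proof (intro nn_integral_mono)
   fix h :: "real^'n"
   have "(NN x. indicator (Q j) h * ennreal ((ph n (x + h) - ph n x)^2)) = indicator (Q j) h * (NN x. ennreal ((ph n (x + h) - ph n x)^2))"
    by (rule nn_integral_cmult) measurable
   also have "... <= indicator (Q j) h * ennreal (c * (norm h)^2)" by (intro mult_left_mono T) simp
   also have "... <= ennreal (c * (rh j)^2) * indicator (Q j) h"
    using c0 rh[of j] by (auto simp: indicator_def Q_def intro!: ennreal_leI mult_left_mono power_mono)
   finally show "(NN x. indicator (Q j) h * ennreal ((ph n (x + h) - ph n x)^2)) <= ennreal (c * (rh j)^2) * indicator (Q j) h" .
  qed
  also have "... = ennreal (c * (rh j)^2) * emeasure lborel (Q j)" by (rule nn_integral_cmult_indicator) simp
  also have "emeasure lborel (Q j) = ennreal (V j)"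
   unfolding V_def using emeasure_compact_finite[OF Q(1)] by (intro emeasure_eq_ennreal_measure) (auto simp: less_top)
  also have "ennreal (1 / V j) * (ennreal (c * (rh j)^2) * ennreal (V j)) = ennreal (c * (rh j)^2)"
   using V[of j] c0 by (simp add: ennreal_mult''[symmetric])
  finally show ?thesis by (simp add: mult_left_mono)
 qed
 have b2: "(A n j x - A n j y)^2 <= c / V j * (norm (x - y))^2" for n j x y
 proof -
  have cc: "continuous_on UNIV (%h. ph n (x + h) - ph n (y + h))" by (intro continuous_intros ct)
  have "(LBINT h. indicator (Q j) h * (ph n (x + h) - ph n (y + h))) / V j = A n j x - A n j y"
   unfolding A_def right_diff_distrib diff_divide_distrib[symmetric]
   by (intro arg_cong2[where f="(/)"] refl L1_integral_diff ii ct)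
  then have "ennreal ((A n j x - A n j y)^2) <= ennreal (1 / V j) * (NN h. indicator (Q j) h * ennreal ((ph n (x + h) - ph n (y + h))^2))"
   using average_square_le[OF cc Q(1), of j] V[of j] by (simp add: V_def)
  also have "... <= ennreal (1 / V j) * (NN h. (%z. ennreal ((ph n (z + (x - y)) - ph n z)^2)) (h + y))"
   by (intro mult_left_mono nn_integral_mono) (auto simp: indicator_def algebra_simps)
  also have "... = ennreal (1 / V j) * (NN z. ennreal ((ph n (z + (x - y)) - ph n z)^2))"
   by (intro arg_cong2[where f="(*)"] refl nn_integral_translate) measurable
  also have "... <= ennreal (1 / V j) * ennreal (c * (norm (x - y))^2)" by (intro mult_left_mono T) simp
  also have "... = ennreal (c / V j * (norm (x - y))^2)" using V[of j] c0 by (simp add: ennreal_mult''[symmetric])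
  finally show ?thesis using V[of j] c0 by (subst (asm) ennreal_le_iff) auto
 qed
 define B where "B = (%j. 1 + P / V j)"
 have b3: "(A n j x)^2 <= B j" for n j x
 proof -
  have [measurable]: "Q j : sets borel" by (rule Q)
  have "ennreal ((A n j x)^2) <= ennreal (1 / V j) * (NN h. indicator (Q j) h * ennreal ((ph n (x + h))^2))"
   using average_square_le[OF ct Q(1), of j n x] V[of j] by (simp add: V_def A_def)
  also have "... <= ennreal (1 / V j) * (NN h. indicator (Q j) h + (%z. ennreal (abs (ph n z) powr ?r)) (h + x))"
  proof (intro mult_left_mono nn_integral_mono)
   fix h
   have le: "y^2 <= 1 + abs y powr ?r" for y :: real
   proof (cases "abs y <= 1")
    case True
    then have "y^2 <= 1" by (simp add: abs_square_le_1)
    then show ?thesis by (simp add: add_increasing2)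
   next
    case False
    then have "abs y powr 2 <= abs y powr ?r" using r2 by (intro powr_mono) auto
    then show ?thesis using False by (simp add: powr_numeral)
   qed
   have "ennreal ((ph n (x + h))^2) <= ennreal (1 + abs (ph n (x + h)) powr ?r)" by (intro ennreal_leI le)
   also have "... = 1 + ennreal (abs (ph n (x + h)) powr ?r)" by (simp add: ennreal_plus)
   finally show "indicator (Q j) h * ennreal ((ph n (x + h))^2) <= indicator (Q j) h + ennreal (abs (ph n (h + x)) powr ?r)"
    by (auto simp: indicator_def add.commute)
  qed simp
  also have "... = ennreal (1 / V j) * (emeasure lborel (Q j) + (NN z. ennreal (abs (ph n z) powr ?r)))"
  proof (intro arg_cong2[where f="(*)"] refl)
   have "(NN h. indicator (Q j) h + (%z. ennreal (abs (ph n z) powr ?r)) (h + x)) = (NN h. indicator (Q j) h) + (NN h. (%z. ennreal (abs (ph n z) powr ?r)) (h + x))"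
    by (rule nn_integral_add) measurable
   also have "(NN h. (%z. ennreal (abs (ph n z) powr ?r)) (h + x)) = (NN z. ennreal (abs (ph n z) powr ?r))"
    by (rule nn_integral_translate) measurable
   finally show "(NN h. indicator (Q j) h + (%z. ennreal (abs (ph n z) powr ?r)) (h + x)) = emeasure lborel (Q j) + (NN z. ennreal (abs (ph n z) powr ?r))"
    using Q(2) by simp
  qed
  also have "emeasure lborel (Q j) = ennreal (V j)"
   unfolding V_def using emeasure_compact_finite[OF Q(1)] by (intro emeasure_eq_ennreal_measure) (auto simp: less_top)
  also have "(NN z. ennreal (abs (ph n z) powr ?r)) = ennreal (LBINT z. abs (ph n z) powr ?r)"
   using r2 by (intro nn_integral_eq_integral test_powr_integrable t) auto
  also have "ennreal (1 / V j) * (ennreal (V j) + ennreal (LBINT z. abs (ph n z) powr ?r)) <= ennreal (1 / V j) * (ennreal (V j) + ennreal P)"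
   by (intro mult_left_mono add_left_mono ennreal_leI P) simp
  also have "... = ennreal (B j)"
   using V[of j] P0 by (simp add: ennreal_plus[symmetric] ennreal_mult''[symmetric] B_def field_simps del: ennreal_plus)
  finally show ?thesis using V[of j] P0 by (subst (asm) ennreal_le_iff) (auto simp: B_def)
 qed
 obtain D :: "(real^'n) set" where D: "countable D" "!!X. open X ==> X ~= {} ==> \<exists>d\<in>D. d : X"
  using countable_dense_exists by blast
 have Dne: "D ~= {}" using D(2)[of UNIV] by auto
 define d where "d = from_nat_into D"
 have d: "\<exists>k. dist (d k) x < e" if e: "e > 0" for x e
 proof -
  have "ball x e ~= {}" using e by simp
  then obtain y where "y : D" "y : ball x e" using D(2)[OF open_ball] by blast
  then show ?thesis using from_nat_into_surj[OF D(1)] by (auto simp: d_def dist_commute)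
 qed
 obtain s where s: "strict_mono s" "!!k. convergent (%n. A (s n) (snd (prod_decode k)) (d (fst (prod_decode k))))"
 proof (rule diagonal_convergent[of "%n k. A n (snd (prod_decode k)) (d (fst (prod_decode k)))" "%k. sqrt (B (snd (prod_decode k)))"])
  show "abs (A n (snd (prod_decode k)) (d (fst (prod_decode k)))) <= sqrt (B (snd (prod_decode k)))" for n k
   using b3 by (intro real_le_rsqrt) simp
 qed blast
 have conv0: "convergent (%n. A (s n) j (d i))" for i j using s(2)[of "prod_encode (i, j)"] by simp
 \<comment> \<open>The Lipschitz bound, uniform in n, carries convergence from the dense set to
   every point.\<close>
 have conv: "convergent (%n. A (s n) j x)" for j x
  unfolding Cauchy_convergent_iff[symmetric]
 proof (rule metric_CauchyI)
  fix e :: real assume e: "e > 0"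
  define L where "L = sqrt (c / V j) + 1"
  have L: "L > 0" using c0 V[of j] by (simp add: L_def add_nonneg_pos)
  obtain k where k: "dist (d k) x < e / (3 * L)" using d[of "e / (3 * L)" x] e L by auto
  have lip: "abs (A n j x - A n j (d k)) < e / 3" for n
  proof -
   have "abs (A n j x - A n j (d k)) <= sqrt (c / V j * (norm (x - d k))^2)" using b2 by (intro real_le_rsqrt) simp
   also have "... = sqrt (c / V j) * dist (d k) x" unfolding real_sqrt_mult by (simp add: dist_norm norm_minus_commute[of "d k" x])
   also have "... <= L * dist (d k) x" by (intro mult_right_mono) (auto simp: L_def)
   also have "... < L * (e / (3 * L))" using k L by (intro mult_strict_left_mono)
   finally show ?thesis using L by simp
  qed
  obtain M where M: "\<And>m n. m \<ge> M \<Longrightarrow> n \<ge> M \<Longrightarrow> dist (A (s m) j (d k)) (A (s n) j (d k)) < e / 3"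
   using metric_CauchyD[OF convergent_Cauchy[OF conv0[of j k]], of "e / 3"] e by auto
  have "dist (A (s m) j x) (A (s n) j x) < e" if "m \<ge> M" "n \<ge> M" for m n
   using lip[of "s m"] lip[of "s n"] M[OF that] unfolding dist_real_def by linarith
  then show "\<exists>M. \<forall>m\<ge>M. \<forall>n\<ge>M. dist (A (s m) j x) (A (s n) j x) < e" by blast
 qed
 define a where "a = (%j x. lim (%n. A (s n) j x))"
 have a: "(%n. A (s n) j x) ~~> a j x" for j x using conv by (simp add: a_def convergent_LIMSEQ_iff)
 have [measurable]: "a j : bmeas borel" for j unfolding a_def by (rule borel_measurable_lim_metric) measurable
 obtain w :: "real^'n => real" where w[measurable]: "w : bmeas borel" "!!x. 0 < w x" "!!x. w x <= 1"
  "(NN x. ennreal (w x)) < \<infinity>" using positive_finite_weight by metis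
 define M where "M = density lborel (%x. ennreal (w x))"
 have [simp, measurable_cong]: "sets M = sets borel" by (simp add: M_def)
 have Mle: "(\<integral>\<^sup>+x. f x \<partial>M) <= (NN x. f x)" if [measurable]: "f : bmeas borel" for f
 proof -
  have "(\<integral>\<^sup>+x. f x \<partial>M) = (NN x. ennreal (w x) * f x)" unfolding M_def by (subst nn_integral_density) auto
  also have "... <= (NN x. 1 * f x)" using w(3) by (intro nn_integral_mono mult_right_mono) (auto simp: ennreal_le_1)
  finally show ?thesis by simp
 qed
 have lim0: "(%n. \<integral>\<^sup>+x. ennreal ((A (s n) j x - a j x)^2) \<partial>M) ~~> (\<integral>\<^sup>+x. 0 \<partial>M)" for j
 proof (rule nn_integral_dominated_convergence[where w="%x. ennreal (4 * B j)"])
  have B0: "B j >= 0" using V[of j] P0 by (simp add: B_def)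
  have aB: "(a j x)^2 <= B j" for x by (rule tendsto_upperbound[OF tendsto_power[OF a]]) (auto simp: b3)
  have "(A (s n) j x - a j x)^2 <= 4 * B j" for n x
   using aB[of x] b3[of "s n" j x] zero_le_power2[of "A (s n) j x + a j x"] by (simp add: power2_eq_square algebra_simps)
  then show "AE x in M. ennreal ((A (s n) j x - a j x)^2) <= ennreal (4 * B j)" for n by (intro AE_I2 ennreal_leI)
  have "emeasure M (space M) < \<infinity>"
  proof -
   have "emeasure M (space M) = (NN x. ennreal (w x))" unfolding M_def by (subst emeasure_density) auto
   then show ?thesis using w(4) by simp
  qed
  then show "(\<integral>\<^sup>+x. ennreal (4 * B j) \<partial>M) < \<infinity>" by (simp add: ennreal_mult_less_top)
  show "AE x in M. (%n. ennreal ((A (s n) j x - a j x)^2)) ~~> 0"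
  proof (rule AE_I2)
   fix x
   have "(%n. (A (s n) j x - a j x)^2) ~~> (a j x - a j x)^2" by (intro tendsto_intros a)
   then show "(%n. ennreal ((A (s n) j x - a j x)^2)) ~~> 0"
    by (drule_tac tendsto_ennrealI) simp
  qed
 qed simp_all
 have quad: "ennreal ((p - q)^2) <= 4 * (ennreal ((b - p)^2) + ennreal ((b - e)^2) + ennreal ((f - e)^2) + ennreal ((f - q)^2))" for p q b e f :: real
 proof -
  have *: "(x + y + z + v)^2 <= 4 * (x^2 + y^2 + z^2 + v^2)" for x y z v :: real
   using zero_le_power2[of "x - y"] zero_le_power2[of "x - z"] zero_le_power2[of "x - v"] zero_le_power2[of "y - z"] zero_le_power2[of "y - v"] zero_le_power2[of "z - v"]
   by (simp add: power2_eq_square algebra_simps)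
  have "(p - q)^2 <= 4 * ((b - p)^2 + (b - e)^2 + (f - e)^2 + (f - q)^2)"
   using *[of "p - b" "b - e" "e - f" "f - q"] by (simp add: power2_commute[of p b] power2_commute[of e f])
  then have "ennreal ((p - q)^2) <= ennreal (4 * ((b - p)^2 + (b - e)^2 + (f - e)^2 + (f - q)^2))" by (rule ennreal_leI)
  then show ?thesis by (simp add: ennreal_mult ennreal_plus)
 qed
 obtain s' u where su: "strict_mono s'" "u : bmeas M" "AE x in M. (%k. ph (s (s' k)) x) ~~> u x"
 proof (rule Riesz_Fischer_L2[of "%n. ph (s n)" M])
  fix e :: real assume e: "e > 0"
  have "(%j. c * (rh j)^2) ~~> c * 0^2" unfolding rh_def by (intro tendsto_intros LIMSEQ_inverse_real_of_nat)
  then have "\<forall>\<^sub>F j in sequentially. c * (rh j)^2 < e / 16" using e by (intro order_tendstoD(2)) auto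
  \<comment> \<open>Two functions are compared in four steps through their averages and the limit of
    the averages; squaring a sum of four terms costs a factor 4, whence e/16.\<close>
  then obtain j where j: "c * (rh j)^2 < e / 16" by (auto simp: eventually_sequentially)
  have "\<forall>\<^sub>F n in sequentially. (\<integral>\<^sup>+x. ennreal ((A (s n) j x - a j x)^2) \<partial>M) < ennreal (e / 16)"
   using lim0[of j] e by (intro order_tendstoD(2)) auto
  then obtain K where K: "!!n. n >= K ==> (\<integral>\<^sup>+x. ennreal ((A (s n) j x - a j x)^2) \<partial>M) < ennreal (e / 16)"
   by (auto simp: eventually_sequentially)
  have b1': "(\<integral>\<^sup>+x. ennreal ((A n j x - ph n x)^2) \<partial>M) <= ennreal (e / 16)" for n
  proof -
   have "(\<integral>\<^sup>+x. ennreal ((A n j x - ph n x)^2) \<partial>M) <= (NN x. ennreal ((A n j x - ph n x)^2))" by (rule Mle) measurable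
   also note b1
   also have "ennreal (c * (rh j)^2) <= ennreal (e / 16)" using j by (intro ennreal_leI) simp
   finally show ?thesis .
  qed
  have "(\<integral>\<^sup>+x. ennreal ((norm (ph (s m) x - ph (s n) x))^2) \<partial>M) <= ennreal e" if mn: "m >= K" "n >= K" for m n
  proof -
   have "(\<integral>\<^sup>+x. ennreal ((norm (ph (s m) x - ph (s n) x))^2) \<partial>M) <= (\<integral>\<^sup>+x. 4 * (ennreal ((A (s m) j x - ph (s m) x)^2) + ennreal ((A (s m) j x - a j x)^2)
    + ennreal ((A (s n) j x - a j x)^2) + ennreal ((A (s n) j x - ph (s n) x)^2)) \<partial>M)"
    using quad by (intro nn_integral_mono) simp
   also have "... = 4 * ((\<integral>\<^sup>+x. ennreal ((A (s m) j x - ph (s m) x)^2) \<partial>M) + (\<integral>\<^sup>+x. ennreal ((A (s m) j x - a j x)^2) \<partial>M)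
    + (\<integral>\<^sup>+x. ennreal ((A (s n) j x - a j x)^2) \<partial>M) + (\<integral>\<^sup>+x. ennreal ((A (s n) j x - ph (s n) x)^2) \<partial>M))"
    by (simp add: nn_integral_cmult nn_integral_add)
   also have "... <= 4 * (ennreal (e / 16) + ennreal (e / 16) + ennreal (e / 16) + ennreal (e / 16))"
    using K[OF mn(1)] K[OF mn(2)] b1' by (intro mult_left_mono add_mono) (auto simp: less_imp_le)
   also have "... = ennreal e"
   proof -
    have "ennreal (e / 16) + ennreal (e / 16) + ennreal (e / 16) + ennreal (e / 16) = ennreal (e / 4)"
     using e by (simp add: ennreal_plus[symmetric] del: ennreal_plus)
    then show ?thesis using e by (simp add: ennreal_mult'[symmetric] flip: ennreal_numeral)
   qed
   finally show ?thesis .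
  qed
  then show "\<exists>K. \<forall>m\<ge>K. \<forall>n\<ge>K. (\<integral>\<^sup>+x. ennreal ((norm (ph (s m) x - ph (s n) x))\<^sup>2) \<partial>M) \<le> ennreal e" by blast
 qed auto
 have "AE x in lborel. 0 < ennreal (w x) --> (%k. ph (s (s' k)) x) ~~> u x"
  using su(3) unfolding M_def by (subst (asm) AE_density) auto
 then have "AE x in lborel. (%k. ph (s (s' k)) x) ~~> u x" using w(2) by simp
 moreover have "u : bmeas borel" using su(2) by simp
 moreover have "strict_mono (%k. s (s' k))" using strict_mono_o[OF s(1) su(1)] by (simp add: o_def)
 ultimately show thesis using that by blast
qed

section \<open>The space of functions with square integrable gradient\<close>

abbreviation en :: "(real^'n => real^'n) => real" where
 "en g \<equiv> (LBINT x. (norm (g x))^2)"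

abbreviation pw :: "real => (real^'n => real) => real" where
 "pw r u \<equiv> (LBINT x. abs (u x) powr r)"

text \<open>The completion of the test functions on \<open>Om\<close> in the Dirichlet norm, with g
  the weak gradient. Convergence of the functions is required only almost everywhere because on the
  whole space they need not lie in L^2.\<close>

definition D12 :: "(real^'n) set => (real^'n => real) => (real^'n => real^'n) => bool" where
 "D12 Om u g \<longleftrightarrow> u : bmeas borel & g : bmeas borel &
  integrable lborel (%x. (norm (g x))^2) &
  (\<exists>ph. (\<forall>k. test_fun Om (ph k)) & (AE x in lborel. (%k. ph k x) ~~> u x) &
    (%k. en (%x. grad (ph k) x - g x)) ~~> 0)"

lemma LIMSEQ_squeeze0:
 fixes a b :: "nat => real"
 assumes "!!k. 0 <= a k" "!!k. a k <= b k" "b ~~> 0"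
 shows "a ~~> 0"
 by (rule Lim_null_comparison[OF _ assms(3)]) (use assms in simp)

lemma fatou_le:
 fixes f :: "nat => 'a => real"
 assumes i: "!!n. integrable M (f n)" and nn: "!!n x. f n x >= 0" and m: "g : bmeas M"
  and ae: "AE x in M. (%n. f n x) ~~> g x" and b: "!!n. (\<integral>x. f n x \<partial>M) <= b n" "b ~~> be"
 shows "integrable M g" "(\<integral>x. g x \<partial>M) <= be"
proof -
 obtain B where B: "!!n. abs (b n) <= B"
  using Bseq_def[of b] convergent_imp_Bseq[of b] b(2) by (auto simp: convergent_def)
 have "abs (\<integral>x. f n x \<partial>M) <= B" for n
  using b(1)[of n] nn B[of n] abs_ge_self[of "b n"] integral_nonneg_AE[of "f n" M] by simp
 then have "bounded (range (%n. \<integral>x. f n x \<partial>M))" by (auto simp: bounded_iff)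
 then obtain L s where s: "strict_mono s" "((%n. \<integral>x. f n x \<partial>M) \<circ> s) ~~> L"
  using bounded_imp_convergent_subsequence by blast
 have ae': "AE x in M. (%n. f (s n) x) ~~> g x"
  using ae by eventually_elim (use LIMSEQ_subseq_LIMSEQ[OF _ s(1)] in \<open>auto simp: o_def\<close>)
 note F = fatou_tendsto[of M "%n. f (s n)" g L, OF i nn m ae' s(2)[unfolded o_def]]
 show "integrable M g" by (rule F)
 have "L <= be" using b(1) by (intro LIMSEQ_le[OF s(2) LIMSEQ_subseq_LIMSEQ[OF b(2) s(1)]]) auto
 then show "(\<integral>x. g x \<partial>M) <= be" using F(2) by simp
qed

lemma L2_inner_tendsto:
 fixes f :: "nat => 'a => 'b::euclidean_space"
 assumes [measurable]: "!!k. f k : bmeas M" "g : bmeas M" "h : bmeas M"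
  and i: "!!k. integrable M (%x. (norm (f k x))^2)" "integrable M (%x. (norm (g x))^2)" "integrable M (%x. (norm (h x))^2)"
  and l: "(%k. \<integral>x. (norm (f k x - g x))^2 \<partial>M) ~~> 0"
 shows "(%k. \<integral>x. f k x \<bullet> h x \<partial>M) ~~> (\<integral>x. g x \<bullet> h x \<partial>M)"
proof -
 have di: "integrable M (%x. (norm (f k x - g x))^2)" for k by (rule L2_inner(3)) (use i in auto)
 have "(%k. sqrt (\<integral>x. (norm (f k x - g x))^2 \<partial>M) * sqrt (\<integral>x. (norm (h x))^2 \<partial>M)) ~~> sqrt 0 * sqrt (\<integral>x. (norm (h x))^2 \<partial>M)"
  by (intro tendsto_intros l)
 then have l0: "(%k. sqrt (\<integral>x. (norm (f k x - g x))^2 \<partial>M) * sqrt (\<integral>x. (norm (h x))^2 \<partial>M)) ~~> 0" by simp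
 have m: "(%x. f k x - g x) : bmeas M" for k by measurable
 have "(%k. \<integral>x. (f k x - g x) \<bullet> h x \<partial>M) ~~> 0"
  by (rule Lim_null_comparison[OF _ l0], rule always_eventually, rule allI, unfold real_norm_def)
   (rule L2_inner(4)[OF m assms(3) di i(3)])
 moreover have "(\<integral>x. (f k x - g x) \<bullet> h x \<partial>M) = (\<integral>x. f k x \<bullet> h x \<partial>M) - (\<integral>x. g x \<bullet> h x \<partial>M)" for k
  unfolding inner_diff_left by (intro L1_integral_diff L2_inner(1) i) auto
 ultimately show ?thesis using LIM_zero_cancel by force
qed

lemma norm2_expand: "(norm (a - b))^2 = (norm a)^2 - 2 * (a \<bullet> b) + (norm b)^2" for a b :: "'b::real_inner"
 by (simp add: power2_norm_eq_inner inner_simps inner_commute)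

lemma L2_norm_diff_eq:
 fixes f g :: "'a => 'b::euclidean_space"
 assumes "f : bmeas M" "g : bmeas M"
  and i: "integrable M (%x. (norm (f x))^2)" "integrable M (%x. (norm (g x))^2)"
 shows "(\<integral>x. (norm (f x - g x))^2 \<partial>M) = (\<integral>x. (norm (f x))^2 \<partial>M) - 2 * (\<integral>x. f x \<bullet> g x \<partial>M) + (\<integral>x. (norm (g x))^2 \<partial>M)"
 unfolding norm2_expand using i L2_inner(1)[OF assms] by simp

lemma L2_norm_tendsto:
 fixes f :: "nat => 'a => 'b::euclidean_space"
 assumes m: "!!k. f k : bmeas M" "g : bmeas M"
  and i: "!!k. integrable M (%x. (norm (f k x))^2)" "integrable M (%x. (norm (g x))^2)"
  and l: "(%k. \<integral>x. (norm (f k x - g x))^2 \<partial>M) ~~> 0"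
 shows "(%k. \<integral>x. (norm (f k x))^2 \<partial>M) ~~> (\<integral>x. (norm (g x))^2 \<partial>M)"
proof -
 have "(\<integral>x. (norm (f k x))^2 \<partial>M) = (\<integral>x. (norm (f k x - g x))^2 \<partial>M) + 2 * (\<integral>x. f k x \<bullet> g x \<partial>M) - (\<integral>x. (norm (g x))^2 \<partial>M)" for k
  using L2_norm_diff_eq[OF m(1)[of k] m(2) i(1)[of k] i(2)] by simp
 moreover have "(%k. (\<integral>x. (norm (f k x - g x))^2 \<partial>M) + 2 * (\<integral>x. f k x \<bullet> g x \<partial>M) - (\<integral>x. (norm (g x))^2 \<partial>M)) ~~>
  0 + 2 * (\<integral>x. g x \<bullet> g x \<partial>M) - (\<integral>x. (norm (g x))^2 \<partial>M)"
  by (intro tendsto_intros l L2_inner_tendsto m i)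
 ultimately show ?thesis by (simp add: power2_norm_eq_inner)
qed

lemma D12_meas [measurable_dest]: "D12 Om u g ==> u : bmeas borel" "D12 Om u g ==> g : bmeas borel"
 by (auto simp: D12_def)

lemma D12_int: "D12 Om u g ==> integrable lborel (%x. (norm (g x))^2)" by (simp add: D12_def)

lemma D12_obtain:
 assumes "D12 Om u g"
 obtains ph where "!!k. test_fun Om (ph k)" "!!k. test_fun UNIV (ph k)" "AE x in lborel. (%k. ph k x) ~~> u x"
  "(%k. en (%x. grad (ph k) x - g x)) ~~> 0" "(%k. en (grad (ph k))) ~~> en g"
proof -
 obtain ph where ph: "!!k. test_fun Om (ph k)" "AE x in lborel. (%k. ph k x) ~~> u x"
  "(%k. en (%x. grad (ph k) x - g x)) ~~> 0" using assms unfolding D12_def by blast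
 have U: "test_fun UNIV (ph k)" for k using ph(1) test_fun_mono by blast
 have "(%k. en (grad (ph k))) ~~> en g"
  using D12_meas[OF assms] D12_int[OF assms] ph(3) test_measurable[OF U] test_grad_integrable[OF U]
  by (intro L2_norm_tendsto) auto
 then show thesis using that ph U by blast
qed

lemma D12_test: assumes "test_fun Om ph" shows "D12 Om ph (grad ph)"
proof -
 have U: "test_fun UNIV ph" using assms test_fun_mono by blast
 show ?thesis unfolding D12_def using test_measurable[OF U] test_grad_integrable[OF U] assms
  by (intro conjI exI[of _ "%k. ph"]) auto
qed

lemma D12_mono: "D12 Om u g ==> Om <= Om' ==> D12 Om' u g"
 unfolding D12_def using test_fun_mono by blast

lemma D12_cong_AE:
 assumes "D12 Om u g" "AE x in lborel. u x = v x" "v : bmeas borel"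
 shows "D12 Om v g"
proof -
 obtain ph where ph: "!!k. test_fun Om (ph k)" "AE x in lborel. (%k. ph k x) ~~> u x"
  "(%k. en (%x. grad (ph k) x - g x)) ~~> 0" using assms unfolding D12_def by blast
 have "AE x in lborel. (%k. ph k x) ~~> v x" using ph(2) assms(2) by eventually_elim simp
 then show ?thesis using assms(1,3) ph unfolding D12_def by blast
qed

lemma D12_lin:
 assumes u: "D12 Om u g" and v: "D12 Om v h"
 shows "D12 Om (%x. u x + c * v x) (%x. g x + c *R h x)"
proof -
 note [measurable] = D12_meas[OF u] D12_meas[OF v]
 obtain ph where ph: "!!k. test_fun Om (ph k)" "!!k. test_fun UNIV (ph k)" "AE x in lborel. (%k. ph k x) ~~> u x"
  "(%k. en (%x. grad (ph k) x - g x)) ~~> 0" "(%k. en (grad (ph k))) ~~> en g"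
  by (rule D12_obtain[OF u]) (rule that)
 obtain psi where psi: "!!k. test_fun Om (psi k)" "!!k. test_fun UNIV (psi k)" "AE x in lborel. (%k. psi k x) ~~> v x"
  "(%k. en (%x. grad (psi k) x - h x)) ~~> 0" "(%k. en (grad (psi k))) ~~> en h"
  by (rule D12_obtain[OF v]) (rule that)
 note [measurable] = test_measurable[OF ph(2)] test_measurable[OF psi(2)]
 define xi where "xi = (%k x. ph k x + c * psi k x)"
 have t: "test_fun Om (xi k)" for k unfolding xi_def by (intro test_fun_add test_fun_scale ph(1) psi(1))
 have gr: "grad (xi k) x = grad (ph k) x + c *R grad (psi k) x" for k x
  unfolding xi_def grad_add[OF test_fun_smooth[OF ph(1)] test_fun_smooth[OF test_fun_scale[OF psi(1)]]]
   grad_scale[OF test_fun_smooth[OF psi(1)]] ..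
 have sc: "integrable lborel (%x. (norm (c *R f x))^2) & en (%x. c *R f x) = c^2 * en f" if "integrable lborel (%x. (norm (f x))^2)" for f :: "real^'a => real^'a"
  using that by (simp add: power_mult_distrib)
 have i1: "integrable lborel (%x. (norm (grad (ph k) x - g x))^2)" for k by (rule L2_inner(3)) (use D12_int[OF u] test_grad_integrable[OF ph(2)] in auto)
 have i2: "integrable lborel (%x. (norm (grad (psi k) x - h x))^2)" for k by (rule L2_inner(3)) (use D12_int[OF v] test_grad_integrable[OF psi(2)] in auto)
 have bd: "en (%x. grad (xi k) x - (g x + c *R h x)) <= 2 * en (%x. grad (ph k) x - g x) + 2 * (c^2 * en (%x. grad (psi k) x - h x))" for k
 proof -
  have e: "grad (xi k) x - (g x + c *R h x) = (grad (ph k) x - g x) + c *R (grad (psi k) x - h x)" for x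
   by (simp add: gr algebra_simps)
  have "en (%x. (grad (ph k) x - g x) + c *R (grad (psi k) x - h x)) <= 2 * en (%x. grad (ph k) x - g x) + 2 * en (%x. c *R (grad (psi k) x - h x))"
   by (rule L2_triangle[OF _ _ i1 conjunct1[OF sc[OF i2]]]) measurable
  then show ?thesis unfolding e conjunct2[OF sc[OF i2[of k]]] .
 qed
 have "(%k. 2 * en (%x. grad (ph k) x - g x) + 2 * (c^2 * en (%x. grad (psi k) x - h x))) ~~> 2 * 0 + 2 * (c^2 * 0)"
  by (intro tendsto_intros ph(4) psi(4))
 then have l0: "(%k. 2 * en (%x. grad (ph k) x - g x) + 2 * (c^2 * en (%x. grad (psi k) x - h x))) ~~> 0" by simp
 have "(%k. en (%x. grad (xi k) x - (g x + c *R h x))) ~~> 0"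
  by (rule LIMSEQ_squeeze0[OF _ bd l0]) simp
 moreover have "AE x in lborel. (%k. xi k x) ~~> u x + c * v x"
  using ph(3) psi(3) unfolding xi_def by eventually_elim (intro tendsto_intros)
 moreover have "integrable lborel (%x. (norm (g x + c *R h x))^2)"
  by (rule L2_inner(2)) (use D12_int[OF u] sc[OF D12_int[OF v]] in auto)
 ultimately show ?thesis unfolding D12_def using t by auto
qed

lemma D12_scale: assumes "D12 Om u g" shows "D12 Om (%x. c * u x) (%x. c *R g x)"
proof -
 have "D12 Om (%x. 0) (grad (%x. 0))" by (rule D12_test[OF test_fun_zero])
 moreover have "grad (%x. 0) = (%x. 0 :: real^'a)" by (rule has_grad_eq) simp
 ultimately show ?thesis using D12_lin[of Om "%x. 0" "%x. 0" u g c] assms by simp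
qed

lemma D12_diff: "D12 Om u g ==> D12 Om v h ==> D12 Om (%x. u x - v x) (%x. g x - h x)"
 using D12_lin[of Om u g v h "-1"] by simp

section \<open>Scaling rules and the best Sobolev constant\<close>

lemma en_scale: "en (%x. c *R g x) = c^2 * en g" by (simp add: power_mult_distrib)

lemma pw_scale: "pw r (%x. c * u x) = abs c powr r * pw r u" by (simp add: abs_mult powr_mult)

text \<open>The largest S with S |ph|_r^2 <= |grad ph|_2^2 for all test functions; the power 2/r
  turns the integral into the squared L^r norm.\<close>

definition Sob :: "'n::finite itself => real" where
 "Sob _ = Inf {en (grad ph) / (pw (crit TYPE('n)) ph) powr (2 / crit TYPE('n)) | ph :: real^'n => real.
  test_fun UNIV ph & pw (crit TYPE('n)) ph > 0}"

lemma test_fun_exists: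
 fixes x0 :: "real^'n" assumes "0 < a" "a < b"
 obtains et where "test_fun (cball x0 b) et" "!!x. 0 <= et x" "!!x. et x <= 1"
  "!!x. norm (x - x0) <= a ==> et x = 1" "!!x. norm (x - x0) >= b ==> et x = 0"
proof -
 obtain et where et: "smooth_on UNIV et" "!!x. 0 <= et x" "!!x. et x <= 1"
  "!!x. norm (x - x0) <= a ==> et x = 1" "!!x. norm (x - x0) >= b ==> et x = 0"
  using smooth_cutoff[OF assms] by metis
 have "test_fun (cball x0 b) et" using et
  by (intro test_funI[of _ "cball x0 b"]) (auto simp: dist_norm norm_minus_commute)
 then show thesis using that et by blast
qed

lemma pw_pos_iff:
 assumes "u : bmeas borel" "integrable lborel (%x. abs (u x) powr r)"
 shows "pw r u = 0 \<longleftrightarrow> (AE x in lborel. u x = 0)"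
 using integral_nonneg_eq_0_iff_AE[OF assms(2)] by simp

lemma Sob_props:
 assumes N: "CARD('n) >= 3"
 shows "Sob TYPE('n) > 0"
  "!!ph :: real^'n => real. test_fun UNIV ph ==> Sob TYPE('n) * pw (crit TYPE('n)) ph powr (2 / crit TYPE('n)) <= en (grad ph)"
  "!!e. e > 0 ==> \<exists>ph :: real^'n => real. test_fun UNIV ph & pw (crit TYPE('n)) ph > 0 &
    en (grad ph) < (Sob TYPE('n) + e) * pw (crit TYPE('n)) ph powr (2 / crit TYPE('n))"
proof -
 let ?r = "crit TYPE('n)"
 let ?A = "{en (grad ph) / (pw ?r ph) powr (2 / ?r) | ph :: real^'n => real. test_fun UNIV ph & pw ?r ph > 0}"
 have r2: "?r > 2" by (rule crit_gt_2[OF N])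
 obtain C where C: "C > 0" "!!ph :: real^'n => real. test_fun UNIV ph ==> pw ?r ph powr (2 / ?r) <= C * en (grad ph)"
  using Sobolev_test[OF N] by metis
 have ne: "?A ~= {}"
 proof -
  obtain et :: "real^'n => real" where et: "test_fun (cball 0 2) et" "!!x. norm (x - 0) <= 1 ==> et x = 1"
   using test_fun_exists[of 1 2 "0::real^'n"] by (metis one_less_numeral_iff semiring_norm(76) zero_less_one)
  have t: "test_fun UNIV et" using et(1) test_fun_mono by blast
  have "pw ?r et ~= 0"
  proof
   assume "pw ?r et = 0"
   then have "AE x in lborel. et x = 0"
    using pw_pos_iff[OF test_measurable(1)[OF t] test_powr_integrable[OF t]] r2 by simp
   then have "AE x in lborel. x \<notin> ball (0::real^'n) 1" by eventually_elim (use et(2) in force)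
   then have "emeasure lborel (ball (0::real^'n) 1) = 0" by (subst (asm) AE_iff_measurable[OF _ refl]) (auto simp: ball_def)
   then show False using emeasure_lborel_ball_finite content_ball_pos[of 1 "0::real^'n"] by (simp add: measure_def)
  qed
  then have "pw ?r et > 0" by (simp add: less_le)
  then show ?thesis using t by blast
 qed
 have lb: "1 / C <= a" if "a : ?A" for a
 proof -
  obtain ph :: "real^'n => real" where ph: "a = en (grad ph) / (pw ?r ph) powr (2 / ?r)" "test_fun UNIV ph" "pw ?r ph > 0" using \<open>a : ?A\<close> by blast
  have "pw ?r ph powr (2 / ?r) > 0" using ph(3) by simp
  then show ?thesis using C(2)[OF ph(2)] C(1) by (simp add: ph(1) field_simps)
 qed
 have bb: "bdd_below ?A" using lb by (intro bdd_belowI) blast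
 have "1 / C <= Sob TYPE('n)" unfolding Sob_def using ne lb by (intro cInf_greatest) auto
 then show "Sob TYPE('n) > 0" using C(1) by (auto intro: less_le_trans[of _ "1 / C"])
 show "Sob TYPE('n) * pw ?r ph powr (2 / ?r) <= en (grad ph)" if t: "test_fun UNIV ph" for ph :: "real^'n => real"
 proof (cases "pw ?r ph > 0")
  case True
  then have "Sob TYPE('n) <= en (grad ph) / (pw ?r ph) powr (2 / ?r)"
   unfolding Sob_def using t by (intro cInf_lower bb) blast
  then show ?thesis using True by (simp add: pos_le_divide_eq)
 next
  case False
  then have "pw ?r ph = 0" by (simp add: le_less_trans not_less antisym)
  then show ?thesis by simp
 qed
 show "\<exists>ph :: real^'n => real. test_fun UNIV ph & pw ?r ph > 0 & en (grad ph) < (Sob TYPE('n) + e) * pw ?r ph powr (2 / ?r)" if "e > 0" for e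
 proof -
  have "Inf ?A < Sob TYPE('n) + e" unfolding Sob_def using that by simp
  then obtain a where a: "a : ?A" "a < Sob TYPE('n) + e" using cInf_lessD[OF ne] by blast
  then obtain ph :: "real^'n => real" where ph: "a = en (grad ph) / (pw ?r ph) powr (2 / ?r)" "test_fun UNIV ph" "pw ?r ph > 0" by blast
  then show ?thesis using a(2) by (intro exI[of _ ph]) (simp add: pos_divide_less_eq)
 qed
qed

lemma D12_Sobolev:
 fixes u :: "real^'n => real"
 assumes N: "CARD('n) >= 3" and u: "D12 Om u g"
 shows "integrable lborel (%x. abs (u x) powr crit TYPE('n))"
  "Sob TYPE('n) * pw (crit TYPE('n)) u powr (2 / crit TYPE('n)) <= en g"
  "pw (crit TYPE('n)) u <= (en g / Sob TYPE('n)) powr (crit TYPE('n) / 2)"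
proof -
 let ?r = "crit TYPE('n)" and ?S = "Sob TYPE('n)"
 have r2: "?r > 2" by (rule crit_gt_2[OF N])
 note S = Sob_props[OF N]
 note [measurable] = D12_meas[OF u]
 obtain ph where "!!k. test_fun Om (ph k)" and ph: "!!k. test_fun UNIV (ph k)" "AE x in lborel. (%k. ph k x) ~~> u x"
  and "(%k. en (%x. grad (ph k) x - g x)) ~~> 0" and ph3: "(%k. en (grad (ph k))) ~~> en g"
  by (rule D12_obtain[OF u]) (rule that)
 have b: "pw ?r (ph k) <= (en (grad (ph k)) / ?S) powr (?r / 2)" for k
 proof -
  have "pw ?r (ph k) powr (2 / ?r) <= en (grad (ph k)) / ?S" using S(2)[OF ph(1)[of k]] S(1) by (simp add: field_simps)
  then have "(pw ?r (ph k) powr (2 / ?r)) powr (?r / 2) <= (en (grad (ph k)) / ?S) powr (?r / 2)"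
   using r2 by (intro powr_mono2) auto
  then show ?thesis using r2 by (simp add: powr_powr)
 qed
 have lim: "(%k. (en (grad (ph k)) / ?S) powr (?r / 2)) ~~> (en g / ?S) powr (?r / 2)"
  using r2 S(1) by (intro tendsto_powr2 tendsto_intros ph3) auto
 have ae: "AE x in lborel. (%k. abs (ph k x) powr ?r) ~~> abs (u x) powr ?r"
  using ph(2) by eventually_elim (use r2 in \<open>auto intro!: tendsto_powr2 tendsto_rabs\<close>)
 have F: "integrable lborel (%x. abs (u x) powr ?r)" "pw ?r u <= (en g / ?S) powr (?r / 2)"
  by (rule fatou_le[OF test_powr_integrable[OF ph(1)] _ _ ae b lim]; use r2 in simp)+
 then show "integrable lborel (%x. abs (u x) powr ?r)" "pw ?r u <= (en g / ?S) powr (?r / 2)" by auto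
 have "pw ?r u powr (2 / ?r) <= ((en g / ?S) powr (?r / 2)) powr (2 / ?r)" using F(2) r2 by (intro powr_mono2) auto
 also have "... = en g / ?S" using r2 S(1) by (simp add: powr_powr)
 finally show "?S * pw ?r u powr (2 / ?r) <= en g" using S(1) by (simp add: field_simps)
qed

lemma D12_Hardy:
 fixes u :: "real^'n => real"
 assumes N: "CARD('n) >= 3" and u: "D12 Om u g"
 shows "integrable lborel (%x. (u x)^2 / (1 + (norm x)^2))"
  "(LBINT x. (u x)^2 / (1 + (norm x)^2)) <= 4 / (real CARD('n) - 2)^2 * en g"
proof -
 note [measurable] = D12_meas[OF u]
 obtain ph where "!!k. test_fun Om (ph k)" and ph: "!!k. test_fun UNIV (ph k)" "AE x in lborel. (%k. ph k x) ~~> u x"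
  and "(%k. en (%x. grad (ph k) x - g x)) ~~> 0" and ph3: "(%k. en (grad (ph k))) ~~> en g"
  by (rule D12_obtain[OF u]) (rule that)
 have ae: "AE x in lborel. (%k. (ph k x)^2 / (1 + (norm x)^2)) ~~> (u x)^2 / (1 + (norm x)^2)"
  using ph(2)
 proof eventually_elim
  case (elim x)
  have "1 + (norm x)^2 ~= 0" using zero_le_power2[of "norm x"] by linarith
  then show ?case by (intro tendsto_intros elim)
 qed
 have lim: "(%k. 4 / (real CARD('n) - 2)^2 * en (grad (ph k))) ~~> 4 / (real CARD('n) - 2)^2 * en g" by (intro tendsto_intros ph3)
 show "integrable lborel (%x. (u x)^2 / (1 + (norm x)^2))"
  "(LBINT x. (u x)^2 / (1 + (norm x)^2)) <= 4 / (real CARD('n) - 2)^2 * en g"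
  by (rule fatou_le[OF Hardy_test(1)[OF N ph(1)] _ _ ae Hardy_test(2)[OF N ph(1)] lim]; simp)+
qed

lemma D12_approx_Lr:
 fixes u :: "nat => real^'n => real"
 assumes N: "CARD('n) >= 3" and un: "!!k. D12 Om (u k) (g k)" and l: "(%k. en (g k)) ~~> 0"
 shows "(%k. pw (crit TYPE('n)) (u k)) ~~> 0"
proof (rule tendsto_sandwich[OF _ _ tendsto_const])
 let ?r = "crit TYPE('n)" and ?S = "Sob TYPE('n)"
 have r2: "?r > 2" by (rule crit_gt_2[OF N])
 have "(%k. (en (g k) / ?S) powr (?r / 2)) ~~> (0 / ?S) powr (?r / 2)"
  using r2 Sob_props(1)[OF N] by (intro tendsto_powr2 tendsto_intros l) auto
 then show "(%k. (en (g k) / ?S) powr (?r / 2)) ~~> 0" using r2 by simp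
 show "\<forall>\<^sub>F k in sequentially. pw ?r (u k) <= (en (g k) / ?S) powr (?r / 2)"
  using D12_Sobolev(3)[OF N un] by simp
qed simp

section \<open>Multiplication by weights and affine changes of variables\<close>

lemma smooth_mult_bound:
 assumes "smooth_on UNIV w" "!!x. abs (w x) <= B" "!!x. (norm (grad w x))^2 * (1 + (norm x)^2) <= B^2"
 shows "(norm (w x *R a + t *R grad w x))^2 <= 2 * B^2 * (norm a)^2 + 2 * B^2 * (t^2 / (1 + (norm x)^2))"
proof -
 have p: "1 + (norm x)^2 > 0" using zero_le_power2[of "norm x"] by linarith
 have "(norm (w x *R a + t *R grad w x))^2 <= (norm (w x *R a) + norm (t *R grad w x))^2"
  by (intro power_mono norm_triangle_ineq) simp
 also have "... <= 2 * (norm (w x *R a))^2 + 2 * (norm (t *R grad w x))^2"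
  using sum_squares_bound[of "norm (w x *R a)" "norm (t *R grad w x)"] by (simp add: power2_sum)
 also have "(norm (w x *R a))^2 <= B^2 * (norm a)^2"
  using power_mono[OF assms(2)[of x], of 2] by (simp add: power_mult_distrib mult_right_mono)
 also have "(norm (t *R grad w x))^2 <= B^2 * (t^2 / (1 + (norm x)^2))"
 proof -
  have "(norm (grad w x))^2 <= B^2 / (1 + (norm x)^2)" using assms(3)[of x] p by (simp add: pos_le_divide_eq)
  then have "t^2 * (norm (grad w x))^2 <= t^2 * (B^2 / (1 + (norm x)^2))" by (rule mult_left_mono) simp
  then show ?thesis by (simp add: power_mult_distrib mult.commute)
 qed
 finally show ?thesis by simp
qed

text \<open>The condition on grad w is the decay that Hardy's inequality can use: it makes u grad w
  square integrable with a bound by the energy of u alone, and the same bound applied to differences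
  gives convergence.\<close>

lemma D12_mult:
 fixes u :: "real^'n => real"
 assumes N: "CARD('n) >= 3" and u: "D12 Om u g" and w: "smooth_on UNIV w" "!!x. abs (w x) <= B"
  "!!x. (norm (grad w x))^2 * (1 + (norm x)^2) <= B^2"
  and t: "!!ph. test_fun Om ph ==> test_fun Om' (%x. w x * ph x)"
 shows "D12 Om' (%x. w x * u x) (%x. w x *R g x + u x *R grad w x)"
proof -
 note gw = smooth_has_grad[OF w(1)]
 note [measurable] = D12_meas[OF u] cont_borel[OF has_gradD(1)[OF gw]] cont_borel[OF has_gradD(2)[OF gw]]
 obtain ph where ph: "!!k. test_fun Om (ph k)" "!!k. test_fun UNIV (ph k)" "AE x in lborel. (%k. ph k x) ~~> u x"
  "(%k. en (%x. grad (ph k) x - g x)) ~~> 0" "(%k. en (grad (ph k))) ~~> en g"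
  by (rule D12_obtain[OF u]) (rule that)
 note [measurable] = test_measurable[OF ph(2)]
 note bd = smooth_mult_bound[OF w]
 have gr: "grad (%x. w x * ph k x) = (%x. w x *R grad (ph k) x + ph k x *R grad w x)" for k
  by (rule grad_mult[OF w(1) test_fun_smooth[OF ph(1)]])
 have int: "integrable lborel (%x. (norm (w x *R a x + v x *R grad w x))^2)"
  "en (%x. w x *R a x + v x *R grad w x) <= (2 * B^2 + 2 * B^2 * (4 / (real CARD('n) - 2)^2)) * en a" if va: "D12 Om v a" for v a
 proof -
  note [measurable] = D12_meas[OF va]
  note H = D12_Hardy[OF N va]
  have ib: "integrable lborel (%x. 2 * B^2 * (norm (a x))^2 + 2 * B^2 * ((v x)^2 / (1 + (norm x)^2)))"
   using D12_int[OF va] H(1) by (intro L1_integrable_add integrable_mult_right)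
  show i: "integrable lborel (%x. (norm (w x *R a x + v x *R grad w x))^2)"
   by (rule L1_integrable_bound[OF ib]) (auto intro!: AE_I2 order_trans[OF bd])
  have "en (%x. w x *R a x + v x *R grad w x) <= (LBINT x. 2 * B^2 * (norm (a x))^2 + 2 * B^2 * ((v x)^2 / (1 + (norm x)^2)))"
   by (intro integral_mono i ib bd)
  also have "... = 2 * B^2 * en a + 2 * B^2 * (LBINT x. (v x)^2 / (1 + (norm x)^2))"
   unfolding integral_mult_right_zero[symmetric]
   by (intro L1_integral_add integrable_mult_right D12_int[OF va] H(1))
  also have "... <= 2 * B^2 * en a + 2 * B^2 * (4 / (real CARD('n) - 2)^2 * en a)"
   by (intro add_left_mono mult_left_mono H(2)) simp
  finally show "en (%x. w x *R a x + v x *R grad w x) <= (2 * B^2 + 2 * B^2 * (4 / (real CARD('n) - 2)^2)) * en a"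
   by (simp add: algebra_simps)
 qed
 let ?M = "2 * B^2 + 2 * B^2 * (4 / (real CARD('n) - 2)^2)"
 have dk: "D12 Om (%x. ph k x - u x) (%x. grad (ph k) x - g x)" for k by (intro D12_diff D12_test ph(1) u)
 have "(%k. ?M * en (%x. grad (ph k) x - g x)) ~~> ?M * 0" by (intro tendsto_mult tendsto_const ph(4))
 then have l0: "(%k. ?M * en (%x. grad (ph k) x - g x)) ~~> 0" by simp
 have bd0: "en (%x. grad (%x. w x * ph k x) x - (w x *R g x + u x *R grad w x)) <= ?M * en (%x. grad (ph k) x - g x)" for k
 proof -
  have e: "grad (%x. w x * ph k x) x - (w x *R g x + u x *R grad w x) = w x *R (grad (ph k) x - g x) + (ph k x - u x) *R grad w x" for x
   by (simp add: gr algebra_simps)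
  show ?thesis unfolding e by (rule int(2)[OF dk])
 qed
 have "(%k. en (%x. grad (%x. w x * ph k x) x - (w x *R g x + u x *R grad w x))) ~~> 0"
  by (rule LIMSEQ_squeeze0[OF _ bd0 l0]) simp
 moreover have "AE x in lborel. (%k. w x * ph k x) ~~> w x * u x"
  using ph(3) by eventually_elim (intro tendsto_intros)
 ultimately show ?thesis unfolding D12_def using int(1)[OF u] t[OF ph(1)] by (intro conjI exI[of _ "%k x. w x * ph k x"]) auto
qed

lemma AE_affine:
 fixes P :: "real^'n => bool"
 assumes c: "c ~= 0" and P: "AE x in lborel. P x"
 shows "AE x in lborel. P (c *R x + y)"
proof -
 obtain Z where Z: "{x. \<not> P x} <= Z" "emeasure lborel Z = 0" "Z : sets borel" using P by (auto elim!: AE_E)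
 have [measurable]: "Z : sets borel" by (rule Z)
 have "0 = (NN x. indicator Z x)" using Z by simp
 also have "... = ennreal (abs c^CARD('n)) * (NN x. indicator Z (c *R x + y))"
  using Z(3) by (intro nn_integral_affine c) auto
 finally have "ennreal (abs c^CARD('n)) * (NN x. indicator Z (c *R x + y)) = 0" by simp
 moreover have "ennreal (abs c^CARD('n)) ~= 0" using c by (simp add: ennreal_eq_0_iff not_le)
 ultimately have "(NN x. indicator Z (c *R x + y)) = 0" by simp
 then have "AE x in lborel. indicator Z (c *R x + y) = (0::ennreal)"
  by (subst (asm) nn_integral_0_iff_AE) auto
 then show ?thesis by eventually_elim (use Z(1) in \<open>auto simp: indicator_def split: if_splits\<close>)
qed

lemma D12_affine:
 fixes u :: "real^'n => real"
 assumes u: "D12 Om u g" and c: "c > 0" and O: "!!x. c *R x + y : Om ==> x : Om'"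
 shows "D12 Om' (%x. k * u (c *R x + y)) (%x. (k * c) *R g (c *R x + y))"
  "en (%x. (k * c) *R g (c *R x + y)) = (k * c)^2 * en g / c ^ CARD('n)"
proof -
 note [measurable] = D12_meas[OF u]
 obtain ph where ph: "!!k. test_fun Om (ph k)" "!!k. test_fun UNIV (ph k)" "AE x in lborel. (%k. ph k x) ~~> u x"
  "(%k. en (%x. grad (ph k) x - g x)) ~~> 0" "(%k. en (grad (ph k))) ~~> en g"
  by (rule D12_obtain[OF u]) (rule that)
 note [measurable] = test_measurable[OF ph(2)]
 define psi where "psi = (%j x. k * ph j (c *R x + y))"
 have sm: "smooth_on UNIV (%x. ph j (c *R x + y))" for j by (intro smooth_affine test_fun_smooth[OF ph(1)])
 have gr: "grad (psi j) x = (k * c) *R grad (ph j) (c *R x + y)" for j x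
  unfolding psi_def by (simp add: grad_scale[OF sm] grad_affine[OF test_fun_smooth[OF ph(1)]])
 have t: "test_fun Om' (psi j)" for j
 proof -
  obtain K where K: "compact K" "K <= Om" "!!x. x \<notin> K ==> ph j x = 0" using test_fun_obtain[OF ph(1)] by metis
  let ?K = "(%z. (1 / c) *R (z - y)) ` K"
  have inv: "(1 / c) *R ((c *R x + y) - y) = x" "c *R ((1 / c) *R (x - y)) + y = x" for x using c by auto
  show ?thesis
  proof (rule test_funI[of _ ?K])
   show "smooth_on UNIV (psi j)" unfolding psi_def by (intro smooth_mult smooth_const sm)
   show "compact ?K" by (intro compact_continuous_image continuous_intros K)
   show "?K <= Om'" using K(2) O inv by force
   show "psi j x = 0" if "x \<notin> ?K" for x
   proof -
    have "c *R x + y \<notin> K" using that inv(1)[of x] by (metis image_eqI)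
    then show ?thesis using K by (simp add: psi_def)
   qed
  qed
 qed
 have en_aff: "en (%x. (k * c) *R f (c *R x + y)) = (k * c)^2 * en f / c ^ CARD('n)" if [measurable]: "f : bmeas borel" for f :: "real^'n => real^'n"
  using integral_affine(2)[of "%x. (norm (f x))^2" c y] c by (simp add: power_mult_distrib)
 show "en (%x. (k * c) *R g (c *R x + y)) = (k * c)^2 * en g / c ^ CARD('n)" by (rule en_aff) simp
 have "(%j. (k * c)^2 * en (%x. grad (ph j) x - g x) / c ^ CARD('n)) ~~> (k * c)^2 * 0 / c ^ CARD('n)"
  using c by (intro tendsto_intros ph(4)) auto
 moreover have "en (%x. grad (psi j) x - (k * c) *R g (c *R x + y)) = (k * c)^2 * en (%x. grad (ph j) x - g x) / c ^ CARD('n)" for j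
  using en_aff[of "%x. grad (ph j) x - g x"] by (simp add: gr scaleR_diff_right)
 ultimately have "(%j. en (%x. grad (psi j) x - (k * c) *R g (c *R x + y))) ~~> 0" by simp
 moreover have "AE x in lborel. (%j. psi j x) ~~> k * u (c *R x + y)"
  using AE_affine[OF _ ph(3), of c y] c unfolding psi_def by (auto elim!: eventually_mono intro!: tendsto_intros)
 moreover have "integrable lborel (%x. (norm ((k * c) *R g (c *R x + y)))^2)"
  using integral_affine(1)[of "%x. (norm (g x))^2" c y] D12_int[OF u] c by (simp add: power_mult_distrib)
 ultimately show "D12 Om' (%x. k * u (c *R x + y)) (%x. (k * c) *R g (c *R x + y))"
  unfolding D12_def using t by auto
qed

section \<open>Weak compactness\<close>

lemma local_powr_integrable:
 fixes v :: "real^'n => real"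
 assumes [measurable]: "v : bmeas borel" "K : sets borel" and "integrable lborel (%x. abs (v x) powr r)"
  and fin: "emeasure lborel K < \<infinity>" and t: "0 < t" "t <= r"
 shows "integrable lborel (%x. indicator K x * abs (v x) powr t)"
proof (rule L1_integrable_bound)
 have "integrable lborel (indicat_real K)" using fin by (intro integrable_real_indicator) simp_all
 then show "integrable lborel (%x. indicat_real K x + abs (v x) powr r)" using assms(3) by (rule L1_integrable_add)
 have "abs y powr t <= 1 + abs y powr r" for y :: real
 proof (cases "abs y <= 1")
  case True
  then have "abs y powr t <= 1 powr t" using t by (intro powr_mono2) auto
  then show ?thesis by (simp add: add_increasing2)
 next
  case False
  then have "abs y powr t <= abs y powr r" using t by (intro powr_mono) auto
  then show ?thesis by simp
 qed
 then show "AE x in lborel. norm (indicator K x * abs (v x) powr t) <= norm (indicat_real K x + abs (v x) powr r)"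
  by (auto simp: indicator_def)
qed measurable

lemma Lr_diff_bound:
 fixes f g :: "'a => real"
 assumes "f : bmeas M" "g : bmeas M"
  and i: "integrable M (%x. abs (f x) powr r)" "integrable M (%x. abs (g x) powr r)" and r: "r >= 0"
 shows "(\<integral>x. abs (f x - g x) powr r \<partial>M) <= 2 powr r * ((\<integral>x. abs (f x) powr r \<partial>M) + (\<integral>x. abs (g x) powr r \<partial>M))"
proof -
 have "(\<integral>x. abs (f x - g x) powr r \<partial>M) <= (\<integral>x. 2 powr r * (abs (f x) powr r + abs (g x) powr r) \<partial>M)"
  using i abs_powr_add_le[OF r, of "f _" "- g _"] integrable_powr_diff[OF assms] by (intro integral_mono) auto
 then show ?thesis using i by simp
qed

text \<open>Almost everywhere convergence with an L^r bound implies convergence in L^1 on sets of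
  finite measure, since r > 1; that suffices against a bounded kernel supported there.\<close>

lemma AE_Lr_weak:
 fixes u :: "nat => real^'n => real"
 assumes r: "r > 1" and [measurable]: "!!n. u n : bmeas borel" "v : bmeas borel"
  "kp : bmeas borel" "K : sets borel"
  and ae: "AE x in lborel. (%n. u n x) ~~> v x"
  and i: "!!n. integrable lborel (%x. abs (u n x) powr r)" and C: "!!n. pw r (u n) <= C"
  and fin: "emeasure lborel K < \<infinity>" and kp: "!!x. abs (kp x) <= B * indicator K x"
 shows "integrable lborel (%x. v x * kp x)" "(%n. LBINT x. u n x * kp x) ~~> (LBINT x. v x * kp x)"
proof -
 have r0: "r > 0" using r by simp
 have m: "!!n. u n : bmeas lborel" "v : bmeas lborel" by simp_all
 note BL = Brezis_Lieb[OF r0 m i C ae]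
 have B0: "B >= 0 \<or> K = {}" using kp by (metis abs_ge_zero all_not_in_conv indicator_simps(1) mult.right_neutral order_trans)
 have wi: "integrable lborel (%x. w x * kp x)" if [measurable]: "w : bmeas borel" and w: "integrable lborel (%x. abs (w x) powr r)" for w
 proof (rule L1_integrable_bound)
  show "integrable lborel (%x. B * (indicator K x * abs (w x) powr 1))"
   using r by (intro integrable_mult_right local_powr_integrable[OF _ _ w fin]) auto
  have "\<bar>w x * kp x\<bar> <= \<bar>B * (indicator K x * \<bar>w x\<bar> powr 1)\<bar>" for x
  proof -
   have "abs (w x * kp x) <= abs (w x) * (B * indicator K x)" unfolding abs_mult using kp by (intro mult_left_mono) auto
   also have "... = B * (indicator K x * abs (w x) powr 1)" by (cases "w x = 0") (auto simp: powr_one_gt_zero_iff)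
   finally show ?thesis by linarith
  qed
  then show "AE x in lborel. norm (w x * kp x) <= norm (B * (indicator K x * abs (w x) powr 1))" by simp
 qed measurable
 have vi: "integrable lborel (%x. abs (v x) powr r)" by (rule BL(1))
 show "integrable lborel (%x. v x * kp x)" by (rule wi[OF _ vi]) measurable
 define w where "w = (%n x. u n x - v x)"
 have [measurable]: "w n : bmeas borel" for n unfolding w_def by measurable
 have wii: "integrable lborel (%x. abs (w n x) powr r)" for n unfolding w_def by (rule BL(2))
 have wC: "(LBINT x. abs (w n x) powr r) <= 2 powr r * (C + pw r v)" for n
 proof -
  have "(LBINT x. abs (w n x) powr r) <= 2 powr r * (pw r (u n) + pw r v)"
   unfolding w_def using r by (intro Lr_diff_bound m i vi) simp
  also have "... <= 2 powr r * (C + pw r v)" using C[of n] by (intro mult_left_mono) auto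
  finally show ?thesis .
 qed
 have aw: "AE x in lborel. (%n. w n x) ~~> 0"
  using ae unfolding w_def by eventually_elim (rule LIM_zero)
 have mw: "!!n. w n : bmeas lborel" "K : sets lborel" by simp_all
 note L = lower_power_tendsto_zero[OF mw fin wii wC aw zero_less_one r]
 have b: "abs (LBINT x. w n x * kp x) <= abs B * (LBINT x. indicator K x * abs (w n x) powr 1)" for n
 proof -
  have "abs (LBINT x. w n x * kp x) <= (LBINT x. abs (w n x * kp x))" by (rule integral_abs_bound)
  also have "... <= (LBINT x. abs B * (indicator K x * abs (w n x) powr 1))"
  proof (rule integral_mono)
   show "integrable lborel (%x. abs (w n x * kp x))" by (intro integrable_abs wi wii) measurable
   show "integrable lborel (%x. abs B * (indicator K x * abs (w n x) powr 1))" by (intro integrable_mult_right L(1))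
   fix x
   have "abs (w n x * kp x) <= abs (w n x) * (abs B * indicator K x)" unfolding abs_mult using kp[of x]
    by (intro mult_left_mono) (auto simp: indicator_def)
   also have "... = abs B * (indicator K x * abs (w n x) powr 1)" by (cases "w n x = 0") (auto simp: powr_one_gt_zero_iff)
   finally show "abs (w n x * kp x) <= abs B * (indicator K x * abs (w n x) powr 1)" .
  qed
  also have "... = abs B * (LBINT x. indicator K x * abs (w n x) powr 1)" by (rule integral_mult_right_zero)
  finally show ?thesis .
 qed
 have "(%n. abs B * (LBINT x. indicator K x * abs (w n x) powr 1)) ~~> abs B * 0"
  by (intro tendsto_mult tendsto_const L(2))
 then have l0: "(%n. abs B * (LBINT x. indicator K x * abs (w n x) powr 1)) ~~> 0" by simp
 have "(%n. LBINT x. w n x * kp x) ~~> 0"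
  by (rule Lim_null_comparison[OF _ l0]) (use b in simp)
 moreover have "(LBINT x. w n x * kp x) = (LBINT x. u n x * kp x) - (LBINT x. v x * kp x)" for n
  unfolding w_def left_diff_distrib by (intro L1_integral_diff wi i vi) measurable
 ultimately have "(%n. (LBINT x. u n x * kp x) - (LBINT x. v x * kp x)) ~~> 0" by simp
 then show "(%n. LBINT x. u n x * kp x) ~~> (LBINT x. v x * kp x)" by (rule LIM_zero_cancel)
qed

section \<open>Identification of weak limits by integration by parts\<close>

definition lap :: "(real^'n => real) => real^'n => real" where
 "lap f x = (\<Sum>i\<in>UNIV. pd [i, i] f x)"

lemma test_ibp:
 fixes psi xi :: "real^'n => real"
 assumes psi: "test_fun UNIV psi" and xi: "test_fun UNIV xi"
 shows "(LBINT x. grad psi x \<bullet> grad xi x) = - (LBINT x. psi x * lap xi x)"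
proof -
 obtain K where K: "compact K" "!!x. x \<notin> K ==> psi x = 0" "!!x. x \<notin> K ==> grad psi x = 0" using test_fun_obtain[OF psi] by metis
 note gpsi = test_fun_grad[OF psi]
 have sxi: "smooth_on UNIV xi" by (rule test_fun_smooth[OF xi])
 note gp = smooth_has_grad[OF smooth_pd[OF sxi]]
 have z: "integrable lborel (%x. psi x * pd [i, i] xi x)" "integrable lborel (%x. pd [i] xi x * grad psi x $ i)"
  "(LBINT x. psi x * pd [i, i] xi x + pd [i] xi x * grad psi x $ i) = 0" for i
 proof -
  show "integrable lborel (%x. psi x * pd [i, i] xi x)"
   using K(2) by (intro integrable_compact_support[OF _ K(1)] continuous_on_mult has_gradD(1)[OF gpsi] smooth_onD(1)[OF sxi]) simp
  show "integrable lborel (%x. pd [i] xi x * grad psi x $ i)"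
   using K(3) by (intro integrable_compact_support[OF _ K(1)] continuous_on_mult continuous_on_component has_gradD(2)[OF gpsi] smooth_onD(1)[OF sxi]) simp
  have i0: "(LBINT x. (psi x *R grad (pd [i] xi) x + pd [i] xi x *R grad psi x) $ i) = 0"
   using K by (intro integral_partial_zero(2)[OF has_grad_mult[OF gpsi gp] K(1)]) auto
  have e: "(psi x *R grad (pd [i] xi) x + pd [i] xi x *R grad psi x) $ i = psi x * pd [i, i] xi x + pd [i] xi x * grad psi x $ i" for x
   by (simp add: grad_def)
  show "(LBINT x. psi x * pd [i, i] xi x + pd [i] xi x * grad psi x $ i) = 0" by (rule i0[unfolded e])
 qed
 have "(LBINT x. psi x * lap xi x + grad psi x \<bullet> grad xi x) = (LBINT x. (\<Sum>i\<in>UNIV. psi x * pd [i, i] xi x + pd [i] xi x * grad psi x $ i))"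
  by (intro L1_integral_cong refl)
   (simp only: lap_def inner_vec_def inner_real_def sum.distrib sum_distrib_left mult.commute[of "grad psi _ $ _"], simp add: grad_def mult.commute)
 also have "... = (\<Sum>i\<in>UNIV. LBINT x. psi x * pd [i, i] xi x + pd [i] xi x * grad psi x $ i)"
  by (intro Bochner_Integration.integral_sum L1_integrable_add z)
 also have "... = 0" by (simp only: z(3)) simp
 finally have s0: "(LBINT x. psi x * lap xi x + grad psi x \<bullet> grad xi x) = 0" .
 have "integrable lborel (%x. psi x * lap xi x)"
  unfolding lap_def sum_distrib_left by (intro Bochner_Integration.integrable_sum z)
 moreover have "integrable lborel (%x. grad psi x \<bullet> grad xi x)"
  using test_measurable(2)[OF psi] test_measurable(2)[OF xi] by (intro L2_inner(1) test_grad_integrable psi xi) simp_all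
 ultimately show ?thesis using s0 by simp
qed

lemma lap_bound:
 fixes xi :: "real^'n => real"
 assumes xi: "test_fun UNIV xi"
 obtains B K where "compact K" "!!x. abs (lap xi x) <= B * indicator K x" "lap xi : bmeas borel"
proof -
 have sxi: "smooth_on UNIV xi" by (rule test_fun_smooth[OF xi])
 obtain K where K: "compact K" "!!x. x \<notin> K ==> xi x = 0" "!!x. x \<notin> K ==> grad xi x = 0" using test_fun_obtain[OF xi] by metis
 have z: "pd [i] xi x = 0" if "x \<notin> K" for x i
 proof -
  have "grad xi x $ i = 0" using K(3)[OF that] by simp
  then show ?thesis by (simp add: grad_def)
 qed
 have c: "continuous_on UNIV (lap xi)" unfolding lap_def by (intro continuous_on_sum smooth_onD(1)[OF sxi])
 have z2: "lap xi x = 0" if "x \<notin> K" for x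
 proof -
  have "pd [i, i] xi x = 0" for i
  proof -
   have t: "test_fun UNIV (pd [i] xi)" by (rule test_funI[OF smooth_pd[OF sxi] K(1) subset_UNIV z])
   have "x \<notin> closure {x. pd [i] xi x ~= 0}"
   proof -
    have "{x. pd [i] xi x ~= 0} <= K" using z by blast
    then have "closure {x. pd [i] xi x ~= 0} <= K" using K(1) by (intro closure_minimal compact_imp_closed)
    then show ?thesis using that by blast
   qed
   moreover have "grad (pd [i] xi) x = 0"
   proof -
    have "open (- K)" "x : - K" using K(1) that by (auto simp: compact_imp_closed open_Compl)
    then obtain e where e: "e > 0" "ball x e <= - K" by (rule openE)
    have "deriv (%t. pd [i] xi (x + t *R axis j 1)) 0 = 0" for j
    proof (rule DERIV_imp_deriv)
     show "((%t. pd [i] xi (x + t *R axis j 1)) has_real_derivative 0) (at 0)"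
     proof (subst DERIV_cong_ev[OF refl _ refl, where g="%t. 0"])
      have "pd [i] xi (x + t *R axis j 1) = 0" if "t : ball 0 e" for t
       using that e by (intro z) (auto simp: subset_eq dist_norm)
      then show "\<forall>\<^sub>F t in nhds 0. pd [i] xi (x + t *R axis j 1) = 0"
       unfolding eventually_nhds using e(1) by (intro exI[of _ "ball 0 e"]) auto
     qed simp
    qed
    then show ?thesis unfolding grad_def by (simp add: vec_eq_iff)
   qed
   then have "grad (pd [i] xi) x $ i = 0" by simp
   then show ?thesis by (simp add: grad_def)
  qed
  then show ?thesis by (simp only: lap_def) simp
 qed
 obtain B where B: "B > 0" "!!x. norm (lap xi x) <= B" by (rule bounded_compact_support[OF c K(1) z2]) (assumption | rule that)+
 have "abs (lap xi x) <= B * indicator K x" for x using B(2)[of x] z2[of x] by (cases "x : K") auto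
 then show thesis using that K(1) cont_borel[OF c] by blast
qed

lemma D12_pw_bounded:
 fixes u :: "nat => real^'n => real"
 assumes N: "CARD('n) >= 3" and "!!n. D12 Om (u n) (g n)" and "!!n. en (g n) <= C"
 shows "pw (crit TYPE('n)) (u n) <= (C / Sob TYPE('n)) powr (crit TYPE('n) / 2)"
proof -
 have "pw (crit TYPE('n)) (u n) <= (en (g n) / Sob TYPE('n)) powr (crit TYPE('n) / 2)" by (rule D12_Sobolev(3)[OF N assms(2)])
 also have "... <= (C / Sob TYPE('n)) powr (crit TYPE('n) / 2)"
  using Sob_props(1)[OF N] crit_gt_2[OF N] assms(3)[of n] by (intro powr_mono2 divide_right_mono) auto
 finally show ?thesis .
qed

text \<open>With both derivatives moved onto xi, the limit of the gradients is tested using only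
  almost everywhere convergence of the functions.\<close>

lemma ibp_tendsto:
 fixes u :: "nat => real^'n => real"
 assumes N: "CARD('n) >= 3" and t: "!!n. test_fun UNIV (u n)" and C: "!!n. en (grad (u n)) <= C"
  and m: "v : bmeas borel" and ae: "AE x in lborel. (%n. u n x) ~~> v x" and xi: "test_fun UNIV xi"
 shows "(%n. LBINT x. grad (u n) x \<bullet> grad xi x) ~~> - (LBINT x. v x * lap xi x)"
proof -
 let ?r = "crit TYPE('n)"
 have r1: "?r > 1" using crit_gt_2[OF N] by simp
 obtain B K where BK: "compact K" "!!x. abs (lap xi x) <= B * indicator K x" "lap xi : bmeas borel"
  by (rule lap_bound[OF xi]) (rule that)
 have "(%n. LBINT x. u n x * lap xi x) ~~> (LBINT x. v x * lap xi x)"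
 proof (rule AE_Lr_weak(2)[OF r1])
  show "!!n. u n : bmeas borel" using test_measurable(1)[OF t] .
  show "!!n. integrable lborel (%x. abs (u n x) powr ?r)" using r1 by (intro test_powr_integrable t) simp
  show "pw ?r (u n) <= (C / Sob TYPE('n)) powr (?r / 2)" for n
   by (rule D12_pw_bounded[OF N D12_test[OF t] C])
  show "emeasure lborel K < \<infinity>" by (rule emeasure_compact_finite[OF BK(1)])
  show "K : sets borel" using BK(1) by (rule borel_compact)
 qed (fact m BK(3) ae BK(2))+
 then show ?thesis unfolding test_ibp[OF t xi] by (rule tendsto_minus)
qed

lemma D12_ibp:
 fixes u :: "real^'n => real"
 assumes N: "CARD('n) >= 3" and u: "D12 Om u g" and xi: "test_fun UNIV xi"
 shows "(LBINT x. g x \<bullet> grad xi x) = - (LBINT x. u x * lap xi x)"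
proof -
 obtain ph where ph: "!!k. test_fun Om (ph k)" "!!k. test_fun UNIV (ph k)" "AE x in lborel. (%k. ph k x) ~~> u x"
  "(%k. en (%x. grad (ph k) x - g x)) ~~> 0" "(%k. en (grad (ph k))) ~~> en g"
  by (rule D12_obtain[OF u]) (rule that)
 have "Bseq (%k. en (grad (ph k)))" using ph(5) by (intro convergent_imp_Bseq convergentI)
 then obtain C where C: "!!k. abs (en (grad (ph k))) <= C" unfolding Bseq_def real_norm_def by blast
 have C': "en (grad (ph k)) <= C" for k using C[of k] by linarith
 have 1: "(%k. LBINT x. grad (ph k) x \<bullet> grad xi x) ~~> - (LBINT x. u x * lap xi x)"
  by (rule ibp_tendsto[OF N ph(2) C' D12_meas(1)[OF u] ph(3) xi])
 have 2: "(%k. LBINT x. grad (ph k) x \<bullet> grad xi x) ~~> (LBINT x. g x \<bullet> grad xi x)"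
 proof (rule L2_inner_tendsto[OF _ _ _ _ _ _ ph(4)])
  show "!!k. grad (ph k) : bmeas lborel" "grad xi : bmeas lborel" "g : bmeas lborel"
   using test_measurable(2)[OF ph(2)] test_measurable(2)[OF xi] D12_meas(2)[OF u] by simp_all
 qed (intro test_grad_integrable ph(2) xi D12_int[OF u])+
 show ?thesis by (rule LIMSEQ_unique[OF 2 1])
qed

text \<open>Closability of the gradient: by integration by parts g is orthogonal to the gradients of
  its own approximating sequence, hence to itself.\<close>

lemma D12_zero:
 fixes u :: "real^'n => real"
 assumes N: "CARD('n) >= 3" and u: "D12 Om u g" and z: "AE x in lborel. u x = 0"
 shows "en g = 0"
proof -
 obtain ph where ph: "!!k. test_fun Om (ph k)" "!!k. test_fun UNIV (ph k)" "AE x in lborel. (%k. ph k x) ~~> u x"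
  "(%k. en (%x. grad (ph k) x - g x)) ~~> 0" "(%k. en (grad (ph k))) ~~> en g"
  by (rule D12_obtain[OF u]) (rule that)
 have "(LBINT x. g x \<bullet> grad (ph k) x) = 0" for k
 proof -
  have "AE x in lborel. u x * lap (ph k) x = 0" using z by eventually_elim simp
  then have "(LBINT x. u x * lap (ph k) x) = 0" by (rule integral_eq_zero_AE)
  then show ?thesis using D12_ibp[OF N u ph(2)[of k]] by simp
 qed
 then have e0: "(LBINT x. grad (ph k) x \<bullet> g x) = 0" for k by (simp only: inner_commute)
 have "(%k. LBINT x. grad (ph k) x \<bullet> g x) ~~> (LBINT x. g x \<bullet> g x)"
 proof (rule L2_inner_tendsto[OF _ _ _ _ _ _ ph(4)])
  show "!!k. grad (ph k) : bmeas lborel" "g : bmeas lborel" "g : bmeas lborel"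
   using test_measurable(2)[OF ph(2)] D12_meas(2)[OF u] by simp_all
 qed (intro test_grad_integrable ph(2) D12_int[OF u])+
 then have "(LBINT x. g x \<bullet> g x) = 0" unfolding e0 using LIMSEQ_unique tendsto_const by blast
 then show ?thesis by (simp add: power2_norm_eq_inner)
qed

text \<open>Gradients of test functions are dense among those of \<open>D12\<close>, and the energy
  bound makes the error uniform in n.\<close>

lemma weak_extend:
 fixes f :: "nat => real^'n => real^'n"
 assumes m: "!!n. f n : bmeas borel" "g : bmeas borel"
  and i: "!!n. integrable lborel (%x. (norm (f n x))^2)" "integrable lborel (%x. (norm (g x))^2)"
  and C: "!!n. en (f n) <= C" and w: "!!xi. test_fun UNIV xi ==> (%n. LBINT x. f n x \<bullet> grad xi x) ~~> (LBINT x. g x \<bullet> grad xi x)"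
  and v: "D12 UNIV v h"
 shows "(%n. LBINT x. f n x \<bullet> h x) ~~> (LBINT x. g x \<bullet> h x)"
proof (rule LIMSEQ_I)
 fix e :: real assume e: "e > 0"
 obtain ph where ph: "!!k. test_fun UNIV (ph k)" "!!k. test_fun UNIV (ph k)" "AE x in lborel. (%k. ph k x) ~~> v x"
  "(%k. en (%x. grad (ph k) x - h x)) ~~> 0" "(%k. en (grad (ph k))) ~~> en h"
  by (rule D12_obtain[OF v]) (rule that)
 define A where "A = sqrt C + sqrt (en g) + 1"
 have "en (f 0) >= 0" by simp
 then have C0: "C >= 0" using C[of 0] by linarith
 have A: "A > 0" "sqrt C <= A" "sqrt (en g) <= A" using C0 by (auto simp: A_def add_nonneg_pos)
 have "(%k. sqrt (en (%x. grad (ph k) x - h x))) ~~> sqrt 0" by (intro tendsto_intros ph(4))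
 then have "\<forall>\<^sub>F k in sequentially. sqrt (en (%x. grad (ph k) x - h x)) < e / (3 * A)" using e A by (intro order_tendstoD(2)) auto
 then obtain k where k: "sqrt (en (%x. grad (ph k) x - h x)) < e / (3 * A)" by (auto simp: eventually_sequentially)
 define xi where "xi = ph k"
 have t: "test_fun UNIV xi" unfolding xi_def by (rule ph(1))
 have mm: "!!n. f n : bmeas lborel" "g : bmeas lborel" "h : bmeas lborel" "grad xi : bmeas lborel"
  using m D12_meas(2)[OF v] test_measurable(2)[OF t] by simp_all
 have di: "integrable lborel (%x. (norm (grad xi x - h x))^2)" by (rule L2_inner(3)[OF mm(4,3) test_grad_integrable[OF t] D12_int[OF v]])
 have md: "(%x. grad xi x - h x) : bmeas lborel" using mm by simp
 have small: "abs (LBINT x. a x \<bullet> (grad xi x - h x)) < e / 3"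
  if a: "a : bmeas lborel" "integrable lborel (%x. (norm (a x))^2)" "sqrt (en a) <= A" for a
 proof -
  have "abs (LBINT x. a x \<bullet> (grad xi x - h x)) <= sqrt (en a) * sqrt (en (%x. grad xi x - h x))"
   by (rule L2_inner(4)[OF a(1) md a(2) di])
  also have "... <= A * sqrt (en (%x. grad xi x - h x))" using a(3) by (intro mult_right_mono) auto
  also have "... < A * (e / (3 * A))" using k A unfolding xi_def by (intro mult_strict_left_mono)
  finally show ?thesis using A by simp
 qed
 have sp: "(LBINT x. a x \<bullet> (grad xi x - h x)) = (LBINT x. a x \<bullet> grad xi x) - (LBINT x. a x \<bullet> h x)"
  if a: "a : bmeas lborel" "integrable lborel (%x. (norm (a x))^2)" for a
  unfolding inner_diff_right
  by (intro L1_integral_diff L2_inner(1)[OF a(1) mm(4) a(2) test_grad_integrable[OF t]] L2_inner(1)[OF a(1) mm(3) a(2) D12_int[OF v]])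
 obtain n0 where n0: "!!n. n >= n0 ==> norm ((LBINT x. f n x \<bullet> grad xi x) - (LBINT x. g x \<bullet> grad xi x)) < e / 3"
  using LIMSEQ_D[OF w[OF t], of "e / 3"] e by auto
 have "norm ((LBINT x. f n x \<bullet> h x) - (LBINT x. g x \<bullet> h x)) < e" if "n >= n0" for n
 proof -
  have fA: "sqrt (en (f n)) <= A" using C[of n] A(2) by (meson order_trans real_sqrt_le_mono)
  show ?thesis
   using n0[OF that] small[OF mm(1) i(1) fA] small[OF mm(2) i(2) A(3)] unfolding sp[OF mm(1) i(1)] sp[OF mm(2) i(2)] real_norm_def
   by linarith
 qed
 then show "\<exists>no. \<forall>n\<ge>no. norm ((\<integral>x. f n x \<bullet> h x \<partial>lborel) - (\<integral>x. g x \<bullet> h x \<partial>lborel)) < e" by blast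
qed

text \<open>Dyadic convex combinations. The parallelogram law uses only midpoints, so these replace
  convex hulls in the proof that energy-minimizing combinations converge strongly.\<close>

inductive_set mids :: "(real^'n => real) set => (real^'n => real) set" for A where
 base: "a : A ==> a : mids A"
| mid: "a : mids A ==> b : mids A ==> (%x. 1/2 * a x + 1/2 * b x) : mids A"

lemma mids_mono: assumes "A <= B" "a : mids A" shows "a : mids B"
 using assms(2)
proof induction
 case (base a) then show ?case using assms(1) by (intro mids.base) blast
next
 case (mid a b) show ?case by (rule mids.mid[OF mid.IH])
qed

lemma mids_test:
 assumes "h : mids A" "!!a. a : A ==> test_fun Om a" shows "test_fun Om h"
 using assms(1)
proof induction
 case (base a) then show ?case by (rule assms(2))
next
 case (mid a b) show ?case by (intro test_fun_add test_fun_scale mid.IH)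
qed

text \<open>Convex combinations of the tail of a convergent sequence stay near its limit; therefore
  passing to midpoints does not change the pointwise limit.\<close>

lemma mids_close:
 assumes "h : mids A" "!!a. a : A ==> abs (a x - l) <= e" shows "abs (h x - l) <= e"
 using assms(1)
proof induction
 case (mid a b)
 have "(1/2 * a x + 1/2 * b x) - l = 1/2 * (a x - l) + 1/2 * (b x - l)" by (simp add: field_simps)
 then show ?case using mid(3,4) by linarith
qed (rule assms(2))

lemma grad_mid:
 assumes "test_fun Om a" "test_fun Om b"
 shows "grad (%x. 1/2 * a x + 1/2 * b x) x = (1/2) *R (grad a x + grad b x)"
 unfolding grad_add[OF test_fun_smooth[OF test_fun_scale[OF assms(1)]] test_fun_smooth[OF test_fun_scale[OF assms(2)]]]
  grad_scale[OF test_fun_smooth[OF assms(1)]] grad_scale[OF test_fun_smooth[OF assms(2)]] by (simp add: scaleR_add_right)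

lemma en_parallelogram:
 fixes f g :: "real^'n => real^'n"
 assumes m: "f : bmeas lborel" "g : bmeas lborel"
  and i: "integrable lborel (%x. (norm (f x))^2)" "integrable lborel (%x. (norm (g x))^2)"
 shows "en (%x. f x - g x) = 2 * en f + 2 * en g - 4 * en (%x. (1/2) *R (f x + g x))"
proof -
 have e: "(norm (f x + g x))^2 = 2 * (norm (f x))^2 + 2 * (norm (g x))^2 - (norm (f x - g x))^2" for x
  by (simp add: power2_norm_eq_inner inner_simps inner_commute)
 have "en (%x. f x + g x) = 2 * en f + 2 * en g - en (%x. f x - g x)"
  unfolding e using i L2_inner(3)[OF m i] by simp
 then show ?thesis unfolding en_scale by (simp add: power_divide field_simps)
qed

lemma mids_energy:
 assumes h: "h : mids A" and t: "!!a. a : A ==> test_fun UNIV a" and C: "!!a. a : A ==> en (grad a) <= C"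
 shows "en (grad h) <= C"
 using h
proof induction
 case (mid a b)
 have ta: "test_fun UNIV a" "test_fun UNIV b" using mids_test[OF mid(1) t] mids_test[OF mid(2) t] by auto
 have m: "grad a : bmeas lborel" "grad b : bmeas lborel"
  using test_measurable(2)[OF ta(1)] test_measurable(2)[OF ta(2)] by simp_all
 have "en (%x. grad a x - grad b x) >= 0" by simp
 then have "4 * en (%x. (1/2) *R (grad a x + grad b x)) <= 2 * en (grad a) + 2 * en (grad b)"
  using en_parallelogram[OF m test_grad_integrable[OF ta(1)] test_grad_integrable[OF ta(2)]] by linarith
 then show ?case unfolding grad_mid[OF ta] using mid(3,4) by linarith
qed (rule C)

text \<open>The gradients of suitable midpoint combinations converge strongly, by the parallelogram law;
  integration by parts against test functions identifies their limit as the weak limit.\<close>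
theorem D12_compact:
 fixes u :: "nat => real^'n => real"
 assumes N: "CARD('n) >= 3" and D: "!!n. D12 Om (u n) (g n)" and C: "!!n. en (g n) <= C"
 obtains s v h where "strict_mono s" "D12 Om v h" "AE x in lborel. (%n. u (s n) x) ~~> v x"
  "!!w k. D12 UNIV w k ==> (%n. LBINT x. g (s n) x \<bullet> k x) ~~> (LBINT x. h x \<bullet> k x)"
proof -
 let ?r = "crit TYPE('n)"
 have r2: "?r > 2" by (rule crit_gt_2[OF N])
 have C0: "C >= 0" using C[of 0] by (rule order_trans[rotated]) simp
 have mg: "g n : bmeas lborel" for n using D12_meas(2)[OF D] by simp
 have gi: "integrable lborel (%x. (norm (g n x))^2)" for n by (rule D12_int[OF D])
 \<comment> \<open>Each u n is replaced by a test function whose gradient is within 1/(n+1) in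
   squared norm, because the Rellich theorem is available for test functions.\<close>
 have "\<exists>ph. test_fun Om ph & en (%x. grad ph x - g n x) <= inverse (real (Suc n))" for n
 proof -
  obtain ph where ph: "!!k. test_fun Om (ph k)" "!!k. test_fun UNIV (ph k)" "AE x in lborel. (%k. ph k x) ~~> u n x"
   "(%k. en (%x. grad (ph k) x - g n x)) ~~> 0" "(%k. en (grad (ph k))) ~~> en (g n)"
   by (rule D12_obtain[OF D]) (rule that)
  have "\<forall>\<^sub>F k in sequentially. en (%x. grad (ph k) x - g n x) < inverse (real (Suc n))"
   by (rule order_tendstoD(2)[OF ph(4)]) simp
  then obtain k where "en (%x. grad (ph k) x - g n x) < inverse (real (Suc n))" by (auto simp: eventually_sequentially)
  then show ?thesis using ph(1)[of k] by (intro exI[of _ "ph k"]) simp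
 qed
 then obtain ph where ph: "!!n. test_fun Om (ph n)" "!!n. en (%x. grad (ph n) x - g n x) <= inverse (real (Suc n))" by metis
 have tU: "test_fun UNIV (ph n)" for n using test_fun_mono[OF ph(1)] by simp
 have mph: "grad (ph n) : bmeas lborel" "ph n : bmeas lborel" for n using test_measurable[OF tU] by simp_all
 have phi: "integrable lborel (%x. (norm (grad (ph n) x))^2)" for n by (rule test_grad_integrable[OF tU])
 have dlim: "(%n. en (%x. grad (ph n) x - g n x)) ~~> 0"
  by (rule LIMSEQ_squeeze0[OF _ ph(2) LIMSEQ_inverse_real_of_nat]) simp
 define C' where "C' = 2 * 1 + 2 * C"
 have C': "en (grad (ph n)) <= C'" for n
 proof -
  have "en (%x. (grad (ph n) x - g n x) + g n x) <= 2 * en (%x. grad (ph n) x - g n x) + 2 * en (g n)"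
   by (rule L2_triangle[OF _ mg L2_inner(3)[OF mph(1) mg phi gi] gi]) (use mph mg in simp)
  moreover have "inverse (real (Suc n)) <= 1" by (simp add: inverse_le_1_iff)
  then have "en (%x. grad (ph n) x - g n x) <= 1" using ph(2)[of n] by linarith
  ultimately show ?thesis using C[of n] by (simp add: C'_def)
 qed
 obtain s1 v where s1: "strict_mono s1" "v : bmeas borel" "AE x in lborel. (%n. ph (s1 n) x) ~~> v x"
  by (rule Rellich_AE[OF N tU C']) (rule that)
 have dD: "D12 Om (%x. ph n x - u n x) (%x. grad (ph n) x - g n x)" for n by (rule D12_diff[OF D12_test[OF ph(1)] D])
 have "(%n. pw ?r (%x. ph n x - u n x)) ~~> 0" by (rule D12_approx_Lr[OF N dD dlim])
 from LIMSEQ_subseq_LIMSEQ[OF this s1(1)]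
 have "(%n. LBINT x. norm (abs (ph (s1 n) x - u (s1 n) x) powr ?r)) ~~> 0" by (simp add: o_def)
 from tendsto_L1_AE_subseq[OF _ this] D12_Sobolev(1)[OF N dD]
 obtain s2 where s2: "strict_mono s2" "AE x in lborel. (%n. abs (ph (s1 (s2 n)) x - u (s1 (s2 n)) x) powr ?r) ~~> 0" by blast
 define s where "s = (%n. s1 (s2 n))"
 have s: "strict_mono s" using strict_mono_o[OF s1(1) s2(1)] by (simp add: s_def o_def)
 define psi where "psi = (%n. ph (s n))"
 have psit: "test_fun Om (psi n)" "test_fun UNIV (psi n)" for n unfolding psi_def by (rule ph(1), rule tU)
 have psiv: "AE x in lborel. (%n. psi n x) ~~> v x"
  using s1(3) unfolding psi_def s_def by eventually_elim (use LIMSEQ_subseq_LIMSEQ[OF _ s2(1)] in \<open>force simp: o_def\<close>)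
 have uv: "AE x in lborel. (%n. u (s n) x) ~~> v x"
  using psiv s2(2)
 proof eventually_elim
  case (elim x)
  have "(%n. (abs (psi n x - u (s n) x) powr ?r) powr (1 / ?r)) ~~> 0 powr (1 / ?r)"
   using r2 elim(2) unfolding psi_def s_def by (intro tendsto_powr2 tendsto_const) auto
  then have "(%n. abs (psi n x - u (s n) x)) ~~> 0" using r2 by (simp add: powr_powr)
  then have "(%n. psi n x - u (s n) x) ~~> 0" by (rule tendsto_rabs_zero_cancel)
  from tendsto_diff[OF elim(1) this] show ?case by simp
 qed
 \<comment> \<open>Combinations of tails. Their minimal energies \<open>d n\<close> increase with n
   and are bounded, so they converge.\<close>
 define K where "K = (%n. mids (psi ` {n..}))"
 have KC: "en (grad h) <= C'" if "h : K n" for h n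
  using that unfolding K_def by (rule mids_energy) (auto simp: psi_def intro: tU C')
 have Kt: "test_fun Om h" "test_fun UNIV h" if "h : K n" for h n
  using that unfolding K_def by (auto intro: mids_test psit)
 have Kmono: "h : K m ==> h : K n" if "n <= m" for h n m
  unfolding K_def by (rule mids_mono) (use that in auto)
 define d where "d = (%n. Inf ((%h. en (grad h)) ` K n))"
 have ne: "(%h. en (grad h)) ` K n ~= {}" for n
 proof -
  have "psi n : K n" unfolding K_def by (intro mids.base imageI) simp
  then show ?thesis by blast
 qed
 have bb: "bdd_below ((%h. en (grad h)) ` K n)" for n by (rule bdd_belowI[of _ 0]) auto
 have dle: "d n <= en (grad h)" if "h : K n" for h n unfolding d_def by (rule cInf_lower[OF imageI[OF that] bb])
 have dmono: "d n <= d m" if "n <= m" for n m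
  unfolding d_def using that by (intro cInf_superset_mono[OF ne bb] image_mono) (auto intro: Kmono)
 have dC: "d n <= C'" for n
 proof -
  have "psi n : K n" unfolding K_def by (intro mids.base imageI) simp
  then show ?thesis using dle KC order_trans by blast
 qed
 have "\<exists>h. h : K n & en (grad h) < d n + inverse (real (Suc n))" for n
 proof -
  have "Inf ((%h. en (grad h)) ` K n) < d n + inverse (real (Suc n))" by (simp add: d_def)
  from cInf_lessD[OF ne this] show ?thesis by blast
 qed
 then obtain h where h: "!!n. h n : K n" "!!n. en (grad (h n)) < d n + inverse (real (Suc n))" by metis
 note ht = Kt(1)[OF h(1)] Kt(2)[OF h(1)]
 have mh: "grad (h n) : bmeas lborel" "h n : bmeas lborel" for n using test_measurable[OF ht(2)] by simp_all
 have hi: "integrable lborel (%x. (norm (grad (h n) x))^2)" for n by (rule test_grad_integrable[OF ht(2)])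
 have "incseq d" using dmono by (simp add: incseq_def)
 then obtain L where L: "d ~~> L" "!!n. d n <= L" using incseq_convergent[of d C'] dC by blast
 \<comment> \<open>The midpoint of h m and h n lies in K n, so its energy is at least d n. As both
   energies are close to the limit L, the parallelogram law makes the gradients a Cauchy
   sequence.\<close>
 have par: "en (%x. grad (h m) x - grad (h n) x) <= 2 * (L - d n) + 2 * inverse (real (Suc n)) + 2 * inverse (real (Suc m))" if nm: "n <= m" for n m
 proof -
  have "(%x. 1/2 * h m x + 1/2 * h n x) : K n"
   using h(1)[of n] Kmono[OF nm h(1)[of m]] unfolding K_def by (rule mids.mid[rotated])
  from dle[OF this] have "d n <= en (%x. (1/2) *R (grad (h m) x + grad (h n) x))" unfolding grad_mid[OF ht(2) ht(2)] .
  then have c: "d n <= en (%x. (1/2) *R (grad (h m) x + grad (h n) x))" .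
  have gen: "E \<le> 2 * (l - dlt) + 2 * i + 2 * j" if "E = 2 * a + 2 * b - 4 * c" "dlt \<le> c" "b < dlt + i" "a < dlt' + j" "dlt' \<le> l"
   for E a b c dlt dlt' i j l :: real using that by (simp add: right_diff_distrib)
  show ?thesis by (rule gen[OF en_parallelogram[OF mh(1) mh(1) hi hi] c h(2) h(2) L(2)])
 qed
 have "\<exists>M. \<forall>m\<ge>M. \<forall>n\<ge>M. (\<integral>\<^sup>+x. ennreal ((norm (grad (h m) x - grad (h n) x))\<^sup>2) \<partial>lborel) \<le> ennreal e" if e: "e > 0" for e
 proof -
  have "(%n. 2 * (L - d n) + 4 * inverse (real (Suc n))) ~~> 2 * (L - L) + 4 * 0"
   by (intro tendsto_intros L(1) LIMSEQ_inverse_real_of_nat)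
  then have "\<forall>\<^sub>F n in sequentially. 2 * (L - d n) + 4 * inverse (real (Suc n)) < e" using e by (intro order_tendstoD(2)) auto
  then obtain M where M: "!!n. n >= M ==> 2 * (L - d n) + 4 * inverse (real (Suc n)) < e" by (auto simp: eventually_sequentially)
  have le: "en (%x. grad (h m) x - grad (h n) x) <= e" if "n >= M" "n <= m" for m n
  proof -
   have "inverse (real (Suc m)) <= inverse (real (Suc n))" using that by (intro le_imp_inverse_le) auto
   then show ?thesis using par[OF that(2)] M[OF that(1)] by linarith
  qed
  have "en (%x. grad (h m) x - grad (h n) x) <= e" if "m >= M" "n >= M" for m n
  proof (cases "n <= m")
   case True then show ?thesis using le that by blast
  next
   case False
   then have "en (%x. grad (h n) x - grad (h m) x) <= e" using le[OF that(1), of n] by simp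
   then show ?thesis by (simp only: norm_minus_commute)
  qed
  then have "(\<integral>\<^sup>+x. ennreal ((norm (grad (h m) x - grad (h n) x))\<^sup>2) \<partial>lborel) \<le> ennreal e" if "m \<ge> M" "n \<ge> M" for m n
   by (subst nn_integral_eq_integral[OF L2_inner(3)[OF mh(1) mh(1) hi hi]]) (use that in \<open>auto intro: ennreal_leI\<close>)
  then show ?thesis by blast
 qed
 then obtain s' G where "strict_mono (s' :: nat \<Rightarrow> nat)" and G: "G \<in> borel_measurable lborel" and "AE x in lborel. (\<lambda>k. grad (h (s' k)) x) \<longlonglongrightarrow> G x"
  and Gl: "\<And>e. e > 0 \<Longrightarrow> \<exists>M. \<forall>n\<ge>M. (\<integral>\<^sup>+x. ennreal ((norm (grad (h n) x - G x))\<^sup>2) \<partial>lborel) \<le> ennreal e"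
  by (rule Riesz_Fischer_L2[OF mh(1)]) (assumption | rule that)+
 have fin1: "\<exists>n. (NN x. ennreal ((norm (grad (h n) x - G x))^2)) <= ennreal 1" using Gl[of 1] by auto
 then obtain n1 where n1: "(NN x. ennreal ((norm (grad (h n1) x - G x))^2)) <= ennreal 1" by blast
 have "integrable lborel (%x. (norm (grad (h n1) x - G x))^2)"
  using n1 G mh(1) by (intro integrableI_nonneg) (auto intro: le_less_trans)
 from L2_inner(3)[OF mh(1)[of n1] _ hi[of n1] this] have Gi: "integrable lborel (%x. (norm (G x))^2)" using G mh(1) by simp
 note hGi = L2_inner(3)[OF mh(1) G hi Gi]
 have hG: "(%n. en (%x. grad (h n) x - G x)) ~~> 0"
 proof (rule LIMSEQ_I)
  fix e :: real assume e: "e > 0"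
  obtain M where M: "\<And>n. n \<ge> M \<Longrightarrow> (\<integral>\<^sup>+x. ennreal ((norm (grad (h n) x - G x))\<^sup>2) \<partial>lborel) \<le> ennreal (e / 2)" using Gl[of "e / 2"] e by auto
  have "en (\<lambda>x. grad (h n) x - G x) \<le> e / 2" if "n \<ge> M" for n
   using M[OF that] e by (subst (asm) nn_integral_eq_integral[OF hGi]) auto
  then have "norm (en (\<lambda>x. grad (h n) x - G x) - 0) < e" if "n \<ge> M" for n using e that by fastforce
  then show "\<exists>no. \<forall>n\<ge>no. norm (en (\<lambda>x. grad (h n) x - G x) - 0) < e" by blast
 qed
 \<comment> \<open>Each h n combines only members of the tail from n on, so it has the same
   pointwise limit; this makes G the gradient of v.\<close>
 have hv: "AE x in lborel. (%n. h n x) ~~> v x"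
  using psiv
 proof eventually_elim
  case (elim x)
  show ?case
  proof (rule LIMSEQ_I)
   fix e :: real assume e: "e > 0"
   obtain M where M: "\<And>n. n \<ge> M \<Longrightarrow> norm (psi n x - v x) < e / 2" using LIMSEQ_D[OF elim, of "e / 2"] e by auto
   have "\<bar>h n x - v x\<bar> \<le> e / 2" if "n \<ge> M" for n
    using h(1)[of n] unfolding K_def by (rule mids_close) (use M that in \<open>force intro: less_imp_le\<close>)
   then show "\<exists>no. \<forall>n\<ge>no. norm (h n x - v x) < e" using e by (intro exI[of _ M]) fastforce
  qed
 qed
 have vD: "D12 Om v G" unfolding D12_def using s1(2) G Gi ht(1) hv hG by (intro conjI exI[of _ h] allI) simp_all
 have weak: "(%n. LBINT x. g (s n) x \<bullet> grad xi x) ~~> (LBINT x. G x \<bullet> grad xi x)" if xi: "test_fun UNIV xi" for xi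
 proof -
  have mxi: "grad xi : bmeas lborel" using test_measurable(2)[OF xi] by simp
  have psiC: "en (grad (psi n)) <= C'" for n unfolding psi_def by (rule C')
  have 1: "(%n. LBINT x. grad (psi n) x \<bullet> grad xi x) ~~> (LBINT x. G x \<bullet> grad xi x)"
   unfolding D12_ibp[OF N vD xi] by (rule ibp_tendsto[OF N psit(2) psiC s1(2) psiv xi])
  have ds: "(%n. en (%x. grad (psi n) x - g (s n) x)) ~~> 0"
   using LIMSEQ_subseq_LIMSEQ[OF dlim s] by (simp add: o_def psi_def)
  have "(%n. sqrt (en (%x. grad (psi n) x - g (s n) x)) * sqrt (en (grad xi))) ~~> sqrt 0 * sqrt (en (grad xi))" by (intro tendsto_intros ds)
  then have l0: "(%n. sqrt (en (%x. grad (psi n) x - g (s n) x)) * sqrt (en (grad xi))) ~~> 0" by simp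
  have mpsi: "grad (psi n) : bmeas lborel" for n unfolding psi_def by (rule mph)
  have "(%n. LBINT x. (grad (psi n) x - g (s n) x) \<bullet> grad xi x) ~~> 0"
  proof (rule Lim_null_comparison[OF _ l0], rule always_eventually, rule allI, unfold real_norm_def, rule L2_inner(4))
   fix n
   show "(%x. grad (psi n) x - g (s n) x) : bmeas lborel" using mpsi mg by simp
   show "integrable lborel (%x. (norm (grad (psi n) x - g (s n) x))^2)"
    by (rule L2_inner(3)[OF mpsi mg test_grad_integrable[OF psit(2)] gi])
  qed (fact mxi, rule test_grad_integrable[OF xi])
  moreover have "(LBINT x. (grad (psi n) x - g (s n) x) \<bullet> grad xi x) = (LBINT x. grad (psi n) x \<bullet> grad xi x) - (LBINT x. g (s n) x \<bullet> grad xi x)" for n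
   unfolding inner_diff_left
   by (intro L1_integral_diff L2_inner(1)[OF mpsi mxi test_grad_integrable[OF psit(2)] test_grad_integrable[OF xi]] L2_inner(1)[OF mg mxi gi test_grad_integrable[OF xi]])
  ultimately have 2: "(%n. (LBINT x. grad (psi n) x \<bullet> grad xi x) - (LBINT x. g (s n) x \<bullet> grad xi x)) ~~> 0" by simp
  from tendsto_diff[OF 1 2] show ?thesis by simp
 qed
 have "(%n. LBINT x. g (s n) x \<bullet> k x) ~~> (LBINT x. G x \<bullet> k x)" if "D12 UNIV w k" for w k
  by (rule weak_extend[OF _ _ gi Gi C weak that]) (use D12_meas(2)[OF D] G in auto)
 with s vD uv show thesis by (rule that)
qed

text \<open>The Hilbert space counterpart of the Brezis-Lieb splitting: expand the square and pass
  to the limit in the mixed term.\<close>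

lemma weak_energy:
 fixes g :: "nat => real^'n => real^'n"
 assumes m: "!!n. g n : bmeas lborel" "h : bmeas lborel"
  and i: "!!n. integrable lborel (%x. (norm (g n x))^2)" "integrable lborel (%x. (norm (h x))^2)"
  and w: "(%n. LBINT x. g n x \<bullet> h x) ~~> (LBINT x. h x \<bullet> h x)" and l: "(%n. en (g n)) ~~> A"
 shows "(%n. en (%x. g n x - h x)) ~~> A - en h" "en h <= A"
proof -
 have "(%n. en (g n) - 2 * (LBINT x. g n x \<bullet> h x) + en h) ~~> A - 2 * (LBINT x. h x \<bullet> h x) + en h"
  by (intro tendsto_intros l w)
 moreover have "(LBINT x. h x \<bullet> h x) = en h" by (simp add: power2_norm_eq_inner)
 ultimately show 1: "(%n. en (%x. g n x - h x)) ~~> A - en h"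
  unfolding L2_norm_diff_eq[OF m(1) m(2) i(1) i(2)] by simp
 have "0 <= A - en h" by (rule LIMSEQ_le_const[OF 1]) simp
 then show "en h <= A" by simp
qed

section \<open>Extremal functions of the Sobolev inequality\<close>

lemma Holder_two:
 fixes f h :: "'a => real"
 assumes [measurable]: "f : bmeas M" "h : bmeas M" and i: "integrable M f" "integrable M h"
  and nn: "!!x. f x >= 0" "!!x. h x >= 0" and aph: "0 < aph" "aph < 1"
 shows "integrable M (%x. f x powr aph * h x powr (1 - aph))"
  "(\<integral>x. f x powr aph * h x powr (1 - aph) \<partial>M) <= (\<integral>x. f x \<partial>M) powr aph * (\<integral>x. h x \<partial>M) powr (1 - aph)"
proof -
 have Y: "a powr aph * b powr (1 - aph) <= aph * a + (1 - aph) * b" if "a >= 0" "b >= 0" for a b :: real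
 proof (cases "a = 0 \<or> b = 0")
  case False
  then show ?thesis using that aph by (intro Youngs_inequality_0) auto
 qed (use that aph in auto)
 show ii: "integrable M (%x. f x powr aph * h x powr (1 - aph))"
 proof (rule L1_integrable_bound)
  show "integrable M (%x. aph * f x + (1 - aph) * h x)" using i by simp
  have "abs (f x powr aph * h x powr (1 - aph)) <= abs (aph * f x + (1 - aph) * h x)" for x
   using Y[OF nn, of x x] by simp
  then show "AE x in M. norm (f x powr aph * h x powr (1 - aph)) <= norm (aph * f x + (1 - aph) * h x)" by simp
 qed measurable
 define a b where "a = (\<integral>x. f x \<partial>M)" and "b = (\<integral>x. h x \<partial>M)"
 have ab: "a >= 0" "b >= 0" using nn by (auto simp: a_def b_def intro!: integral_nonneg_AE)
 show "(\<integral>x. f x powr aph * h x powr (1 - aph) \<partial>M) <= a powr aph * b powr (1 - aph)"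
 proof (cases "a = 0 \<or> b = 0")
  case True
  then have "AE x in M. f x = 0 \<or> h x = 0"
   using integral_nonneg_eq_0_iff_AE[OF i(1)] integral_nonneg_eq_0_iff_AE[OF i(2)] nn by (auto simp: a_def b_def)
  then have "AE x in M. f x powr aph * h x powr (1 - aph) = 0" by eventually_elim auto
  then have "(\<integral>x. f x powr aph * h x powr (1 - aph) \<partial>M) = 0" by (rule integral_eq_zero_AE)
  then show ?thesis by simp
 next
  case False
  then have p: "a > 0" "b > 0" using ab by auto
  have le: "f x powr aph * h x powr (1 - aph) <= (a powr aph * b powr (1 - aph)) * (aph / a * f x + (1 - aph) / b * h x)" for x
  proof -
   have "f x powr aph * h x powr (1 - aph) = (a powr aph * b powr (1 - aph)) * ((f x / a) powr aph * (h x / b) powr (1 - aph))"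
    using p nn by (simp add: powr_divide)
   also have "... <= (a powr aph * b powr (1 - aph)) * (aph * (f x / a) + (1 - aph) * (h x / b))"
    using p nn by (intro mult_left_mono Y) auto
   finally show ?thesis by simp
  qed
  have "(\<integral>x. f x powr aph * h x powr (1 - aph) \<partial>M) <= (\<integral>x. (a powr aph * b powr (1 - aph)) * (aph / a * f x + (1 - aph) / b * h x) \<partial>M)"
   using i by (intro integral_mono ii le) simp
  also have "... = (a powr aph * b powr (1 - aph)) * (aph / a * a + (1 - aph) / b * b)"
   using i by (simp add: a_def b_def)
  finally show ?thesis using p by simp
 qed
qed

text \<open>For a >= 1 this is Young's inequality for (1+ax)^(1/a); for a <= 0 it follows from
  ln(1+x) <= x and exp y >= 1+y. Both take the place of Taylor expansions below.\<close>

lemma Bernoulli_powr: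
 fixes x a :: real
 shows "a >= 1 ==> x >= -1 ==> 1 + a * x <= (1 + x) powr a" "a <= 0 ==> x > -1 ==> 1 + a * x <= (1 + x) powr a"
proof -
 assume a: "a >= 1" "x >= -1"
 show "1 + a * x <= (1 + x) powr a"
 proof (cases "1 + a * x > 0")
  case True
  have "(1 + a * x) powr (1 / a) * 1 powr (1 - 1 / a) <= 1 / a * (1 + a * x) + (1 - 1 / a) * 1"
   using a True by (intro Youngs_inequality_0) auto
  also have "... = 1 + x" using a by (simp add: field_simps)
  finally have "((1 + a * x) powr (1 / a)) powr a <= (1 + x) powr a" using a by (intro powr_mono2) auto
  then show ?thesis using True a by (simp add: powr_powr)
 qed (auto intro: order_trans[OF _ powr_ge_zero])
next
 assume a: "a <= 0" "x > -1"
 have "a * x <= a * ln (1 + x)" using a ln_add_one_self_le_self2[of x] by (intro mult_left_mono_neg) auto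
 then have "1 + a * x <= exp (a * ln (1 + x))" using exp_ge_add_one_self[of "a * ln (1 + x)"] by linarith
 then show "1 + a * x <= (1 + x) powr a" using a by (simp add: powr_def)
qed

text \<open>The numerical core of an approximate Euler-Lagrange equation. An almost minimizer with
  energy excess t^2 is perturbed by a step of size t; the first-order terms of size t must then
  balance up to order t^2, and dividing by t leaves an error of order t.\<close>

lemma quasi_EL_num:
 fixes S r t A M K B P :: real
 assumes S: "S > 0" and r: "r > 2" and tau: "abs tau = t" "t > 0" and M: "0 <= M" "M <= 1" and A: "abs A <= B" and K: "0 <= K" "K <= B"
  and P: "1 + r * tau * M <= P" "S * P powr (2 / r) <= S + t^2 + 2 * tau * A + tau^2 * K"
  and small: "t <= 1" "t * r <= 1 / 2" "t * (1 + 3 * B) * r <= S"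
 shows "tau * (S * M - A) <= t^2 * (1 + B + r * (1 + 3 * B)) / 2"
proof -
 \<comment> \<open>The relative excess of the perturbed energy over S, so that P^(2/r) <= 1 +
   x.\<close>
 define x where "x = (t^2 + 2 * tau * A + tau^2 * K) / S"
 have tau2: "tau^2 = t^2" using tau by (metis power2_abs)
 have B0: "B >= 0" using K by simp
 have tt: "t^2 <= t * 1" unfolding power2_eq_square using small tau by (intro mult_left_mono) auto
 have Q: "abs (t^2 + 2 * tau * A + tau^2 * K) <= t * (1 + 3 * B)"
 proof -
  have "abs (2 * tau * A) <= 2 * t * B" unfolding abs_mult using tau A by (intro mult_mono) auto
  moreover have "0 <= t^2 * K" "t^2 * K <= t * B" using tt K tau by (auto intro!: mult_mono)
  ultimately have "abs (t^2 + 2 * tau * A + t^2 * K) <= t + 2 * t * B + t * B" using tt zero_le_power2[of t] by linarith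
  then show ?thesis unfolding tau2 by (simp add: algebra_simps)
 qed
 have x: "abs x * S <= t * (1 + 3 * B)" using Q S by (simp add: x_def abs_divide)
 have rx: "r * abs x <= 1"
 proof -
  have "r * abs x * S <= r * (t * (1 + 3 * B))" using mult_left_mono[OF x, of r] r by (simp add: mult.assoc)
  also have "... <= 1 * S" using small(3) by (simp add: mult_ac)
  finally show ?thesis using S by (simp only: mult_le_cancel_right_pos)
 qed
 have x1: "abs x < 1 / 2"
 proof -
  have "2 * abs x <= r * abs x" using r by (intro mult_right_mono) auto
  then have "abs x <= 1/2" using rx by linarith
  moreover have "abs x ~= 1/2"
  proof
   assume e: "abs x = 1/2"
   from rx have "r * (1/2) <= 1" unfolding e .
   with r show False by simp
  qed
  ultimately show ?thesis by linarith
 qed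
 have rM: "abs (r * tau * M) <= 1 / 2"
 proof -
  have "abs (r * tau * M) = r * t * M" using r tau M by (simp add: abs_mult)
  also have "... <= r * t * 1" using r tau M by (intro mult_left_mono) auto
  finally show ?thesis using small(2) by (simp add: mult.commute)
 qed
 have P0: "P > 0" using P(1) rM by linarith
 have "S * P powr (2 / r) <= S * (1 + x)" 
 proof -
  have "S * x = t^2 + 2 * tau * A + tau^2 * K" using S by (simp add: x_def)
  then show ?thesis using P(2) by (simp add: distrib_left)
 qed
 then have "P powr (2 / r) <= 1 + x" using S by simp
 then have "(P powr (2 / r)) powr (r / 2) <= (1 + x) powr (r / 2)" using r by (intro powr_mono2) auto
 then have "P <= (1 + x) powr (r / 2)" using P0 r by (simp add: powr_powr)
 then have 1: "1 + r * tau * M <= (1 + x) powr (r / 2)" using P(1) by simp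
 \<comment> \<open>Multiplying the bound (1+x)^(r/2) by this lower bound for (1+x)^(-r/2) gives 1 on
   the right, and an inequality linear in x remains.\<close>
 have "1 + (- (r / 2)) * x <= (1 + x) powr (- (r / 2))" using r x1 by (intro Bernoulli_powr(2)) auto
 then have 2: "1 - r / 2 * x <= (1 + x) powr (- (r / 2))" by simp
 have nn: "0 <= 1 - r / 2 * x" "0 <= 1 + r * tau * M"
 proof -
  have "r * x <= r * abs x" using r by (intro mult_left_mono) auto
  then show "0 <= 1 - r / 2 * x" using rx by simp
  show "0 <= 1 + r * tau * M" using rM by linarith
 qed
 have "(1 + r * tau * M) * (1 - r / 2 * x) <= (1 + x) powr (r / 2) * (1 + x) powr (- (r / 2))"
  using 1 2 nn by (intro mult_mono) auto
 also have "... = 1" using x1 by (simp add: powr_add[symmetric])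
 finally have "r * tau * M <= r / 2 * x * (1 + r * tau * M)" by (simp add: algebra_simps)
 then have "r * (2 * tau * M) <= r * (x * (1 + r * tau * M))" by (simp add: algebra_simps)
 then have "2 * tau * M <= x * (1 + r * tau * M)" using r by simp
 then have "S * (2 * tau * M) <= S * x * (1 + r * tau * M)" using S by (simp add: mult.assoc)
 also have "S * x = t^2 + 2 * tau * A + t^2 * K" using S by (simp add: x_def tau2)
 finally have "2 * (tau * (S * M - A)) <= t^2 + t^2 * K + (t^2 + 2 * tau * A + t^2 * K) * (r * tau * M)" by (simp add: algebra_simps)
 also have "(t^2 + 2 * tau * A + t^2 * K) * (r * tau * M) <= (t * (1 + 3 * B)) * (r * t)"
 proof -
  have "(t^2 + 2 * tau * A + t^2 * K) * (r * tau * M) <= abs (t^2 + 2 * tau * A + t^2 * K) * abs (r * tau * M)" by (metis abs_ge_self abs_mult)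
  also have "... <= (t * (1 + 3 * B)) * (r * t)"
  proof (intro mult_mono)
   show "abs (t^2 + 2 * tau * A + t^2 * K) <= t * (1 + 3 * B)" using Q by (simp add: tau2)
   have "abs (r * tau * M) = r * t * M" using r tau M by (simp add: abs_mult)
   also have "... <= r * t * 1" using r tau M by (intro mult_left_mono) auto
   finally show "abs (r * tau * M) <= r * t" by simp
  qed (use tau B0 in auto)
  finally show ?thesis .
 qed
 also have "t^2 + t^2 * K <= t^2 + t^2 * B" using K by (intro add_left_mono mult_left_mono) auto
 finally have "2 * (tau * (S * M - A)) <= t^2 * (1 + B + r * (1 + 3 * B))" by (simp add: algebra_simps power2_eq_square)
 then show ?thesis by simp
qed

lemma indicator_powr_integrable:
 fixes u :: "real^'n => real"
 assumes "u : bmeas borel" "A : sets borel" "integrable lborel (%x. abs (u x) powr r)"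
 shows "integrable lborel (%x. indicator A x * abs (u x) powr r)"
 using integrable_mult_indicator[of A lborel "%x. abs (u x) powr r"] assms by simp

text \<open>Dilations and translations are used to fix the concentration scale of a minimizing sequence.\<close>
lemma concentration_normalize:
 fixes ph :: "real^'n => real"
 assumes N: "CARD('n) >= 3" and t: "test_fun UNIV ph" and p1: "pw (crit TYPE('n)) ph = 1"
 shows "\<exists>(u :: real^'n => real) g. D12 UNIV u g & pw (crit TYPE('n)) u = 1 & en g = en (grad ph) &
  (LBINT x. indicator (cball 0 2) x * abs (u x) powr crit TYPE('n)) >= 1/2 &
  (\<forall>y. (LBINT x. indicator (cball y (3/4)) x * abs (u x) powr crit TYPE('n)) <= 1/2)"
proof -
 let ?r = "crit TYPE('n)" and ?N = "real CARD('n)"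
 have r2: "?r > 2" by (rule crit_gt_2[OF N])
 have [measurable]: "ph : bmeas borel" by (rule test_measurable[OF t])
 have [measurable]: "cball a b : sets borel" for a :: "real^'n" and b by simp
 have pi: "integrable lborel (%x. abs (ph x) powr ?r)" using r2 by (intro test_powr_integrable t) simp
 obtain K where K: "compact K" "!!x. x \<notin> K ==> ph x = 0" using test_fun_obtain[OF t] by metis
 obtain B where B: "B > 0" "!!x. norm (ph x) <= B"
  by (rule bounded_compact_support[OF has_gradD(1)[OF test_fun_grad[OF t]] K]) (assumption | rule that)+
 define m where "m = (%y rh. LBINT x. indicator (cball y rh) x * abs (ph x) powr ?r)"
 have mi: "integrable lborel (%x. indicator (cball y rh) x * abs (ph x) powr ?r)" for y rh
  by (intro indicator_powr_integrable pi) auto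
 have mmono: "m y rh <= m y rh'" if "rh <= rh'" for y rh rh'
  unfolding m_def using that by (intro integral_mono mi) (auto simp: indicator_def)
 \<comment> \<open>The radii of balls that capture at least half of the mass.\<close>
 define R where "R = {rh. rh > 0 & (\<exists>y. m y rh >= 1/2)}"
 have Rne: "R ~= {}"
 proof -
  obtain b where b: "b > 0" "!!x. x : K ==> norm x <= b" using compact_imp_bounded[OF K(1)] bounded_pos by blast
  have "m 0 b = pw ?r ph" unfolding m_def
   by (intro L1_integral_cong refl) (use b(2) K(2) r2 in \<open>force simp: indicator_def\<close>)
  then have "b : R" using p1 b unfolding R_def by (auto intro!: exI[of _ 0])
  then show ?thesis by blast
 qed
 define V where "V = B powr ?r * unit_ball_vol ?N"
 have V0: "V > 0" using B by (simp add: V_def unit_ball_vol_pos)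
 have mV: "m y rh <= V * rh ^ CARD('n)" if "rh >= 0" for y rh
 proof -
  have "m y rh <= (LBINT x. B powr ?r * indicator (cball y rh) x)"
   unfolding m_def
  proof (intro integral_mono mi)
   show "integrable lborel (%x. B powr ?r * indicat_real (cball y rh) x)"
    by (intro integrable_mult_right integrable_real_indicator) (use emeasure_lborel_cball_finite[of y rh] in simp_all)
   show "indicator (cball y rh) x * abs (ph x) powr ?r <= B powr ?r * indicator (cball y rh) x" for x
    using B(2)[of x] r2 by (auto simp: indicator_def intro!: powr_mono2)
  qed
  also have "... = B powr ?r * measure lborel (cball y rh)" by simp
  also have "measure lborel (cball y rh) = unit_ball_vol ?N * rh ^ CARD('n)"
   using that content_cball[of rh y] by simp
  finally show ?thesis by (simp add: V_def)
 qed
 \<comment> \<open>Below this radius a ball has mass at most V rh^N <= V rh <= 1/4, so no radius in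
   R is smaller and the infimum is positive.\<close>
 define rh1 where "rh1 = min 1 (1 / (4 * V))"
 have rh1: "rh1 > 0" using V0 by (simp add: rh1_def)
 have Rlb: "rh1 <= rh" if "rh : R" for rh
 proof (rule ccontr)
  assume "\<not> rh1 <= rh"
  then have l: "0 < rh" "rh < rh1" using that by (auto simp: R_def)
  have "rh ^ CARD('n) <= rh ^ 1" using l N by (intro power_decreasing) (auto simp: rh1_def)
  then have "V * rh ^ CARD('n) <= V * rh1" using l V0 by (intro mult_left_mono) auto
  also have "... <= V * (1 / (4 * V))" using V0 by (intro mult_left_mono) (auto simp: rh1_def)
  finally have "V * rh ^ CARD('n) <= 1/4" using V0 by simp
  moreover obtain y where "m y rh >= 1/2" using \<open>rh : R\<close> unfolding R_def by blast
  ultimately show False using mV[of rh y] l by linarith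
 qed
 define rh0 where "rh0 = Inf R"
 have rh0: "rh0 > 0"
 proof -
  have "rh1 <= rh0" unfolding rh0_def by (rule cInf_greatest[OF Rne Rlb])
  then show ?thesis using rh1 by linarith
 qed
 \<comment> \<open>The infimum need not be attained. The factor 2 gives a ball with half of the
   mass, the factor 3/4 lies strictly below the infimum; after dilation by rh0 these become the
   radii 2 and 3/4.\<close>
 have "Inf R < 2 * rh0" using rh0 by (simp add: rh0_def)
 then obtain rh where rh: "rh : R" "rh < 2 * rh0" using cInf_lessD[OF Rne] by blast
 obtain y0 where "m y0 rh >= 1/2" using rh(1) unfolding R_def by blast
 then have big: "m y0 (2 * rh0) >= 1/2" using mmono[of rh "2 * rh0" y0] rh(2) by linarith
 have small: "m y (3/4 * rh0) <= 1/2" for y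
 proof (rule ccontr)
  assume "\<not> m y (3/4 * rh0) <= 1/2"
  then have "3/4 * rh0 : R" using rh0 by (auto simp: R_def intro!: exI[of _ y])
  then have "rh0 <= 3/4 * rh0" unfolding rh0_def by (rule cInf_lower) (rule bdd_belowI[OF Rlb])
  then show False using rh0 by simp
 qed
 \<comment> \<open>The amplitude for which dilation preserves both the critical integral and the
   energy.\<close>
 define k where "k = rh0 powr ((?N - 2) / 2)"
 have k0: "k > 0" using rh0 by (simp add: k_def)
 have N2: "?N - 2 > 0" using N by simp
 have kr: "k powr ?r = rh0 ^ CARD('n)"
 proof -
  have "(?N - 2) / 2 * ?r = ?N" using N2 by (simp add: crit_def field_simps)
  then show ?thesis using rh0 by (simp add: k_def powr_powr powr_realpow)
 qed
 have k2: "(k * rh0)^2 = rh0 ^ CARD('n)"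
 proof -
  have "k * rh0 = rh0 powr (?N / 2)" using rh0 powr_add[of rh0 "(?N - 2) / 2" 1] by (simp add: k_def diff_divide_distrib)
  then have "(k * rh0)^2 = rh0 powr (?N / 2 + ?N / 2)" unfolding power2_eq_square by (simp only: powr_add)
  then show ?thesis using rh0 by (simp add: powr_realpow)
 qed
 define u where "u = (%x. k * ph (rh0 *R x + y0))"
 define g where "g = (%x. (k * rh0) *R grad ph (rh0 *R x + y0))"
 have D: "D12 UNIV u g" unfolding u_def g_def by (rule D12_affine(1)[OF D12_test[OF t] rh0]) simp
 have e: "en g = en (grad ph)"
 proof -
  have "en g = (k * rh0)^2 * en (grad ph) / rh0 ^ CARD('n)" unfolding g_def by (rule D12_affine(2)[OF D12_test[OF t] rh0, where Om'=UNIV]) simp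
  then show ?thesis using rh0 by (simp add: k2)
 qed
 have ur: "abs (u x) powr ?r = rh0 ^ CARD('n) * abs (ph (rh0 *R x + y0)) powr ?r" for x
  using k0 by (simp add: u_def abs_mult powr_mult kr)
 have pu: "pw ?r u = 1"
  unfolding ur using integral_affine(2)[of "%x. abs (ph x) powr ?r" rh0 y0] rh0 p1 by simp
 have mu: "(LBINT x. indicator (cball y sig) x * abs (u x) powr ?r) = m (rh0 *R y + y0) (sig * rh0)" for y sig
 proof -
  have ind: "indicator (cball y sig) x = (indicator (cball (rh0 *R y + y0) (sig * rh0)) (rh0 *R x + y0) :: real)" for x
  proof -
   have "dist (rh0 *R y + y0) (rh0 *R x + y0) = rh0 * dist y x"
    using rh0 by (simp add: dist_norm flip: scaleR_diff_right)
   then show ?thesis using rh0 by (simp add: indicator_def mult.commute)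
  qed
  have "(LBINT x. indicator (cball y sig) x * abs (u x) powr ?r) =
   (LBINT x. rh0 ^ CARD('n) * (%z. indicator (cball (rh0 *R y + y0) (sig * rh0)) z * abs (ph z) powr ?r) (rh0 *R x + y0))"
   unfolding ur ind by (intro L1_integral_cong refl) simp
  also have "... = rh0 ^ CARD('n) * (LBINT x. (%z. indicator (cball (rh0 *R y + y0) (sig * rh0)) z * abs (ph z) powr ?r) (rh0 *R x + y0))"
   by (rule integral_mult_right_zero)
  also have "... = m (rh0 *R y + y0) (sig * rh0)"
  proof -
   have "(%z. indicat_real (cball (rh0 *R y + y0) (sig * rh0)) z * abs (ph z) powr ?r) : bmeas borel"
    by measurable
   from integral_affine(2)[OF this, of rh0 y0] show ?thesis using rh0 by (simp add: m_def)
  qed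
  finally show ?thesis .
 qed
 have "(LBINT x. indicator (cball 0 2) x * abs (u x) powr ?r) >= 1/2" unfolding mu using big by simp
 moreover have "\<forall>y. (LBINT x. indicator (cball y (3/4)) x * abs (u x) powr ?r) <= 1/2" unfolding mu using small by simp
 ultimately show ?thesis using D pu e by (intro exI[of _ u] exI[of _ g] conjI)
qed

lemma cutoff_bounds:
 fixes et :: "real^'n => real"
 assumes t: "test_fun UNIV et"
 obtains B where "B > 0" "!!x. abs (et x) <= B" "!!x. (norm (grad et x))^2 * (1 + (norm x)^2) <= B^2"
proof -
 obtain K where K: "compact K" "!!x. x \<notin> K ==> et x = 0" "!!x. x \<notin> K ==> grad et x = 0" using test_fun_obtain[OF t] by metis
 note g = test_fun_grad[OF t]
 obtain B1 where B1: "B1 > 0" "!!x. norm (et x) <= B1"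
  by (rule bounded_compact_support[OF has_gradD(1)[OF g] K(1,2)]) (assumption | rule that)+
 have c: "continuous_on UNIV (%x. (norm (grad et x))^2 * (1 + (norm x)^2))" by (intro continuous_intros has_gradD(2)[OF g])
 obtain B2 where B2: "B2 > 0" "!!x. norm ((norm (grad et x))^2 * (1 + (norm x)^2)) <= B2"
  by (rule bounded_compact_support[OF c K(1)]) (use K(3) that in auto)
 define B where "B = B1 + B2 + 1"
 have "B2 <= B * 1" using B1 B2 by (simp add: B_def)
 also have "... <= B * B" using B1 B2 by (intro mult_left_mono) (auto simp: B_def)
 finally have "B2 <= B^2" by (simp add: power2_eq_square)
 then have b: "(norm (grad et x))^2 * (1 + (norm x)^2) <= B^2" for x
  using B2(2)[of x] abs_ge_self[of "(norm (grad et x))^2 * (1 + (norm x)^2)"] unfolding real_norm_def by linarith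
 show thesis
 proof (rule that[OF _ _ b])
  show "B > 0" using B1 B2 by (simp add: B_def)
  show "abs (et x) <= B" for x using B1(2)[of x] B1(1) B2(1) unfolding B_def real_norm_def by linarith
 qed
qed

text \<open>The competitor is u - t et^2 u. Bernoulli's inequality bounds its critical integral
  below pointwise by 1 - r t et^2, so one step in this direction gives the needed one-sided estimate
  without differentiating the integral.\<close>

lemma Sobolev_quasi_EL:
 fixes u :: "real^'n => real"
 assumes N: "CARD('n) >= 3" and u: "D12 UNIV u g" and p1: "pw (crit TYPE('n)) u = 1"
  and d: "en g <= Sob TYPE('n) + t^2" and t: "t > 0" and et: "test_fun UNIV et" "!!x. 0 <= et x" "!!x. et x <= 1"
  and h: "h = (%x. (et x * et x) *R g x + u x *R (et x *R grad et x + et x *R grad et x))"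
  and hD: "D12 UNIV (%x. (et x * et x) * u x) h"
  and B: "abs (LBINT x. g x \<bullet> h x) <= B" "en h <= B"
  and small: "t <= 1" "t * crit TYPE('n) <= 1 / 2" "t * (1 + 3 * B) * crit TYPE('n) <= Sob TYPE('n)"
 shows "(LBINT x. g x \<bullet> h x) <= Sob TYPE('n) * (LBINT x. (et x)^2 * abs (u x) powr crit TYPE('n)) + t * (1 + B + crit TYPE('n) * (1 + 3 * B)) / 2"
proof -
 let ?r = "crit TYPE('n)" and ?S = "Sob TYPE('n)"
 define M A where "M = (LBINT x. (et x)^2 * abs (u x) powr ?r)" and "A = (LBINT x. g x \<bullet> h x)"
 have r2: "?r > 2" by (rule crit_gt_2[OF N])
 note [measurable] = D12_meas[OF u] test_measurable[OF et(1)]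
 have ui: "integrable lborel (%x. abs (u x) powr ?r)" by (rule D12_Sobolev(1)[OF N u])
 have e1: "(et x)^2 <= 1" for x using et(2,3)[of x] by (simp add: power_le_one)
 have Mi: "integrable lborel (%x. (et x)^2 * abs (u x) powr ?r)"
  by (rule L1_integrable_bound[OF ui]) (auto intro!: mult_left_le_one_le e1)
 have M: "0 <= M" "M <= 1"
 proof -
  show "0 <= M" by (simp add: M_def)
  have "M <= pw ?r u" unfolding M_def by (intro integral_mono Mi ui mult_left_le_one_le e1) auto
  then show "M <= 1" using p1 by simp
 qed
 have D: "D12 UNIV (%x. u x + (- t) * ((et x * et x) * u x)) (%x. g x + (- t) *R h x)" by (rule D12_lin[OF u hD])
 have P: "1 + ?r * (- t) * M <= pw ?r (%x. u x + (- t) * ((et x * et x) * u x))"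
 proof -
  have "1 + ?r * (- t) * M = (LBINT x. abs (u x) powr ?r + (?r * (- t)) * ((et x)^2 * abs (u x) powr ?r))"
   using ui Mi p1 by (simp add: M_def)
  also have "... <= pw ?r (%x. u x + (- t) * ((et x * et x) * u x))"
  proof (intro integral_mono D12_Sobolev(1)[OF N D] L1_integrable_add integrable_mult_right ui Mi)
   fix x
   have "t * (et x)^2 <= 1 * 1" using small(1) t e1 by (intro mult_mono) auto
   then have b: "-1 <= - t * (et x)^2" by simp
   have "1 + ?r * (- t * (et x)^2) <= (1 + - t * (et x)^2) powr ?r" using r2 b by (intro Bernoulli_powr(1)) auto
   then have "(1 + ?r * (- t * (et x)^2)) * abs (u x) powr ?r <= (1 + - t * (et x)^2) powr ?r * abs (u x) powr ?r" by (rule mult_right_mono) simp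
   also have "... = abs ((1 + - t * (et x)^2) * u x) powr ?r" using b by (simp add: abs_mult powr_mult)
   finally show "abs (u x) powr ?r + (?r * (- t)) * ((et x)^2 * abs (u x) powr ?r) <= abs (u x + (- t) * ((et x * et x) * u x)) powr ?r"
    by (simp add: algebra_simps power2_eq_square)
  qed
  finally show ?thesis .
 qed
 have E: "en (%x. g x + (- t) *R h x) = en g + 2 * (- t) * A + (- t)^2 * en h"
 proof -
  have m: "g : bmeas lborel" "h : bmeas lborel" using D12_meas(2)[OF u] D12_meas(2)[OF hD] by simp_all
  have "en (%x. g x - t *R h x) = en g - 2 * (LBINT x. g x \<bullet> (t *R h x)) + en (%x. t *R h x)"
   using m D12_int[OF u] D12_int[OF hD] by (intro L2_norm_diff_eq) (simp_all add: power_mult_distrib)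
  then show ?thesis by (simp add: A_def power_mult_distrib)
 qed
 have S: "?S * pw ?r (%x. u x + (- t) * ((et x * et x) * u x)) powr (2 / ?r) <= ?S + t^2 + 2 * (- t) * A + (- t)^2 * en h"
  using D12_Sobolev(2)[OF N D] d unfolding E by linarith
 have "(- t) * (?S * M - A) <= t^2 * (1 + B + ?r * (1 + 3 * B)) / 2"
  by (rule quasi_EL_num[OF Sob_props(1)[OF N] r2 _ t M _ _ B(2) P S small]) (use t B(1) in \<open>simp_all add: A_def\<close>)
 then have "t * (A - ?S * M) <= t * (t * (1 + B + ?r * (1 + 3 * B)) / 2)" by (simp add: algebra_simps power2_eq_square)
 then have "A - ?S * M <= t * (1 + B + ?r * (1 + 3 * B)) / 2" using t by (simp only: mult_le_cancel_left_pos)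
 then show ?thesis unfolding A_def M_def by linarith
qed

text \<open>A minimizing sequence at unit concentration scale cannot vanish: testing with $\eta^2 u$ and
  using that balls of radius below one carry at most half of the mass, the mass of every half ball
  would tend to zero.\<close>
lemma no_vanishing:
 fixes u :: "nat => real^'n => real"
 assumes N: "CARD('n) >= 3" and u: "!!n. D12 UNIV (u n) (g n)" and p1: "!!n. pw (crit TYPE('n)) (u n) = 1"
  and d: "!!n. en (g n) <= Sob TYPE('n) + (t n)^2" and t: "!!n. t n > 0" "t ~~> 0"
  and half: "!!n y. (LBINT x. indicator (cball y (3/4)) x * abs (u n x) powr crit TYPE('n)) <= 1/2"
  and ae: "AE x in lborel. (%n. u n x) ~~> 0"
 shows "(%n. LBINT x. indicator (cball y (1/2)) x * abs (u n x) powr crit TYPE('n)) ~~> 0"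
proof -
 let ?r = "crit TYPE('n)" and ?S = "Sob TYPE('n)"
 have r2: "?r > 2" by (rule crit_gt_2[OF N])
 have S0: "?S > 0" by (rule Sob_props(1)[OF N])
 note [measurable] = D12_meas[OF u]
 have [measurable]: "cball a b : sets borel" for a :: "real^'n" and b by simp
 have ui: "integrable lborel (%x. abs (u n x) powr ?r)" for n by (rule D12_Sobolev(1)[OF N u])
 obtain et where et0: "test_fun (cball y (3/4)) et" and et: "!!x. 0 <= et x" "!!x. et x <= 1"
  "!!x. norm (x - y) <= 1/2 ==> et x = 1" "!!x. norm (x - y) >= 3/4 ==> et x = 0"
  by (rule test_fun_exists[of "1/2" "3/4" y]) (simp, simp, rule that)
 have ett: "test_fun UNIV et" using test_fun_mono[OF et0] by simp
 note [measurable] = test_measurable[OF ett]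
 obtain B1 where B1: "B1 > 0" "!!x. abs (et x) <= B1" "!!x. (norm (grad et x))^2 * (1 + (norm x)^2) <= B1^2" by (rule cutoff_bounds[OF ett]) (rule that)
 have e2t: "test_fun UNIV (%x. et x * et x)" by (rule test_fun_mult[OF ett test_fun_smooth[OF ett]])
 have g2: "grad (%x. et x * et x) = (%x. et x *R grad et x + et x *R grad et x)"
  by (rule grad_mult[OF test_fun_smooth[OF ett] test_fun_smooth[OF ett]])
 obtain B2 where B2: "B2 > 0" "!!x. abs (et x * et x) <= B2" "!!x. (norm (grad (%x. et x * et x) x))^2 * (1 + (norm x)^2) <= B2^2" by (rule cutoff_bounds[OF e2t]) (rule that)
 define h where "h = (%n x. (et x * et x) *R g n x + u n x *R (et x *R grad et x + et x *R grad et x))"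
 have hD: "D12 UNIV (%x. (et x * et x) * u n x) (h n)" for n
  unfolding h_def g2[THEN fun_cong, symmetric]
  by (rule D12_mult[OF N u test_fun_smooth[OF e2t] B2(2,3)]) (rule test_fun_mult[OF _ test_fun_smooth[OF e2t]])
 define k where "k = (%n x. et x *R g n x + u n x *R grad et x)"
 have kD: "D12 UNIV (%x. et x * u n x) (k n)" for n
  unfolding k_def by (rule D12_mult[OF N u test_fun_smooth[OF ett] B1(2,3)]) (rule test_fun_mult[OF _ test_fun_smooth[OF ett]])
 have mg: "g n : bmeas lborel" "h n : bmeas lborel" "k n : bmeas lborel" for n
  using D12_meas(2)[OF u] D12_meas(2)[OF hD] D12_meas(2)[OF kD] by simp_all
 obtain E where E: "!!n. en (g n) <= E"
 proof -
  have "Bseq t" using t(2) by (intro convergent_imp_Bseq convergentI)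
  then obtain T where T: "!!n. abs (t n) <= T" unfolding Bseq_def real_norm_def by blast
  have "(t n)^2 <= T^2" for n using T[of n] power_mono[of "abs (t n)" T 2] by simp
  then have "en (g n) <= ?S + T^2" for n using d[of n] by (meson add_left_mono order_trans)
  then show thesis by (rule that)
 qed
 have E0: "E >= 0" using E[of 0] by (rule order_trans[rotated]) simp
 define C where "C = 2 * B2^2 + 2 * B2^2 * (4 / (real CARD('n) - 2)^2)"
 have C0: "C >= 0" by (simp add: C_def)
 have hC: "en (h n) <= C * E" for n
 proof -
  note H = D12_Hardy[OF N u[of n]]
  have ib: "integrable lborel (%x. 2 * B2^2 * (norm (g n x))^2 + 2 * B2^2 * ((u n x)^2 / (1 + (norm x)^2)))"
   using D12_int[OF u] H(1) by (intro L1_integrable_add integrable_mult_right)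
  have "en (h n) <= (LBINT x. 2 * B2^2 * (norm (g n x))^2 + 2 * B2^2 * ((u n x)^2 / (1 + (norm x)^2)))"
   unfolding h_def g2[THEN fun_cong, symmetric]
   by (intro integral_mono ib smooth_mult_bound[OF test_fun_smooth[OF e2t] B2(2,3)])
    (use D12_int[OF hD[of n]] in \<open>simp only: h_def g2\<close>)
  also have "... = 2 * B2^2 * en (g n) + 2 * B2^2 * (LBINT x. (u n x)^2 / (1 + (norm x)^2))"
   unfolding integral_mult_right_zero[symmetric]
   by (intro L1_integral_add integrable_mult_right D12_int[OF u] H(1))
  also have "... <= 2 * B2^2 * en (g n) + 2 * B2^2 * (4 / (real CARD('n) - 2)^2 * en (g n))"
   by (intro add_left_mono mult_left_mono H(2)) simp
  also have "... = C * en (g n)" by (simp add: C_def algebra_simps)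
  also have "... <= C * E" by (intro mult_left_mono E C0)
  finally show ?thesis .
 qed
 define B where "B = E + C * E"
 have hB: "en (h n) <= B" "abs (LBINT x. g n x \<bullet> h n x) <= B" for n
 proof -
  show "en (h n) <= B" using hC[of n] E0 by (simp add: B_def)
  have "abs (LBINT x. g n x \<bullet> h n x) <= sqrt (en (g n)) * sqrt (en (h n))"
   by (rule L2_inner(4)[OF mg(1,2) D12_int[OF u] D12_int[OF hD]])
  also have "... <= (sqrt (en (g n)))^2 + (sqrt (en (h n)))^2"
  proof -
   have "0 <= sqrt (en (g n)) * sqrt (en (h n))" by simp
   then show ?thesis using sum_squares_bound[of "sqrt (en (g n))" "sqrt (en (h n))"] by linarith
  qed
  also have "... = en (g n) + en (h n)" by simp
  also have "... <= B" using E[of n] hC[of n] by (simp add: B_def)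
  finally show "abs (LBINT x. g n x \<bullet> h n x) <= B" .
 qed
 \<comment> \<open>The error from differentiating the cut-off; it involves only u^2 on a ball and
   tends to 0, as 2 is below the critical exponent.\<close>
 define G where "G = (%n. LBINT x. (norm (grad et x))^2 * (u n x)^2)"
 have cb: "emeasure lborel (cball y (3/4)) < \<infinity>" by (rule emeasure_lborel_cball_finite)
 have mu: "!!n. u n : bmeas lborel" "cball y (3/4) : sets lborel" by simp_all
 note L = lower_power_tendsto_zero[OF mu cb ui eq_refl[OF p1] ae, of 2]
 have gz: "(norm (grad et x))^2 <= B1^2 * indicator (cball y (3/4)) x" for x
 proof (cases "x : cball y (3/4)")
  case True
  have "(norm (grad et x))^2 * 1 <= (norm (grad et x))^2 * (1 + (norm x)^2)" by (intro mult_left_mono) auto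
  then show ?thesis using B1(3)[of x] True by simp
 next
  case False
  obtain K where K: "K <= cball y (3/4)" "!!x. x \<notin> K ==> grad et x = 0" using test_fun_obtain[OF et0] by metis
  then have "grad et x = 0" using False by blast
  then show ?thesis using False by simp
 qed
 have gu: "(norm (grad et x))^2 * (u n x)^2 <= B1^2 * (indicator (cball y (3/4)) x * abs (u n x) powr 2)" for n x
  using mult_right_mono[OF gz, of "(u n x)^2" x] by (simp add: powr_numeral mult.assoc)
 have Li: "integrable lborel (%x. B1^2 * (indicator (cball y (3/4)) x * abs (u n x) powr 2))" for n
  using L(1)[of n] r2 by (intro integrable_mult_right) simp
 have Gi: "integrable lborel (%x. (norm (grad et x))^2 * (u n x)^2)" for n
  by (rule L1_integrable_bound[OF Li]) (use gu in \<open>auto intro!: AE_I2 order_trans[OF _ abs_ge_self]\<close>)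
 have Gl: "G ~~> 0"
 proof (rule LIMSEQ_squeeze0)
  show "0 <= G n" for n by (simp add: G_def)
  show "G n <= B1^2 * (LBINT x. indicator (cball y (3/4)) x * abs (u n x) powr 2)" for n
   unfolding G_def integral_mult_right_zero[symmetric] by (intro integral_mono Gi Li gu)
  show "(%n. B1^2 * (LBINT x. indicator (cball y (3/4)) x * abs (u n x) powr 2)) ~~> 0"
   using tendsto_mult_right_zero[OF L(2)] r2 by simp
 qed
 \<comment> \<open>The identity |grad(et u)|^2 = grad u . grad(et^2 u) + u^2 |grad et|^2 ties the
   energy of the cut-off function to the tested equation.\<close>
 have ek: "en (k n) = (LBINT x. g n x \<bullet> h n x) + G n" for n
 proof -
  have "(norm (k n x))^2 = g n x \<bullet> h n x + (norm (grad et x))^2 * (u n x)^2" for x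
   unfolding power2_norm_eq_inner k_def h_def scaleR_add_left[symmetric]
   by (simp add: inner_simps inner_commute[of "grad et x" "g n x"] power2_eq_square algebra_simps)
  then show ?thesis unfolding G_def
   by (simp add: L1_integral_add[OF L2_inner(1)[OF mg(1,2) D12_int[OF u] D12_int[OF hD]] Gi])
 qed
 \<comment> \<open>A ball of radius 3/4 has at most half of the mass, so Hoelder's inequality yields
   this factor; being below 1, it lets the right-hand side be absorbed.\<close>
 define th where "th = (1/2::real) powr (1 - 2 / ?r)"
 have th: "th < 1" unfolding th_def using r2 powr_less_mono2[of "1 - 2 / ?r" "1/2" 1] by simp
 define X where "X = (%n. pw ?r (%x. et x * u n x) powr (2 / ?r))"
 have MX: "(LBINT x. (et x)^2 * abs (u n x) powr ?r) <= X n * th" for n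
 proof -
  let ?f = "%x. abs (et x * u n x) powr ?r" and ?h = "%x. indicator (cball y (3/4)) x * abs (u n x) powr ?r"
  have hi: "integrable lborel ?h" by (intro indicator_powr_integrable ui) auto
  have eq: "(et x)^2 * abs (u n x) powr ?r = ?f x powr (2 / ?r) * ?h x powr (1 - 2 / ?r)" for x
  proof (cases "u n x = 0 \<or> et x = 0")
   case False
   then have "x : cball y (3/4)" using et(4)[of x] by (cases "norm (x - y) >= 3/4") (auto simp: dist_norm norm_minus_commute)
   moreover have "?f x powr (2 / ?r) = abs (et x * u n x) powr 2" using r2 by (simp add: powr_powr)
   moreover have "(abs (u n x) powr ?r) powr (1 - 2 / ?r) = abs (u n x) powr (?r - 2)" using r2 by (simp add: powr_powr right_diff_distrib)
   moreover have "abs (u n x) powr ?r = abs (u n x) powr 2 * abs (u n x) powr (?r - 2)" unfolding powr_add[symmetric] by simp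
   ultimately show ?thesis by (simp add: abs_mult powr_mult powr_numeral)
  qed (use r2 in auto)
  have "(LBINT x. (et x)^2 * abs (u n x) powr ?r) = (LBINT x. ?f x powr (2 / ?r) * ?h x powr (1 - 2 / ?r))" unfolding eq ..
  also have "... <= (LBINT x. ?f x) powr (2 / ?r) * (LBINT x. ?h x) powr (1 - 2 / ?r)"
  proof (intro Holder_two(2) D12_Sobolev(1)[OF N kD] hi)
   show "?f : bmeas lborel" "?h : bmeas lborel" by measurable
  qed (use r2 in auto)
  also have "... <= X n * th" unfolding X_def th_def using half[where n=n and y=y] r2 by (intro mult_left_mono powr_mono2) auto
  finally show ?thesis .
 qed
 define c where "c = (1 + B + ?r * (1 + 3 * B)) / 2"
 have ev: "\<forall>\<^sub>F n in sequentially. t n <= 1 & t n * ?r <= 1/2 & t n * (1 + 3 * B) * ?r <= ?S"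
 proof -
  have "(%n. t n * ?r) ~~> 0" "(%n. t n * (1 + 3 * B) * ?r) ~~> 0"
   using t(2) by (auto intro!: tendsto_mult_left_zero)
  from order_tendstoD(2)[OF this(1), of "1/2"] order_tendstoD(2)[OF this(2) S0] order_tendstoD(2)[OF t(2), of 1]
  have "\<forall>\<^sub>F n in sequentially. t n * ?r < 1/2" "\<forall>\<^sub>F n in sequentially. t n * (1 + 3 * B) * ?r < ?S" "\<forall>\<^sub>F n in sequentially. t n < 1" by simp_all
  then show ?thesis by eventually_elim simp
 qed
 have Xb: "\<forall>\<^sub>F n in sequentially. X n <= (t n * c + G n) / (?S * (1 - th))"
  using ev
 proof eventually_elim
  case (elim n)
  have "?S * X n <= en (k n)" unfolding X_def by (rule D12_Sobolev(2)[OF N kD])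
  also have "... <= ?S * (LBINT x. (et x)^2 * abs (u n x) powr ?r) + t n * c + G n"
   unfolding ek c_def
   using Sobolev_quasi_EL[OF N u p1 d t(1) ett et(1,2) h_def[THEN fun_cong] hD hB(2,1), of n] elim by simp
  also have "... <= ?S * (X n * th) + t n * c + G n" using S0 MX by (intro add_right_mono mult_left_mono) auto
  finally have "(?S * (1 - th)) * X n <= t n * c + G n" by (simp add: algebra_simps)
  moreover have "?S * (1 - th) > 0" using S0 th by simp
  ultimately show ?case by (simp add: pos_le_divide_eq mult.commute)
 qed
 have Xl: "X ~~> 0"
 proof (rule Lim_null_comparison)
  show "\<forall>\<^sub>F n in sequentially. norm (X n) <= (t n * c + G n) / (?S * (1 - th))" using Xb by eventually_elim (simp add: X_def)
  have "(%n. (t n * c + G n) / (?S * (1 - th))) ~~> (0 * c + 0) / (?S * (1 - th))" using S0 th by (intro tendsto_intros t(2) Gl) auto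
  then show "(%n. (t n * c + G n) / (?S * (1 - th))) ~~> 0" by simp
 qed
 have "(%n. X n powr (?r / 2)) ~~> 0 powr (?r / 2)" using r2 by (intro tendsto_powr2 Xl tendsto_const) (auto simp: X_def)
 then have Pl: "(%n. pw ?r (%x. et x * u n x)) ~~> 0" using r2 by (simp add: X_def powr_powr)
 show ?thesis
 proof (rule LIMSEQ_squeeze0[OF _ _ Pl])
  show "(LBINT x. indicator (cball y (1/2)) x * abs (u n x) powr ?r) <= pw ?r (%x. et x * u n x)" for n
   by (intro integral_mono indicator_powr_integrable ui D12_Sobolev(1)[OF N kD])
    (use et(3) in \<open>auto simp: indicator_def dist_norm norm_minus_commute\<close>)
 qed simp
qed

text \<open>A normalized minimizing sequence has a nonzero weak limit, since vanishing is excluded.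
  Were the mass split into tau and 1 - tau, the Sobolev inequality for both parts would give
  tau^(2/r) + (1-tau)^(2/r) <= 1, which is false for 0 < tau < 1.\<close>

theorem Sobolev_extremal:
 assumes N: "CARD('n) >= 3"
 obtains U :: "real^'n => real" and G where "D12 UNIV U G" "pw (crit TYPE('n)) U = 1" "en G = Sob TYPE('n)"
proof -
 let ?r = "crit TYPE('n)" and ?S = "Sob TYPE('n)"
 have r2: "?r > 2" by (rule crit_gt_2[OF N])
 have S0: "?S > 0" by (rule Sob_props(1)[OF N])
 define t where "t = (%n. inverse (real (Suc n)))"
 have t: "t n > 0" "t n <= 1" for n by (auto simp: t_def inverse_le_1_iff)
 have tl: "t ~~> 0" unfolding t_def by (rule LIMSEQ_inverse_real_of_nat)
 \<comment> \<open>The tolerance is (t n)^2 rather than t n, so that the Euler-Lagrange equation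
   holds up to an error of order t n.\<close>
 define P where "P = (%n (u :: real^'n => real) g. D12 UNIV u g & pw ?r u = 1 & en g <= ?S + (t n)^2 &
  (LBINT x. indicator (cball 0 2) x * abs (u x) powr ?r) >= 1/2 &
  (\<forall>y. (LBINT x. indicator (cball y (3/4)) x * abs (u x) powr ?r) <= 1/2))"
 have exP: "\<exists>u g. P n u g" for n
 proof -
  obtain ph :: "real^'n => real" where ph: "test_fun UNIV ph" "pw ?r ph > 0" "en (grad ph) < (?S + (t n)^2) * pw ?r ph powr (2 / ?r)"
   using Sob_props(3)[OF N, of "(t n)^2"] t(1)[of n] by auto
  define c where "c = pw ?r ph powr (- 1 / ?r)"
  have c0: "c > 0" using ph(2) by (simp add: c_def)
  have "c powr ?r = pw ?r ph powr (-1)" unfolding c_def powr_powr using r2 by simp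
  then have cr: "c powr ?r * pw ?r ph = 1" using ph(2) by (simp add: powr_minus)
  have "c^2 = c powr 2" using c0 by (simp add: powr_numeral)
  also have "... = pw ?r ph powr (- (2 / ?r))" by (simp add: c_def powr_powr)
  finally have c2: "c^2 * pw ?r ph powr (2 / ?r) = 1" using ph(2) by (simp add: powr_minus)
  have tpsi: "test_fun UNIV (%x. c * ph x)" by (rule test_fun_scale[OF ph(1)])
  have p1: "pw ?r (%x. c * ph x) = 1" unfolding pw_scale using cr c0 by simp
  have "en (grad (%x. c * ph x)) = c^2 * en (grad ph)" unfolding grad_scale[OF test_fun_smooth[OF ph(1)]] by (rule en_scale)
  also have "... <= c^2 * ((?S + (t n)^2) * pw ?r ph powr (2 / ?r))" using ph(3) by (intro mult_left_mono) auto
  also have "... = (?S + (t n)^2) * (c^2 * pw ?r ph powr (2 / ?r))" by (simp only: mult_ac)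
  finally have "en (grad (%x. c * ph x)) <= ?S + (t n)^2" unfolding c2 by simp
  moreover from concentration_normalize[OF N tpsi p1] obtain u :: "real^'n => real" and g where
   "D12 UNIV u g" "pw ?r u = 1" "en g = en (grad (%x. c * ph x))"
   "(LBINT x. indicator (cball 0 2) x * abs (u x) powr ?r) >= 1/2"
   "\<forall>y. (LBINT x. indicator (cball y (3/4)) x * abs (u x) powr ?r) <= 1/2" by (elim exE conjE)
  ultimately have "P n u g" unfolding P_def by simp
  then show ?thesis by blast
 qed
 obtain u g where Pu: "!!n. P n (u n) (g n)" using exP by metis
 have u: "!!n. D12 UNIV (u n) (g n)" "!!n. pw ?r (u n) = 1" "!!n. en (g n) <= ?S + (t n)^2"
  "!!n. (LBINT x. indicator (cball 0 2) x * abs (u n x) powr ?r) >= 1/2"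
  "!!n y. (LBINT x. indicator (cball y (3/4)) x * abs (u n x) powr ?r) <= 1/2"
  using Pu unfolding P_def by blast+
 have C: "en (g n) <= ?S + 1" for n
  using u(3)[of n] t[of n] power_le_one[of "t n" 2] by linarith
 obtain s v h where s: "strict_mono s" and vD: "D12 UNIV v h" and ae: "AE x in lborel. (%n. u (s n) x) ~~> v x"
  and wk: "!!w k. D12 UNIV w k ==> (%n. LBINT x. g (s n) x \<bullet> k x) ~~> (LBINT x. h x \<bullet> k x)"
  by (rule D12_compact[OF N u(1) C]) (rule that)
 have ts: "(%n. t (s n)) ~~> 0" using LIMSEQ_subseq_LIMSEQ[OF tl s] by (simp add: o_def)
 have ui: "integrable lborel (%x. abs (u n x) powr ?r)" for n by (rule D12_Sobolev(1)[OF N u(1)])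
 have vi: "integrable lborel (%x. abs (v x) powr ?r)" by (rule D12_Sobolev(1)[OF N vD])
 have mm: "u n : bmeas lborel" "v : bmeas lborel" "g n : bmeas lborel" "h : bmeas lborel" for n
  using D12_meas[OF u(1)] D12_meas[OF vD] by simp_all
 \<comment> \<open>Otherwise the mass of every ball of radius 1/2 would vanish in the limit;
   finitely many of them cover \<open>cball 0 2\<close>, which always holds half of the
   mass.\<close>
 have v0: "\<not> (AE x in lborel. v x = 0)"
 proof
  assume z: "AE x in lborel. v x = 0"
  have ae0: "AE x in lborel. (%n. u (s n) x) ~~> 0" using ae z by eventually_elim simp
  have van: "(%n. LBINT x. indicator (cball y (1/2)) x * abs (u (s n) x) powr ?r) ~~> 0" for y
   by (rule no_vanishing[OF N u(1,2,3) t(1) ts u(5) ae0])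
  obtain F where F: "finite F" "cball (0::real^'n) 2 <= (\<Union>y\<in>F. ball y (1/2))"
  proof -
   have "x : ball x (1/2)" for x :: "real^'n" by simp
   then have "cball (0::real^'n) 2 <= (\<Union>y\<in>UNIV. ball y (1/2))" by blast
   then obtain F where "F <= UNIV" "finite F" "cball (0::real^'n) 2 <= (\<Union>y\<in>F. ball y (1/2))"
    by (rule compactE_image[OF compact_cball, of UNIV "%y. ball y (1/2)" 0 2, rotated]) auto
   then show thesis using that by blast
  qed
  have le: "(1/2::real) <= (\<Sum>y\<in>F. LBINT x. indicator (cball y (1/2)) x * abs (u (s n) x) powr ?r)" for n
  proof -
   have ii: "integrable lborel (%x. indicator (cball y a) x * abs (u (s n) x) powr ?r)" for y a
    by (intro indicator_powr_integrable ui) (use D12_meas[OF u(1)] in auto)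
   have "1/2 <= (LBINT x. indicator (cball 0 2) x * abs (u (s n) x) powr ?r)" by (rule u(4))
   also have "... <= (LBINT x. (\<Sum>y\<in>F. indicator (cball y (1/2)) x * abs (u (s n) x) powr ?r))"
   proof (intro integral_mono Bochner_Integration.integrable_sum ii)
    fix x :: "real^'n"
    show "indicator (cball 0 2) x * abs (u (s n) x) powr ?r <= (\<Sum>y\<in>F. indicator (cball y (1/2)) x * abs (u (s n) x) powr ?r)"
    proof (cases "x : cball 0 2")
     case True
     then obtain y where y: "y : F" "x : ball y (1/2)" using F(2) by blast
     have "indicator (cball 0 2) x * abs (u (s n) x) powr ?r = indicator (cball y (1/2)) x * abs (u (s n) x) powr ?r" using True y(2) by (simp add: indicator_def)
     also have "... <= (\<Sum>y\<in>F. indicator (cball y (1/2)) x * abs (u (s n) x) powr ?r)" by (rule member_le_sum[OF y(1) _ F(1)]) simp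
     finally show ?thesis .
    qed (simp add: sum_nonneg)
   qed
   also have "... = (\<Sum>y\<in>F. LBINT x. indicator (cball y (1/2)) x * abs (u (s n) x) powr ?r)" by (intro Bochner_Integration.integral_sum ii)
   finally show ?thesis .
  qed
  have "(%n. \<Sum>y\<in>F. LBINT x. indicator (cball y (1/2)) x * abs (u (s n) x) powr ?r) ~~> (\<Sum>y\<in>F. 0)" by (intro tendsto_sum van)
  then have "(1/2::real) <= (\<Sum>y\<in>F. 0)" by (rule LIMSEQ_le_const) (use le in auto)
  then show False by simp
 qed
 define tau where "tau = pw ?r v"
 have tau0: "tau > 0"
 proof -
  have "tau ~= 0" unfolding tau_def using v0 pw_pos_iff[OF D12_meas(1)[OF vD] vi] by simp
  then show ?thesis by (simp add: tau_def less_le)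
 qed
 have p1': "pw ?r (u (s n)) <= 1" for n using u(2) by simp
 note BL = Brezis_Lieb[of ?r "%n. u (s n)" lborel v 1, OF _ mm(1) mm(2) ui p1' ae]
 have r0: "?r > 0" using r2 by simp
 have "(%n. pw ?r (u (s n)) - (pw ?r (u (s n)) - pw ?r (%x. u (s n) x - v x))) ~~> 1 - tau"
  unfolding u(2) tau_def by (intro tendsto_diff tendsto_const BL(3)[unfolded u(2)] r0)
 then have pl: "(%n. pw ?r (%x. u (s n) x - v x)) ~~> 1 - tau" by simp
 have tau1: "tau <= 1"
 proof -
  have "0 <= 1 - tau" by (rule LIMSEQ_le_const[OF pl]) simp
  then show ?thesis by simp
 qed
 have gl: "(%n. en (g (s n))) ~~> ?S"
 proof (rule tendsto_sandwich)
  show "\<forall>\<^sub>F n in sequentially. ?S <= en (g (s n))" using D12_Sobolev(2)[OF N u(1)] unfolding u(2) by simp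
  show "\<forall>\<^sub>F n in sequentially. en (g (s n)) <= ?S + (t (s n))^2" using u(3) by simp
  have "(%n. ?S + (t (s n))^2) ~~> ?S + 0^2" by (intro tendsto_intros ts)
  then show "(%n. ?S + (t (s n))^2) ~~> ?S" by simp
 qed simp
 note WE = weak_energy[OF mm(3) mm(4) D12_int[OF u(1)] D12_int[OF vD] wk[OF vD] gl]
 have dD: "D12 UNIV (%x. u (s n) x - v x) (%x. g (s n) x - h x)" for n by (rule D12_diff[OF u(1) vD])
 have le1: "?S * (1 - tau) powr (2 / ?r) <= ?S - en h"
 proof (rule LIMSEQ_le[OF _ WE(1)])
  show "(%n. ?S * pw ?r (%x. u (s n) x - v x) powr (2 / ?r)) ~~> ?S * (1 - tau) powr (2 / ?r)"
   using r2 by (intro tendsto_mult tendsto_const tendsto_powr2 pl) auto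
 qed (use D12_Sobolev(2)[OF N dD] in auto)
 have le2: "?S * tau powr (2 / ?r) <= en h" unfolding tau_def by (rule D12_Sobolev(2)[OF N vD])
 have "?S * (tau powr (2 / ?r) + (1 - tau) powr (2 / ?r)) <= ?S * 1" using le1 le2 by (simp add: distrib_left)
 then have sum1: "tau powr (2 / ?r) + (1 - tau) powr (2 / ?r) <= 1" using S0 by simp
 \<comment> \<open>As 2/r < 1, each of tau and 1 - tau would be strictly increased by the
   power.\<close>
 have "tau = 1"
 proof (rule ccontr)
  assume "tau ~= 1"
  then have l: "tau < 1" using tau1 by simp
  have "x powr 1 < x powr (2 / ?r)" if "0 < x" "x < 1" for x :: real
   using r2 that by (intro powr_less_mono') simp_all
  from this[OF tau0 l] this[of "1 - tau"] show False using sum1 tau0 l by simp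
 qed
 moreover have "en h = ?S" using WE(2) le2 \<open>tau = 1\<close> by simp
 ultimately show thesis using that[OF vD] by (simp add: tau_def)
qed

section \<open>Euler-Lagrange equation and decay of the extremals\<close>

lemma en_add_scale:
 fixes g h :: "real^'n => real^'n"
 assumes "g : bmeas borel" "h : bmeas borel"
  "integrable lborel (%x. (norm (g x))^2)" "integrable lborel (%x. (norm (h x))^2)"
 shows "en (%x. g x + e *R h x) = en g + 2 * e * (LBINT x. g x \<bullet> h x) + e^2 * en h"
proof -
 have "(norm (g x + e *R h x))^2 = (norm (g x))^2 + 2 * e * (g x \<bullet> h x) + e^2 * (norm (h x))^2" for x
  unfolding power2_norm_eq_inner by (simp add: inner_simps inner_commute power2_eq_square algebra_simps)
 moreover have "integrable lborel (%x. g x \<bullet> h x)" using assms by (intro L2_inner(1)) simp_all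
 ultimately show ?thesis using assms(3,4) by simp
qed

text \<open>The defect of the Sobolev inequality along U + e v is nonnegative and vanishes at e = 0,
  so its derivative there is zero.\<close>

lemma Sobolev_EL:
 fixes U :: "real^'n => real"
 assumes N: "CARD('n) >= 3" and U: "D12 UNIV U G" "pw (crit TYPE('n)) U = 1" "en G = Sob TYPE('n)" and v: "D12 UNIV v h"
 shows "(LBINT x. G x \<bullet> h x) = Sob TYPE('n) * (LBINT x. sgn (U x) * abs (U x) powr (crit TYPE('n) - 1) * v x)"
proof -
 let ?r = "crit TYPE('n)" and ?S = "Sob TYPE('n)"
 have r2: "?r > 2" by (rule crit_gt_2[OF N])
 define I where "I = (LBINT x. sgn (U x) * abs (U x) powr (?r - 1) * v x)"
 define A where "A = (LBINT x. G x \<bullet> h x)"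
 define F where "F = (%e. (en G + 2 * e * A + e^2 * en h) - ?S * (LBINT x. abs (U x + e * v x) powr ?r) powr (2 / ?r))"
 have D: "D12 UNIV (%x. U x + e * v x) (%x. G x + e *R h x)" for e by (rule D12_lin[OF U(1) v])
 have F0: "F e >= 0" for e
  using D12_Sobolev(2)[OF N D, of e] en_add_scale[OF D12_meas(2)[OF U(1)] D12_meas(2)[OF v] D12_int[OF U(1)] D12_int[OF v], of e]
  unfolding F_def A_def by linarith
 have dI: "((%e. LBINT x. abs (U x + e * v x) powr ?r) has_real_derivative ?r * I) (at 0)"
  unfolding I_def using r2 D12_meas(1)[OF U(1)] D12_meas(1)[OF v]
  by (intro DERIV_powr_integral(2) D12_Sobolev(1)[OF N U(1)] D12_Sobolev(1)[OF N v]) simp_all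
 have dP: "((%y. y powr (2 / ?r)) has_real_derivative 2 / ?r * 1 powr (2 / ?r - 1)) (at (LBINT x. abs (U x + 0 * v x) powr ?r))"
  using U(2) by (auto intro!: derivative_eq_intros)
 have "(F has_real_derivative (0 + 2 * A + 0) - ?S * (2 / ?r * 1 powr (2 / ?r - 1) * (?r * I))) (at 0)"
  unfolding F_def by (rule DERIV_diff[OF _ DERIV_cmult[OF DERIV_chain2[OF dP dI]]]) (auto intro!: derivative_eq_intros)
 then have "(F has_real_derivative 2 * A - ?S * (2 * I)) (at 0)" using r2 by simp
 moreover have "F 0 = 0" using U by (simp add: F_def)
 ultimately have "2 * A - ?S * (2 * I) = 0"
  by (intro DERIV_local_min[of F _ 0 1]) (use F0 in auto)
 then show ?thesis unfolding A_def I_def by simp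
qed

text \<open>The power (1+|x|^2)^a truncated at height ep^-a. It is bounded for each ep, while its
  logarithmic gradient is at most 2a/sqrt(1+|x|^2) for every ep; this constant, free of ep, is what
  is compared with Hardy's constant.\<close>

lemma weight_props:
 fixes ep a :: real
 assumes e: "0 < ep" "ep <= 1" and a: "a > 0"
 defines "w \<equiv> (%x::real^'n. (1 + (norm x)^2) powr a * (1 + ep * (norm x)^2) powr (- a))"
 shows "smooth_on UNIV w" "!!x. 0 < w x" "!!x. w x <= (1 + (norm x)^2) powr a" "!!x. w x <= (1 / ep) powr a"
  "!!x. (norm (grad w x))^2 * (1 + (norm x)^2) <= (2 * a)^2 * (w x)^2"
proof -
 have p: "1 + c * (norm x)^2 > 0" if "c >= 0" for c and x :: "real^'n"
  using mult_nonneg_nonneg[OF that zero_le_power2[of "norm x"]] by linarith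
 note p1 = p[of 1, simplified] and pe = p[of ep]
 have sm: "smooth_on UNIV (%x::real^'n. 1 + c * (norm x)^2)" for c
  using smooth_add[OF smooth_const[of 1] smooth_mult[OF smooth_const[of c] smooth_norm2[of 0]]] by simp
 show "smooth_on UNIV w" unfolding w_def
  using sm[of 1] sm[of ep] p1 pe e by (intro smooth_mult smooth_powr) auto
 show w0: "0 < w x" for x using p1[of x] pe[of x] e by (simp add: w_def)
 show "w x <= (1 + (norm x)^2) powr a" for x
 proof -
  have "1 <= 1 + ep * (norm x)^2" using e by simp
  then have "(1 + ep * (norm x)^2) powr (- a) <= 1 powr (- a)" using a by (intro powr_mono2') auto
  then show ?thesis unfolding w_def by (intro mult_right_le_one_le) auto
 qed
 show "w x <= (1 / ep) powr a" for x
 proof -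
  have "w x = ((1 + (norm x)^2) / (1 + ep * (norm x)^2)) powr a"
   using p1[of x] pe[of x] e by (simp add: w_def powr_divide powr_minus_divide)
  also have "... <= (1 / ep) powr a"
   using p1[of x] pe[of x] e a by (intro powr_mono2) (auto simp: field_simps)
  finally show ?thesis .
 qed
 define F where "F = (%rh. (1 + rh) powr a * (1 + ep * rh) powr (- a))"
 define F' where "F' = (%rh. F rh * (a * (1 - ep) / ((1 + rh) * (1 + ep * rh))))"
 have dF: "(F has_real_derivative F' rh) (at rh)" if "rh >= 0" for rh
 proof -
  have q: "1 + rh > 0" "1 + ep * rh > 0" using that e by (auto intro: add_pos_nonneg)
  have d: "(F has_real_derivative (a * (1 + rh) powr (a - 1)) * (1 + ep * rh) powr (- a) + (- a * (1 + ep * rh) powr (- a - 1) * ep) * (1 + rh) powr a) (at rh)"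
   unfolding F_def using q by (auto intro!: derivative_eq_intros)
  have pd: "(1 + rh) powr (a - 1) = (1 + rh) powr a / (1 + rh)" "(1 + ep * rh) powr (- a - 1) = (1 + ep * rh) powr (- a) / (1 + ep * rh)"
   using q by (simp_all add: powr_diff)
  have gen: "(a * (A / x)) * B + (- a * (B / y) * ep) * A = (A * B) * (a * (1 - ep) / (x * y))" if "x ~= 0" "y ~= 0" "y - ep * x = 1 - ep" for A B x y :: real
  proof -
   have "(a * (A / x)) * B + (- a * (B / y) * ep) * A = (A * B) * (a * (y - ep * x) / (x * y))" using that(1,2) by (simp add: field_simps)
   then show ?thesis unfolding that(3) .
  qed
  have e: "(a * ((1 + rh) powr a / (1 + rh))) * (1 + ep * rh) powr (- a) + (- a * ((1 + ep * rh) powr (- a) / (1 + ep * rh)) * ep) * (1 + rh) powr a = F' rh"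
   unfolding F'_def F_def by (rule gen) (use q in \<open>auto simp: algebra_simps\<close>)
  show ?thesis using d unfolding pd e .
 qed
 have "has_grad (%x. F ((norm x)^2)) (%x::real^'n. F' ((norm x)^2) *R (2 *R x))"
 proof (rule has_grad_compose[OF has_grad_norm2 dF])
  have sub: "range (%x::real^'n. (norm x)^2) <= {0..}" by auto
  have "continuous_on {0..} F'"
   unfolding F'_def F_def using e by (intro continuous_intros ballI) (auto simp: add_pos_nonneg add_nonneg_eq_0_iff)
  then show "continuous_on (range (%x::real^'n. (norm x)^2)) F'" by (rule continuous_on_subset[OF _ sub])
 qed simp
 then have gw: "grad w = (%x. F' ((norm x)^2) *R (2 *R x))" unfolding w_def F_def by (rule has_grad_eq)
 show "(norm (grad w x))^2 * (1 + (norm x)^2) <= (2 * a)^2 * (w x)^2" for x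
 proof -
  define rh where "rh = (norm x)^2"
  have q: "rh >= 0" "1 + rh > 0" "1 + ep * rh >= 1" using e by (auto simp: rh_def add_pos_nonneg)
  have b: "0 <= (1 - ep) / ((1 + rh) * (1 + ep * rh))" "(1 - ep) / ((1 + rh) * (1 + ep * rh)) <= 1 / (1 + rh)"
  proof -
   show "0 <= (1 - ep) / ((1 + rh) * (1 + ep * rh))" using q e by (intro divide_nonneg_nonneg mult_nonneg_nonneg) auto
   show "(1 - ep) / ((1 + rh) * (1 + ep * rh)) <= 1 / (1 + rh)"
   proof (intro frac_le)
    show "1 + rh <= (1 + rh) * (1 + ep * rh)" using mult_left_mono[OF q(3), of "1 + rh"] q(2) by simp
   qed (use q e in auto)
  qed
  have wF: "w x = F rh" by (simp add: w_def F_def rh_def)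
  have F'e: "F' rh = w x * a * ((1 - ep) / ((1 + rh) * (1 + ep * rh)))" by (simp add: F'_def wF)
  have "0 <= F' rh" unfolding F'e using w0[of x] a b(1) by (intro mult_nonneg_nonneg) auto
  then have "norm (grad w x) = F' rh * 2 * norm x" unfolding gw rh_def[symmetric] by simp
  then have "norm (grad w x) = w x * a * ((1 - ep) / ((1 + rh) * (1 + ep * rh))) * 2 * norm x" unfolding F'e .
  also have "w x * a * ((1 - ep) / ((1 + rh) * (1 + ep * rh))) * 2 * norm x <= w x * a * (1 / (1 + rh)) * 2 * norm x"
   using a w0[of x] b by (intro mult_right_mono mult_left_mono) auto
  finally have "norm (grad w x) <= 2 * a * w x * (norm x / (1 + rh))" by (simp add: mult_ac)
  then have "(norm (grad w x))^2 <= (2 * a * w x * (norm x / (1 + rh)))^2" by (intro power_mono) auto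
  also have "... = (2 * a)^2 * (w x)^2 * (rh / (1 + rh)^2)" by (simp add: power_mult_distrib power_divide rh_def)
  finally have "(norm (grad w x))^2 * (1 + rh) <= (2 * a)^2 * (w x)^2 * (rh / (1 + rh)^2) * (1 + rh)" using q by (intro mult_right_mono) auto
  also have "... = (2 * a)^2 * (w x)^2 * (rh / (1 + rh))" using q by (simp add: power2_eq_square)
  also have "... <= (2 * a)^2 * (w x)^2 * 1" using q by (intro mult_left_mono) (auto simp: divide_le_eq)
  finally show ?thesis by (simp add: rh_def)
 qed
qed

text \<open>Testing the Euler--Lagrange equation with $w^2 U$ for a truncated power weight $w$; Hardy's
  inequality absorbs the gradient of the weight as long as $\alpha < (N - 2) / 2$.\<close>
theorem Sobolev_extremal_decay:
 fixes U :: "real^'n => real"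
 assumes N: "CARD('n) >= 3" and U: "D12 UNIV U G" "pw (crit TYPE('n)) U = 1" "en G = Sob TYPE('n)"
  and al: "0 < aph" "2 * aph < real CARD('n) - 2"
 shows "integrable lborel (%x. (1 + (norm x)^2) powr (aph - 1) * (U x)^2)"
  "integrable lborel (%x. (1 + (norm x)^2) powr (aph * crit TYPE('n) / 2) * abs (U x) powr crit TYPE('n))"
proof -
 let ?r = "crit TYPE('n)" and ?S = "Sob TYPE('n)" and ?N = "real CARD('n)"
 have r2: "?r > 2" by (rule crit_gt_2[OF N])
 have S0: "?S > 0" by (rule Sob_props(1)[OF N])
 note [measurable] = D12_meas[OF U(1)]
 have Ui: "integrable lborel (%x. abs (U x) powr ?r)" by (rule D12_Sobolev(1)[OF N U(1)])
 \<comment> \<open>The fraction of the energy of wU taken up by the term U^2 |grad w|^2; it is below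
   1 exactly because 2 aph < N - 2.\<close>
 define H where "H = aph^2 * (4 / (?N - 2)^2)"
 have H: "H < 1" "H >= 0"
 proof -
  have "(2 * aph)^2 < (?N - 2)^2" using al by (intro power_strict_mono) auto
  moreover have "(?N - 2)^2 > 0" using N by simp
  ultimately show "H < 1" by (simp add: H_def power_mult_distrib)
  show "H >= 0" by (simp add: H_def)
 qed
 \<comment> \<open>If the mass of U outside a ball is below kp, Hoelder's inequality turns the
   nonlinear term there into at most (1-H)/2 times the energy; another (1-H)/2 is left after the
   absorption.\<close>
 define kp where "kp = ((1 - H) / 2) powr (1 / (1 - 2 / ?r))"
 have p0: "1 - 2 / ?r > 0" using r2 by simp
 have kp: "kp > 0" "kp powr (1 - 2 / ?r) = (1 - H) / 2" using H p0 by (auto simp: kp_def powr_powr)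
 define tl where "tl = (%n::nat. LBINT x. indicator (- cball 0 (real n)) x * abs (U x) powr ?r)"
 have tli: "integrable lborel (%x. indicator (- cball 0 (real n)) x * abs (U x) powr ?r)" for n
  by (intro indicator_powr_integrable Ui) auto
 have "tl ~~> integral\<^sup>L lborel (%x::real^'n. 0)" unfolding tl_def
 proof (rule integral_dominated_convergence[where w="%x. abs (U x) powr ?r"])
  show "AE x in lborel. (%n. indicator (- cball 0 (real n)) x * abs (U x) powr ?r) ~~> 0"
  proof (rule AE_I2)
   fix x :: "real^'n"
   obtain k :: nat where k: "norm x <= real k" using real_arch_simple by blast
   have "indicator (- cball 0 (real n)) x * abs (U x) powr ?r = 0" if "n >= k" for n
    using k that by (auto simp: indicator_def)
   then show "(%n. indicator (- cball 0 (real n)) x * abs (U x) powr ?r) ~~> 0"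
    by (intro tendsto_eventually eventually_sequentiallyI[of k])
  qed
  show "(%x. indicator (- cball 0 (real n)) x * abs (U x) powr ?r) : bmeas lborel" for n using tli by blast
 qed (use Ui in \<open>auto simp: indicator_def\<close>)
 then have "tl ~~> 0" by simp
 from order_tendstoD(2)[OF this kp(1)] obtain n0 where n0: "tl n0 < kp" by (auto simp: eventually_sequentially)
 define Q where "Q = ?S * (1 + (real n0)^2) powr aph"
 define w where "w = (%ep x::real^'n. (1 + (norm x)^2) powr (aph / 2) * (1 + ep * (norm x)^2) powr (- (aph / 2)))"
 define k where "k = (%ep x. w ep x *R G x + U x *R grad (w ep) x)"
 have main: "D12 UNIV (%x. w ep x * U x) (k ep) & en (k ep) <= Q / ((1 - H) / 2)" if e: "0 < ep" "ep <= 1" for ep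
 proof -
  have a2: "aph / 2 > 0" using al by simp
  have W: "smooth_on UNIV (w ep)" "!!x. 0 < w ep x" "!!x. w ep x <= (1 + (norm x)^2) powr (aph / 2)" "!!x. w ep x <= (1 / ep) powr (aph / 2)"
   "!!x. (norm (grad (w ep) x))^2 * (1 + (norm x)^2) <= (2 * (aph / 2))^2 * (w ep x)^2"
   unfolding w_def by (rule weight_props[OF e a2])+
  \<comment> \<open>With b = ep^(-aph/2), this exceeds b, aph b, b^2 and 2 aph b^2, so one constant
    serves \<open>D12_mult\<close> for both w and w^2. It depends on ep, which does no harm as it
    enters no estimate.\<close>
  define B where "B = (1 + aph) * (1 / ep) powr (aph / 2) + 2 * aph * ((1 / ep) powr (aph / 2))^2 + ((1 / ep) powr (aph / 2))^2"
  define b where "b = (1 / ep) powr (aph / 2)"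
  have b0: "b > 0" using e by (simp add: b_def)
  have Bb: "B = b + aph * b + 2 * aph * b^2 + b^2" by (simp add: B_def b_def algebra_simps)
  have gwb: "(norm (grad (w ep) x))^2 * (1 + (norm x)^2) <= aph^2 * (w ep x)^2" for x using W(5)[of x] by simp
  have wB: "abs (w ep x) <= B" for x
  proof -
   have "abs (w ep x) <= b" using W(2)[of x] W(4)[of x] by (simp add: b_def)
   then show ?thesis using Bb b0 al mult_nonneg_nonneg[of aph b] mult_nonneg_nonneg[of aph "b^2"] by (simp add: add_increasing2)
  qed
  have gB: "(norm (grad (w ep) x))^2 * (1 + (norm x)^2) <= B^2" for x
  proof -
   have "aph^2 * (w ep x)^2 = (aph * w ep x)^2" by (simp add: power_mult_distrib)
   also have "... <= B^2"
   proof (intro power_mono)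
    have "aph * w ep x <= aph * b" using W(4)[of x] al by (intro mult_left_mono) (auto simp: b_def)
    also have "... <= B" using Bb b0 al mult_nonneg_nonneg[of aph "b^2"] by (simp add: add_increasing2)
    finally show "aph * w ep x <= B" .
   qed (use al W(2)[of x] in simp)
   finally show ?thesis using gwb[of x] by linarith
  qed
  have kD: "D12 UNIV (%x. w ep x * U x) (k ep)" unfolding k_def
   by (rule D12_mult[OF N U(1) W(1) wB gB]) (rule test_fun_mult[OF _ W(1)])
  have s2: "smooth_on UNIV (%x. w ep x * w ep x)" by (rule smooth_mult[OF W(1) W(1)])
  have g2: "grad (%x. w ep x * w ep x) x = (2 * w ep x) *R grad (w ep) x" for x
   unfolding grad_mult[OF W(1) W(1)] scaleR_add_left[symmetric] by simp
  define h where "h = (%x. (w ep x * w ep x) *R G x + U x *R grad (%x. w ep x * w ep x) x)"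
  have hD: "D12 UNIV (%x. (w ep x * w ep x) * U x) h" unfolding h_def
  proof (rule D12_mult[OF N U(1) s2, where B=B])
   fix x
   have wb: "0 < w ep x" "w ep x <= b" using W(2,4)[of x] by (auto simp: b_def)
   have "w ep x * w ep x <= b * b" using wb by (intro mult_mono) auto
   also have "... <= B" using Bb b0 al mult_nonneg_nonneg[of aph "b^2"] mult_nonneg_nonneg[of aph b] by (simp add: power2_eq_square add_increasing)
   finally show "abs (w ep x * w ep x) <= B" using wb by simp
   have "(norm (grad (%x. w ep x * w ep x) x))^2 * (1 + (norm x)^2) = (2 * w ep x)^2 * ((norm (grad (w ep) x))^2 * (1 + (norm x)^2))"
    unfolding g2 by (simp add: power_mult_distrib)
   also have "... <= (2 * w ep x)^2 * (aph^2 * (w ep x)^2)" by (intro mult_left_mono gwb) simp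
   also have "... = (2 * aph * (w ep x * w ep x))^2" by (simp add: power_mult_distrib)
   also have "... <= B^2"
   proof (intro power_mono)
    have "2 * aph * (w ep x * w ep x) <= 2 * aph * b^2" using \<open>w ep x * w ep x <= b * b\<close> al by (simp add: power2_eq_square)
    also have "... <= B" using Bb b0 al mult_nonneg_nonneg[of aph b] by (simp add: add_increasing)
    finally show "2 * aph * (w ep x * w ep x) <= B" .
   qed (use al wb in simp)
   finally show "(norm (grad (%x. w ep x * w ep x) x))^2 * (1 + (norm x)^2) <= B^2" .
  qed (rule test_fun_mult[OF _ s2])
  have mG: "G : bmeas lborel" "h : bmeas lborel" using D12_meas(2)[OF U(1)] D12_meas(2)[OF hD] by simp_all
  note wm[measurable] = cont_borel[OF has_gradD(1)[OF smooth_has_grad[OF W(1)]]] cont_borel[OF has_gradD(2)[OF smooth_has_grad[OF W(1)]]]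
  have w2i: "integrable lborel (%x. (w ep x)^2 * abs (U x) powr ?r)"
  proof (rule L1_integrable_bound[OF integrable_mult_right[OF Ui, of "b^2"]])
   have "(w ep x)^2 <= b^2" for x using W(2,4)[of x] by (intro power_mono) (auto simp: b_def)
   then show "AE x in lborel. norm ((w ep x)^2 * abs (U x) powr ?r) <= norm (b^2 * abs (U x) powr ?r)" by (auto intro!: mult_right_mono)
  qed measurable
  have EL: "(LBINT x. G x \<bullet> h x) = ?S * (LBINT x. (w ep x)^2 * abs (U x) powr ?r)"
  proof -
   have "sgn (U x) * abs (U x) powr (?r - 1) * ((w ep x * w ep x) * U x) = (w ep x)^2 * abs (U x) powr ?r" for x
   proof -
    have "sgn (U x) * abs (U x) powr (?r - 1) * ((w ep x * w ep x) * U x) = (w ep x)^2 * (abs (U x) * abs (U x) powr (?r - 1))"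
     by (simp add: sgn_if power2_eq_square)
    also have "abs (U x) * abs (U x) powr (?r - 1) = abs (U x) powr ?r" using powr_mult_base[of "abs (U x)" "?r - 1"] by simp
    finally show ?thesis .
   qed
   then show ?thesis using Sobolev_EL[OF N U hD] by simp
  qed
  note HV = D12_Hardy[OF N kD]
  have gUb: "(norm (grad (w ep) x))^2 * (U x)^2 <= aph^2 * ((w ep x * U x)^2 / (1 + (norm x)^2))" for x
  proof -
   have p: "1 + (norm x)^2 > 0" using zero_le_power2[of "norm x"] by linarith
   have "(norm (grad (w ep) x))^2 <= aph^2 * (w ep x)^2 / (1 + (norm x)^2)" using gwb[of x] p by (simp add: pos_le_divide_eq)
   from mult_right_mono[OF this, of "(U x)^2"] show ?thesis by (simp add: power_mult_distrib)
  qed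
  have gUi: "integrable lborel (%x. (norm (grad (w ep) x))^2 * (U x)^2)"
   by (rule L1_integrable_bound[OF integrable_mult_right[OF HV(1), of "aph^2"]])
    (use gUb in \<open>auto intro!: AE_I2 order_trans[OF _ abs_ge_self]\<close>)
  have "(norm (k ep x))^2 = G x \<bullet> h x + (norm (grad (w ep) x))^2 * (U x)^2" for x
   unfolding power2_norm_eq_inner k_def h_def g2 by (simp add: inner_simps inner_commute[of "grad (w ep) x" "G x"] power2_eq_square algebra_simps)
  then have "en (k ep) = (LBINT x. G x \<bullet> h x) + (LBINT x. (norm (grad (w ep) x))^2 * (U x)^2)"
   by (simp add: L1_integral_add[OF L2_inner(1)[OF mG D12_int[OF U(1)] D12_int[OF hD]] gUi])
  also have "(LBINT x. (norm (grad (w ep) x))^2 * (U x)^2) <= H * en (k ep)"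
  proof -
   have "(LBINT x. (norm (grad (w ep) x))^2 * (U x)^2) <= (LBINT x. aph^2 * ((w ep x * U x)^2 / (1 + (norm x)^2)))"
    by (intro integral_mono gUi integrable_mult_right HV(1) gUb)
   also have "... <= aph^2 * (4 / (?N - 2)^2 * en (k ep))" unfolding integral_mult_right_zero by (intro mult_left_mono HV(2)) simp
   finally show ?thesis by (simp add: H_def mult.assoc)
  qed
  finally have k1: "en (k ep) <= ?S * (LBINT x. (w ep x)^2 * abs (U x) powr ?r) + H * en (k ep)" unfolding EL by simp
  define C where "C = - cball (0::real^'n) (real n0)"
  have Cm[measurable]: "C : sets borel" by (simp add: C_def)
  let ?f = "%x. abs (w ep x * U x) powr ?r" and ?h = "%x. indicator C x * abs (U x) powr ?r"
  have hi: "integrable lborel ?h" unfolding C_def by (rule tli)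
  have fi: "integrable lborel ?f" by (rule D12_Sobolev(1)[OF N kD])
  have fm: "?f : bmeas lborel" "?h : bmeas lborel" by measurable
  note HT = Holder_two[OF fm fi hi, of "2 / ?r"]
  \<comment> \<open>Inside the ball the weight is bounded and contributes to Q; outside, the
    integrand is factored for Hoelder's inequality into powers of |wU|^r and of |U|^r on the
    tail.\<close>
  have split: "(w ep x)^2 * abs (U x) powr ?r <= (1 + (real n0)^2) powr aph * abs (U x) powr ?r + ?f x powr (2 / ?r) * ?h x powr (1 - 2 / ?r)" for x
  proof (cases "x : C")
   case True
   have "?f x powr (2 / ?r) * ?h x powr (1 - 2 / ?r) = (w ep x)^2 * abs (U x) powr ?r"
   proof (cases "U x = 0")
    case False
    have "?f x powr (2 / ?r) = abs (w ep x * U x) powr 2" using r2 by (simp add: powr_powr)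
    moreover have "(abs (U x) powr ?r) powr (1 - 2 / ?r) = abs (U x) powr (?r - 2)" using r2 by (simp add: powr_powr right_diff_distrib)
    moreover have "abs (U x) powr ?r = abs (U x) powr 2 * abs (U x) powr (?r - 2)" unfolding powr_add[symmetric] by simp
    ultimately show ?thesis using True by (simp add: abs_mult powr_mult powr_numeral)
   qed (use r2 in simp)
   then show ?thesis by simp
  next
   case False
   then have "(norm x)^2 <= (real n0)^2" unfolding C_def by (intro power_mono) auto
   have "(w ep x)^2 <= ((1 + (norm x)^2) powr (aph / 2))^2" using W(2,3)[of x] by (intro power_mono) auto
   also have "... = (1 + (norm x)^2) powr aph" unfolding power2_eq_square powr_add[symmetric] by simp
   also have "... <= (1 + (real n0)^2) powr aph" using \<open>(norm x)\<^sup>2 <= (real n0)^2\<close> al by (intro powr_mono2) auto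
   finally have "(w ep x)^2 * abs (U x) powr ?r <= (1 + (real n0)^2) powr aph * abs (U x) powr ?r" by (rule mult_right_mono) simp
   then show ?thesis by (simp add: add_increasing2)
  qed
  have HTi: "integrable lborel (%x. ?f x powr (2 / ?r) * ?h x powr (1 - 2 / ?r))" using r2 by (intro HT(1)) auto
  have "(LBINT x. (w ep x)^2 * abs (U x) powr ?r) <= (LBINT x. (1 + (real n0)^2) powr aph * abs (U x) powr ?r + ?f x powr (2 / ?r) * ?h x powr (1 - 2 / ?r))"
   by (intro integral_mono w2i L1_integrable_add integrable_mult_right Ui HTi split)
  also have "... = (1 + (real n0)^2) powr aph + (LBINT x. ?f x powr (2 / ?r) * ?h x powr (1 - 2 / ?r))"
   using Ui HTi U(2) by simp
  also have "(LBINT x. ?f x powr (2 / ?r) * ?h x powr (1 - 2 / ?r)) <= (LBINT x. ?f x) powr (2 / ?r) * (LBINT x. ?h x) powr (1 - 2 / ?r)"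
   using r2 by (intro HT(2)) auto
  also have "... <= (LBINT x. ?f x) powr (2 / ?r) * ((1 - H) / 2)"
  proof (intro mult_left_mono)
   have "(LBINT x. ?h x) powr (1 - 2 / ?r) <= kp powr (1 - 2 / ?r)"
    using n0 p0 by (intro powr_mono2) (auto simp: tl_def C_def)
   then show "(LBINT x. ?h x) powr (1 - 2 / ?r) <= (1 - H) / 2" by (simp add: kp)
  qed simp
  finally have "?S * (LBINT x. (w ep x)^2 * abs (U x) powr ?r) <= ?S * ((1 + (real n0)^2) powr aph + (LBINT x. ?f x) powr (2 / ?r) * ((1 - H) / 2))"
   using S0 by simp
  also have "... = Q + (?S * (LBINT x. ?f x) powr (2 / ?r)) * ((1 - H) / 2)" by (simp add: Q_def algebra_simps)
  also have "... <= Q + en (k ep) * ((1 - H) / 2)" using H by (intro add_left_mono mult_right_mono D12_Sobolev(2)[OF N kD]) auto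
  finally have "en (k ep) <= Q + en (k ep) * ((1 - H) / 2) + H * en (k ep)" using k1 by linarith
  then have "en (k ep) * ((1 - H) / 2) <= Q" by (simp add: field_simps)
  then have "en (k ep) <= Q / ((1 - H) / 2)" using H by (subst pos_le_divide_eq) auto
  then show ?thesis using kD by blast
 qed
 \<comment> \<open>The energy bound does not depend on ep, so Fatou's lemma removes the truncation,
   once under Hardy's and once under Sobolev's inequality.\<close>
 define ep where "ep = (%n. inverse (real (Suc n)))"
 have e: "0 < ep n" "ep n <= 1" for n by (auto simp: ep_def inverse_le_1_iff)
 define C1 where "C1 = Q / ((1 - H) / 2)"
 note mD = conjunct1[OF main[OF e]] and mE = conjunct2[OF main[OF e], folded C1_def]
 have wl: "(%n. w (ep n) x) ~~> (1 + (norm x)^2) powr (aph / 2)" for x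
 proof -
  have "(%n. w (ep n) x) ~~> (1 + (norm x)^2) powr (aph / 2) * (1 + 0 * (norm x)^2) powr (- (aph / 2))"
   unfolding w_def ep_def by (intro tendsto_intros LIMSEQ_inverse_real_of_nat) auto
  then show ?thesis by simp
 qed
 have pn: "1 + (norm x)^2 > 0" for x :: "real^'n" using zero_le_power2[of "norm x"] by linarith
 show "integrable lborel (%x. (1 + (norm x)^2) powr (aph - 1) * (U x)^2)"
 proof (rule fatou_bound(1)[where f="%n x. (w (ep n) x * U x)^2 / (1 + (norm x)^2)"])
  show "integrable lborel (%x. (w (ep n) x * U x)^2 / (1 + (norm x)^2))" for n by (rule D12_Hardy(1)[OF N mD])
  have "4 / (?N - 2)^2 * en (k (ep n)) <= 4 / (?N - 2)^2 * C1" for n by (intro mult_left_mono mE) simp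
  then show "(LBINT x. (w (ep n) x * U x)^2 / (1 + (norm x)^2)) <= 4 / (?N - 2)^2 * C1" for n
   using D12_Hardy(2)[OF N mD, of n] order_trans by blast
  show "AE x in lborel. (%n. (w (ep n) x * U x)^2 / (1 + (norm x)^2)) ~~> (1 + (norm x)^2) powr (aph - 1) * (U x)^2"
  proof (rule AE_I2)
   fix x
   have "(%n. (w (ep n) x * U x)^2 / (1 + (norm x)^2)) ~~> ((1 + (norm x)^2) powr (aph / 2) * U x)^2 / (1 + (norm x)^2)"
    using pn[of x] by (intro tendsto_intros wl) auto
   also have "((1 + (norm x)^2) powr (aph / 2) * U x)^2 = (1 + (norm x)^2) powr aph * (U x)^2"
    unfolding power_mult_distrib unfolding power2_eq_square[of "_ powr _"] powr_add[symmetric] by simp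
   also have "... / (1 + (norm x)^2) = (1 + (norm x)^2) powr (aph - 1) * (U x)^2" using pn[of x] by (simp add: powr_diff)
   finally show "(%n. (w (ep n) x * U x)^2 / (1 + (norm x)^2)) ~~> (1 + (norm x)^2) powr (aph - 1) * (U x)^2" .
  qed
  show "(%x. (1 + (norm x)^2) powr (aph - 1) * (U x)^2) : bmeas lborel" by measurable
 qed simp
 show "integrable lborel (%x. (1 + (norm x)^2) powr (aph * ?r / 2) * abs (U x) powr ?r)"
 proof (rule fatou_bound(1)[where f="%n x. abs (w (ep n) x * U x) powr ?r"])
  show "integrable lborel (%x. abs (w (ep n) x * U x) powr ?r)" for n by (rule D12_Sobolev(1)[OF N mD])
  show "pw ?r (%x. w (ep n) x * U x) <= (C1 / ?S) powr (?r / 2)" for n by (rule D12_pw_bounded[OF N mD mE])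
  show "AE x in lborel. (%n. abs (w (ep n) x * U x) powr ?r) ~~> (1 + (norm x)^2) powr (aph * ?r / 2) * abs (U x) powr ?r"
  proof (rule AE_I2)
   fix x
   have "(%n. abs (w (ep n) x * U x) powr ?r) ~~> abs ((1 + (norm x)^2) powr (aph / 2) * U x) powr ?r"
    using r2 by (intro tendsto_powr2 tendsto_intros wl) auto
   also have "abs ((1 + (norm x)^2) powr (aph / 2) * U x) powr ?r = (1 + (norm x)^2) powr (aph * ?r / 2) * abs (U x) powr ?r" by (simp add: abs_mult powr_mult powr_powr)
   finally show "(%n. abs (w (ep n) x * U x) powr ?r) ~~> (1 + (norm x)^2) powr (aph * ?r / 2) * abs (U x) powr ?r" .
  qed
  show "(%x. (1 + (norm x)^2) powr (aph * ?r / 2) * abs (U x) powr ?r) : bmeas lborel" by measurable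
 qed simp
qed

section \<open>Minimization on the Nehari manifold\<close>

text \<open>Bernoulli's inequality with exponent k/j. It compares the terms of different degree in
  the energy along a ray.\<close>

lemma powr_quotient_mono:
 fixes t j k :: real assumes "t > 0" "0 < j" "j <= k"
 shows "(t powr j - 1) / j <= (t powr k - 1) / k"
proof -
 have "1 + k / j * (t powr j - 1) <= (1 + (t powr j - 1)) powr (k / j)"
  using assms by (intro Bernoulli_powr(1)) (auto simp: le_divide_eq)
 also have "... = t powr k" using assms by (simp add: powr_powr)
 finally have "k * ((t powr j - 1) / j) <= t powr k - 1" by (simp add: field_simps)
 then show ?thesis using assms by (simp add: le_divide_eq mult.commute)
qed

lemma powr_interpolate:
 fixes tau P r :: real assumes "tau > 0" "2 < P" "P < r"
 obtains K where "K > 0" "!!y::real. abs y powr P <= tau * y^2 + K * abs y powr r"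
proof -
 define l where "l = tau powr (1 / (P - 2))"
 have l: "l > 0" "l powr (P - 2) = tau" using assms by (auto simp: l_def powr_powr)
 have "abs y powr P <= tau * y^2 + l powr (P - r) * abs y powr r" for y :: real
 proof (cases "abs y <= l")
  case True
  have "abs y powr P = abs y powr (P - 2) * abs y powr 2" unfolding powr_add[symmetric] by simp
  also have "... <= tau * abs y powr 2" unfolding l(2)[symmetric] using True assms by (intro mult_right_mono powr_mono2) auto
  also have "abs y powr 2 = y^2" by (cases "y = 0") (auto simp: powr_numeral)
  finally show ?thesis by (simp add: add_increasing2)
 next
  case False
  have "abs y powr P = abs y powr (P - r) * abs y powr r" unfolding powr_add[symmetric] by simp
  also have "... <= l powr (P - r) * abs y powr r" using False l assms by (intro mult_right_mono powr_mono2') auto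
  finally show ?thesis using assms by (simp add: add_increasing)
 qed
 then show thesis using that[of "l powr (P - r)"] l by simp
qed

text \<open>The least Dirichlet energy a that can be lost together with a critical integral d >= a:
  inserting d >= a into the Sobolev inequality leaves S <= a^(1-2/r).\<close>

lemma critical_energy_lower_bound:
 fixes a d S r :: real assumes "S > 0" "r > 2" "a > 0" "a <= d" "S * d powr (2 / r) <= a"
 shows "S powr (r / (r - 2)) <= a"
proof -
 have "S * a powr (2 / r) <= S * d powr (2 / r)" using assms by (intro mult_left_mono powr_mono2) auto
 also note assms(5)
 also have "a = a powr (1 - 2 / r) * a powr (2 / r)" unfolding powr_add[symmetric] using assms by simp
 finally have "S * a powr (2 / r) <= a powr (1 - 2 / r) * a powr (2 / r)" .
 then have "S <= a powr (1 - 2 / r)" using assms by simp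
 then have "S powr (r / (r - 2)) <= (a powr (1 - 2 / r)) powr (r / (r - 2))" using assms by (intro powr_mono2) auto
 also have "... = a" using assms by (simp add: powr_powr left_diff_distrib diff_divide_distrib[symmetric])
 finally show ?thesis .
qed

lemma D12_outside:
 assumes "D12 Om u g" shows "AE x in lborel. x \<notin> Om --> u x = 0"
proof -
 obtain ph where ph: "!!k. test_fun Om (ph k)" "AE x in lborel. (%k. ph k x) ~~> u x" using assms unfolding D12_def by blast
 have z: "ph k x = 0" if "x \<notin> Om" for k x
  by (rule test_fun_obtain[OF ph(1)[of k]]) (use that in blast)
 show ?thesis using ph(2)
 proof eventually_elim
  case (elim x)
  show ?case
  proof
   assume "x \<notin> Om"
   then have "(%k. 0) ~~> u x" using elim z by simp
   then show "u x = 0" using LIMSEQ_unique[OF _ tendsto_const] by blast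
  qed
 qed
qed

text \<open>\<open>muu\<close> stands for |x|^-s dx and P for p+1. The singular weight enters only
  through null sets and the finiteness of its integral for powers of test functions.\<close>

locale nehari =
 fixes Om :: "(real^'n) set" and muu :: "(real^'n) measure" and q P :: real
 assumes N: "CARD('n) >= 3" and bdd: "bounded Om" and sets_muu [simp, measurable_cong]: "sets muu = sets borel"
  and ac: "!!Q. AE x in lborel. Q x ==> AE x in muu. Q x"
  and exps: "2 < q" "q < P" "P < crit TYPE('n)"
  and test_muu: "!!ph. test_fun Om ph ==> integrable muu (%x. abs (ph x) powr q)"
begin

definition bq :: "(real^'n => real) => real" where "bq u = (\<integral>x. abs (u x) powr q \<partial>muu)"

text \<open>The finite weighted integral is a membership condition, in place of a Hardy-Sobolev
  inequality; it survives limits by Fatou's lemma because this integral is bounded along minimizing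
  sequences.\<close>

definition X :: "(real^'n => real) => (real^'n => real^'n) => bool" where
 "X u g \<longleftrightarrow> D12 Om u g & integrable muu (%x. abs (u x) powr q)"

text \<open>The energy at the point t of the ray through u, as a function of the four integrals of
  u.\<close>

definition Psi :: "real => real => real => real => real => real" where
 "Psi a b c d t = a * t powr 2 / 2 + b * t powr q / q - c * t powr P / P - d * t powr crit TYPE('n) / crit TYPE('n)"

text \<open>The derivative of the energy along the ray through u, taken at u itself.\<close>

definition J :: "(real^'n => real) => (real^'n => real^'n) => real" where
 "J u g = en g + bq u - pw P u - pw (crit TYPE('n)) u"

text \<open>The energy minus J/P. It agrees with the energy where J = 0, but the P-term has
  cancelled and all coefficients are positive; this makes it coercive and additive under the
  splitting of a sequence.\<close>

definition En :: "(real^'n => real) => (real^'n => real^'n) => real" where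
 "En u g = (1/2 - 1/P) * en g + (1/q - 1/P) * bq u + (1/P - 1/crit TYPE('n)) * pw (crit TYPE('n)) u"

definition Neh :: "(real^'n => real) => (real^'n => real^'n) => bool" where
 "Neh u g \<longleftrightarrow> X u g & en g > 0 & J u g = 0"

definition m :: real where "m = Inf {En u g | u g. Neh u g}"

lemma r2: "crit TYPE('n) > 2" by (rule crit_gt_2[OF N])
lemma S0: "Sob TYPE('n) > 0" by (rule Sob_props(1)[OF N])
lemma coef: "1/2 - 1/P > 0" "1/q - 1/P > 0" "1/P - 1/crit TYPE('n) > 0" using exps r2 by (auto simp: field_simps)

lemma bq_nonneg: "bq u >= 0" by (simp add: bq_def)

lemma XD: assumes "X u g"
 shows "D12 Om u g" "integrable muu (%x. abs (u x) powr q)" "u : bmeas borel" "u : bmeas muu"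
  "integrable lborel (%x. abs (u x) powr crit TYPE('n))"
 using assms D12_meas(1)[of Om u g] D12_Sobolev(1)[OF N, of Om u g] by (auto simp: X_def cong: measurable_cong_sets)

lemma D12_lower:
 assumes u: "D12 Om u g" and K: "Om <= cball 0 R" and t: "0 < t" "t <= crit TYPE('n)"
 shows "integrable lborel (%x. abs (u x) powr t)" "pw t u = (LBINT x. indicator (cball 0 R) x * abs (u x) powr t)"
proof -
 note [measurable] = D12_meas(1)[OF u]
 have i: "integrable lborel (%x. indicator (cball 0 R) x * abs (u x) powr t)"
  by (rule local_powr_integrable[OF _ _ D12_Sobolev(1)[OF N u] emeasure_lborel_cball_finite t]) auto
 have e: "AE x in lborel. abs (u x) powr t = indicator (cball 0 R) x * abs (u x) powr t"
  using D12_outside[OF u] by eventually_elim (use K t in \<open>auto simp: indicator_def\<close>)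
 have ms: "(%x. indicator (cball 0 R) x * abs (u x) powr t) : bmeas lborel" using i by blast
 have mu: "(%x. abs (u x) powr t) : bmeas lborel" by measurable
 show "integrable lborel (%x. abs (u x) powr t)" using integrable_cong_AE[OF mu ms e] i by simp
 show "pw t u = (LBINT x. indicator (cball 0 R) x * abs (u x) powr t)" by (rule integral_cong_AE[OF mu ms e])
qed

lemma cball_R: obtains R where "R > 0" "Om <= cball 0 R"
 proof -
 obtain R where "0 < R" "Om <= ball 0 R" using bounded_subset_ballD[OF bdd] by blast
 then show thesis using that[of R] by (auto simp: subset_eq less_imp_le)
qed

lemma pwP_int: "D12 Om u g ==> integrable lborel (%x. abs (u x) powr P)"
 by (rule cball_R) (use D12_lower(1)[of u g _ P] exps in auto)

lemma energy_pos: assumes "D12 Om u g" shows "en g > 0 \<longleftrightarrow> \<not> (AE x in lborel. u x = 0)"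
proof
 assume "en g > 0" then show "\<not> (AE x in lborel. u x = 0)" using D12_zero[OF N assms] by auto
next
 assume n: "\<not> (AE x in lborel. u x = 0)"
 show "en g > 0"
 proof (rule ccontr)
  assume "\<not> en g > 0"
  then have e0: "en g = 0" by (simp add: not_less antisym)
  have "pw (crit TYPE('n)) u <= (en g / Sob TYPE('n)) powr (crit TYPE('n) / 2)" by (rule D12_Sobolev(3)[OF N assms])
  then have "pw (crit TYPE('n)) u <= 0" unfolding e0 using r2 by simp
  then have "pw (crit TYPE('n)) u = 0" by (simp add: antisym)
  then show False using n pw_pos_iff[OF D12_meas(1)[OF assms] D12_Sobolev(1)[OF N assms]] by simp
 qed
qed

lemma X_scale: assumes "X u g" shows "X (%x. t * u x) (%x. t *R g x)"
 unfolding X_def using D12_scale[OF XD(1)[OF assms], of t] integrable_mult_right[OF XD(2)[OF assms], of "abs t powr q"]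
 by (simp add: abs_mult powr_mult)

lemma scaled_values:
 assumes "t > 0"
 shows "en (%x. t *R g x) = t powr 2 * en g" "bq (%x. t * u x) = t powr q * bq u" "pw k (%x. t * u x) = t powr k * pw k u"
 unfolding en_scale pw_scale bq_def using assms by (simp_all add: powr_numeral abs_mult powr_mult)

text \<open>The P-term is interpolated between u^2 and |u|^r. Half of the energy absorbs the
  quadratic part, the weighted term has the favourable sign, and Sobolev's inequality leaves en <= M
  en^(r/2), which keeps en away from 0.\<close>

lemma Nehari_lower_bound:
 obtains dlt where "dlt > 0" "!!u g. X u g ==> en g > 0 ==> J u g <= 0 ==> dlt <= en g"
proof -
 obtain R where R: "R > 0" "Om <= cball 0 R" by (rule cball_R)
 \<comment> \<open>A Poincare constant for \<open>Om\<close>: there 1+|x|^2 <= 1+R^2, so Hardy's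
   inequality bounds the L^2 norm.\<close>
 define H where "H = (1 + R^2) * (4 / (real CARD('n) - 2)^2)"
 have H0: "H > 0" using N by (simp add: H_def add_pos_nonneg)
 obtain K where K: "K > 0" "!!y. abs y powr P <= (1 / (2 * H)) * y^2 + K * abs y powr crit TYPE('n)"
  using powr_interpolate[of "1 / (2 * H)" P "crit TYPE('n)"] H0 exps by auto
 define M where "M = 2 * (K + 1) * (1 / Sob TYPE('n)) powr (crit TYPE('n) / 2)"
 have M0: "M > 0" using K S0 by (simp add: M_def)
 define dlt where "dlt = (1 / M) powr (1 / (crit TYPE('n) / 2 - 1))"
 have "dlt <= en g" if X: "X u g" "en g > 0" "J u g <= 0" for u g
 proof -
  note D = XD(1)[OF X(1)]
  note Ha = D12_Hardy[OF N D]
  note [measurable] = XD(3)[OF X(1)]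
  have "AE x in lborel. abs (u x) powr P <= (1 / (2 * H)) * ((1 + R^2) * ((u x)^2 / (1 + (norm x)^2))) + K * abs (u x) powr crit TYPE('n)"
   using D12_outside[OF D]
  proof eventually_elim
   case (elim x)
   have p: "1 + (norm x)^2 > 0" using zero_le_power2[of "norm x"] by linarith
   have "(u x)^2 <= (1 + R^2) * ((u x)^2 / (1 + (norm x)^2))"
   proof (cases "x : Om")
    case True
    then have "norm x <= R" using R(2) by (auto simp: subset_eq)
    then have "(norm x)^2 <= R^2" by (intro power_mono) auto
    then have "(u x)^2 * (1 + (norm x)^2) <= (u x)^2 * (1 + R^2)" by (intro mult_left_mono) auto
    then show ?thesis using p by (simp add: pos_le_divide_eq mult.commute)
   qed (use elim in simp)
   then have "(1 / (2 * H)) * (u x)^2 <= (1 / (2 * H)) * ((1 + R^2) * ((u x)^2 / (1 + (norm x)^2)))" using H0 by (intro mult_left_mono) auto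
   then show ?case using K(2)[of "u x"] by linarith
  qed
  then have "pw P u <= (LBINT x. (1 / (2 * H)) * ((1 + R^2) * ((u x)^2 / (1 + (norm x)^2))) + K * abs (u x) powr crit TYPE('n))"
   by (intro integral_mono_AE pwP_int[OF D] L1_integrable_add integrable_mult_right Ha(1) XD(5)[OF X(1)])
  also have "... = (1 / (2 * H)) * ((1 + R^2) * (LBINT x. (u x)^2 / (1 + (norm x)^2))) + K * pw (crit TYPE('n)) u"
   unfolding integral_mult_right_zero[symmetric]
   by (intro L1_integral_add integrable_mult_right Ha(1) XD(5)[OF X(1)])
  also have "... <= (1 / (2 * H)) * ((1 + R^2) * (4 / (real CARD('n) - 2)^2 * en g)) + K * pw (crit TYPE('n)) u"
   using H0 by (intro add_right_mono mult_left_mono Ha(2)) auto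
  also have "(1 + R^2) * (4 / (real CARD('n) - 2)^2 * en g) = H * en g" by (simp add: H_def)
  also have "(1 / (2 * H)) * (H * en g) = en g / 2" using H0 by simp
  finally have c: "pw P u <= en g / 2 + K * pw (crit TYPE('n)) u" .
  have "en g <= pw P u + pw (crit TYPE('n)) u" using X(3) bq_nonneg[of u] by (simp add: J_def)
  then have "en g <= 2 * (K + 1) * pw (crit TYPE('n)) u" using c by (simp add: algebra_simps)
  also have "... <= 2 * (K + 1) * (en g / Sob TYPE('n)) powr (crit TYPE('n) / 2)" using K D12_Sobolev(3)[OF N D] by (intro mult_left_mono) auto
  also have "... = M * en g powr (crit TYPE('n) / 2)" using S0 by (simp add: M_def powr_divide)
  also have "en g powr (crit TYPE('n) / 2) = en g powr (crit TYPE('n) / 2 - 1) * en g" using X(2) powr_add[of "en g" "crit TYPE('n) / 2 - 1" 1] by simp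
  finally have "1 * en g <= (M * en g powr (crit TYPE('n) / 2 - 1)) * en g" by (simp add: mult.assoc)
  then have "1 <= M * en g powr (crit TYPE('n) / 2 - 1)" using X(2) by (simp only: mult_le_cancel_right_pos)
  then have "1 / M <= en g powr (crit TYPE('n) / 2 - 1)" using X(2) M0 by (simp add: field_simps)
  then have "dlt <= (en g powr (crit TYPE('n) / 2 - 1)) powr (1 / (crit TYPE('n) / 2 - 1))" unfolding dlt_def using M0 r2 by (intro powr_mono2) auto
  then show ?thesis using X(2) r2 by (simp add: powr_powr)
 qed
 moreover have "dlt > 0" using M0 by (simp add: dlt_def)
 ultimately show thesis using that by blast
qed

text \<open>With t^2 divided out, the remaining exponents are positive, so the function is
  continuous on [0, t1] with value a > 0 at 0, and the intermediate value theorem applies.\<close>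

lemma ray_root:
 assumes a: "a > 0" and h: "0 < t1" "a + b * t1 powr (q - 2) - c * t1 powr (P - 2) - d * t1 powr (crit TYPE('n) - 2) <= 0"
 obtains t where "0 < t" "t <= t1" "a + b * t powr (q - 2) - c * t powr (P - 2) - d * t powr (crit TYPE('n) - 2) = 0"
proof -
 define f where "f = (%t. a + b * t powr (q - 2) - c * t powr (P - 2) - d * t powr (crit TYPE('n) - 2))"
 have "continuous_on {0..t1} f" unfolding f_def using exps r2 by (intro continuous_intros continuous_on_powr') auto
 moreover have f0: "f 0 > 0" using a by (simp add: f_def)
 ultimately obtain t where "0 <= t" "t <= t1" "f t = 0" using IVT2'[of f t1 0 0] h by (auto simp: f_def)
 moreover have "t ~= 0" using calculation f0 by auto
 ultimately show thesis using that[of t] by (simp add: f_def)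
qed

lemma J_ray:
 assumes "t > 0"
 shows "J (%x. t * u x) (%x. t *R g x) = t powr 2 * (en g + bq u * t powr (q - 2) - pw P u * t powr (P - 2) - pw (crit TYPE('n)) u * t powr (crit TYPE('n) - 2))"
proof -
 have e: "t powr k = t powr 2 * t powr (k - 2)" for k unfolding powr_add[symmetric] by simp
 show ?thesis unfolding J_def scaled_values[OF assms] e[of q] e[of P] e[of "crit TYPE('n)"] by (simp add: algebra_simps)
qed

lemma Neh_ray:
 assumes "X u g" "en g > 0" "t > 0" "en g + bq u * t powr (q - 2) - pw P u * t powr (P - 2) - pw (crit TYPE('n)) u * t powr (crit TYPE('n) - 2) = 0"
 shows "Neh (%x. t * u x) (%x. t *R g x)"
 unfolding Neh_def J_ray[OF assms(3)] scaled_values(1)[OF assms(3)] assms(4) using X_scale[OF assms(1)] assms by simp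

lemma En_eq: "En u g = Psi (en g) (bq u) (pw P u) (pw (crit TYPE('n)) u) 1 - J u g / P"
 using exps r2 by (simp add: En_def Psi_def J_def field_simps)

lemma En_nonneg: "En u g >= 0" unfolding En_def using coef bq_nonneg[of u] by (intro add_nonneg_nonneg mult_nonneg_nonneg) auto

lemma m_le: assumes "Neh u g" shows "m <= En u g"
 unfolding m_def using assms by (intro cInf_lower bdd_belowI[of _ 0]) (auto intro: En_nonneg)

lemma m_pos: assumes "Neh u0 g0" shows "m > 0"
proof -
 obtain dlt where d: "dlt > 0" "!!u g. X u g ==> en g > 0 ==> J u g <= 0 ==> dlt <= en g" by (rule Nehari_lower_bound) (rule that)
 have "(1/2 - 1/P) * dlt <= En u g" if "Neh u g" for u g
 proof -
  have "dlt <= en g" using d(2)[of u g] that by (simp add: Neh_def)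
  then have "(1/2 - 1/P) * dlt <= (1/2 - 1/P) * en g" using coef by (intro mult_left_mono) auto
  moreover have "0 <= (1/q - 1/P) * bq u" "0 <= (1/P - 1/crit TYPE('n)) * pw (crit TYPE('n)) u" using coef bq_nonneg[of u] by auto
  ultimately show ?thesis unfolding En_def by linarith
 qed
 then have "(1/2 - 1/P) * dlt <= m" unfolding m_def using assms by (intro cInf_greatest) auto
 moreover have "(1/2 - 1/P) * dlt > 0" using d coef by simp
 ultimately show ?thesis by linarith
qed

text \<open>If J <= 0, the ray meets the manifold at some t <= 1, and there \<open>En\<close> is at
  most t^2 En u <= t^2 m. Since m > 0, this forces t = 1. It lets a weak limit, or |u|, be
  recognized as a minimizer from inequalities alone.\<close>

lemma below_level_attained:
 assumes X: "X u g" "en g > 0" "J u g <= 0" and le: "En u g <= m" and ne: "Neh u0 g0"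
 shows "Neh u g" "En u g = m"
proof -
 have h1: "en g + bq u * 1 powr (q - 2) - pw P u * 1 powr (P - 2) - pw (crit TYPE('n)) u * 1 powr (crit TYPE('n) - 2) <= 0" using X(3) by (simp add: J_def)
 obtain t where t: "0 < t" "t <= 1" "en g + bq u * t powr (q - 2) - pw P u * t powr (P - 2) - pw (crit TYPE('n)) u * t powr (crit TYPE('n) - 2) = 0"
  by (rule ray_root[OF X(2) _ h1]) (simp, rule that)
 note Nt = Neh_ray[OF X(1,2) t(1,3)]
 have tk: "t powr k * y <= t powr 2 * y" if "k >= 2" "y >= 0" for k y :: real using t that by (intro mult_right_mono powr_mono') auto
 have "m <= En (%x. t * u x) (%x. t *R g x)" by (rule m_le[OF Nt])
 also have "... <= t powr 2 * En u g"
 proof -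
  have "0 <= (1/q - 1/P) * bq u" "0 <= (1/P - 1/crit TYPE('n)) * pw (crit TYPE('n)) u" using coef bq_nonneg[of u] by auto
  from tk[OF _ this(1), of q] tk[OF _ this(2), of "crit TYPE('n)"] show ?thesis
   unfolding En_def scaled_values[OF t(1)] using exps r2 by (simp add: distrib_left mult.left_commute)
 qed
 also have "... <= t powr 2 * m" using le by (intro mult_left_mono) auto
 finally have "1 <= t powr 2" using m_pos[OF ne] by simp
 then have "t = 1" using t powr_less_mono2[of 2 t 1] by (cases "t < 1") auto
 then show n: "Neh u g" using Nt by simp
 then show "En u g = m" using m_le[OF n] le by simp
qed

text \<open>The weak limit v and the part lost share the level m additively. If v is nonzero with J
  v <= 0, it is a minimizer. Otherwise the lost part satisfies av + bv <= dv with av > 0 and alone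
  costs the threshold energy, which exceeds m.\<close>

theorem Nehari_minimizer:
 assumes n0: "Neh u0 g0" and lt: "En u0 g0 < (1/2 - 1/crit TYPE('n)) * Sob TYPE('n) powr (crit TYPE('n) / (crit TYPE('n) - 2))"
 obtains u g where "Neh u g" "En u g = m"
proof -
 let ?A = "{En u g | u g. Neh u g}"
 have ne: "?A ~= {}" using n0 by blast
 have mlt: "m < (1/2 - 1/crit TYPE('n)) * Sob TYPE('n) powr (crit TYPE('n) / (crit TYPE('n) - 2))" using m_le[OF n0] lt by linarith
 have "\<exists>u g. Neh u g & En u g < m + inverse (real (Suc n))" for n
 proof -
  have "Inf ?A < m + inverse (real (Suc n))" by (simp add: m_def)
  from cInf_lessD[OF ne this] show ?thesis by blast
 qed
 then obtain u g where u: "!!n. Neh (u n) (g n)" "!!n. En (u n) (g n) < m + inverse (real (Suc n))" by metis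
 have Xu: "X (u n) (g n)" for n using u(1) by (simp add: Neh_def)
 have El: "(%n. En (u n) (g n)) ~~> m"
 proof (rule tendsto_sandwich[of "%_. m"])
  have "(%n. m + inverse (real (Suc n))) ~~> m + 0" by (intro tendsto_intros LIMSEQ_inverse_real_of_nat)
  then show "(%n. m + inverse (real (Suc n))) ~~> m" by simp
 qed (use m_le[OF u(1)] u(2) in \<open>auto intro: less_imp_le always_eventually\<close>)
 have E1: "En (u n) (g n) <= m + 1" for n
 proof -
  have "inverse (real (Suc n)) <= 1" by (simp add: inverse_le_1_iff)
  then show ?thesis using u(2)[of n] by linarith
 qed
 have parts: "0 <= (1/2 - 1/P) * en (g n)" "0 <= (1/q - 1/P) * bq (u n)" "0 <= (1/P - 1/crit TYPE('n)) * pw (crit TYPE('n)) (u n)" for n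
  using coef bq_nonneg[of "u n"] by auto
 define Ca Cb Cd where "Ca = (m + 1) / (1/2 - 1/P)" and "Cb = (m + 1) / (1/q - 1/P)" and "Cd = (m + 1) / (1/P - 1/crit TYPE('n))"
 have bnd: "en (g n) <= Ca" "bq (u n) <= Cb" "pw (crit TYPE('n)) (u n) <= Cd" for n
 proof -
  have "(1/2 - 1/P) * en (g n) <= m + 1" "(1/q - 1/P) * bq (u n) <= m + 1" "(1/P - 1/crit TYPE('n)) * pw (crit TYPE('n)) (u n) <= m + 1"
   using parts[of n] E1[of n] unfolding En_def by linarith+
  then show "en (g n) <= Ca" "bq (u n) <= Cb" "pw (crit TYPE('n)) (u n) <= Cd"
   unfolding Ca_def Cb_def Cd_def using coef by (simp_all add: pos_le_divide_eq mult.commute)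
 qed
 obtain s1 v h where s1: "strict_mono s1" and vD: "D12 Om v h" and ae1: "AE x in lborel. (%n. u (s1 n) x) ~~> v x"
  and wk1: "!!w k. D12 UNIV w k ==> (%n. LBINT x. g (s1 n) x \<bullet> k x) ~~> (LBINT x. h x \<bullet> k x)"
  by (rule D12_compact[OF N XD(1)[OF Xu] bnd(1)]) (rule that)
 have "bounded (range (%n. (en (g (s1 n)), bq (u (s1 n)), pw (crit TYPE('n)) (u (s1 n)))))"
 proof (rule bounded_subset)
  show "bounded ({0..Ca} \<times> {0..Cb} \<times> {0..Cd})" by (intro bounded_Times) auto
  show "range (%n. (en (g (s1 n)), bq (u (s1 n)), pw (crit TYPE('n)) (u (s1 n)))) <= {0..Ca} \<times> {0..Cb} \<times> {0..Cd}"
   using bnd bq_nonneg by auto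
 qed
 then obtain l s2 where s2: "strict_mono s2" "((%n. (en (g (s1 n)), bq (u (s1 n)), pw (crit TYPE('n)) (u (s1 n)))) \<circ> s2) ~~> l"
  using bounded_imp_convergent_subsequence by blast
 define s where "s = (%n. s1 (s2 n))"
 obtain A B D where l: "l = (A, B, D)" by (cases l) auto
 have lim: "(%n. en (g (s n))) ~~> A" "(%n. bq (u (s n))) ~~> B" "(%n. pw (crit TYPE('n)) (u (s n))) ~~> D"
  using tendsto_fst[OF s2(2)] tendsto_fst[OF tendsto_snd[OF s2(2)]] tendsto_snd[OF tendsto_snd[OF s2(2)]] by (simp_all add: l o_def s_def)
 have ss: "strict_mono s" using strict_mono_o[OF s1 s2(1)] by (simp add: s_def o_def)
 have ae: "AE x in lborel. (%n. u (s n) x) ~~> v x"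
  using ae1 unfolding s_def by eventually_elim (use LIMSEQ_subseq_LIMSEQ[OF _ s2(1)] in \<open>force simp: o_def\<close>)
 have vU: "D12 UNIV v h" by (rule D12_mono[OF vD]) simp
 have wk: "(%n. LBINT x. g (s n) x \<bullet> h x) ~~> (LBINT x. h x \<bullet> h x)"
  using LIMSEQ_subseq_LIMSEQ[OF wk1[OF vU] s2(1)] by (simp add: o_def s_def)
 have ml: "u n : bmeas lborel" "v : bmeas lborel" "g n : bmeas lborel" "h : bmeas lborel" for n
  using D12_meas[OF XD(1)[OF Xu]] D12_meas[OF vD] by simp_all
 have mv: "v : bmeas muu" using D12_meas(1)[OF vD] by (simp cong: measurable_cong_sets)
 note WE = weak_energy[OF ml(3,4) D12_int[OF XD(1)[OF Xu]] D12_int[OF vD] wk lim(1)]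
 have q0: "q > 0" "P > 0" "crit TYPE('n) > 0" using exps r2 by auto
 note BLq = Brezis_Lieb[of q "%n. u (s n)" muu v, OF q0(1) XD(4)[OF Xu] mv XD(2)[OF Xu] bnd(2)[unfolded bq_def] ac[OF ae]]
 note BLr = Brezis_Lieb[of "crit TYPE('n)" "%n. u (s n)" lborel v, OF q0(3) ml(1,2) XD(5)[OF Xu] bnd(3) ae]
 have Xv: "X v h" unfolding X_def using vD BLq(1) by blast
 obtain R where R: "R > 0" "Om <= cball 0 R" by (rule cball_R)
 have dD: "D12 Om (%x. u (s n) x - v x) (%x. g (s n) x - h x)" for n by (rule D12_diff[OF XD(1)[OF Xu] vD])
 \<comment> \<open>The subcritical term passes to the limit entirely, because P is below the
   critical exponent and the functions live on a bounded set.\<close>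
 have Pl: "(%n. pw P (u (s n))) ~~> pw P v"
 proof -
  have ps: "0 < P" "P <= crit TYPE('n)" "P < crit TYPE('n)" using exps by auto
  have CP: "pw P (u (s n)) <= measure lborel (cball (0::real^'n) R) + Cd" for n
  proof -
   have le: "indicator (cball 0 R) x * abs y powr P <= indicator (cball (0::real^'n) R) x + abs y powr crit TYPE('n)" for x and y :: real
   proof (cases "abs y <= 1")
    case True
    then have "abs y powr P <= 1 powr P" using ps by (intro powr_mono2) auto
    then show ?thesis by (auto simp: indicator_def add_increasing2)
   next
    case False
    then have "abs y powr P <= abs y powr crit TYPE('n)" using ps by (intro powr_mono) auto
    then show ?thesis by (auto simp: indicator_def)
   qed
   have ic: "integrable lborel (indicat_real (cball (0::real^'n) R))"
    using emeasure_lborel_cball_finite[of "0::real^'n" R] by (intro integrable_real_indicator) simp_all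
   have im: "integrable lborel (%x. indicator (cball 0 R) x * abs (u (s n) x) powr P)"
    by (rule local_powr_integrable[OF XD(3)[OF Xu] _ XD(5)[OF Xu] emeasure_lborel_cball_finite ps(1,2)]) simp
   have "pw P (u (s n)) = (LBINT x. indicator (cball 0 R) x * abs (u (s n) x) powr P)" by (rule D12_lower(2)[OF XD(1)[OF Xu] R(2) ps(1,2)])
   also have "... <= (LBINT x. indicator (cball 0 R) x + abs (u (s n) x) powr crit TYPE('n))"
    by (intro integral_mono im L1_integrable_add ic XD(5)[OF Xu] le)
   also have "... = measure lborel (cball (0::real^'n) R) + pw (crit TYPE('n)) (u (s n))" using ic XD(5)[OF Xu] by simp
   finally show ?thesis using bnd(3)[of "s n"] by linarith
  qed
  note BLP = Brezis_Lieb[of P "%n. u (s n)" lborel v, OF q0(2) ml(1,2) pwP_int[OF XD(1)[OF Xu]] CP ae]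
  have wC: "pw (crit TYPE('n)) (%x. u (s n) x - v x) <= 2 powr crit TYPE('n) * (Cd + pw (crit TYPE('n)) v)" for n
  proof -
   have "pw (crit TYPE('n)) (%x. u (s n) x - v x) <= 2 powr crit TYPE('n) * (pw (crit TYPE('n)) (u (s n)) + pw (crit TYPE('n)) v)"
    using r2 by (intro Lr_diff_bound ml XD(5)[OF Xu] BLr(1)) simp
   also have "... <= 2 powr crit TYPE('n) * (Cd + pw (crit TYPE('n)) v)" using bnd(3)[of "s n"] by (intro mult_left_mono) auto
   finally show ?thesis .
  qed
  have aw: "AE x in lborel. (%n. u (s n) x - v x) ~~> 0" using ae by eventually_elim (rule LIM_zero)
  have mw: "!!n. (%x. u (s n) x - v x) : bmeas lborel" "cball (0::real^'n) R : sets lborel" using ml by simp_all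
  have "(%n. pw P (%x. u (s n) x - v x)) ~~> 0"
   unfolding D12_lower(2)[OF dD R(2) ps(1,2)]
   by (rule lower_power_tendsto_zero(2)[OF mw emeasure_lborel_cball_finite BLr(2) wC aw ps(1,3)])
  from tendsto_add[OF BLP(3) this] show ?thesis by simp
 qed
 have sub: "(%n. x n) ~~> X - y" if "(%n. z n - x n) ~~> y" "z ~~> X" for x z :: "nat => real" and X y
  using tendsto_diff[OF that(2,1)] by simp
 have bl: "(%n. bq (%x. u (s n) x - v x)) ~~> B - bq v" unfolding bq_def by (rule sub[OF BLq(3) lim(2)[unfolded bq_def]])
 have dl: "(%n. pw (crit TYPE('n)) (%x. u (s n) x - v x)) ~~> D - pw (crit TYPE('n)) v" by (rule sub[OF BLr(3) lim(3)])
 \<comment> \<open>The Dirichlet energy, weighted integral and critical integral lost in the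
   limit.\<close>
 define av bv dv where "av = A - en h" and "bv = B - bq v" and "dv = D - pw (crit TYPE('n)) v"
 have nn: "av >= 0" "bv >= 0" "dv >= 0"
  using WE(2) LIMSEQ_le_const[OF bl, of 0] LIMSEQ_le_const[OF dl, of 0] bq_nonneg by (auto simp: av_def bv_def dv_def)
 have Sv: "Sob TYPE('n) * dv powr (2 / crit TYPE('n)) <= av"
 proof (rule LIMSEQ_le[OF _ WE(1)[folded av_def]])
  show "(%n. Sob TYPE('n) * pw (crit TYPE('n)) (%x. u (s n) x - v x) powr (2 / crit TYPE('n))) ~~> Sob TYPE('n) * dv powr (2 / crit TYPE('n))"
   unfolding dv_def using r2 by (intro tendsto_mult tendsto_const tendsto_powr2 dl) auto
 qed (use D12_Sobolev(2)[OF N dD] in auto)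
 have J0: "A + B - pw P v - D = 0"
 proof -
  have "(%n. J (u (s n)) (g (s n))) ~~> A + B - pw P v - D" unfolding J_def by (intro tendsto_intros lim Pl)
  moreover have "J (u (s n)) (g (s n)) = 0" for n using u(1) by (simp add: Neh_def)
  ultimately show ?thesis using LIMSEQ_unique[OF _ tendsto_const] by (simp only:) blast
 qed
 have mE: "m = (1/2 - 1/P) * A + (1/q - 1/P) * B + (1/P - 1/crit TYPE('n)) * D"
 proof -
  have "(%n. En (u (s n)) (g (s n))) ~~> (1/2 - 1/P) * A + (1/q - 1/P) * B + (1/P - 1/crit TYPE('n)) * D" unfolding En_def by (intro tendsto_intros lim)
  moreover have "(%n. En (u (s n)) (g (s n))) ~~> m" using LIMSEQ_subseq_LIMSEQ[OF El ss] by (simp add: o_def)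
  ultimately show ?thesis using LIMSEQ_unique by blast
 qed
 have Jv: "J v h = dv - av - bv" using J0 by (simp add: J_def av_def bv_def dv_def)
 have split: "m = En v h + ((1/2 - 1/P) * av + (1/q - 1/P) * bv + (1/P - 1/crit TYPE('n)) * dv)"
  unfolding mE En_def av_def bv_def dv_def by (simp add: algebra_simps)
 have rest: "0 <= (1/2 - 1/P) * av" "0 <= (1/q - 1/P) * bv" "0 <= (1/P - 1/crit TYPE('n)) * dv" using coef nn by auto
 \<comment> \<open>With dv >= av + bv, the lost level is at least (1/2 - 1/r) av, the coefficient
   1/P cancelling, and av is at least S^(r/(r-2)).\<close>
 have contra: False if "av > 0" "av + bv <= dv"
 proof -
  have "Sob TYPE('n) powr (crit TYPE('n) / (crit TYPE('n) - 2)) <= av" using that nn by (intro critical_energy_lower_bound[OF S0 r2 _ _ Sv]) auto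
  then have "(1/2 - 1/crit TYPE('n)) * Sob TYPE('n) powr (crit TYPE('n) / (crit TYPE('n) - 2)) <= (1/2 - 1/crit TYPE('n)) * av" using r2 by (intro mult_left_mono) auto
  also have "... <= (1/2 - 1/P) * av + (1/q - 1/P) * bv + (1/P - 1/crit TYPE('n)) * dv"
  proof -
   have "(1/P - 1/crit TYPE('n)) * (av + bv) <= (1/P - 1/crit TYPE('n)) * dv" using coef that by (intro mult_left_mono) auto
   moreover have "0 <= (1/q - 1/crit TYPE('n)) * bv" using coef nn by (intro mult_nonneg_nonneg) auto
   ultimately show ?thesis by (simp add: algebra_simps add_divide_distrib)
  qed
  also have "... <= m" using split En_nonneg[of v h] by linarith
  finally show False using mlt by linarith
 qed
 show thesis
 proof (cases "en h > 0 & J v h <= 0")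
  case True
  have "En v h <= m" using split rest by linarith
  then show thesis using below_level_attained[OF Xv _ _ _ n0] True that by blast
 next
  case False
  show thesis
  proof (cases "en h > 0")
   case True
   then have dvp: "dv > av + bv" using False Jv by simp
   then have "dv > 0" using nn by linarith
   then have "Sob TYPE('n) * dv powr (2 / crit TYPE('n)) > 0" using S0 by simp
   then have "av > 0" using Sv by linarith
   then show thesis using contra dvp by force
  next
   case False
   then have e0: "en h = 0" by (simp add: not_less antisym)
   have z: "AE x in lborel. v x = 0" using energy_pos[OF vD] False by blast
   have "bq v = 0" unfolding bq_def by (rule integral_eq_zero_AE) (use ac[OF z] in \<open>auto elim: eventually_mono\<close>)
   moreover have "pw P v = 0" "pw (crit TYPE('n)) v = 0" by (rule integral_eq_zero_AE, use z in \<open>auto elim: eventually_mono\<close>)+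
   ultimately have "dv = av + bv" using Jv e0 by (simp add: J_def)
   \<comment> \<open>For v = 0 all of the energy is lost, and on the manifold it is bounded
     below.\<close>
   moreover have "av > 0"
   proof -
    obtain dlt where d: "dlt > 0" "!!u g. X u g ==> en g > 0 ==> J u g <= 0 ==> dlt <= en g" by (rule Nehari_lower_bound) (rule that)
    have "dlt <= en (g n)" for n using d(2)[OF Xu] u(1)[of n] by (simp add: Neh_def)
    then have "dlt <= A" by (intro LIMSEQ_le_const[OF lim(1)]) auto
    then show ?thesis using d(1) e0 by (simp add: av_def)
   qed
   ultimately show thesis using contra by simp
  qed
 qed
qed

end

section \<open>The Euler-Lagrange equation\<close>

context nehari begin

text \<open>Every (t^k - 1)/k is compared with the one for k = q: the terms with positive sign have
  k <= q, those with negative sign k >= q, and the constraint a + b = c + d cancels what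
  remains.\<close>

lemma Psi_ray_max:
 assumes "0 <= a" "0 <= b" "0 <= c" "0 <= d" "a + b - c - d = 0" "t > 0"
 shows "Psi a b c d t <= Psi a b c d 1"
proof -
 define f where "f k = (t powr k - 1) / k" for k
 have f: "f 2 <= f q" "f q <= f P" "f q <= f (crit TYPE('n))"
  unfolding f_def using exps assms(6) by (intro powr_quotient_mono; linarith)+
 have "Psi a b c d t - Psi a b c d 1 = a * f 2 + b * f q - c * f P - d * f (crit TYPE('n))"
  unfolding Psi_def f_def using exps r2 by (simp add: field_simps)
 also have "... <= a * f q + b * f q - c * f q - d * f q"
  using f assms by (intro diff_mono add_mono mult_left_mono) auto
 also have "... = (a + b - c - d) * f q" by (simp add: algebra_simps)
 finally show ?thesis using assms by simp
qed

text \<open>After division by t^(q-2) the a-term decreases strictly, the b-term is constant and the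
  subtracted terms do not decrease; so the sign changes exactly at t = 1.\<close>

lemma ray_sign:
 assumes "0 < a" "0 <= c" "0 <= d" "a + b - c - d = 0" "t > 0"
 shows "t < 1 ==> a + b * t powr (q - 2) - c * t powr (P - 2) - d * t powr (crit TYPE('n) - 2) > 0"
  "t > 1 ==> a + b * t powr (q - 2) - c * t powr (P - 2) - d * t powr (crit TYPE('n) - 2) < 0"
proof -
 have e: "t powr (k - 2) = t powr (q - 2) * t powr (k - q)" for k unfolding powr_add[symmetric] by simp
 have e2: "a = t powr (q - 2) * (a * t powr (2 - q))"
  using assms(5) powr_add[of t "q - 2" "2 - q"] by simp
 have h: "a + b * t powr (q - 2) - c * t powr (P - 2) - d * t powr (crit TYPE('n) - 2) =
  t powr (q - 2) * (a * t powr (2 - q) + b - c * t powr (P - q) - d * t powr (crit TYPE('n) - q))"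
  (is "?l = ?m * ?f") by (subst e2, subst e[of P], subst e[of "crit TYPE('n)"]) (simp add: algebra_simps)
 show "?l > 0" if t: "t < 1"
 proof -
  have "a * t powr (2 - q) > a * 1" using assms exps t powr_less_mono2_neg[of "2 - q" t 1] by (intro mult_strict_left_mono) auto
  moreover have "c * t powr (P - q) <= c * 1" "d * t powr (crit TYPE('n) - q) <= d * 1"
   using assms exps t by (intro mult_left_mono powr_le1; simp)+
  ultimately have "?f > 0" using assms(4) by linarith
  then show ?thesis unfolding h using assms by simp
 qed
 show "?l < 0" if t: "t > 1"
 proof -
  have "a * t powr (2 - q) < a * 1" using assms exps t powr_less_mono2_neg[of "2 - q" 1 t] by (intro mult_strict_left_mono) auto
  moreover have "c * 1 <= c * t powr (P - q)" "d * 1 <= d * t powr (crit TYPE('n) - q)"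
   using assms exps t by (intro mult_left_mono ge_one_powr_ge_zero; simp)+
  ultimately have "?f < 0" using assms(4) by linarith
  then show ?thesis unfolding h using assms by (simp add: mult_pos_neg)
 qed
qed

text \<open>Lagrange multipliers without the implicit function theorem. The sign change at t = 1
  persists under small perturbations, so perturbed rays have crossing points t(e) tending to 1. As t
  = 1 maximizes the unperturbed ray, only the four data need be differentiated, never t(e).\<close>

lemma ray_variation:
 fixes A B C D :: "real => real"
 assumes d: "(A has_real_derivative a) (at 0)" "(B has_real_derivative b) (at 0)" "(C has_real_derivative c) (at 0)" "(D has_real_derivative d) (at 0)"
  and z: "0 < A 0" "0 <= B 0" "0 <= C 0" "0 <= D 0" "A 0 + B 0 - C 0 - D 0 = 0"
  and le: "!!e t. A e > 0 ==> t > 0 ==> A e + B e * t powr (q - 2) - C e * t powr (P - 2) - D e * t powr (crit TYPE('n) - 2) = 0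
   ==> Psi (A 0) (B 0) (C 0) (D 0) 1 <= Psi (A e) (B e) (C e) (D e) t"
 shows "0 <= a / 2 + b / q - c / P - d / crit TYPE('n)"
proof -
 define h where "h e t = A e + B e * t powr (q - 2) - C e * t powr (P - 2) - D e * t powr (crit TYPE('n) - 2)" for e t
 have c: "A \<midarrow>0\<rightarrow> A 0" "B \<midarrow>0\<rightarrow> B 0" "C \<midarrow>0\<rightarrow> C 0" "D \<midarrow>0\<rightarrow> D 0"
  using d[THEN DERIV_isCont] by (simp_all add: isCont_def)
 have hl: "((%e. h e t) \<longlongrightarrow> h 0 t) (at_right 0)" for t
  unfolding h_def by (intro tendsto_intros c[THEN tendsto_mono[OF at_le[OF subset_UNIV]]])
 have Al: "(A \<longlongrightarrow> A 0) (at_right 0)" by (rule tendsto_mono[OF at_le[OF subset_UNIV] c(1)])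
 have "\<exists>e t. 0 < e & e < 1 / real (Suc k) & 1 - 1 / real (k + 2) <= t & t <= 1 + 1 / real (k + 2) & 0 < A e & h e t = 0" for k
 proof -
  \<comment> \<open>The shift by 2 keeps y < 1 already for k = 0, so that 1 - y is a positive ray
    parameter.\<close>
  define y where "y = 1 / real (k + 2)"
  have y: "0 < y" "y < 1" by (auto simp: y_def)
  have "h 0 (1 - y) > 0" "h 0 (1 + y) < 0" unfolding h_def using ray_sign[OF z(1,3,4,5)] y by auto
  then have "\<forall>\<^sub>F e in at_right 0. h e (1 - y) > 0 & h e (1 + y) < 0 & A e > 0 & 0 < e & e < 1 / real (Suc k)"
   using order_tendstoD[OF hl] order_tendstoD(1)[OF Al z(1)] eventually_at_right_less[of "0::real"] eventually_at_right_real[of 0 "1 / real (Suc k)"]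
   by (auto intro!: eventually_conj elim: eventually_mono)
  then obtain e where e: "h e (1 - y) > 0" "h e (1 + y) < 0" "A e > 0" "0 < e" "e < 1 / real (Suc k)"
   using eventually_happens'[OF trivial_limit_at_right_real] by blast
  have "continuous_on {1 - y..1 + y} (h e)" unfolding h_def[abs_def] using y by (intro continuous_intros) auto
  then obtain t where "1 - y <= t" "t <= 1 + y" "h e t = 0" using IVT2'[of "h e" "1 + y" 0 "1 - y"] e y by auto
  then show ?thesis using e by (auto simp: y_def)
 qed
 then obtain e t where e: "!!k. 0 < e k" "!!k. e k < 1 / real (Suc k)" "!!k. 1 - 1 / real (k + 2) <= t k" "!!k. t k <= 1 + 1 / real (k + 2)"
  "!!k. 0 < A (e k)" "!!k. h (e k) (t k) = 0" by metis
 have inv: "(%k. 1 / real (Suc k)) ~~> 0" "(%k. 1 / real (k + 2)) ~~> 0"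
  using LIMSEQ_inverse_real_of_nat LIMSEQ_ignore_initial_segment[OF lim_1_over_n[where 'a = real], of 2] by (simp_all add: inverse_eq_divide)
 have t1: "t ~~> 1"
  by (rule tendsto_sandwich[OF _ _ tendsto_diff[OF tendsto_const inv(2), of 1, simplified] tendsto_add[OF tendsto_const inv(2), of 1, simplified]]) (use e in auto)
 have e0: "filterlim e (at 0) sequentially"
 proof (rule filterlim_atI)
  show "e ~~> 0" by (rule tendsto_sandwich[OF _ _ tendsto_const inv(1)]) (use e in \<open>auto intro: less_imp_le always_eventually\<close>)
  show "\<forall>\<^sub>F k in sequentially. e k ~= 0" using e(1) by (intro always_eventually) (metis less_irrefl)
 qed
 have dq: "(%k. (F (e k) - F 0) / e k) ~~> f" if "(F has_real_derivative f) (at 0)" for F f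
  using filterlim_compose[OF that[unfolded DERIV_def] e0] by simp
 have pl: "(%k. t k powr j) ~~> 1" for j using tendsto_powr[OF t1 tendsto_const, of j] by simp
 have "(%k. Psi ((A (e k) - A 0) / e k) ((B (e k) - B 0) / e k) ((C (e k) - C 0) / e k) ((D (e k) - D 0) / e k) (t k))
  ~~> a * 1 / 2 + b * 1 / q - c * 1 / P - d * 1 / crit TYPE('n)"
  unfolding Psi_def using exps r2 by (intro tendsto_intros dq d pl) auto
 moreover have "0 <= Psi ((A (e k) - A 0) / e k) ((B (e k) - B 0) / e k) ((C (e k) - C 0) / e k) ((D (e k) - D 0) / e k) (t k)" (is "0 <= ?Q") for k
 proof -
  have "1 / real (k + 2) < 1" by simp
  then have t0: "t k > 0" using e(3)[of k] by linarith
  \<comment> \<open>Unperturbed value at t k <= unperturbed value at 1 <= perturbed value at t k.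
    Both ends use the same t k, and \<open>Psi\<close> is linear in the data, so their difference is
    a difference quotient.\<close>
  have "Psi (A 0) (B 0) (C 0) (D 0) (t k) <= Psi (A 0) (B 0) (C 0) (D 0) 1" using z t0 by (intro Psi_ray_max) auto
  also have "... <= Psi (A (e k)) (B (e k)) (C (e k)) (D (e k)) (t k)" by (rule le[OF e(5) t0]) (use e(6)[of k] in \<open>simp add: h_def\<close>)
  also have "... - Psi (A 0) (B 0) (C 0) (D 0) (t k) = e k * ?Q"
   unfolding Psi_def using e(1)[of k] by (simp add: distrib_left right_diff_distrib left_diff_distrib diff_divide_distrib)
  finally show ?thesis using e(1)[of k] by (simp add: zero_le_mult_iff)
 qed
 ultimately show ?thesis using LIMSEQ_le_const[of _ _ 0] by fastforce
qed

lemma X_test: "test_fun Om ph ==> X ph (grad ph)"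
 unfolding X_def by (intro conjI D12_test test_muu)

theorem Nehari_Euler_Lagrange:
 assumes u: "Neh u g" "En u g = m" and XT: "X v h"
 shows "integrable muu (%x. sgn (u x) * abs (u x) powr (q - 1) * v x)"
  "integrable lborel (%x. sgn (u x) * abs (u x) powr (P - 1) * v x)"
  "integrable lborel (%x. sgn (u x) * abs (u x) powr (crit TYPE('n) - 1) * v x)"
  "(LBINT x. g x \<bullet> h x) + (\<integral>x. sgn (u x) * abs (u x) powr (q - 1) * v x \<partial>muu)
   = (LBINT x. sgn (u x) * abs (u x) powr (P - 1) * v x) + (LBINT x. sgn (u x) * abs (u x) powr (crit TYPE('n) - 1) * v x)"
proof -
 have Xu: "X u g" and en0: "en g > 0" and J0: "J u g = 0" using u by (auto simp: Neh_def)
 note DT = XD(1)[OF XT]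
 have q1: "q > 1" "P > 1" "crit TYPE('n) > 1" using exps r2 by auto
 have ml: "u : bmeas lborel" "v : bmeas lborel" using XD(3)[OF Xu] XD(3)[OF XT] by simp_all
 note dB = DERIV_powr_integral[OF q1(1) XD(4)[OF Xu] XD(4)[OF XT] XD(2)[OF Xu] XD(2)[OF XT]]
 note dC = DERIV_powr_integral[OF q1(2) ml pwP_int[OF XD(1)[OF Xu]] pwP_int[OF DT]]
 note dD = DERIV_powr_integral[OF q1(3) ml XD(5)[OF Xu] XD(5)[OF XT]]
 show "integrable muu (%x. sgn (u x) * abs (u x) powr (q - 1) * v x)"
  "integrable lborel (%x. sgn (u x) * abs (u x) powr (P - 1) * v x)"
  "integrable lborel (%x. sgn (u x) * abs (u x) powr (crit TYPE('n) - 1) * v x)" by (rule dB(1) dC(1) dD(1))+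
 define Ig Ib Ic Id where "Ig = (LBINT x. g x \<bullet> h x)" and "Ib = (\<integral>x. sgn (u x) * abs (u x) powr (q - 1) * v x \<partial>muu)"
  and "Ic = (LBINT x. sgn (u x) * abs (u x) powr (P - 1) * v x)" and "Id = (LBINT x. sgn (u x) * abs (u x) powr (crit TYPE('n) - 1) * v x)"
 define A where "A e = en (%x. g x + e *R h x)" for e
 define B where "B e = bq (%x. u x + e * v x)" for e
 define C where "C e = pw P (%x. u x + e * v x)" for e
 define D where "D e = pw (crit TYPE('n)) (%x. u x + e * v x)" for e
 have A: "A = (%e. en g + 2 * e * Ig + e^2 * en (h))"
  unfolding A_def Ig_def by (rule ext) (rule en_add_scale[OF D12_meas(2)[OF XD(1)[OF Xu]] D12_meas(2)[OF DT] D12_int[OF XD(1)[OF Xu]] D12_int[OF DT]])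
 have dA: "(A has_real_derivative 2 * Ig) (at 0)" unfolding A by (auto intro!: derivative_eq_intros)
 have ds: "(B has_real_derivative q * Ib) (at 0)" "(C has_real_derivative P * Ic) (at 0)" "(D has_real_derivative crit TYPE('n) * Id) (at 0)"
  unfolding B_def[abs_def] C_def[abs_def] D_def[abs_def] bq_def Ib_def Ic_def Id_def by (rule dB(2) dC(2) dD(2))+
 have z: "0 < A 0" "0 <= B 0" "0 <= C 0" "0 <= D 0" "A 0 + B 0 - C 0 - D 0 = 0"
  unfolding A_def B_def C_def D_def using en0 J0 bq_nonneg[of u] by (auto simp: J_def)
 have m1: "Psi (A 0) (B 0) (C 0) (D 0) 1 = m" using En_eq[of u g] u J0 by (simp add: A_def B_def C_def D_def)
 have le: "Psi (A 0) (B 0) (C 0) (D 0) 1 <= Psi (A e) (B e) (C e) (D e) t"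
  if "A e > 0" "t > 0" "A e + B e * t powr (q - 2) - C e * t powr (P - 2) - D e * t powr (crit TYPE('n) - 2) = 0" for e t
 proof -
  have "X (%x. u x + e * v x) (%x. g x + e *R h x)"
   unfolding X_def
  proof
   show "D12 Om (%x. u x + e * v x) (%x. g x + e *R h x)" by (rule D12_lin[OF XD(1)[OF Xu] DT])
   have "integrable muu (%x. abs (e * v x) powr q)" using XD(2)[OF X_scale[OF XT, of e]] by simp
   then show "integrable muu (%x. abs (u x + e * v x) powr q)"
    using q1 XD(4)[OF Xu] XD(4)[OF X_scale[OF XT, of e]] XD(2)[OF Xu] by (intro integrable_powr_add) auto
  qed
  note n = Neh_ray[OF this that(1)[unfolded A_def] that(2) that(3)[unfolded A_def B_def C_def D_def]]
  from m_le[OF n] show ?thesis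
   unfolding m1 En_eq n[unfolded Neh_def, THEN conjunct2, THEN conjunct2] scaled_values[OF that(2)]
   by (simp add: Psi_def A_def B_def C_def D_def mult.commute)
 qed
 have "0 <= 2 * Ig / 2 + q * Ib / q - P * Ic / P - crit TYPE('n) * Id / crit TYPE('n)" by (rule ray_variation[OF dA ds z le])
 \<comment> \<open>The variation lemma gives one inequality; replacing e by -e supplies the
   other.\<close>
 moreover have "0 <= (2 * Ig * - 1) / 2 + (q * Ib * - 1) / q - (P * Ic * - 1) / P - (crit TYPE('n) * Id * - 1) / crit TYPE('n)"
 proof (rule ray_variation[of "%e. A (- e)" _ "%e. B (- e)" _ "%e. C (- e)" _ "%e. D (- e)"])
  have mi: "(uminus has_real_derivative - 1) (at (0::real))" by (auto intro!: derivative_eq_intros)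
  have ch: "((%e. F (- e)) has_real_derivative f * - 1) (at 0)" if "(F has_real_derivative f) (at 0)" for F f
   by (rule DERIV_chain2[where g = uminus]) (use that mi in auto)
  show "((%e. A (- e)) has_real_derivative 2 * Ig * - 1) (at 0)" "((%e. B (- e)) has_real_derivative q * Ib * - 1) (at 0)"
   "((%e. C (- e)) has_real_derivative P * Ic * - 1) (at 0)" "((%e. D (- e)) has_real_derivative crit TYPE('n) * Id * - 1) (at 0)"
   by (rule ch[OF dA] ch[OF ds(1)] ch[OF ds(2)] ch[OF ds(3)])+
 qed (use z le in simp_all)
 ultimately have "Ig + Ib = Ic + Id" using q1 by simp
 then show "(LBINT x. g x \<bullet> h x) + (\<integral>x. sgn (u x) * abs (u x) powr (q - 1) * v x \<partial>muu)
   = (LBINT x. sgn (u x) * abs (u x) powr (P - 1) * v x) + (LBINT x. sgn (u x) * abs (u x) powr (crit TYPE('n) - 1) * v x)"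
  by (simp only: Ig_def Ib_def Ic_def Id_def)
qed

end

section \<open>Nonnegativity and the strong maximum principle\<close>

lemma norm_add_square_le: "(norm (x + y))^2 <= 2 * (norm x)^2 + 2 * (norm y)^2" for x y :: "'a::real_inner"
proof -
 have "2 * (norm x)^2 + 2 * (norm y)^2 - (norm (x + y))^2 = (norm (x - y))^2"
  by (simp add: power2_norm_eq_inner inner_simps inner_commute)
 then show ?thesis using zero_le_power2[of "norm (x - y)"] by linarith
qed

text \<open>The function $\sqrt{u^2+\delta^2}-\delta$ replaces the absolute value, which is not smooth.\<close>

lemma D12_abs:
 fixes u :: "real^'n => real"
 assumes N: "CARD('n) >= 3" and u: "D12 Om u g"
 obtains h where "D12 Om (%x. abs (u x)) h" "en h <= en g"
proof -
 obtain ph where ph: "!!k. test_fun Om (ph k)" "!!k. test_fun UNIV (ph k)" "AE x in lborel. (%k. ph k x) ~~> u x"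
  "(%k. en (%x. grad (ph k) x - g x)) ~~> 0" "(%k. en (grad (ph k))) ~~> en g"
  by (rule D12_obtain[OF u]) (rule that)
 define dlt where "dlt k = inverse (real (Suc k))" for k
 have d0: "dlt k > 0" for k by (simp add: dlt_def)
 have dl: "dlt ~~> 0" unfolding dlt_def by (rule LIMSEQ_inverse_real_of_nat)
 define psi where "psi k x = sqrt ((ph k x)^2 + (dlt k)^2) - dlt k" for k x
 have p: "t^2 + (dlt k)^2 > 0" for t k using d0[of k] by (simp add: add_nonneg_pos)
 have t: "test_fun Om (psi k)" for k
 proof -
  obtain K where K: "compact K" "K <= Om" "!!x. x \<notin> K ==> ph k x = 0" by (rule test_fun_obtain[OF ph(1)[of k]]) (rule that)
  have e: "psi k = (%x. (ph k x * ph k x + (dlt k)^2) powr (1/2) - dlt k)"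
   unfolding psi_def using p[of "ph k _" k] by (simp add: fun_eq_iff powr_half_sqrt power2_eq_square)
  have "smooth_on UNIV (psi k)" unfolding e
   by (intro smooth_diff smooth_powr smooth_add smooth_mult smooth_const test_fun_smooth[OF ph(1)]) (use p in \<open>simp add: power2_eq_square\<close>)
  then show ?thesis by (rule test_funI[OF _ K(1,2)]) (use K(3) d0[of k] in \<open>simp add: psi_def\<close>)
 qed
 have gr: "grad (psi k) = (%x. (ph k x / sqrt ((ph k x)^2 + (dlt k)^2)) *R grad (ph k) x)" for k
  unfolding psi_def[abs_def]
 proof (rule has_grad_eq, rule has_grad_compose[OF test_fun_grad[OF ph(1)], where F = "%t. sqrt (t^2 + (dlt k)^2) - dlt k"])
  show "((%t. sqrt (t^2 + (dlt k)^2) - dlt k) has_real_derivative ph k x / sqrt ((ph k x)^2 + (dlt k)^2)) (at (ph k x))" for x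
   using p[of "ph k x" k] by (auto intro!: derivative_eq_intros simp: divide_simps)
  show "continuous_on (range (ph k)) (%t. t / sqrt (t^2 + (dlt k)^2))" by (intro continuous_intros) (use p[of _ k] in \<open>auto simp: less_imp_neq[symmetric]\<close>)
 qed
 have le: "en (grad (psi k)) <= en (grad (ph k))" for k
 proof (rule integral_mono[OF D12_int[OF D12_test[OF t]] D12_int[OF D12_test[OF ph(1)]]])
  fix x
  have "abs (ph k x) <= sqrt ((ph k x)^2 + (dlt k)^2)" by (rule real_le_rsqrt) simp
  then have "abs (ph k x / sqrt ((ph k x)^2 + (dlt k)^2)) <= 1" using p[of "ph k x" k] by (simp add: abs_divide)
  then have "norm (grad (psi k) x) <= 1 * norm (grad (ph k) x)" unfolding gr norm_scaleR by (intro mult_right_mono) auto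
  then show "(norm (grad (psi k) x))^2 <= (norm (grad (ph k) x))^2" by (simp add: power_mono)
 qed
 obtain C where C: "!!k. en (grad (ph k)) <= C"
  using convergent_imp_Bseq[OF convergentI[OF ph(5)]] unfolding Bseq_def by (auto dest: abs_le_D1)
 have C': "en (grad (psi k)) <= C" for k using le[of k] C[of k] by linarith
 obtain s v h where s: "strict_mono s" and v: "D12 Om v h" and ae: "AE x in lborel. (%n. psi (s n) x) ~~> v x"
  and wk: "!!w k. D12 UNIV w k ==> (%n. LBINT x. grad (psi (s n)) x \<bullet> k x) ~~> (LBINT x. h x \<bullet> k x)"
  by (rule D12_compact[OF N D12_test[OF t] C']) (rule that)
 have "AE x in lborel. v x = abs (u x)" using ae ph(3)
 proof eventually_elim
  case (elim x)
  have "(%k. sqrt ((ph k x)^2 + (dlt k)^2) - dlt k) ~~> sqrt ((u x)^2 + 0^2) - 0" by (intro tendsto_intros elim dl)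
  then have "(%k. psi k x) ~~> abs (u x)" by (simp add: psi_def)
  from LIMSEQ_unique[OF elim(1) LIMSEQ_subseq_LIMSEQ[OF this s, unfolded o_def]] show ?case .
 qed
 then have D: "D12 Om (%x. abs (u x)) h" by (rule D12_cong_AE[OF v]) (use D12_meas(1)[OF u] in measurable)
 \<comment> \<open>The gradients converge only weakly, so the energy bound is recovered by testing
   with h itself and cancelling sqrt(en h).\<close>
 have "(LBINT x. h x \<bullet> h x) <= sqrt (en g) * sqrt (en h)"
 proof (rule LIMSEQ_le[OF wk[OF D12_mono[OF v subset_UNIV]]])
  show "(%n. sqrt (en (grad (ph (s n)))) * sqrt (en h)) ~~> sqrt (en g) * sqrt (en h)"
   by (intro tendsto_intros LIMSEQ_subseq_LIMSEQ[OF ph(5) s, unfolded o_def])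
  have "(LBINT x. grad (psi n) x \<bullet> h x) <= sqrt (en (grad (ph n))) * sqrt (en h)" for n
  proof -
   have "abs (LBINT x. grad (psi n) x \<bullet> h x) <= sqrt (en (grad (psi n))) * sqrt (en h)"
    by (rule L2_inner(4)) (use D12_meas(2)[OF v] D12_meas(2)[OF D12_test[OF t]] D12_int[OF v] D12_int[OF D12_test[OF t]] in simp_all)
   also have "\<dots> \<le> sqrt (en (grad (ph n))) * sqrt (en h)" using le[of n] by (intro mult_right_mono) auto
   finally show ?thesis by linarith
  qed
  then show "\<exists>M. \<forall>n\<ge>M. (\<integral>x. grad (psi (s n)) x \<bullet> h x \<partial>lborel) \<le> sqrt (en (grad (ph (s n)))) * sqrt (en h)" by blast
 qed
 then have l: "sqrt (en h) * sqrt (en h) <= sqrt (en g) * sqrt (en h)" by (simp add: power2_norm_eq_inner)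
 have "en h <= en g"
 proof (cases "en h = 0")
  case False
  then have "sqrt (en h) > 0" by (simp add: order.strict_iff_order)
  from mult_right_le_imp_le[OF l this] show ?thesis by simp
 qed simp
 then show thesis by (rule that[OF D])
qed

text \<open>The chain rule for a smooth G with bounded derivative. The gradient error splits into G'
  times the error of the gradients and the change of G' times g; the second part tends to 0 by
  dominated convergence.\<close>

lemma D12_compose:
 fixes u :: "real^'n => real"
 assumes u: "D12 Om u g" and sm: "!!f::real^'n => real. smooth_on UNIV f ==> smooth_on UNIV (%x. G (f x))"
  and der: "!!t. (G has_real_derivative G' t) (at t)" and cont: "continuous_on UNIV G'" and B: "!!t. abs (G' t) <= B" and z: "G 0 = 0"
 shows "D12 Om (%x. G (u x)) (%x. G' (u x) *R g x)"
proof -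
 obtain ph where ph: "!!k. test_fun Om (ph k)" "!!k. test_fun UNIV (ph k)" "AE x in lborel. (%k. ph k x) ~~> u x"
  "(%k. en (%x. grad (ph k) x - g x)) ~~> 0" "(%k. en (grad (ph k))) ~~> en g"
  by (rule D12_obtain[OF u]) (rule that)
 have cG: "continuous_on UNIV G" using der by (intro continuous_at_imp_continuous_on) (auto intro: DERIV_isCont)
 have [measurable]: "G : bmeas borel" "G' : bmeas borel" using cG cont by (auto intro: borel_measurable_continuous_onI)
 note [measurable] = D12_meas[OF u] test_measurable[OF ph(2)]
 have t: "test_fun Om (%x. G (ph k x))" for k
 proof -
  obtain K where K: "compact K" "K <= Om" "!!x. x \<notin> K ==> ph k x = 0" by (rule test_fun_obtain[OF ph(1)[of k]]) (rule that)
  show ?thesis by (rule test_funI[OF sm[OF test_fun_smooth[OF ph(1)]] K(1,2)]) (simp add: K(3) z)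
 qed
 have gr: "grad (%x. G (ph k x)) = (%x. G' (ph k x) *R grad (ph k) x)" for k
  by (rule has_grad_eq, rule has_grad_compose[OF test_fun_grad[OF ph(1)] der continuous_on_subset[OF cont subset_UNIV]])
 have i: "integrable lborel (%x. 4 * B^2 * (norm (g x))^2)" by (rule integrable_mult_right[OF D12_int[OF u]])
 have sq: "(G' t)\<^sup>2 \<le> B\<^sup>2" for t using B[of t] by (metis abs_ge_zero power2_abs power_mono)
 have dsq: "(G' t - G' s)\<^sup>2 \<le> 4 * B\<^sup>2" for t s
 proof -
  have "\<bar>G' t - G' s\<bar> \<le> 2 * B" using B[of t] B[of s] by linarith
  then have "\<bar>G' t - G' s\<bar>\<^sup>2 \<le> (2 * B)\<^sup>2" by (intro power_mono) auto
  then show ?thesis by (simp add: power_mult_distrib)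
 qed
 have id: "integrable lborel (%x. (G' (ph k x) - G' (u x))^2 * (norm (g x))^2)" for k
  by (rule L1_integrable_bound[OF i]) (use dsq in \<open>auto intro!: mult_right_mono simp: abs_mult\<close>)
 have lim: "(%k. LBINT x. (G' (ph k x) - G' (u x))^2 * (norm (g x))^2) ~~> (LBINT (x::real^'n). (0::real))"
 proof (rule integral_dominated_convergence[where w = "%x. 4 * B^2 * (norm (g x))^2"])
  show "AE x in lborel. (%k. (G' (ph k x) - G' (u x))^2 * (norm (g x))^2) ~~> 0" using ph(3)
  proof eventually_elim
   case (elim x)
   have "(%k. G' (ph k x)) ~~> G' (u x)" using continuous_on_tendsto_compose[OF cont elim] by simp
   then have "(%k. (G' (ph k x) - G' (u x))^2 * (norm (g x))^2) ~~> (G' (u x) - G' (u x))^2 * (norm (g x))^2" by (intro tendsto_intros)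
   then show ?case by simp
  qed
 qed (use dsq i in \<open>auto intro!: mult_right_mono simp: abs_mult\<close>)
 have mem: "integrable lborel (%x. (norm (G' (u x) *R g x))^2)"
  by (rule L1_integrable_bound[OF integrable_mult_right[OF D12_int[OF u], of "B^2"]])
   (use sq in \<open>auto intro!: mult_right_mono simp: power_mult_distrib abs_mult\<close>)
 have dd: "integrable lborel (%x. (norm (grad (ph k) x - g x))^2)" for k by (rule D12_int[OF D12_diff[OF D12_test[OF ph(1)] u]])
 have "en (%x. grad (%x. G (ph k x)) x - G' (u x) *R g x)
  <= 2 * B^2 * en (%x. grad (ph k) x - g x) + 2 * (LBINT x. (G' (ph k x) - G' (u x))^2 * (norm (g x))^2)" for k
 proof -
  have pt: "(norm (grad (%x. G (ph k x)) x - G' (u x) *R g x))^2 <= 2 * B^2 * (norm (grad (ph k) x - g x))^2 + 2 * ((G' (ph k x) - G' (u x))^2 * (norm (g x))^2)" for x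
  proof -
   have "grad (%x. G (ph k x)) x - G' (u x) *R g x = G' (ph k x) *R (grad (ph k) x - g x) + (G' (ph k x) - G' (u x)) *R g x"
    by (simp add: gr algebra_simps)
   also have "(norm ...)^2 <= 2 * ((G' (ph k x))^2 * (norm (grad (ph k) x - g x))^2) + 2 * ((G' (ph k x) - G' (u x))^2 * (norm (g x))^2)"
    by (rule order_trans[OF norm_add_square_le]) (simp add: power_mult_distrib)
   also have "... <= 2 * (B^2 * (norm (grad (ph k) x - g x))^2) + 2 * ((G' (ph k x) - G' (u x))^2 * (norm (g x))^2)"
    by (intro add_right_mono mult_left_mono mult_right_mono sq) auto
   finally show ?thesis by simp
  qed
  have ir: "integrable lborel (%x. 2 * B^2 * (norm (grad (ph k) x - g x))^2)" "integrable lborel (%x. 2 * ((G' (ph k x) - G' (u x))^2 * (norm (g x))^2))"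
   by (intro integrable_mult_right dd id)+
  have "en (%x. grad (%x. G (ph k x)) x - G' (u x) *R g x) <= (LBINT x. 2 * B^2 * (norm (grad (ph k) x - g x))^2 + 2 * ((G' (ph k x) - G' (u x))^2 * (norm (g x))^2))"
   by (rule integral_mono'[OF L1_integrable_add[OF ir] pt]) simp
  also have "... = 2 * B^2 * en (%x. grad (ph k) x - g x) + 2 * (LBINT x. (G' (ph k x) - G' (u x))^2 * (norm (g x))^2)"
   by (subst L1_integral_add[OF ir]) simp
  finally show ?thesis .
 qed
 moreover have "(%k. 2 * B^2 * en (%x. grad (ph k) x - g x) + 2 * (LBINT x. (G' (ph k x) - G' (u x))^2 * (norm (g x))^2)) ~~> 0"
  using tendsto_add[OF tendsto_mult[OF tendsto_const ph(4)] tendsto_mult[OF tendsto_const lim], of "2 * B^2" 2] by simp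
 ultimately have el: "(%k. en (%x. grad (%x. G (ph k x)) x - G' (u x) *R g x)) ~~> 0" by (rule LIMSEQ_squeeze0[rotated]) simp
 have ae: "AE x in lborel. (%k. G (ph k x)) ~~> G (u x)" using ph(3)
  by eventually_elim (rule continuous_on_tendsto_compose[OF cG], auto)
 have ms: "(%x. G (u x)) : bmeas borel" "(%x. G' (u x) *R g x) : bmeas borel" by measurable
 show ?thesis unfolding D12_def by (intro conjI exI[of _ "%k x. G (ph k x)"] allI ms mem t ae el)
qed

text \<open>Transfers the estimate from test functions by Fatou's lemma. Restriction of the gradient
  integral to B is kept, since gradient bounds will be available only locally.\<close>

lemma D12_translation:
 fixes v :: "real^'n => real"
 assumes v: "D12 Om v g" and [measurable]: "A : sets borel" "B : sets borel" and AB: "!!x. x : A ==> cball x (norm h) <= B"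
 shows "(NN x. indicator A x * ennreal ((v (x + h) - v x)^2))
  <= ennreal (2 ^ CARD('n) * (norm h)^2 * (LBINT x. indicator B x * (norm (g x))^2))"
proof -
 obtain ph where ph: "!!k. test_fun Om (ph k)" "!!k. test_fun UNIV (ph k)" "AE x in lborel. (%k. ph k x) ~~> v x"
  "(%k. en (%x. grad (ph k) x - g x)) ~~> 0" "(%k. en (grad (ph k))) ~~> en g"
  by (rule D12_obtain[OF v]) (rule that)
 note [measurable] = D12_meas[OF v] test_measurable[OF ph(2)]
 have e: "(norm (indicat_real B x *R y))^2 = indicator B x * (norm y)^2" for x and y :: "real^'n" by (simp add: indicator_def)
 have ib: "integrable lborel (%x. indicator B x * (norm (k x))^2)" if "integrable lborel (%x. (norm (k x))^2)" for k :: "real^'n => real^'n"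
  using integrable_mult_indicator[OF _ that, of B] by simp
 have l0: "(%k. en (%x. indicat_real B x *R grad (ph k) x - indicat_real B x *R g x)) ~~> 0"
 proof (rule LIMSEQ_squeeze0[OF _ _ ph(4)])
  fix k
  have d: "integrable lborel (%x. (norm (grad (ph k) x - g x))^2)" by (rule D12_int[OF D12_diff[OF D12_test[OF ph(1)] v]])
  show "en (%x. indicat_real B x *R grad (ph k) x - indicat_real B x *R g x) <= en (%x. grad (ph k) x - g x)"
   unfolding scaleR_diff_right[symmetric] e by (rule integral_mono[OF ib[OF d] d]) (simp add: indicator_def)
 qed simp
 have L: "(%k. LBINT x. indicator B x * (norm (grad (ph k) x))^2) ~~> (LBINT x. indicator B x * (norm (g x))^2)"
  using L2_norm_tendsto[OF _ _ _ _ l0] unfolding e by (simp add: ib[OF D12_int[OF D12_test[OF ph(1)]]] ib[OF D12_int[OF v]])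
 define R where "R k = 2 ^ CARD('n) * (norm h)^2 * (LBINT x. indicator B x * (norm (grad (ph k) x))^2)" for k
 have st: "(NN x. indicator A x * ennreal ((ph k (x + h) - ph k x)^2)) <= ennreal (R k)" for k
 proof -
  have "(NN x. indicator B x * ennreal ((norm (grad (ph k) x))^2)) = (NN x. ennreal (indicator B x * (norm (grad (ph k) x))^2))"
   by (intro nn_integral_cong) (simp add: indicator_def)
  also have "... = ennreal (LBINT x. indicator B x * (norm (grad (ph k) x))^2)"
   by (rule nn_integral_eq_integral[OF ib[OF D12_int[OF D12_test[OF ph(1)]]]]) simp
  finally show ?thesis using translation_L2[OF test_fun_grad[OF ph(1)[of k]] assms(2,3) AB] by (simp add: R_def ennreal_mult)
 qed
 have ae2: "AE x in lborel. (%k. ph k (x + h)) ~~> v (x + h)" using AE_affine[OF _ ph(3), of 1 h] by simp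
 have "(NN x. indicator A x * ennreal ((v (x + h) - v x)^2)) = (NN x. liminf (%k. indicator A x * ennreal ((ph k (x + h) - ph k x)^2)))"
 proof (rule nn_integral_cong_AE)
  show "AE x in lborel. indicator A x * ennreal ((v (x + h) - v x)^2) = liminf (%k. indicator A x * ennreal ((ph k (x + h) - ph k x)^2))" using ph(3) ae2
  proof eventually_elim
   case (elim x)
   have "(%k. indicator A x * ennreal ((ph k (x + h) - ph k x)^2)) ~~> indicator A x * ennreal ((v (x + h) - v x)^2)"
    by (cases "x : A") (auto intro!: tendsto_intros tendsto_ennrealI elim)
   then show ?case by (rule lim_imp_Liminf[OF sequentially_bot, symmetric])
  qed
 qed
 also have "... <= liminf (%k. NN x. indicator A x * ennreal ((ph k (x + h) - ph k x)^2))" by (rule nn_integral_liminf) measurable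
 also have "... <= liminf (%k. ennreal (R k))" using st by (intro Liminf_mono always_eventually) blast
 also have "... = ennreal (2 ^ CARD('n) * (norm h)^2 * (LBINT x. indicator B x * (norm (g x))^2))"
  unfolding R_def by (intro lim_imp_Liminf[OF sequentially_bot] tendsto_ennrealI tendsto_intros L)
 finally show ?thesis .
qed

text \<open>A smooth substitute for e + 2 max(t, 0). It must be smooth and at least e on the whole
  line, because the test functions approximating u may be negative; for t >= 0 its slope lies
  between 1 and 2.\<close>

definition logreg :: "real => real => real" where "logreg e t = e + t + sqrt (t^2 + e^2)"

definition logreg' :: "real => real => real" where "logreg' e t = 1 + t / sqrt (t^2 + e^2)"

lemma logreg:
 assumes e: "e > 0"
 shows "logreg e t >= e" "t <= logreg e t" "logreg e 0 = 2 * e" "0 <= logreg' e t" "logreg' e t <= 2" "t >= 0 ==> 1 <= logreg' e t"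
  "(logreg e has_real_derivative logreg' e t) (at t)" "continuous_on UNIV (logreg' e)"
  "smooth_on UNIV f ==> smooth_on UNIV (%x. logreg e (f x) powr b)"
proof -
 have p: "t^2 + e^2 > 0" for t using e by (simp add: add_nonneg_pos)
 have s: "abs t <= sqrt (t^2 + e^2)" for t by (rule real_le_rsqrt) simp
 have ge: "logreg e t >= e" for t unfolding logreg_def using s[of t] by linarith
 then show "logreg e t >= e" .
 show "t <= logreg e t" using e p[of t] by (simp add: logreg_def)
 show "logreg e 0 = 2 * e" using e by (simp add: logreg_def)
 have "abs (t / sqrt (t^2 + e^2)) <= 1" using s[of t] p[of t] by (simp add: abs_divide)
 then show "0 <= logreg' e t" "logreg' e t <= 2" unfolding logreg'_def by linarith+
 show "t >= 0 ==> 1 <= logreg' e t" by (simp add: logreg'_def)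
 show "(logreg e has_real_derivative logreg' e t) (at t)" unfolding logreg_def[abs_def] logreg'_def
  using p[of t] by (auto intro!: derivative_eq_intros simp: divide_simps)
 show "continuous_on UNIV (logreg' e)" unfolding logreg'_def[abs_def]
  by (intro continuous_intros) (use p in \<open>auto simp: less_imp_neq[symmetric]\<close>)
 assume f: "smooth_on UNIV f"
 have q: "logreg e (f x) = e + f x + (f x * f x + e^2) powr (1/2)" for x
  unfolding logreg_def using p[of "f x"] by (simp add: powr_half_sqrt power2_eq_square)
 have pos: "e + f x + (f x * f x + e^2) powr (1/2) > 0" for x using ge[of "f x"] e unfolding q[symmetric] by linarith
 show "smooth_on UNIV (%x. logreg e (f x) powr b)" unfolding q
  by (intro smooth_powr smooth_add smooth_mult smooth_const f pos) (use p in \<open>simp add: power2_eq_square\<close>)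
qed

text \<open>The value at 0 is subtracted so that the composition preserves compact support.\<close>

lemma D12_logreg_powr:
 fixes u :: "real^'n => real"
 assumes u: "D12 Om u g" and e: "e > 0" and b: "b > 0"
 shows "D12 Om (%x. logreg e (u x) powr (- b) - logreg e 0 powr (- b)) (%x. (- b * logreg e (u x) powr (- b - 1) * logreg' e (u x)) *R g x)"
proof (rule D12_compose[OF u, where B = "b * e powr (- b - 1) * 2"])
 note m = logreg[OF e]
 have m0: "logreg e t > 0" for t using m(1)[of t] e by linarith
 show "((%t. logreg e t powr - b - logreg e 0 powr - b) has_real_derivative - b * logreg e t powr (- b - 1) * logreg' e t) (at t)" for t
  using m0[of t] by (auto intro!: derivative_eq_intros m(7))
 have "continuous_on UNIV (logreg e)" using m(7) by (intro continuous_at_imp_continuous_on) (auto intro: DERIV_isCont)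
 then show "continuous_on UNIV (%t. - b * logreg e t powr (- b - 1) * logreg' e t)"
  by (intro continuous_intros m(8)) (use m0 in \<open>auto simp: less_imp_neq[symmetric]\<close>)
 show "abs (- b * logreg e t powr (- b - 1) * logreg' e t) <= b * e powr (- b - 1) * 2" for t
  unfolding abs_mult using m(1,4,5)[of t] b e by (intro mult_mono) (auto intro: powr_mono2')
 show "smooth_on UNIV (%x. logreg e (f x) powr - b - logreg e 0 powr - b)" if "smooth_on UNIV f" for f :: "real^'n => real"
  by (intro smooth_diff m(9) smooth_const that)
qed simp

section \<open>The zero set of a nonnegative minimizer\<close>

lemma AE_open_locally:
 fixes S :: "(real^'n) set"
 assumes "!!x. x : S ==> \<exists>r>0. AE y in lborel. y : cball x r --> Q y"
 shows "AE y in lborel. y : S --> Q y"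
proof -
 obtain r where r: "!!x. x : S ==> r x > 0" "!!x. x : S ==> AE y in lborel. y : cball x (r x) --> Q y" using assms by metis
 have op: "open T" if "T : (%x. ball x (r x)) ` S" for T using that by blast
 obtain F where F: "F <= (%x. ball x (r x)) ` S" "countable F" "\<Union>F = \<Union>((%x. ball x (r x)) ` S)"
  by (rule Lindelof[OF op]) (assumption, rule that)
 have "AE y in lborel. y : T --> Q y" if T: "T : F" for T
 proof -
  obtain x where x: "x : S" "T = ball x (r x)" using T F(1) by blast
  show ?thesis using r(2)[OF x(1)] unfolding x(2) by eventually_elim simp
 qed
 then have "AE y in lborel. \<forall>T\<in>F. y : T --> Q y" by (subst AE_ball_countable[OF F(2)]) blast
 then show ?thesis
 proof eventually_elim
  case (elim y)
  show ?case
  proof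
   assume "y : S"
   then have "y : \<Union>F" unfolding F(3) using r(1) by (auto intro!: bexI[of _ y])
   then show "Q y" using elim by blast
  qed
 qed
qed

context nehari begin

text \<open>Testing the equation with $\zeta^2/m(u)$, $m(t)=\varepsilon+t+\sqrt{t^2+\varepsilon^2}$, bounds the gradient of $\log m(u)$ independently of $\varepsilon$.\<close>

lemma log_gradient_bound:
 assumes u: "Neh u g" "En u g = m" "!!x. u x >= 0" and ze: "test_fun Om ze" "!!x. 0 <= ze x" "!!x. ze x <= 1"
  and xi: "test_fun Om xi" "!!x. ze x ~= 0 ==> xi x = 1"
 obtains C where "!!e. e > 0 ==> integrable lborel (%x. (ze x)^2 * (norm (g x) / logreg e (u x))^2)"
  "!!e. e > 0 ==> (LBINT x. (ze x)^2 * (norm (g x) / logreg e (u x))^2) <= C"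
proof -
 have Xu: "X u g" using u by (simp add: Neh_def)
 note D = XD(1)[OF Xu]
 note [measurable] = D12_meas[OF D] XD(4)[OF Xu]
 \<comment> \<open>As xi = 1 where ze is nonzero, |xi|^q is a \<open>muu\<close>-integrable majorant
   of 1 on the support of ze.\<close>
 define K where "K = (\<integral>x. abs (xi x) powr q + abs (u x) powr q \<partial>muu)"
 define z where "z x = ze x * ze x" for x
 have sz: "smooth_on UNIV ze" by (rule test_fun_smooth[OF ze(1)])
 have tz: "test_fun Om z" unfolding z_def[abs_def] by (rule test_fun_mult[OF ze(1) sz])
 have gz: "grad z x = (2 * ze x) *R grad ze x" for x unfolding z_def[abs_def] grad_mult[OF sz sz] by (simp add: scaleR_2[symmetric])
 have [measurable]: "ze : bmeas borel" using test_measurable[OF test_fun_mono[OF ze(1) subset_UNIV]] by simp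
 have main: "integrable lborel (%x. (ze x)^2 * (norm (g x) / logreg e (u x))^2) &
  (LBINT x. (ze x)^2 * (norm (g x) / logreg e (u x))^2) <= 4 * en (grad ze) + 2 * K" if e: "e > 0" for e
 proof -
  note L = logreg[OF e]
  have m0: "logreg e t > 0" for t using L(1)[of t] e by linarith
  define F where "F x = inverse (logreg e (u x))" for x
  have F: "0 < F x" "F x <= 1 / e" for x using m0[of "u x"] L(1)[of "u x"] e by (auto simp: F_def divide_simps)
  have Fp: "logreg e (u x) powr - 1 = F x" "logreg e (u x) powr (- 1 - 1) = (F x)^2" for x
   using m0[of "u x"] by (simp_all add: F_def powr_minus powr_numeral power_inverse)
  have [measurable]: "logreg e : bmeas borel" by (intro borel_measurable_continuous_onI continuous_at_imp_continuous_on) (auto intro: DERIV_isCont[OF L(7)])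
  obtain B where B: "!!x. abs (z x) <= B" "!!x. (norm (grad z x))^2 * (1 + (norm x)^2) <= B^2" by (rule cutoff_bounds[OF test_fun_mono[OF tz subset_UNIV]]) (rule that)
  \<comment> \<open>This is z/m(u), with the value of 1/m at 0 subtracted and added back, so that
    both parts lie in \<open>D12\<close>.\<close>
  define v where "v x = z x * (logreg e (u x) powr - 1 - logreg e 0 powr - 1) + logreg e 0 powr - 1 * z x" for x
  define k where "k x = (z x *R (- 1 * logreg e (u x) powr (- 1 - 1) * logreg' e (u x)) *R g x + (logreg e (u x) powr - 1 - logreg e 0 powr - 1) *R grad z x)
   + logreg e 0 powr - 1 *R grad z x" for x
  have vD: "D12 Om v k" unfolding v_def[abs_def] k_def[abs_def]
   by (rule D12_lin[OF D12_mult[OF N D12_logreg_powr[OF D e zero_less_one] test_fun_smooth[OF tz] B] D12_test[OF tz]])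
    (rule test_fun_mult[OF _ test_fun_smooth[OF tz]])
  have v: "v x = z x * F x" for x unfolding v_def Fp by (simp add: algebra_simps)
  have k: "k x = (- z x * (F x)^2 * logreg' e (u x)) *R g x + F x *R grad z x" for x unfolding k_def Fp by (simp add: algebra_simps)
  have z01: "0 <= z x" "z x <= ze x" "z x <= 1" for x using ze(2,3)[of x] by (auto simp: z_def mult_left_le mult_le_one)
  have Xv: "X v k" unfolding X_def
  proof (intro conjI vD L1_integrable_bound[OF test_muu[OF test_fun_scale[OF ze(1), of "1 / e"]]] AE_I2)
   show "(%x. abs (v x) powr q) : bmeas muu" using D12_meas(1)[OF vD] by simp
   have "abs (v x) <= abs (1 / e * ze x)" for x unfolding v
    using mult_mono[OF z01(2)[of x] F(2)[of x] ze(2)[of x]] F(1)[of x] z01(1)[of x] e ze(2)[of x] by (simp add: mult.commute)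
   then show "norm (abs (v x) powr q) <= norm (abs (1 / e * ze x) powr q)" for x using exps by (simp add: powr_mono2)
  qed
  note EL = Nehari_Euler_Lagrange[OF u(1,2) Xv]
  have vn: "v x >= 0" for x unfolding v using z01(1)[of x] F(1)[of x] by simp
  have nn: "0 <= sgn (u x) * abs (u x) powr j * v x" for x j using u(3)[of x] vn[of x] by (intro mult_nonneg_nonneg) (auto simp: sgn_if)
  \<comment> \<open>The subcritical and critical terms are nonnegative on v, so they may be dropped;
    no upper bound for them enters.\<close>
  have f1: "0 <= (LBINT x. g x \<bullet> k x) + (\<integral>x. sgn (u x) * abs (u x) powr (q - 1) * v x \<partial>muu)"
   unfolding EL(4) by (intro add_nonneg_nonneg L1_integral_nonneg nn)
  have f2: "(\<integral>x. sgn (u x) * abs (u x) powr (q - 1) * v x \<partial>muu) <= K" unfolding K_def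
  proof (rule integral_mono[OF EL(1) L1_integrable_add[OF test_muu[OF xi(1)] XD(2)[OF Xu]]])
   fix x
   show "sgn (u x) * abs (u x) powr (q - 1) * v x <= abs (xi x) powr q + abs (u x) powr q"
   proof (cases "u x > 0 & ze x ~= 0")
    case True
    have "F x <= 1 / u x" using L(2)[of "u x"] True m0[of "u x"] by (simp add: F_def divide_simps)
    then have "v x <= 1 * (1 / u x)" unfolding v using z01[of x] F(1)[of x] by (intro mult_mono) auto
    then have "u x powr (q - 1) * v x <= u x powr (q - 1) * (1 / u x)" by (intro mult_left_mono) auto
    also have "... = u x powr (q - 2)" using True powr_diff[of "u x" "q - 1" 1] by simp
    also have "... <= 1 + u x powr q"
    proof (cases "u x <= 1")
     case le: True
     then have "u x powr (q - 2) <= 1" using True exps by (intro powr_le1) auto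
     then show ?thesis by (simp add: add_increasing2)
    next
     case False
     then have "u x powr (q - 2) <= u x powr q" by (intro powr_mono) auto
     then show ?thesis by simp
    qed
    finally show ?thesis using True xi(2)[of x] by simp
   next
    case False
    then have e0: "sgn (u x) * abs (u x) powr (q - 1) * v x = 0" using u(3)[of x] by (auto simp: v z_def)
    show ?thesis unfolding e0 by simp
   qed
  qed
  define W where "W x = (ze x)^2 * (norm (g x) / logreg e (u x))^2" for x
  have W: "W x = z x * ((F x)^2 * (norm (g x))^2)" for x by (simp add: W_def z_def F_def power2_eq_square divide_inverse)
  have Wi: "integrable lborel W"
  proof (rule L1_integrable_bound[OF integrable_mult_right[OF D12_int[OF D], of "(1 / e)^2"]])
   show "W : bmeas lborel" unfolding W_def[abs_def] by measurable
   have "W x <= 1 * ((1 / e)^2 * (norm (g x))^2)" for x unfolding W using F[of x] z01[of x] by (intro mult_mono power_mono) auto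
   then show "AE x in lborel. norm (W x) <= norm ((1 / e)^2 * (norm (g x))^2)" by (simp add: W_def)
  qed
  have "(LBINT x. g x \<bullet> k x) <= (LBINT x. 2 * (norm (grad ze x))^2 - (1/2) * W x)"
  proof (rule integral_mono)
   show "integrable lborel (%x. g x \<bullet> k x)" by (rule L2_inner(1)) (use D12_meas[OF D] D12_meas[OF vD] D12_int[OF D] D12_int[OF vD] in simp_all)
   show "integrable lborel (%x. 2 * (norm (grad ze x))^2 - (1/2) * W x)"
    by (intro L1_integrable_diff integrable_mult_right D12_int[OF D12_test[OF ze(1)]] Wi)
   fix x
   \<comment> \<open>The derivative of 1/m(u) produces -W with slope at least 1, and Young's
     inequality takes back only half of W for the term with the gradient of the cut-off.\<close>
   define a b where "a = ze x * F x * norm (g x)" and "b = norm (grad ze x)"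
   have W2: "W x = a^2" by (simp add: W a_def z_def power2_eq_square)
   have "g x \<bullet> k x = - (W x * logreg' e (u x)) + F x * (2 * ze x) * (g x \<bullet> grad ze x)"
    unfolding k W gz by (simp add: inner_simps power2_norm_eq_inner)
   also have "F x * (2 * ze x) * (g x \<bullet> grad ze x) <= F x * (2 * ze x) * (norm (g x) * norm (grad ze x))"
    using F(1)[of x] ze(2)[of x] by (intro mult_left_mono norm_cauchy_schwarz) auto
   also have "... = 2 * a * b" by (simp add: a_def b_def)
   also have "... <= (1/2) * a^2 + 2 * b^2" using zero_le_power2[of "a - 2 * b"] by (simp add: power2_eq_square algebra_simps)
   also have "- (W x * logreg' e (u x)) <= - (W x * 1)" using L(6)[OF u(3)[of x]] unfolding W2 by (intro le_imp_neg_le mult_left_mono) auto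
   finally show "g x \<bullet> k x <= 2 * (norm (grad ze x))^2 - (1/2) * W x" by (simp add: W2 b_def)
  qed
  also have "... = 2 * en (grad ze) - (1/2) * (LBINT x. W x)"
   by (subst L1_integral_diff) (use Wi D12_int[OF D12_test[OF ze(1)]] in auto)
  finally have "(LBINT x. W x) <= 4 * en (grad ze) + 2 * K" using f1 f2 by linarith
  then show ?thesis using Wi unfolding W_def[abs_def] by blast
 qed
 show thesis by (rule that[of "4 * en (grad ze) + 2 * K"]) (use main in blast)+
qed

text \<open>The function (e/m(u))^tau is at least 1/2 where u = 0 and at most 1/4 where u >=
  1/(n+1), if e is small. Its gradient is of order tau times that of log m(u), hence tends to 0 in
  L^2 with tau. So for each small shift h, almost no point with u = 0 is moved to a point with u >
  0. Integrating over h shows that one of the two sets is null.\<close>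

lemma zero_set_dichotomy:
 assumes u: "Neh u g" "En u g = m" "!!x. u x >= 0" and rh: "rh > 0" "cball x0 (5 * rh) <= Om"
 shows "(AE x in lborel. x : cball x0 rh --> u x = 0) \<or> (AE x in lborel. x : cball x0 rh --> u x > 0)"
proof -
 have Xu: "X u g" using u by (simp add: Neh_def)
 note D = XD(1)[OF Xu]
 note [measurable] = D12_meas[OF D]
 \<comment> \<open>Two points of \<open>cball x0 rh\<close> differ by at most 2 rh, and shifting by
   that much stays in radius 3 rh. There ze must be 1; it vanishes outside radius 4 rh, where xi is
   still 1, and xi needs radius 5 rh.\<close>
 obtain ze where ze: "test_fun (cball x0 (4 * rh)) ze" "!!x. 0 <= ze x" "!!x. ze x <= 1"
  "!!x. norm (x - x0) <= 3 * rh ==> ze x = 1" "!!x. norm (x - x0) >= 4 * rh ==> ze x = 0"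
  by (rule test_fun_exists[of "3 * rh" "4 * rh" x0]) (use rh in simp, use rh in simp, rule that)
 obtain xi where xi: "test_fun (cball x0 (5 * rh)) xi" "!!x. norm (x - x0) <= 4 * rh ==> xi x = 1"
  by (rule test_fun_exists[of "4 * rh" "5 * rh" x0]) (use rh in simp, use rh in simp, rule that)
 have c45: "cball x0 (4 * rh) <= Om" using rh by (intro order_trans[OF _ rh(2)] subset_cball) simp
 have xi1: "xi x = 1" if "ze x ~= 0" for x using ze(5)[of x] xi(2)[of x] that by fastforce
 obtain C where C: "!!e. e > 0 ==> integrable lborel (%x. (ze x)^2 * (norm (g x) / logreg e (u x))^2)"
  "!!e. e > 0 ==> (LBINT x. (ze x)^2 * (norm (g x) / logreg e (u x))^2) <= C"
  by (rule log_gradient_bound[OF u test_fun_mono[OF ze(1) c45] ze(2,3) test_fun_mono[OF xi(1) rh(2)] xi1]) (assumption, rule that)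
 have [measurable]: "cball a b : sets borel" for a :: "real^'n" and b by simp
 define A where "A = cball x0 rh"
 have [measurable]: "A : sets borel" by (simp add: A_def)
 have null: "emeasure lborel {x\<in>A. u x = 0 & 1 / real (Suc n) <= u (x + h)} = 0" (is "emeasure _ ?E = 0") if h: "norm h <= 2 * rh" for h n
 proof -
  have E[measurable]: "?E : sets borel" by measurable
  have bnd: "emeasure lborel ?E <= ennreal (16 * (2 ^ CARD('n) * (norm h)^2 * (4 * C)) * (inverse (real (Suc k)))^2)" for k
  proof -
   define tau where "tau = inverse (real (Suc k))"
   have tau: "0 < tau" "tau <= 1" by (auto simp: tau_def inverse_le_1_iff)
   \<comment> \<open>Chosen so that (e(n+1))^tau = 1/4. Since m(0) = 2e, the value at zeros of u is
     (1/2)^tau >= 1/2, so the jump is at least 1/4 for every tau <= 1.\<close>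
   define e where "e = (1/4) powr (1 / tau) / real (Suc n)"
   have e: "e > 0" by (simp add: e_def)
   have e4: "(e * real (Suc n)) powr tau = 1/4" using tau by (simp add: e_def powr_powr)
   note L = logreg[OF e]
   have m0: "logreg e t > 0" for t using L(1)[of t] e by linarith
   define v where "v x = e powr tau * (logreg e (u x) powr - tau - logreg e 0 powr - tau)" for x
   define k where "k x = e powr tau *R (- tau * logreg e (u x) powr (- tau - 1) * logreg' e (u x)) *R g x" for x
   have vD: "D12 Om v k" unfolding v_def[abs_def] k_def[abs_def] by (rule D12_scale[OF D12_logreg_powr[OF D e tau(1)]])
   have ev: "e powr tau * logreg e t powr - tau = (e / logreg e t) powr tau" for t using e m0[of t] by (simp add: powr_divide powr_minus_divide)
   have nk: "norm (k x) <= 2 * tau * (norm (g x) / logreg e (u x))" for x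
   proof -
    have "logreg e (u x) powr (- tau - 1) = logreg e (u x) powr - tau / logreg e (u x)" using m0[of "u x"] powr_diff[of "logreg e (u x)" "- tau" 1] by simp
    then have "norm (k x) = tau * logreg' e (u x) * (e powr tau * logreg e (u x) powr - tau) * (norm (g x) / logreg e (u x))"
     unfolding k_def using tau m0[of "u x"] L(4)[of "u x"] by (simp add: abs_mult)
    also have "... <= tau * 2 * 1 * (norm (g x) / logreg e (u x))" unfolding ev
     using tau e m0[of "u x"] L(1,4,5)[of "u x"] by (intro mult_right_mono mult_mono powr_le1) auto
    finally show ?thesis by (simp add: mult.commute)
   qed
   have "(LBINT x. indicator (cball x0 (3 * rh)) x * (norm (k x))^2) <= (LBINT x. 4 * tau^2 * ((ze x)^2 * (norm (g x) / logreg e (u x))^2))"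
   proof (rule integral_mono'[OF integrable_mult_right[OF C(1)[OF e]]])
    show "indicator (cball x0 (3 * rh)) x * (norm (k x))^2 <= 4 * tau^2 * ((ze x)^2 * (norm (g x) / logreg e (u x))^2)" for x
    proof (cases "x : cball x0 (3 * rh)")
     case True
     then have "ze x = 1" by (intro ze(4)) (simp add: dist_norm norm_minus_commute)
     moreover have "(norm (k x))^2 <= (2 * tau * (norm (g x) / logreg e (u x)))^2" using nk[of x] by (intro power_mono) auto
     ultimately show ?thesis using True by (simp add: power_mult_distrib power_divide)
    qed simp
   qed simp
   also have "... <= 4 * tau^2 * C" unfolding integral_mult_right_zero by (intro mult_left_mono C(2)[OF e]) simp
   finally have kC: "(LBINT x. indicator (cball x0 (3 * rh)) x * (norm (k x))^2) <= 4 * tau^2 * C" .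
   have sub: "cball x (norm h) <= cball x0 (3 * rh)" if "x : A" for x
   proof
    fix y assume "y : cball x (norm h)"
    then show "y : cball x0 (3 * rh)" using that h dist_triangle[of x0 y x] by (simp add: A_def)
   qed
   have "emeasure lborel ?E = (NN x. indicator ?E x)" by simp
   also have "... <= (NN x. ennreal 16 * (indicator A x * ennreal ((v (x + h) - v x)^2)))"
   proof (rule nn_integral_mono)
    fix x
    show "indicator ?E x <= ennreal 16 * (indicator A x * ennreal ((v (x + h) - v x)^2))"
    proof (cases "x : ?E")
     case True
     have "(e / logreg e (u (x + h))) powr tau <= (e * real (Suc n)) powr tau"
     proof (rule powr_mono2)
      have "1 / real (Suc n) <= logreg e (u (x + h))" using True L(2)[of "u (x + h)"] by simp
      then have "e / logreg e (u (x + h)) <= e / (1 / real (Suc n))" using e m0[of "u (x + h)"] by (intro divide_left_mono) auto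
      then show "e / logreg e (u (x + h)) <= e * real (Suc n)" by simp
     qed (use tau e m0[of "u (x + h)"] in auto)
     then have v1: "(e / logreg e (u (x + h))) powr tau <= 1/4" unfolding e4 .
     have "(1/2) powr 1 <= (1/2 :: real) powr tau" using tau by (intro powr_mono') auto
     then have "1/2 <= (e / logreg e (u x)) powr tau" using True e L(3) by simp
     then have "1/4 <= v x - v (x + h)" using v1 unfolding v_def right_diff_distrib ev by linarith
     then have "(1/4)^2 <= (v x - v (x + h))^2" by (intro power_mono) auto
     then have "1 <= 16 * (v (x + h) - v x)^2" unfolding power2_commute[of "v x"] by (simp add: power_divide)
     then have "ennreal 1 <= ennreal (16 * (v (x + h) - v x)^2)" by (rule ennreal_leI)
     then show ?thesis using True by (simp add: ennreal_mult)
    qed simp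
   qed
   also have "... = ennreal 16 * (NN x. indicator A x * ennreal ((v (x + h) - v x)^2))"
    by (rule nn_integral_cmult) (use D12_meas(1)[OF vD] in measurable)
   also have "... <= ennreal 16 * ennreal (2 ^ CARD('n) * (norm h)^2 * (LBINT x. indicator (cball x0 (3 * rh)) x * (norm (k x))^2))"
    by (intro mult_left_mono D12_translation[OF vD _ _ sub]) auto
   also have "... <= ennreal 16 * ennreal (2 ^ CARD('n) * (norm h)^2 * (4 * tau^2 * C))"
    by (intro mult_left_mono ennreal_leI kC) auto
   also have "... = ennreal (16 * (2 ^ CARD('n) * (norm h)^2 * (4 * C)) * tau^2)"
    by (subst ennreal_mult'[symmetric]) (auto simp: mult_ac)
   finally show ?thesis unfolding tau_def .
  qed
  have "(%k. ennreal (16 * (2 ^ CARD('n) * (norm h)^2 * (4 * C)) * (inverse (real (Suc k)))^2)) ~~> ennreal (16 * (2 ^ CARD('n) * (norm h)^2 * (4 * C)) * 0^2)"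
   by (intro tendsto_ennrealI tendsto_mult tendsto_const tendsto_power LIMSEQ_inverse_real_of_nat)
  from LIMSEQ_le_const[OF this] bnd have "emeasure lborel ?E <= ennreal (16 * (2 ^ CARD('n) * (norm h)^2 * (4 * C)) * 0^2)" by blast
  then show ?thesis by simp
 qed
 define a b where "a = {x\<in>A. u x = 0}" and "b = {x\<in>A. u x > 0}"
 have [measurable]: "a : sets borel" "b : sets borel" unfolding a_def b_def by measurable
 have z: "(NN x. indicator a x * indicator b (h + x)) = 0" for h
 proof (cases "norm h <= 2 * rh")
  case True
  have "AE x in lborel. x \<notin> {x\<in>A. u x = 0 & 1 / real (Suc n) <= u (x + h)}" for n by (intro AE_not_in null_setsI null[OF True]) measurable
  then have "AE x in lborel. \<forall>n. x \<notin> {x\<in>A. u x = 0 & 1 / real (Suc n) <= u (x + h)}" unfolding AE_all_countable by blast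
  then have "AE x in lborel. indicator a x * indicator b (h + x) = (0::ennreal)"
  proof eventually_elim
   case (elim x)
   have "\<exists>n. 1 / real (Suc n) <= u (x + h)" if "u (x + h) > 0" using reals_Archimedean[OF that] less_imp_le unfolding inverse_eq_divide by blast
   then show ?case using elim by (auto simp: a_def b_def indicator_def add.commute)
  qed
  then show ?thesis by (subst nn_integral_0_iff_AE) auto
 next
  case False
  have e0: "indicator a x * indicator b (h + x) = (0::ennreal)" for x
  proof (rule ccontr)
   assume "indicator a x * indicator b (h + x) ~= (0::ennreal)"
   then have "x : A" "h + x : A" by (auto simp: a_def b_def indicator_def split: if_splits)
   then show False using False dist_triangle[of "h + x" x x0] by (simp add: A_def dist_norm norm_minus_commute)
  qed
  show ?thesis unfolding e0 by simp
 qed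
 \<comment> \<open>By Fubini the product of the measures is the integral over all shifts h of the
   measure of the points x in a with x + h in b.\<close>
 have "emeasure lborel a * emeasure lborel b = (NN x. indicator a x * (NN h. indicator b h))" by (simp add: nn_integral_multc)
 also have "... = (NN x. (NN h. indicator a x * indicator b (h + x)))"
  by (intro nn_integral_cong) (subst nn_integral_cmult, measurable, subst nn_integral_translate, auto)
 also have "... = (NN h. (NN x. indicator a x * indicator b (h + x)))" by (rule lborel_pair.Fubini'[symmetric]) measurable
 also have "... = 0" unfolding z by simp
 finally have "emeasure lborel a = 0 \<or> emeasure lborel b = 0" by simp
 then show ?thesis
 proof
  assume "emeasure lborel a = 0"
  then have "AE x in lborel. x \<notin> a" by (intro AE_not_in null_setsI) auto
  then have "AE x in lborel. x : cball x0 rh --> u x > 0" by eventually_elim (use u(3) in \<open>auto simp: a_def A_def order.strict_iff_order\<close>)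
  then show ?thesis ..
 next
  assume "emeasure lborel b = 0"
  then have "AE x in lborel. x \<notin> b" by (intro AE_not_in null_setsI) auto
  then have "AE x in lborel. x : cball x0 rh --> u x = 0" by eventually_elim (use u(3) in \<open>auto simp: b_def A_def order.strict_iff_order\<close>)
  then show ?thesis ..
 qed
qed

text \<open>|u| has no larger energy and the same other integrals, so it is again a minimizer.
  Around every point it is locally either almost everywhere zero or almost everywhere positive; both
  alternatives are open, and connectedness leaves one of them.\<close>

theorem Nehari_minimizer_positive:
 assumes op: "open Om" "connected Om" and u: "Neh u g" "En u g = m"
 obtains v h where "Neh v h" "En v h = m" "!!x. v x >= 0" "AE x in lborel. x : Om --> v x > 0"
proof -
 have Xu: "X u g" and gp: "en g > 0" and J: "J u g = 0" using u by (auto simp: Neh_def)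
 define v where "v x = abs (u x)" for x
 have va: "v = (%x. abs (u x))" by (simp add: v_def[abs_def])
 obtain h where h0: "D12 Om (%x. abs (u x)) h" "en h <= en g" by (rule D12_abs[OF N XD(1)[OF Xu]]) (rule that)
 note h = h0(1)[folded va] h0(2)
 have eq: "bq v = bq u" "pw k v = pw k u" for k by (simp_all add: v_def bq_def)
 have Xv: "X v h" unfolding X_def using h XD(2)[OF Xu] by (simp add: v_def)
 have nz: "\<not> (AE x in lborel. v x = 0)" using gp energy_pos[OF XD(1)[OF Xu]] by (simp add: v_def)
 have Jv: "J v h <= 0" using J h(2) by (simp add: J_def eq)
 have "(1/2 - 1/P) * en h <= (1/2 - 1/P) * en g" using coef h(2) by (intro mult_left_mono) auto
 then have "En v h <= m" using u(2) by (simp add: En_def eq)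
 note mv = below_level_attained[OF Xv _ Jv this u(1)]
 have n: "Neh v h" "En v h = m" using mv energy_pos[OF h(1)] nz by auto
 have v0: "v x >= 0" for x by (simp add: v_def)
 define Z W where "Z = {x\<in>Om. \<exists>r>0. AE y in lborel. y : cball x r --> v y = 0}" and "W = {x\<in>Om. \<exists>r>0. AE y in lborel. y : cball x r --> v y > 0}"
 have opn: "open {x\<in>Om. \<exists>r>0. AE y in lborel. y : cball x r --> Q y}" for Q
  unfolding open_contains_ball
 proof
  fix x assume "x : {x\<in>Om. \<exists>r>0. AE y in lborel. y : cball x r --> Q y}"
  then obtain r where r: "x : Om" "r > 0" "AE y in lborel. y : cball x r --> Q y" by blast
  obtain d where d: "d > 0" "ball x d <= Om" using op(1) r(1) open_contains_ball by blast
  have "AE z in lborel. z : cball y (r / 2) --> Q z" if y: "y : ball x (min d (r / 2))" for y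
   using r(3)
  proof eventually_elim
   case (elim z)
   show ?case using elim y dist_triangle[of x z y] by auto
  qed
  then have "ball x (min d (r / 2)) <= {x\<in>Om. \<exists>r>0. AE y in lborel. y : cball x r --> Q y}" using d(2) r(2) by (auto intro!: exI[of _ "r / 2"])
  then show "\<exists>e>0. ball x e <= {x\<in>Om. \<exists>r>0. AE y in lborel. y : cball x r --> Q y}" using d(1) r(2) by (intro exI[of _ "min d (r / 2)"]) auto
 qed
 have cover: "Om <= Z \<union> W"
 proof
  fix x assume x: "x : Om"
  then obtain d where d: "d > 0" "cball x d <= Om" using op(1) open_contains_cball by blast
  have "(AE y in lborel. y : cball x (d / 5) --> v y = 0) \<or> (AE y in lborel. y : cball x (d / 5) --> v y > 0)"
   by (rule zero_set_dichotomy[OF n v0]) (use d in auto)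
  moreover have "d / 5 > 0" using d(1) by simp
  ultimately show "x : Z \<union> W" unfolding Z_def W_def using x by blast
 qed
 have disj: "Z \<inter> W = {}"
 proof (rule ccontr)
  assume "Z \<inter> W ~= {}"
  then obtain x r1 r2 where r: "r1 > 0" "AE y in lborel. y : cball x r1 --> v y = 0" "r2 > 0" "AE y in lborel. y : cball x r2 --> v y > 0"
   unfolding Z_def W_def by blast
  have "AE y in lborel. y \<notin> cball x (min r1 r2)" using r(2,4) by eventually_elim auto
  then have "emeasure lborel (cball x (min r1 r2)) = 0" by (subst (asm) AE_iff_measurable[of "cball x (min r1 r2)"]) auto
  then show False using content_cball_pos[of "min r1 r2" x] r by (simp add: measure_def)
 qed
 have "Om \<inter> Z = {} \<or> Om \<inter> W = {}" using op(2) opn[of "%y. v y = 0"] opn[of "%y. v y > 0"] cover disj unfolding connected_def Z_def W_def by blast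
 moreover have "Om \<inter> W ~= {}"
 proof
  assume "Om \<inter> W = {}"
  then have "AE x in lborel. x : Om --> v x = 0" using cover by (intro AE_open_locally) (auto simp: Z_def)
  then have "AE x in lborel. v x = 0" using D12_outside[OF h(1)] by eventually_elim auto
  then show False using nz by simp
 qed
 ultimately have "Om <= W" using cover by blast
 then have "AE x in lborel. x : Om --> v x > 0" by (intro AE_open_locally) (auto simp: W_def)
 then show thesis by (rule that[OF n v0])
qed

end

section \<open>The level estimate\<close>

text \<open>Bounds an intermediate power by the two weighted powers that the decay theorem controls.
  At the height where |y|^(q-2) = j^(aph-1) the first term takes over, and the hypothesis on the
  exponents says that above it the second term suffices.\<close>

lemma powr_split_weight:
 fixes y j q r aph :: real
 assumes "j >= 1" "2 < q" "q < r" "(1 - aph) * (r - q) <= (aph * r / 2) * (q - 2)"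
 shows "abs y powr q <= j powr (aph - 1) * y^2 + j powr (aph * r / 2) * abs y powr r"
proof (cases "abs y powr (q - 2) <= j powr (aph - 1)")
 case True
 have "abs y powr q = abs y powr (q - 2) * abs y powr 2" unfolding powr_add[symmetric] by simp
 also have "... <= j powr (aph - 1) * abs y powr 2" by (intro mult_right_mono True) auto
 also have "abs y powr 2 = y^2" by (cases "y = 0") (auto simp: powr_numeral)
 finally show ?thesis by (simp add: add_increasing2)
next
 case False
 then have y: "abs y > 0" by (cases "y = 0") auto
 have "(j powr (aph - 1)) powr ((r - q) / (q - 2)) <= (abs y powr (q - 2)) powr ((r - q) / (q - 2))" using False assms by (intro powr_mono2) auto
 then have a: "j powr ((aph - 1) * ((r - q) / (q - 2))) <= abs y powr (r - q)" using assms by (simp add: powr_powr)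
 have "0 <= (aph - 1) * ((r - q) / (q - 2)) + aph * r / 2" using assms by (simp add: field_simps)
 then have "1 <= j powr ((aph - 1) * ((r - q) / (q - 2)) + aph * r / 2)" using assms by (intro ge_one_powr_ge_zero) auto
 also have "... = j powr ((aph - 1) * ((r - q) / (q - 2))) * j powr (aph * r / 2)" by (rule powr_add)
 also have "... <= abs y powr (r - q) * j powr (aph * r / 2)" by (intro mult_right_mono a) auto
 finally have "abs y powr q * 1 <= abs y powr q * (abs y powr (r - q) * j powr (aph * r / 2))" by (intro mult_left_mono) auto
 also have "... = j powr (aph * r / 2) * (abs y powr q * abs y powr (r - q))" by simp
 also have "abs y powr q * abs y powr (r - q) = abs y powr r" unfolding powr_add[symmetric] by simp
 finally show ?thesis by (simp add: add_increasing)
qed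

text \<open>Truncated and rescaled extremals. Testing the equation of $U$ with $w^2U$ shows that the truncation costs only $\int U^2|\nabla w|^2$.\<close>

theorem Sobolev_bubbles:
 fixes x0 :: "real^'n" and kp :: "real => real"
 assumes N4: "CARD('n) >= 4" and rh: "rh > 0" and ex: "2 < q" "q < P" "P < crit TYPE('n)"
  and kp: "!!t. kp t = real CARD('n) - (real CARD('n) - 2) * t / 2"
 obtains aph C c0 e0 where "kp q < 2 * aph" "C > 0" "c0 > 0" "0 < e0" "e0 <= 1"
  "!!e. 0 < e ==> e <= e0 ==> \<exists>v g. D12 (cball x0 rh) v g & (\<forall>x. x \<notin> cball x0 rh --> v x = 0) &
   en g <= Sob TYPE('n) + C * e powr (2 * aph) & 1 - C * e powr (2 * aph) <= pw (crit TYPE('n)) v &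
   c0 * e powr kp P <= pw P v & integrable lborel (%x. abs (v x) powr q) & pw q v <= C * e powr kp q"
proof -
 define n where "n = real CARD('n)"
 define r where "r = crit TYPE('n)"
 have N: "CARD('n) >= 3" and n4: "n >= 4" using N4 by (auto simp: n_def)
 have rn: "r = 2 * n / (n - 2)" by (simp add: r_def crit_def n_def)
 have r2: "r > 2" unfolding r_def by (rule crit_gt_2[OF N])
 have S0: "Sob TYPE('n) > 0" by (rule Sob_props(1)[OF N])
 \<comment> \<open>In the application this exponent equals s.\<close>
 define sig where "sig = kp q"
 have sq: "(n - 2) * q = 2 * (n - sig)" by (simp add: sig_def kp n_def)
 have rq: "(n - 2) * r = 2 * n" using n4 by (simp add: rn)
 have sig: "sig < 2"
 proof -
  have "(n - 2) * 2 < (n - 2) * q" using n4 ex by (intro mult_strict_left_mono) auto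
  then show ?thesis unfolding sq by simp
 qed
 have sig0: "0 < sig"
 proof -
  have "(n - 2) * q < (n - 2) * r" using n4 ex by (intro mult_strict_left_mono) (auto simp: r_def)
  then show ?thesis unfolding sq rq by simp
 qed
 \<comment> \<open>The midpoint of sig/2 and 1. Thus 2 aph exceeds sig, the cost of the singular
   term, and stays below 2 <= N - 2, as the decay theorem requires.\<close>
 define aph where "aph = (sig / 2 + 1) / 2"
 have aph: "1/2 <= aph" "aph < 1" "sig < 2 * aph" "2 * aph < real CARD('n) - 2" using sig sig0 n4 by (auto simp: aph_def n_def)
 have wt: "(1 - aph) * (r - q) <= (aph * r / 2) * (q - 2)"
 proof -
  have "(n - 2) * (r - q) = 2 * sig" "(n - 2) * (q - 2) = 2 * (2 - sig)" using sq rq by (simp_all add: algebra_simps)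
  then have e: "r - q = 2 * sig / (n - 2)" "q - 2 = 2 * (2 - sig) / (n - 2)" using n4 by (simp_all add: field_simps)
  have "(1 - aph) * sig = (2 - sig) * (sig / 4)" by (simp add: aph_def field_simps)
  also have "... <= (2 - sig) * (aph * r / 2)"
  proof (intro mult_left_mono)
   have "aph * 2 <= aph * r" using aph r2 by (intro mult_left_mono) auto
   then show "sig / 4 <= aph * r / 2" using aph sig by linarith
  qed (use sig in simp)
  finally have "((1 - aph) * sig) * (2 / (n - 2)) <= ((2 - sig) * (aph * r / 2)) * (2 / (n - 2))" using n4 by (intro mult_right_mono) auto
  moreover have "(1 - aph) * (2 * sig / (n - 2)) = ((1 - aph) * sig) * (2 / (n - 2))" by simp
  moreover have "(aph * r / 2) * (2 * (2 - sig) / (n - 2)) = ((2 - sig) * (aph * r / 2)) * (2 / (n - 2))" by (simp add: mult_ac)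
  ultimately show ?thesis unfolding e by linarith
 qed
 obtain U :: "real^'n => real" and G where U: "D12 UNIV U G" "pw (crit TYPE('n)) U = 1" "en G = Sob TYPE('n)" by (rule Sobolev_extremal[OF N]) (rule that)
 note [measurable] = D12_meas[OF U(1)]
 define I1 where "I1 x = (1 + (norm x)^2) powr (aph - 1) * (U x)^2" for x
 define I2 where "I2 x = (1 + (norm x)^2) powr (aph * r / 2) * abs (U x) powr r" for x
 have aph0: "0 < aph" using aph by linarith
 have I: "integrable lborel I1" "integrable lborel I2"
  using Sobolev_extremal_decay[OF N U aph0 aph(4)] unfolding I1_def[abs_def] I2_def[abs_def] r_def by blast+
 have J1: "1 + (norm x)^2 >= (1::real)" for x :: "real^'n" by simp
 have J0: "1 + (norm x)^2 ~= (0::real)" for x :: "real^'n" using J1[of x] by linarith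
 have Uq: "abs (U x) powr q <= I1 x + I2 x" for x unfolding I1_def I2_def using ex wt by (intro powr_split_weight J1) (auto simp: r_def)
 have iUq: "integrable lborel (%x. abs (U x) powr q)"
  by (rule L1_integrable_bound[OF L1_integrable_add[OF I]]) (use Uq in \<open>auto intro: order_trans[OF _ abs_ge_self]\<close>)
 have iUr: "integrable lborel (%x. abs (U x) powr r)" unfolding r_def by (rule D12_Sobolev(1)[OF N U(1)])
 have iUP: "integrable lborel (%x. indicator (cball 0 R) x * abs (U x) powr P)" for R
  by (rule local_powr_integrable[OF _ _ iUr emeasure_lborel_cball_finite]) (use ex in \<open>auto simp: r_def\<close>)
 have "\<exists>k::nat. (LBINT x. indicator (cball 0 (real k)) x * abs (U x) powr P) ~= 0"
 proof (rule ccontr)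
  assume "\<not> ?thesis"
  then have "AE x in lborel. indicator (cball 0 (real k)) x * abs (U x) powr P = 0" for k
   using integral_nonneg_eq_0_iff_AE[OF iUP[of "real k"]] by simp
  then have "AE x in lborel. \<forall>k. indicator (cball 0 (real k)) x * abs (U x) powr P = 0" unfolding AE_all_countable by blast
  then have "AE x in lborel. U x = 0"
  proof eventually_elim
   case (elim x)
   obtain k where "norm x <= real k" using real_arch_simple by blast
   then show ?case using spec[OF elim, of k] by (simp add: indicator_def)
  qed
  then have "pw (crit TYPE('n)) U = 0" using pw_pos_iff[OF D12_meas(1)[OF U(1)] D12_Sobolev(1)[OF N U(1)]] by blast
  then show False using U(2) by simp
 qed
 then obtain k :: nat where k: "(LBINT x. indicator (cball 0 (real k)) x * abs (U x) powr P) ~= 0" by blast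
 \<comment> \<open>A radius at which U has positive P-mass; adding 1 keeps R positive if k = 0. For
   e <= e0 the cut-off is 1 on \<open>cball 0 k\<close>, so this mass survives.\<close>
 define R c0 where "R = real k + 1" and "c0 = (LBINT x. indicator (cball 0 (real k)) x * abs (U x) powr P)"
 have c0: "c0 > 0" unfolding c0_def using k by (intro order.not_eq_order_implies_strict[OF k[symmetric]] L1_integral_nonneg) auto
 define e0 where "e0 = min 1 (rh / (2 * R))"
 have R: "R > 0" by (simp add: R_def)
 have "e0 * R <= rh / (2 * R) * R" unfolding e0_def using R by (intro mult_right_mono) auto
 then have e0: "0 < e0" "e0 <= 1" "e0 * R <= rh / 2" using rh R by (auto simp: e0_def)
 obtain et where et: "test_fun (cball 0 rh) et" "!!x. 0 <= et x" "!!x. et x <= 1"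
  "!!x. norm (x - 0) <= rh / 2 ==> et x = 1" "!!x. norm (x - (0::real^'n)) >= rh ==> et x = 0"
  by (rule test_fun_exists[of "rh / 2" rh 0]) (use rh in simp, use rh in simp, rule that)
 have ets: "smooth_on UNIV et" by (rule test_fun_smooth[OF et(1)])
 have g0: "grad et x = 0" if "norm x > rh" for x by (rule test_fun_obtain[OF et(1)]) (use that in \<open>auto simp: subset_eq not_le[symmetric]\<close>)
 obtain B where B: "B > 0" "!!x. (norm (grad et x))^2 * (1 + (norm x)^2) <= B^2" by (rule cutoff_bounds[OF test_fun_mono[OF et(1) subset_UNIV]]) (rule that)
 have B': "(norm (grad et x))^2 <= B^2" for x using B(2)[of x] mult_left_mono[OF J1[of x] zero_le_power2[of "norm (grad et x)"]] by simp
 define C1 C2 C3 where "C1 = B^2 * (1 + rh^2) powr (1 - aph) * (LBINT x. I1 x)" and "C2 = (2 / rh) powr (aph * r) * (LBINT x. I2 x)" and "C3 = (LBINT x. abs (U x) powr q)"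
 have C0: "C1 >= 0" "C2 >= 0" "C3 >= 0" unfolding C1_def C2_def C3_def I1_def I2_def by (auto intro!: mult_nonneg_nonneg L1_integral_nonneg)
 define C where "C = C1 + C2 + C3 + 1"
 have main: "\<exists>v g. D12 (cball x0 rh) v g & (\<forall>x. x \<notin> cball x0 rh --> v x = 0) &
   en g <= Sob TYPE('n) + C * e powr (2 * aph) & 1 - C * e powr (2 * aph) <= pw (crit TYPE('n)) v &
   c0 * e powr kp P <= pw P v & integrable lborel (%x. abs (v x) powr q) & pw q v <= C * e powr kp q" if e: "0 < e" "e <= e0" for e
 proof -
  have e1: "e <= 1" using e e0 by simp
  define w where "w x = et (e *R x)" for x
  have ws: "smooth_on UNIV w" using smooth_affine[OF ets, of e 0] by (simp add: w_def[abs_def])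
  have w01: "0 <= w x" "w x <= 1" for x using et(2,3) by (auto simp: w_def)
  have gw: "grad w x = e *R grad et (e *R x)" for x using fun_cong[OF grad_affine[OF ets, of e 0], of x] by (simp add: w_def[abs_def])
  have w0: "w x = 0" if "x \<notin> cball 0 (rh / e)" for x unfolding w_def by (rule et(5)) (use that e in \<open>simp add: field_simps\<close>)
  have wt': "test_fun (cball 0 (rh / e)) w" by (rule test_funI[OF ws compact_cball order_refl w0])
  obtain Bw where Bw: "!!x. abs (w x) <= Bw" "!!x. (norm (grad w x))^2 * (1 + (norm x)^2) <= Bw^2" by (rule cutoff_bounds[OF test_fun_mono[OF wt' subset_UNIV]]) (rule that)
  have tm: "test_fun (cball 0 (rh / e)) (%x. w x * ph x)" if "test_fun UNIV ph" for ph
   using test_fun_mult[OF wt' test_fun_smooth[OF that]] by (simp add: mult.commute)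
  define V where "V x = w x * U x" for x
  define H where "H x = w x *R G x + U x *R grad w x" for x
  have VD: "D12 (cball 0 (rh / e)) V H" unfolding V_def[abs_def] H_def[abs_def] by (rule D12_mult[OF N U(1) ws Bw tm])
  note VU = D12_mono[OF VD subset_UNIV]
  note [measurable] = D12_meas[OF VD]
  have WD: "D12 UNIV (%x. w x * V x) (%x. w x *R H x + V x *R grad w x)" by (rule D12_mult[OF N VU ws Bw test_fun_mult[OF _ ws]])
  have mw[measurable]: "w : bmeas borel" "grad w : bmeas borel" using test_measurable[OF test_fun_mono[OF wt' subset_UNIV]] by simp_all
  have Vle: "abs (V x) powr t <= abs (U x) powr t" if "t >= 0" for x t
   using w01[of x] that by (intro powr_mono2) (auto simp: V_def abs_mult mult_left_le_one_le)
  have iV: "integrable lborel (%x. abs (V x) powr t)" if "integrable lborel (%x. abs (U x) powr t)" "t >= 0" for t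
   by (rule L1_integrable_bound[OF that(1)]) (use Vle[OF that(2)] in auto)
  \<comment> \<open>On the support of the cut-off 1+|x|^2 <= (1+rh^2)/e^2, so introducing the decay
    weight of exponent aph-1 costs e^(2 aph - 2), against e^2 from the gradient of the dilated
    cut-off.\<close>
  have dw: "(U x)^2 * (norm (grad w x))^2 <= (B^2 * (1 + rh^2) powr (1 - aph) * e powr (2 * aph)) * I1 x" for x
  proof (cases "norm x <= rh / e")
   case True
   have "(norm x)^2 <= (rh / e)^2" using True by (intro power_mono) auto
   moreover have "1 <= 1 / e^2" using e e1 by (simp add: power_le_one)
   ultimately have "1 + (norm x)^2 <= (1 + rh^2) / e^2" by (simp add: power_divide add_divide_distrib)
   then have "(1 + (norm x)^2) powr (1 - aph) <= ((1 + rh^2) / e^2) powr (1 - aph)" using aph J1[of x] by (intro powr_mono2) auto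
   also have "... = (1 + rh^2) powr (1 - aph) / (e powr 2) powr (1 - aph)" using e by (simp add: powr_divide powr_numeral)
   finally have a: "(1 + (norm x)^2) powr (1 - aph) <= (1 + rh^2) powr (1 - aph) / e powr (2 - 2 * aph)" by (simp add: powr_powr right_diff_distrib)
   have "1 = (1 + (norm x)^2) powr (1 - aph) * (1 + (norm x)^2) powr (aph - 1)" unfolding powr_add[symmetric] using J0[of x] by simp
   also have "... <= (1 + rh^2) powr (1 - aph) / e powr (2 - 2 * aph) * (1 + (norm x)^2) powr (aph - 1)" by (intro mult_right_mono a) auto
   finally have "e^2 * B^2 * (U x)^2 * 1 <= e^2 * B^2 * (U x)^2 * ((1 + rh^2) powr (1 - aph) / e powr (2 - 2 * aph) * (1 + (norm x)^2) powr (aph - 1))"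
    by (intro mult_left_mono) auto
   also have "... = (B^2 * (1 + rh^2) powr (1 - aph) * (e^2 / e powr (2 - 2 * aph))) * I1 x" by (simp add: I1_def)
   also have "e^2 / e powr (2 - 2 * aph) = e powr (2 * aph)" using e by (simp add: powr_diff powr_numeral)
   finally have "e^2 * B^2 * (U x)^2 <= (B^2 * (1 + rh^2) powr (1 - aph) * e powr (2 * aph)) * I1 x" by simp
   moreover have "(U x)^2 * (norm (grad w x))^2 <= (U x)^2 * (e^2 * B^2)" unfolding gw norm_scaleR power_mult_distrib power2_abs using B'[of "e *R x"] by (intro mult_left_mono) auto
   ultimately show ?thesis by (simp add: mult_ac)
  next
   case False
   then have "grad w x = 0" unfolding gw using e by (subst g0) (auto simp: field_simps)
   then show ?thesis by (simp add: I1_def)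
  qed
  have idw: "integrable lborel (%x. (U x)^2 * (norm (grad w x))^2)"
   by (rule L1_integrable_bound[OF integrable_mult_right[OF I(1)]]) (use dw in \<open>auto intro: order_trans[OF _ abs_ge_self]\<close>)
  have iin: "integrable lborel (%x. G x \<bullet> (w x *R H x + V x *R grad w x))"
   by (rule L2_inner(1)) (use D12_meas[OF U(1)] D12_meas[OF WD] D12_int[OF U(1)] D12_int[OF WD] in simp_all)
  \<comment> \<open>The first term tests the equation of U with w^2 U and is at most S, because w <=
    1; only the gradient of w contributes an excess.\<close>
  have "en H = (LBINT x. G x \<bullet> (w x *R H x + V x *R grad w x) + (U x)^2 * (norm (grad w x))^2)"
   by (intro L1_integral_cong refl, unfold power2_norm_eq_inner)
    (simp add: H_def V_def inner_add_left inner_add_right inner_commute[of "grad w _" "G _"] power2_eq_square distrib_left distrib_right mult_ac)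
  also have "... = (LBINT x. G x \<bullet> (w x *R H x + V x *R grad w x)) + (LBINT x. (U x)^2 * (norm (grad w x))^2)"
   by (rule L1_integral_add[OF iin idw])
  also have "(LBINT x. G x \<bullet> (w x *R H x + V x *R grad w x)) <= Sob TYPE('n) * 1"
   unfolding Sobolev_EL[OF N U WD]
  proof (rule mult_left_mono)
   have "(LBINT x. sgn (U x) * abs (U x) powr (crit TYPE('n) - 1) * (w x * V x)) <= (LBINT x. abs (U x) powr r)"
   proof (rule integral_mono'[OF iUr])
    show "sgn (U x) * abs (U x) powr (crit TYPE('n) - 1) * (w x * V x) <= abs (U x) powr r" for x
    proof -
     have "sgn (U x) * abs (U x) powr (crit TYPE('n) - 1) * (w x * V x) = (w x * w x) * (abs (U x) powr (r - 1) * abs (U x) powr 1)"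
      by (cases "U x" "0::real" rule: linorder_cases) (auto simp: V_def r_def mult_ac)
     also have "... = (w x * w x) * abs (U x) powr r" unfolding powr_add[symmetric] by simp
     also have "... <= 1 * abs (U x) powr r" using w01[of x] by (intro mult_right_mono mult_le_one) auto
     finally show ?thesis by simp
    qed
   qed simp
   then show "(LBINT x. sgn (U x) * abs (U x) powr (crit TYPE('n) - 1) * (w x * V x)) <= 1" using U(2) by (simp add: r_def)
  qed (use S0 in simp)
  also have "(LBINT x. (U x)^2 * (norm (grad w x))^2) <= (LBINT x. (B^2 * (1 + rh^2) powr (1 - aph) * e powr (2 * aph)) * I1 x)"
   by (intro integral_mono idw integrable_mult_right I(1) dw)
  also have "... = C1 * e powr (2 * aph)" by (simp add: C1_def)
  also have "... <= C * e powr (2 * aph)" using C0 by (intro mult_right_mono) (auto simp: C_def)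
  finally have aV: "en H <= Sob TYPE('n) + C * e powr (2 * aph)" by simp
  \<comment> \<open>Mass is lost only where e|x| > rh/2; there a power of 2e|x|/rh is inserted and
    paid for by the decay integral. Since r > 2, e^(aph r) is at most e^(2 aph).\<close>
  have "(LBINT x. abs (U x) powr r - abs (V x) powr r) <= (LBINT x. ((2 / rh) powr (aph * r) * e powr (2 * aph)) * I2 x)"
  proof (intro integral_mono L1_integrable_diff iUr iV integrable_mult_right I(2))
   show "abs (U x) powr r - abs (V x) powr r <= ((2 / rh) powr (aph * r) * e powr (2 * aph)) * I2 x" for x
   proof (cases "norm (e *R x) <= rh / 2")
    case True
    then have "w x = 1" unfolding w_def by (intro et(4)) simp
    then show ?thesis by (simp add: V_def I2_def)
   next
    case False
    then have "1 <= (2 / rh) * (e * norm x)" using e rh by (simp add: field_simps)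
    then have "1 <= ((2 / rh) * (e * norm x)) powr (aph * r)" using aph0 r2 by (intro ge_one_powr_ge_zero) auto
    also have "... = (2 / rh) powr (aph * r) * (e powr (aph * r) * norm x powr (aph * r))"
     using e rh by ((simp only: powr_mult; fail) | (subst powr_mult, simp, simp, subst powr_mult, simp_all))
    also have "... <= (2 / rh) powr (aph * r) * (e powr (2 * aph) * (1 + (norm x)^2) powr (aph * r / 2))"
    proof (intro mult_left_mono mult_mono)
     show "e powr (aph * r) <= e powr (2 * aph)" using e e1 aph0 r2 by (intro powr_mono') auto
     have n2: "(norm x)^2 = norm x powr 2" by (cases "x = 0") (simp_all add: powr_numeral)
     have "norm x powr (aph * r) = ((norm x)^2) powr (aph * r / 2)" unfolding n2 powr_powr by simp
     also have "... <= (1 + (norm x)^2) powr (aph * r / 2)" using aph0 r2 by (intro powr_mono2) auto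
     finally show "norm x powr (aph * r) <= (1 + (norm x)^2) powr (aph * r / 2)" .
    qed auto
    finally have "1 * abs (U x) powr r <= (2 / rh) powr (aph * r) * (e powr (2 * aph) * (1 + (norm x)^2) powr (aph * r / 2)) * abs (U x) powr r" by (intro mult_right_mono) auto
    then have "abs (U x) powr r <= ((2 / rh) powr (aph * r) * e powr (2 * aph)) * I2 x" by (simp add: I2_def mult_ac)
    moreover have "abs (V x) powr r >= 0" by simp
    ultimately show ?thesis by linarith
   qed
  qed (use r2 in simp)
  moreover have "(LBINT x. abs (U x) powr r - abs (V x) powr r) = 1 - pw r V"
   using U(2) r2 by (subst L1_integral_diff[OF iUr iV[OF iUr]]) (auto simp: r_def)
  ultimately have "1 - pw r V <= C2 * e powr (2 * aph)" by (simp add: C2_def mult_ac)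
  also have "... <= C * e powr (2 * aph)" using C0 by (intro mult_right_mono) (auto simp: C_def)
  finally have dV: "1 - C * e powr (2 * aph) <= pw r V" by simp
  have iVP: "integrable lborel (%x. abs (V x) powr P)"
  proof (rule L1_integrable_bound[OF iUP[of "rh / e"]])
   show "AE x in lborel. norm (abs (V x) powr P) <= norm (indicator (cball 0 (rh / e)) x * abs (U x) powr P)"
   proof (rule AE_I2)
    fix x show "norm (abs (V x) powr P) <= norm (indicator (cball 0 (rh / e)) x * abs (U x) powr P)"
     using Vle[of P x] ex w0[of x] by (cases "x : cball 0 (rh / e)") (auto simp: V_def)
   qed
  qed simp
  have cV: "c0 <= pw P V" unfolding c0_def
  proof (rule integral_mono[OF iUP iVP])
   fix x show "indicator (cball 0 (real k)) x * abs (U x) powr P <= abs (V x) powr P"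
   proof (cases "x : cball 0 (real k)")
    case True
    have "e * norm x <= e0 * R" using True e e0 by (intro mult_mono) (auto simp: R_def)
    then have "w x = 1" unfolding w_def using e e0(3) by (intro et(4)) simp
    then show ?thesis by (simp add: V_def indicator_def)
   qed simp
  qed
  have bV: "pw q V <= C3" unfolding C3_def using ex by (intro integral_mono iV iUq Vle) auto
  \<comment> \<open>The dilation preserving energy and critical integral; on the integral of the
    t-th power it acts by the factor e^(kp t).\<close>
  define s v g where "s = e powr (- (n - 2) / 2)" and "v = (%x. s * V ((1 / e) *R x + (- (1 / e)) *R x0))"
   and "g = (%x. (s * (1 / e)) *R H ((1 / e) *R x + (- (1 / e)) *R x0))"
  have arg: "(1 / e) *R x + (- (1 / e)) *R x0 = (1 / e) *R (x - x0)" for x by (simp add: scaleR_diff_right)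
  have inb: "(1 / e) *R x + (- (1 / e)) *R x0 : cball 0 (rh / e) \<longleftrightarrow> x : cball x0 rh" for x
   unfolding arg using e by (simp add: dist_norm norm_minus_commute divide_le_cancel)
  have e': "1 / e > 0" using e by simp
  note aff = D12_affine[OF VD e' inb[THEN iffD1], where k = s and y = "(- (1 / e)) *R x0", folded v_def g_def]
  have cN: "(1 / e) ^ CARD('n) = e powr (- n)" using e by (simp add: n_def powr_minus powr_realpow power_one_over inverse_eq_divide)
  have "(s * (1 / e))^2 = e powr (- n)"
  proof -
   have "s * (1 / e) = e powr (- (n - 2) / 2) * e powr (- 1)" using e by (simp add: s_def powr_minus inverse_eq_divide)
   also have "... = e powr (- n / 2)" unfolding powr_add[symmetric] by (simp add: diff_divide_distrib)
   finally have "(s * (1 / e))^2 = e powr (- n / 2) * e powr (- n / 2)" by (simp add: power2_eq_square)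
   then show ?thesis unfolding powr_add[symmetric] by simp
  qed
  moreover have "en g = (s * (1 / e))^2 * en H / (1 / e) ^ CARD('n)" unfolding g_def by (rule aff(2))
  ultimately have eg: "en g = en H" using e unfolding cN by simp
  have pv: "pw t v = e powr kp t * pw t V" for t
  proof -
   have "pw t v = abs s powr t * ((LBINT x. abs (V x) powr t) / abs (1 / e) ^ CARD('n))"
    unfolding v_def pw_scale by (subst integral_affine(2)[of "%x. abs (V x) powr t"]) (use e in simp_all)
   also have "... = (abs s powr t / abs (1 / e) ^ CARD('n)) * pw t V" by simp
   also have "abs s powr t / abs (1 / e) ^ CARD('n) = e powr (- (n - 2) / 2 * t) / e powr (- n)" using e cN by (simp add: s_def powr_powr)
   also have "... = e powr (- (n - 2) / 2 * t - - n)" by (rule powr_diff[symmetric])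
   also have "- (n - 2) / 2 * t - - n = kp t" by (simp add: kp n_def field_simps)
   finally show ?thesis .
  qed
  have "kp r = 0" using rq by (simp add: kp n_def)
  then have pr: "pw r v = pw r V" unfolding pv using e by simp
  have iv: "integrable lborel (%x. abs (v x) powr q)"
  proof -
   have "integrable lborel (%x. abs (V ((1 / e) *R x + (- (1 / e)) *R x0)) powr q)"
    by (subst integral_affine(1)[of "%x. abs (V x) powr q"]) (use e iV[OF iUq] ex in auto)
   then show ?thesis unfolding v_def by (simp add: abs_mult powr_mult)
  qed
  have "C3 <= C" using C0 by (simp add: C_def)
  then have "pw q v <= C * e powr kp q" unfolding pv using bV by (subst mult.commute) (intro mult_right_mono, auto)
  moreover have "c0 * e powr kp P <= pw P v" unfolding pv using cV by (subst mult.commute) (intro mult_left_mono, auto)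
  moreover have "\<forall>x. x \<notin> cball x0 rh --> v x = 0" unfolding v_def V_def using w0 inb by auto
  ultimately show ?thesis using aff(1) aV dV iv pr eg unfolding r_def by (intro exI[of _ v] exI[of _ g]) simp
 qed
 have "C > 0" using C0 by (simp add: C_def)
 with that[of aph C c0 e0] aph(3) c0 e0(1,2) main show thesis unfolding sig_def by blast
qed

section \<open>The energy of a bubble along its ray\<close>

lemma Sobolev_ray_max:
 fixes S r t :: real assumes "S > 0" "r > 2" "t > 0"
 shows "S * t powr 2 / 2 - t powr r / r <= (1/2 - 1/r) * S powr (r / (r - 2))"
proof -
 \<comment> \<open>The parameter relative to the maximum point S^(1/(r-2)); it scales S out and
   leaves the comparison of (tau^2 - 1)/2 with (tau^r - 1)/r.\<close>
 define tau where "tau = t / S powr (1 / (r - 2))"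
 have tau: "tau > 0" "t = S powr (1 / (r - 2)) * tau" using assms by (auto simp: tau_def)
 have t2: "S * t powr 2 = S powr (r / (r - 2)) * tau powr 2"
 proof -
  have "S * t powr 2 = S powr 1 * S powr (1 / (r - 2) * 2) * tau powr 2" unfolding tau(2) using assms tau(1) by (simp add: powr_mult powr_powr)
  also have "S powr 1 * S powr (1 / (r - 2) * 2) = S powr (r / (r - 2))" unfolding powr_add[symmetric] using assms by (simp add: field_simps)
  finally show ?thesis .
 qed
 have tr: "t powr r = S powr (r / (r - 2)) * tau powr r" unfolding tau(2) using assms tau(1) by (simp add: powr_mult powr_powr)
 have "(tau powr 2 - 1) / 2 <= (tau powr r - 1) / r" by (rule powr_quotient_mono) (use assms tau in auto)
 then have "tau powr 2 / 2 - tau powr r / r <= 1/2 - 1/r" unfolding diff_divide_distrib by linarith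
 then have "S powr (r / (r - 2)) * (tau powr 2 / 2 - tau powr r / r) <= S powr (r / (r - 2)) * (1/2 - 1/r)" by (rule mult_left_mono) simp
 then show ?thesis unfolding t2 tr by (simp add: right_diff_distrib mult.commute)
qed

lemma powr_small:
 fixes b M :: real assumes "b > 0" "M > 0"
 obtains e0 where "e0 > 0" "!!e. 0 < e ==> e <= e0 ==> e powr b < M"
proof (rule that[of "(M / 2) powr (1 / b)"])
 fix e :: real assume e: "0 < e" "e <= (M / 2) powr (1 / b)"
 have "e powr b <= ((M / 2) powr (1 / b)) powr b" using e assms by (intro powr_mono2) auto
 also have "... < M" using assms by (simp add: powr_powr)
 finally show "e powr b < M" .
qed (use assms in simp)

context nehari begin

text \<open>On the ray through a bubble the energy is at most the maximum of S t^2/2 - t^r/r, which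
  is the threshold, plus losses of order e^(kp q) and minus a gain of order e^(kp P). As kp P < kp
  q, the gain wins for small e, provided t stays in a compact interval of positive numbers.\<close>

theorem below_threshold:
 fixes La rh :: real and x0 :: "real^'n"
 assumes N4: "CARD('n) >= 4" and rh: "rh > 0" "cball x0 rh <= Om" and La: "La >= 0"
  and wt: "!!w. (!!x. 0 <= w x) ==> (!!x. x \<notin> cball x0 rh ==> w x = 0) ==> integrable lborel w ==> integrable muu w & (\<integral>x. w x \<partial>muu) <= La * (LBINT x. w x)"
 obtains u0 g0 where "Neh u0 g0" "En u0 g0 < (1/2 - 1/crit TYPE('n)) * Sob TYPE('n) powr (crit TYPE('n) / (crit TYPE('n) - 2))"
proof -
 define r S where "r = crit TYPE('n)" and "S = Sob TYPE('n)"
 have r2': "r > 2" and rP: "P < r" and S0': "S > 0" using r2 exps S0 by (auto simp: r_def S_def)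
 define kp where "kp t = real CARD('n) - (real CARD('n) - 2) * t / 2" for t
 obtain aph C c0 e0 where b: "kp q < 2 * aph" "C > 0" "c0 > 0" "0 < e0" "e0 <= 1"
  "!!e. 0 < e ==> e <= e0 ==> \<exists>v g. D12 (cball x0 rh) v g & (\<forall>x. x \<notin> cball x0 rh --> v x = 0) &
   en g <= Sob TYPE('n) + C * e powr (2 * aph) & 1 - C * e powr (2 * aph) <= pw (crit TYPE('n)) v &
   c0 * e powr kp P <= pw P v & integrable lborel (%x. abs (v x) powr q) & pw q v <= C * e powr kp q"
  by (rule Sobolev_bubbles[OF N4 rh(1) exps kp_def]) (rule that)
 have kps: "kp P < kp q" "0 < kp q"
 proof -
  have "(real CARD('n) - 2) * q < (real CARD('n) - 2) * P" "(real CARD('n) - 2) * P < (real CARD('n) - 2) * r" using N4 exps rP by (auto intro!: mult_strict_left_mono)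
  moreover have "(real CARD('n) - 2) * r = 2 * real CARD('n)" using N4 by (simp add: r_def crit_def)
  ultimately show "kp P < kp q" "0 < kp q" by (auto simp: kp_def)
 qed
 obtain dlt where dlt: "dlt > 0" "!!u g. X u g ==> en g > 0 ==> J u g <= 0 ==> dlt <= en g" by (rule Nehari_lower_bound) (rule that)
 \<comment> \<open>A bound for the energy plus the weighted integral of the bubble, valid for all e
   <= 1.\<close>
 define M where "M = S + C + La * C"
 have M: "M > 0" using S0' b(2) La by (simp add: M_def add_pos_nonneg)
 \<comment> \<open>With T^(r-q) > 2M the critical term, whose integral is at least 1/2, outweighs
   the positive terms at T, so the ray meets the manifold before T.\<close>
 define T where "T = (2 * M + 1) powr (1 / (r - q))"
 have T1: "T >= 1" unfolding T_def using M exps rP by (intro ge_one_powr_ge_zero) auto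
 have Tr: "T powr (r - q) = 2 * M + 1" unfolding T_def using M exps rP by (simp add: powr_powr)
 \<comment> \<open>On the manifold dlt <= t^2 en g <= t^2 M, so t >= t0; this keeps the gain from
   the P-term bounded below.\<close>
 define t0 where "t0 = sqrt (dlt / M)"
 have t0: "t0 > 0" using dlt M by (simp add: t0_def)
 define K1 K3 where "K1 = C * T powr 2 / 2 + C * T powr r / r + La * C * T powr q / q" and "K3 = c0 * t0 powr P / P"
 have K: "K1 > 0" "K3 > 0" unfolding K1_def K3_def using b(2,3) T1 t0 La exps r2' by (auto intro!: add_pos_nonneg add_nonneg_nonneg)
 \<comment> \<open>The first smallness condition keeps the critical integral above 1/2; the next one
   makes the gain exceed the losses.\<close>
 obtain e1 where e1: "e1 > 0" "!!e. 0 < e ==> e <= e1 ==> e powr (2 * aph) < 1 / (2 * C)"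
  by (rule powr_small[of "2 * aph" "1 / (2 * C)"]) (use b kps in linarith, use b in simp, rule that)
 obtain e2 where e2: "e2 > 0" "!!e. 0 < e ==> e <= e2 ==> e powr (kp q - kp P) < K3 / K1"
  by (rule powr_small[of "kp q - kp P" "K3 / K1"]) (use kps in simp, use K in simp, rule that)
 define e where "e = min e0 (min e1 e2)"
 have e: "0 < e" "e <= e0" "e <= e1" "e <= e2" "e <= 1" using b(4,5) e1(1) e2(1) by (auto simp: e_def)
 obtain v g where v: "D12 (cball x0 rh) v g" "!!x. x \<notin> cball x0 rh ==> v x = 0" "en g <= S + C * e powr (2 * aph)" "1 - C * e powr (2 * aph) <= pw r v"
   "c0 * e powr kp P <= pw P v" "integrable lborel (%x. abs (v x) powr q)" "pw q v <= C * e powr kp q"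
  using b(6)[OF e(1,2)] unfolding r_def S_def by blast
 have q0: "q > 0" using exps by simp
 have vw: "integrable muu (%x. abs (v x) powr q) & bq v <= La * pw q v" unfolding bq_def by (rule wt) (use v(2,6) q0 in auto)
 have Xv: "X v g" unfolding X_def using D12_mono[OF v(1) rh(2)] vw by blast
 define E where "E = e powr (2 * aph)"
 have E: "0 < E" "E <= 1" "E <= e powr kp q" unfolding E_def using e(1,5) b(1) kps by (auto intro!: powr_mono' powr_le1)
 have bE: "bq v <= La * (C * e powr kp q)" using vw mult_left_mono[OF v(7) La] by linarith
 have eq1: "e powr kp q <= 1" using e(1,5) kps by (intro powr_le1) auto
 have d: "1/2 <= pw r v" "1 - C * E <= pw r v"
 proof -
  have "C * E < C * (1 / (2 * C))" unfolding E_def using e1(2)[OF e(1,3)] b(2) by (intro mult_strict_left_mono) auto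
  then have "C * E < 1/2" using b(2) by simp
  then show "1/2 <= pw r v" "1 - C * E <= pw r v" using v(4) unfolding E_def by linarith+
 qed
 have aS: "en g <= S + C * E" using v(3) by (simp add: E_def)
 have "S * pw r v powr (2 / r) <= en g" using D12_Sobolev(2)[OF N XD(1)[OF Xv]] by (simp add: S_def r_def)
 moreover have "S * pw r v powr (2 / r) > 0" using S0' d(1) by simp
 ultimately have a0: "en g > 0" by linarith
 have aM: "en g <= M" "en g + bq v <= M"
 proof -
  have "C * E <= C * 1" "La * (C * e powr kp q) <= La * (C * 1)" using E eq1 b(2) La by (auto intro!: mult_left_mono)
  then show "en g <= M" "en g + bq v <= M" using aS bE bq_nonneg[of v] unfolding M_def by linarith+
 qed
 have "en g + bq v * T powr (q - 2) - pw P v * T powr (P - 2) - pw r v * T powr (r - 2) <= 0"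
 proof -
  have T2: "1 <= T powr (q - 2)" using T1 exps by (intro ge_one_powr_ge_zero) auto
  have "en g * 1 + bq v * T powr (q - 2) <= en g * T powr (q - 2) + bq v * T powr (q - 2)" using T2 a0 by (intro add_right_mono mult_left_mono) auto
  also have "... = (en g + bq v) * T powr (q - 2)" by (simp add: distrib_right)
  also have "... <= M * T powr (q - 2)" by (intro mult_right_mono aM) auto
  also have "... <= (1/2 * T powr (r - q)) * T powr (q - 2)" unfolding Tr by (intro mult_right_mono) auto
  also have "... = 1/2 * (T powr (r - q) * T powr (q - 2))" by simp
  also have "T powr (r - q) * T powr (q - 2) = T powr (r - 2)" unfolding powr_add[symmetric] by simp
  also have "1/2 * T powr (r - 2) <= pw r v * T powr (r - 2)" by (intro mult_right_mono d) auto
  finally have "en g + bq v * T powr (q - 2) <= pw r v * T powr (r - 2)" by simp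
  moreover have "0 <= pw P v * T powr (P - 2)" by simp
  ultimately show ?thesis by linarith
 qed
 then obtain t where t: "0 < t" "t <= T" "en g + bq v * t powr (q - 2) - pw P v * t powr (P - 2) - pw r v * t powr (r - 2) = 0"
  using ray_root[OF a0, of T "bq v" "pw P v" "pw r v"] T1 unfolding r_def by auto
 note n = Neh_ray[OF Xv a0 t(1) t(3)[unfolded r_def]]
 have tt: "t0 <= t"
 proof -
  have n': "X (%x. t * v x) (%x. t *R g x)" "en (%x. t *R g x) > 0" "J (%x. t * v x) (%x. t *R g x) <= 0" using n by (auto simp: Neh_def)
  have "dlt <= t^2 * en g" using dlt(2)[OF n'] unfolding en_scale .
  also have "... <= t^2 * M" by (intro mult_left_mono aM) auto
  finally have "dlt / M <= t^2" using M by (simp add: pos_divide_le_eq)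
  then show ?thesis unfolding t0_def using t(1) by (intro real_le_lsqrt) auto
 qed
 have pT: "t powr j <= T powr j" if "j >= 0" for j using t that by (intro powr_mono2) auto
 have "En (%x. t * v x) (%x. t *R g x) = Psi (en g) (bq v) (pw P v) (pw r v) t"
  unfolding En_eq using n unfolding Neh_def scaled_values[OF t(1)] by (simp add: Psi_def r_def mult.commute)
 also have "... = en g * t powr 2 / 2 + bq v * t powr q / q - pw P v * t powr P / P - pw r v * t powr r / r" by (simp only: Psi_def r_def)
 also have "... <= (S * t powr 2 / 2 - t powr r / r) + K1 * e powr kp q - K3 * e powr kp P"
 proof -
  have CE: "C * E >= 0" using b(2) E by simp
  have "en g * t powr 2 <= (S + C * E) * t powr 2" by (intro mult_right_mono aS) auto
  also have "... <= S * t powr 2 + C * E * T powr 2" unfolding distrib_right by (intro add_left_mono mult_left_mono CE pT) auto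
  finally have 1: "en g * t powr 2 / 2 <= S * t powr 2 / 2 + C * T powr 2 / 2 * E" by (simp add: add_divide_distrib mult_ac)
  have "(1 - C * E) * t powr r <= pw r v * t powr r" by (intro mult_right_mono d) auto
  then have "t powr r - pw r v * t powr r <= C * E * t powr r" by (simp add: left_diff_distrib)
  also have "... <= C * E * T powr r" using r2' by (intro mult_left_mono CE pT) auto
  finally have "(t powr r - pw r v * t powr r) / r <= C * E * T powr r / r" using r2' by (intro divide_right_mono) auto
  then have 2: "- (pw r v * t powr r / r) <= - (t powr r / r) + C * T powr r / r * E" unfolding diff_divide_distrib by (simp add: mult_ac)
  have "bq v * t powr q <= La * (C * e powr kp q) * T powr q" using La b(2) exps by (intro mult_mono bE pT) auto
  then have "bq v * t powr q / q <= La * (C * e powr kp q) * T powr q / q" using q0 by (intro divide_right_mono) auto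
  then have 3: "bq v * t powr q / q <= La * C * T powr q / q * e powr kp q" by (simp add: mult_ac)
  have "c0 * e powr kp P * t0 powr P <= pw P v * t powr P" using b(3) t0 tt exps by (intro mult_mono v(5) powr_mono2) auto
  then have "c0 * e powr kp P * t0 powr P / P <= pw P v * t powr P / P" using exps by (intro divide_right_mono) auto
  then have 4: "K3 * e powr kp P <= pw P v * t powr P / P" by (simp add: K3_def mult_ac)
  have "(C * T powr 2 / 2 + C * T powr r / r) * E <= (C * T powr 2 / 2 + C * T powr r / r) * e powr kp q" using b(2) r2' by (intro mult_left_mono E) auto
  then have "C * T powr 2 / 2 * E + C * T powr r / r * E + La * C * T powr q / q * e powr kp q <= K1 * e powr kp q" unfolding K1_def distrib_right by linarith
  then show ?thesis using 1 2 3 4 by linarith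
 qed
 also have "... < S * t powr 2 / 2 - t powr r / r"
 proof -
  have "K1 * (e powr (kp q - kp P) * e powr kp P) < K1 * (K3 / K1 * e powr kp P)" using e2(2)[OF e(1,4)] K e(1) by (intro mult_strict_left_mono mult_strict_right_mono) auto
  also have "e powr (kp q - kp P) * e powr kp P = e powr kp q" unfolding powr_add[symmetric] by simp
  finally show ?thesis using K by simp
 qed
 also have "... <= (1/2 - 1/r) * S powr (r / (r - 2))" by (rule Sobolev_ray_max[OF S0' r2' t(1)])
 finally show thesis using that[OF n] unfolding r_def S_def by blast
qed

end

section \<open>The Hardy-Sobolev problem\<close>

text \<open>On a bounded domain Hardy's inequality bounds the L^2 norm of
  \<open>ph k x - u x\<close> by the energy of the difference, which turns almost everywhere
  approximation into approximation in H^1.\<close>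

lemma D12_H10:
 fixes u :: "real^'n => real"
 assumes N: "CARD('n) >= 3" and bd: "bounded Om" and op: "open Om" and u: "D12 Om u g"
 shows "H10 Om u g"
proof -
 obtain R where R: "Om <= ball 0 R" using bounded_subset_ballD[OF bd] by blast
 have [measurable]: "Om : sets borel" using op by simp
 define c where "c = 4 / (real CARD('n) - 2)^2"
 have sq: "integrable lborel (%x. indicat_real Om x *R (w x)^2) & (LBINT x. indicat_real Om x *R (w x)^2) <= (1 + R^2) * (c * en k)"
  if w: "D12 Om w k" for w k
 proof -
  note [measurable] = D12_meas(1)[OF w]
  note H = D12_Hardy[OF N w]
  have le: "indicat_real Om x *R (w x)^2 <= (1 + R^2) * ((w x)^2 / (1 + (norm x)^2))" for x
  proof (cases "x : Om")
   case True
   then have "norm x <= R" using R by (auto simp: subset_eq less_imp_le)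
   then have "(norm x)^2 <= R^2" by (intro power_mono) auto
   then have "(w x)^2 * (1 + (norm x)^2) <= (w x)^2 * (1 + R^2)" by (intro mult_left_mono) auto
   moreover have "1 + (norm x)^2 > 0" using zero_le_power2[of "norm x"] by linarith
   ultimately show ?thesis using True by (simp add: pos_le_divide_eq mult.commute)
  qed simp
  have i: "integrable lborel (%x. (1 + R^2) * ((w x)^2 / (1 + (norm x)^2)))" by (rule integrable_mult_right[OF H(1)])
  have j: "integrable lborel (%x. indicat_real Om x *R (w x)^2)"
   by (rule L1_integrable_bound[OF i]) (use le in \<open>auto intro: order_trans[OF _ abs_ge_self]\<close>)
  have "(LBINT x. indicat_real Om x *R (w x)^2) <= (LBINT x. (1 + R^2) * ((w x)^2 / (1 + (norm x)^2)))" by (rule integral_mono[OF j i le])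
  also have "... <= (1 + R^2) * (c * en k)" unfolding integral_mult_right_zero c_def by (intro mult_left_mono H(2)) auto
  finally show ?thesis using j by blast
 qed
 obtain ph where ph: "!!k. test_fun Om (ph k)" "!!k. test_fun UNIV (ph k)" "AE x in lborel. (%k. ph k x) ~~> u x"
  "(%k. en (%x. grad (ph k) x - g x)) ~~> 0" "(%k. en (grad (ph k))) ~~> en g"
  by (rule D12_obtain[OF u]) (rule that)
 note dD = D12_diff[OF D12_test[OF ph(1)] u]
 have l1: "(%k. LBINT x. indicat_real Om x *R (ph k x - u x)^2) ~~> 0"
 proof (rule LIMSEQ_squeeze0)
  show "(LBINT x. indicat_real Om x *R (ph k x - u x)^2) <= (1 + R^2) * (c * en (%x. grad (ph k) x - g x))" for k using sq[OF dD[of k]] by blast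
  show "(%k. (1 + R^2) * (c * en (%x. grad (ph k) x - g x))) ~~> 0"
   using tendsto_mult_right_zero[OF tendsto_mult_right_zero[OF ph(4)]] .
 qed simp
 have l2: "(%k. LBINT x. indicat_real Om x *R (norm (grad (ph k) x - g x))^2) ~~> 0"
 proof (rule LIMSEQ_squeeze0[OF _ _ ph(4)])
  show "(LBINT x. indicat_real Om x *R (norm (grad (ph k) x - g x))^2) <= en (%x. grad (ph k) x - g x)" for k
   by (rule integral_mono'[OF D12_int[OF dD]]) (auto simp: indicator_def)
 qed simp
 have m: "(%x. indicat_real Om x *R u x) : bmeas lborel" "(%x. indicat_real Om x *R g x) : bmeas lborel" using D12_meas[OF u] by simp_all
 have i2: "integrable lborel (%x. indicat_real Om x *R (norm (g x))^2)" by (rule integrable_mult_indicator[OF _ D12_int[OF u]]) simp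
 show ?thesis unfolding H10_def set_borel_measurable_def set_integrable_def set_lebesgue_integral_def
  using m i2 sq[OF u] ph(1) l1 l2 by blast
qed

text \<open>Away from the origin |x|^-s is bounded. This serves both the finiteness of the weighted
  integral of test functions and the cost of the singular term on bubbles.\<close>

lemma weight_comparison:
 fixes w :: "real^'n => real" and s :: real
 assumes s: "s >= 0" and d: "d > 0" "!!x. x : K ==> d <= norm x" and w: "!!x. 0 <= w x" "!!x. x \<notin> K ==> w x = 0" "integrable lborel w"
 shows "integrable (density lborel (%x. ennreal (norm x powr - s))) w &
  (\<integral>x. w x \<partial>density lborel (%x. ennreal (norm x powr - s))) <= d powr - s * (LBINT x. w x)"
proof -
 have [measurable]: "w : bmeas borel" using w(3) by simp
 have le: "norm x powr - s * w x <= d powr - s * w x" for x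
  using d(2)[of x] d(1) s w by (cases "x : K") (auto intro!: mult_right_mono powr_mono2')
 have j: "integrable lborel (%x. d powr - s * w x)" by (rule integrable_mult_right[OF w(3)])
 have i: "integrable lborel (%x. norm x powr - s * w x)"
  by (rule L1_integrable_bound[OF j]) (use le w(1) in \<open>auto simp: abs_mult\<close>)
 have "(LBINT x. norm x powr - s * w x) <= (LBINT x. d powr - s * w x)" by (rule integral_mono[OF i j le])
 then show ?thesis using i by (simp add: integrable_density integral_density)
qed

theorem theorem5p1:
  fixes \<Omega> :: "(real^'n) set" and s p :: real
  assumes "CARD('n) \<ge> 4"
    and "smooth_bounded_domain \<Omega>"
    and "0 \<in> frontier \<Omega>"
    and "0 < s" and "s < 2"
    and "crit_hs (real CARD('n)) s - 1 < p"
    and "p < (real CARD('n) + 2) / (real CARD('n) - 2)"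
  shows "\<exists>u. weak_solution \<Omega> s p u"
proof -
 define N where "N = real CARD('n)"
 define q where "q = crit_hs N s"
 define muu where "muu = density lborel (%x::real^'n. ennreal (norm x powr - s))"
 have N4: "N >= 4" and N3: "CARD('n) >= 3" using assms(1) by (auto simp: N_def)
 have op: "open \<Omega>" "connected \<Omega>" "\<Omega> ~= {}" "bounded \<Omega>" using assms(2) by (auto simp: smooth_bounded_domain_def)
 \<comment> \<open>An open set contains no point of its frontier; hence every compact subset keeps a
   positive distance from the singularity.\<close>
 have z: "0 \<notin> \<Omega>" using assms(3) op(1) by (auto simp: frontier_def interior_open)
 have far: "\<exists>d>0. \<forall>x\<in>K. d <= norm x" if "compact K" "K <= \<Omega>" for K
  using separate_point_closed[OF compact_imp_closed[OF that(1)], of 0] that(2) z by auto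
 have r: "crit TYPE('n) = (N + 2) / (N - 2) + 1" using N4 by (simp add: crit_def N_def field_simps)
 have q2: "2 < q" using N4 assms(5) by (simp add: q_def crit_hs_def field_simps)
 interpret nehari \<Omega> muu q "p + 1"
 proof
  show "CARD('n) >= 3" "bounded \<Omega>" "sets muu = sets borel" "2 < q" by (simp_all add: N3 op muu_def q2)
  show "q < p + 1" "p + 1 < crit TYPE('n)" using assms(6,7) unfolding q_def r N_def by simp_all
  show "AE x in muu. Q x" if "AE x in lborel. Q x" for Q
   unfolding muu_def by (subst AE_density) (use that in \<open>auto elim: eventually_mono\<close>)
  show "integrable muu (%x. abs (ph x) powr q)" if ph: "test_fun \<Omega> ph" for ph
  proof -
   obtain K where K: "compact K" "K <= \<Omega>" "!!x. x \<notin> K ==> ph x = 0" by (rule test_fun_obtain[OF ph]) (rule that)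
   obtain d where d: "d > 0" "!!x. x : K ==> d <= norm x" using far[OF K(1,2)] by blast
   have i: "integrable lborel (%x. abs (ph x) powr q)" by (rule test_powr_integrable[OF test_fun_mono[OF ph subset_UNIV]]) (use q2 in simp)
   show ?thesis unfolding muu_def using weight_comparison[OF _ d _ _ i] assms(4) K(3) by simp
  qed
 qed
 \<comment> \<open>Any interior point will do: bubbles concentrate in a ball around it that stays
   away from 0.\<close>
 obtain x0 where "x0 : \<Omega>" using op(3) by blast
 then obtain rh where rh: "rh > 0" "cball x0 rh <= \<Omega>" using op(1) open_contains_cball by blast
 obtain d where d: "d > 0" "!!x. x : cball x0 rh ==> d <= norm x" using far[OF compact_cball rh(2)] by blast
 have cmp: "integrable muu w & (\<integral>x. w x \<partial>muu) <= d powr - s * (LBINT x. w x)"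
  if "!!x. 0 <= w x" "!!x. x \<notin> cball x0 rh ==> w x = 0" "integrable lborel w" for w
  unfolding muu_def by (rule weight_comparison[OF less_imp_le[OF assms(4)] d that])
 obtain u0 g0 where "Neh u0 g0" "En u0 g0 < (1/2 - 1/crit TYPE('n)) * Sob TYPE('n) powr (crit TYPE('n) / (crit TYPE('n) - 2))"
  by (rule below_threshold[OF assms(1) rh powr_ge_zero cmp]) (assumption | rule that)+
 then obtain u1 g1 where "Neh u1 g1" "En u1 g1 = m" by (rule Nehari_minimizer) (rule that)
 then obtain u g where u: "Neh u g" "En u g = m" "!!x. u x >= 0" "AE x in lborel. x : \<Omega> --> u x > 0"
  by (rule Nehari_minimizer_positive[OF op(1,2)]) (rule that)
 have Xu: "X u g" using u(1) by (simp add: Neh_def)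
 note [measurable] = XD(3)[OF Xu]
 have sg: "sgn (u x) * abs (u x) powr k = u x powr k" for x k using u(3)[of x] by (cases "u x = 0") auto
 have "set_integrable lborel \<Omega> (%x. (u x powr p + u x powr ((N + 2) / (N - 2)) - u x powr (q - 1) / norm x powr s) * ph x) &
  (LINT x:\<Omega>|lborel. g x \<bullet> grad ph x) = (LINT x:\<Omega>|lborel. (u x powr p + u x powr ((N + 2) / (N - 2)) - u x powr (q - 1) / norm x powr s) * ph x)"
  if ph: "test_fun \<Omega> ph" for ph
 proof -
  obtain K where K: "compact K" "K <= \<Omega>" "!!x. x \<notin> K ==> ph x = 0" "!!x. x \<notin> K ==> grad ph x = 0" by (rule test_fun_obtain[OF ph]) (rule that)
  have zo: "ph x = 0" "grad ph x = 0" if "x \<notin> \<Omega>" for x using K that by blast+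
  have [measurable]: "ph : bmeas borel" using test_measurable(1)[OF test_fun_mono[OF ph subset_UNIV]] .
  note EL = Nehari_Euler_Lagrange[OF u(1,2) X_test[OF ph], unfolded sg]
  have b: "integrable lborel (%x. norm x powr - s * (u x powr (q - 1) * ph x))"
   "(\<integral>x. u x powr (q - 1) * ph x \<partial>muu) = (LBINT x. norm x powr - s * (u x powr (q - 1) * ph x))"
   using EL(1) unfolding muu_def by (simp_all add: integrable_density integral_density)
  have c: "integrable lborel (%x. u x powr p * ph x)" "integrable lborel (%x. u x powr ((N + 2) / (N - 2)) * ph x)"
   using EL(2,3) unfolding r by simp_all
  \<comment> \<open>Outside the domain the test function vanishes, so the indicator drops out;
    inside, the division by |x|^s becomes the density of \<open>muu\<close>.\<close>
  have f: "indicat_real \<Omega> x *R ((u x powr p + u x powr ((N + 2) / (N - 2)) - u x powr (q - 1) / norm x powr s) * ph x)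
   = u x powr p * ph x + u x powr ((N + 2) / (N - 2)) * ph x - norm x powr - s * (u x powr (q - 1) * ph x)" for x
   using zo(1)[of x] by (cases "x : \<Omega>") (auto simp: powr_minus divide_inverse algebra_simps)
  have gr: "indicat_real \<Omega> x *R (g x \<bullet> grad ph x) = g x \<bullet> grad ph x" for x using zo(2)[of x] by (cases "x : \<Omega>") auto
  show ?thesis unfolding set_integrable_def set_lebesgue_integral_def f gr
   using b c EL(4)[unfolded b(2)] by (simp add: r)
 qed
 moreover have "H10 \<Omega> u g" by (rule D12_H10[OF N3 op(4,1) XD(1)[OF Xu]])
 ultimately show ?thesis unfolding weak_solution_def Let_def q_def N_def using u(4) by blast
qed

end
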